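(* The singular locus of the toric variety $P=P(n_1,\dots,n_l,n)$ is the union $\bigcup_{b\in B}W_b$ of the codimension $3$ strata $W_b$, $b\in B$. These are conifold strata: for every $b\in B$, transversally to a generic point of $W_b$ the variety $P$ has an ordinary double point (a $3$-dimensional node $\{xy=zw\}\subset\mathbb{C}^4$).
   Context: Let $l\ge 1$ and let $k_1,\dots,k_{l+1}$ be positive integers; put $n_0=0$, $n_i=k_1+\dots+k_i$ and $n=n_{l+1}$. Ladder diagram. $\Lambda\subset\mathbb{R}^2$ is the union of the unit squares $[a-1,a]\times[c-1,c]$ ($a,c\ge1$ integers) such that $1\le c\le n-n_i$, where $i$ is the index with $n_{i-1}<a\le n_i$. (The number of unit squares is the dimension of the partial flag manifold $F(n_1,\dots,n_l,n)$.) Graph $\Gamma$. $D$ is the set of centers of the unit squares of $\Lambda$ ("dots"). $S=\{s_1,\dots,s_{l+1}\}$ is the set of "stars" $s_i=(n_{i-1}+\tfrac12,\,n-n_i+\tfrac12)$. $E$ is the set of horizontal and vertical unit segments joining two elements of $D\cup S$ at distance $1$; horizontal edges are oriented to the right and vertical edges downwards. $\Gamma$ is the oriented graph with vertex set $D\cup S$ and edge set $E$; $h(e)$ and $t(e)$ denote the head and tail of $e\in E$. $L(D),L(S),L(E)$ are the free abelian groups on $D,S,E$, and $\delta:L(E)\to L(D)$ is the composition of $\partial:L(E)\to L(D)\oplus L(S)$, $\partial(e)=h(e)-t(e)$, with the projection $L(D)\oplus L(S)\to L(D)$. Boxes. A box is a set $b\subset E$ of four edges forming a $4$-cycle (unit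 square) in $\Gamma$; $B$ is the set of boxes. Toric variety. $\Delta$ is the convex hull of $\delta(E)$ in $L(D)\otimes\mathbb{R}$; $\Sigma$ is the complete fan of cones over all proper faces of $\Delta$; $P=P(n_1,\dots,n_l,n)$ is the toric variety over $\mathbb{C}$ associated with the fan $\Sigma$ in the lattice $L(D)$. Strata. For $b\in B$, $W_b\subset P$ is the closure of the torus orbit corresponding to the $3$-dimensional cone $\sigma_b\in\Sigma$ generated by the four vectors $\delta(e)$, $e\in b$. *)

theory Defs
  imports
    "HOL-Analysis.Analysis"
    "HOL-Analysis.Finite_Function_Topology"
    "HOL-Library.Poly_Mapping"
    "HOL-Library.Extended_Nat"
    "HOL-Computational_Algebra.Fraction_Field"
    "HOL-Algebra.QuotRing"
    "HOL-Algebra.Ideal_Product"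
begin

section \<open>Local commutative algebra\<close>

definition krull_dim :: "('a, 'm) ring_scheme \<Rightarrow> enat" where
  "krull_dim R = Sup {enat n | n.
     \<exists>P. (\<forall>i\<le>n. primeideal (P i) R) \<and> (\<forall>i<n. P i \<subset> P (Suc i))}"

definition nonunits :: "('a, 'm) ring_scheme \<Rightarrow> 'a set" where
  "nonunits R = carrier R - Units R"

text \<open>A Noetherian local ring of Krull dimension \<open>d\<close> is regular if its maximal ideal, which
  consists of the non-units, can be generated by \<open>d\<close> elements. The predicate below is only
  applied to local rings of points of a complex variety, which are Noetherian and local.\<close>

definition regular_local :: "('a, 'm) ring_scheme \<Rightarrow> bool" where
  "regular_local R \<longleftrightarrow>
     (\<exists>G \<subseteq> carrier R. finite G \<and> enat (card G) \<le> krull_dim R \<and> Idl\<^bsub>R\<^esub> G = nonunits R)"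

primrec ideal_power :: "('a, 'm) ring_scheme \<Rightarrow> 'a set \<Rightarrow> nat \<Rightarrow> 'a set" where
  "ideal_power R I 0 = carrier R"
| "ideal_power R I (Suc n) = I \<cdot>\<^bsub>R\<^esub> ideal_power R I n"

text \<open>The \<open>I\<close>-adic completion \<open>lim R/I\<^sup>n\<close>. Elements of \<open>R/I\<^sup>n\<close> are cosets, so the transition
  map \<open>R/I\<^sup>n\<^sup>+\<^sup>1 \<rightarrow> R/I\<^sup>n\<close> sends \<open>X\<close> to the unique coset containing \<open>X\<close>.\<close>

definition completion :: "('a, 'm) ring_scheme \<Rightarrow> 'a set \<Rightarrow> (nat \<Rightarrow> 'a set) ring" where
  "completion R I =
     \<lparr>carrier = {s. \<forall>n. s n \<in> carrier (R Quot ideal_power R I n) \<and> s (Suc n) \<subseteq> s n},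
      monoid.mult = (\<lambda>s t n. s n \<otimes>\<^bsub>R Quot ideal_power R I n\<^esub> t n),
      one = (\<lambda>n. \<one>\<^bsub>R Quot ideal_power R I n\<^esub>),
      zero = (\<lambda>n. \<zero>\<^bsub>R Quot ideal_power R I n\<^esub>),
      add = (\<lambda>s t n. s n \<oplus>\<^bsub>R Quot ideal_power R I n\<^esub> t n)\<rparr>"

definition to_completion :: "('a, 'm) ring_scheme \<Rightarrow> 'a set \<Rightarrow> 'a \<Rightarrow> (nat \<Rightarrow> 'a set)" where
  "to_completion R I a = (\<lambda>n. ideal_power R I n +>\<^bsub>R\<^esub> a)"

text \<open>The closure in the completion of the image of an ideal \<open>J\<close>; for Noetherian \<open>R\<close> this is the
  ideal generated by \<open>J\<close>, that is, the completion of \<open>J\<close>.\<close>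

definition completed_ideal ::
    "('a, 'm) ring_scheme \<Rightarrow> 'a set \<Rightarrow> 'a set \<Rightarrow> (nat \<Rightarrow> 'a set) set" where
  "completed_ideal R I J = {s \<in> carrier (completion R I). \<forall>n. s n \<inter> J \<noteq> {}}"


section \<open>Irreducible closed sets and codimension\<close>

definition irreducible_closed :: "'a topology \<Rightarrow> 'a set \<Rightarrow> bool" where
  "irreducible_closed X Z \<longleftrightarrow> closedin X Z \<and> Z \<noteq> {} \<and>
     (\<forall>A B. closedin X A \<longrightarrow> closedin X B \<longrightarrow> Z \<subseteq> A \<union> B \<longrightarrow> Z \<subseteq> A \<or> Z \<subseteq> B)"

definition codim_in :: "'a topology \<Rightarrow> 'a set \<Rightarrow> enat" where
  "codim_in X W = Sup {enat n | n.
     \<exists>Z. Z 0 = W \<and> (\<forall>i\<le>n. irreducible_closed X (Z i)) \<and> (\<forall>i<n. Z i \<subset> Z (Suc i))}"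


section \<open>The toric variety of a fan\<close>

text \<open>Fix a finite set \<open>D\<close>. The lattice \<open>N\<close> is the free abelian group on \<open>D\<close>, cones live in its
  realification, the set of \<open>v :: 'v \<Rightarrow>\<^sub>0 real\<close> with keys in \<open>D\<close>, and the dual lattice
  \<open>M = Hom(N, Z)\<close> is identified with the \<open>m :: 'v \<Rightarrow>\<^sub>0 int\<close> with keys in \<open>D\<close>.
  The linear order on \<open>'v\<close> serves only to make the Laurent polynomials an instance of
  class \<open>idom\<close>.\<close>

type_synonym 'v laurent = "('v \<Rightarrow>\<^sub>0 int) \<Rightarrow>\<^sub>0 complex"

definition dual_lattice :: "'v set \<Rightarrow> ('v \<Rightarrow>\<^sub>0 int) set" where
  "dual_lattice D = {m. Poly_Mapping.keys m \<subseteq> D}"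

definition pairing :: "('v \<Rightarrow>\<^sub>0 int) \<Rightarrow> ('v \<Rightarrow>\<^sub>0 real) \<Rightarrow> real" where
  "pairing m v =
     (\<Sum>x\<in>Poly_Mapping.keys m. of_int (Poly_Mapping.lookup m x) * Poly_Mapping.lookup v x)"

definition dual_monoid :: "'v set \<Rightarrow> ('v \<Rightarrow>\<^sub>0 real) set \<Rightarrow> ('v \<Rightarrow>\<^sub>0 int) set" where
  "dual_monoid D \<sigma> = {m \<in> dual_lattice D. \<forall>v\<in>\<sigma>. 0 \<le> pairing m v}"

definition perp :: "'v set \<Rightarrow> ('v \<Rightarrow>\<^sub>0 real) set \<Rightarrow> ('v \<Rightarrow>\<^sub>0 int) set" where
  "perp D \<sigma> = {m \<in> dual_lattice D. \<forall>v\<in>\<sigma>. pairing m v = 0}"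

text \<open>The coordinate ring \<open>C[S\<^sub>\<sigma>]\<close> of the affine chart \<open>U\<^sub>\<sigma>\<close>, where \<open>S\<^sub>\<sigma>\<close> is the dual monoid, as a
  subset of \<open>C[M]\<close>.\<close>

definition coord_ring :: "'v set \<Rightarrow> ('v \<Rightarrow>\<^sub>0 real) set \<Rightarrow> 'v laurent set" where
  "coord_ring D \<sigma> = {f. Poly_Mapping.keys f \<subseteq> dual_monoid D \<sigma>}"

text \<open>The complex points of \<open>U\<^sub>\<sigma>\<close>: monoid homomorphisms from \<open>S\<^sub>\<sigma>\<close> to \<open>(C, \<cdot>)\<close>.\<close>

definition chart :: "'v set \<Rightarrow> ('v \<Rightarrow>\<^sub>0 real) set \<Rightarrow> (('v \<Rightarrow>\<^sub>0 int) \<Rightarrow> complex) set" where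
  "chart D \<sigma> = {\<gamma> \<in> extensional (dual_monoid D \<sigma>). \<gamma> 0 = 1 \<and>
     (\<forall>m\<in>dual_monoid D \<sigma>. \<forall>m'\<in>dual_monoid D \<sigma>. \<gamma> (m + m') = \<gamma> m * \<gamma> m')}"

definition evalp :: "'v laurent \<Rightarrow> (('v \<Rightarrow>\<^sub>0 int) \<Rightarrow> complex) \<Rightarrow> complex" where
  "evalp f \<gamma> = (\<Sum>m\<in>Poly_Mapping.keys f. Poly_Mapping.lookup f m * \<gamma> m)"

type_synonym 'v chart_point = "('v \<Rightarrow>\<^sub>0 real) set \<times> (('v \<Rightarrow>\<^sub>0 int) \<Rightarrow> complex)"

text \<open>The charts \<open>U\<^sub>\<sigma>\<close> and \<open>U\<^sub>\<tau>\<close> are glued along \<open>U\<^bsub>\<sigma>\<inter>\<tau>\<^esub>\<close>, whose inclusion into \<open>U\<^sub>\<sigma>\<close> restricts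
  homomorphisms from \<open>S\<^bsub>\<sigma>\<inter>\<tau>\<^esub>\<close> to \<open>S\<^sub>\<sigma>\<close>.\<close>

definition glue ::
    "'v set \<Rightarrow> ('v \<Rightarrow>\<^sub>0 real) set set \<Rightarrow> ('v chart_point \<times> 'v chart_point) set" where
  "glue D \<Sigma> = {((\<sigma>, \<gamma>), (\<tau>, \<gamma>')). \<sigma> \<in> \<Sigma> \<and> \<tau> \<in> \<Sigma> \<and> \<gamma> \<in> chart D \<sigma> \<and> \<gamma>' \<in> chart D \<tau> \<and>
     (\<exists>\<omega> \<in> chart D (\<sigma> \<inter> \<tau>).
        restrict \<omega> (dual_monoid D \<sigma>) = \<gamma> \<and> restrict \<omega> (dual_monoid D \<tau>) = \<gamma>')}"

type_synonym 'v toric_point = "'v chart_point set"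

definition toric_variety :: "'v set \<Rightarrow> ('v \<Rightarrow>\<^sub>0 real) set set \<Rightarrow> 'v toric_point set" where
  "toric_variety D \<Sigma> = (SIGMA \<sigma>:\<Sigma>. chart D \<sigma>) // glue D \<Sigma>"

definition toric_pt ::
    "'v set \<Rightarrow> ('v \<Rightarrow>\<^sub>0 real) set set \<Rightarrow> ('v \<Rightarrow>\<^sub>0 real) set \<Rightarrow> (('v \<Rightarrow>\<^sub>0 int) \<Rightarrow> complex) \<Rightarrow>
     'v toric_point" where
  "toric_pt D \<Sigma> \<sigma> \<gamma> = glue D \<Sigma> `` {(\<sigma>, \<gamma>)}"

definition zariski_open ::
    "'v set \<Rightarrow> ('v \<Rightarrow>\<^sub>0 real) set set \<Rightarrow> 'v toric_point set \<Rightarrow> bool" where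
  "zariski_open D \<Sigma> U \<longleftrightarrow> U \<subseteq> toric_variety D \<Sigma> \<and>
     (\<forall>\<sigma>\<in>\<Sigma>. \<exists>F \<subseteq> coord_ring D \<sigma>.
        {\<gamma> \<in> chart D \<sigma>. toric_pt D \<Sigma> \<sigma> \<gamma> \<in> U} = {\<gamma> \<in> chart D \<sigma>. \<exists>f\<in>F. evalp f \<gamma> \<noteq> 0})"

definition zariski :: "'v set \<Rightarrow> ('v \<Rightarrow>\<^sub>0 real) set set \<Rightarrow> 'v toric_point topology" where
  "zariski D \<Sigma> = topology (zariski_open D \<Sigma>)"

lemma evalp_superset:
  assumes "finite A" "Poly_Mapping.keys f \<subseteq> A"
  shows "evalp f \<gamma> = (\<Sum>m\<in>A. Poly_Mapping.lookup f m * \<gamma> m)"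
  unfolding evalp_def using assms by (intro sum.mono_neutral_left) (auto simp: in_keys_iff)

lemma evalp_zero [simp]: "evalp 0 \<gamma> = 0"
  by (simp add: evalp_def)

lemma evalp_single: "evalp (Poly_Mapping.single m c) \<gamma> = c * \<gamma> m"
  by (simp add: evalp_def)

lemma evalp_add: "evalp (f + g) \<gamma> = evalp f \<gamma> + evalp g \<gamma>"
proof -
  let ?A = "Poly_Mapping.keys f \<union> Poly_Mapping.keys g"
  have "Poly_Mapping.keys (f + g) \<subseteq> ?A" by (rule Poly_Mapping.keys_add)
  then show ?thesis
    by (simp add: evalp_superset[of ?A] lookup_add sum.distrib algebra_simps)
qed

lemma evalp_sum: "evalp (\<Sum>i\<in>A. f i) \<gamma> = (\<Sum>i\<in>A. evalp (f i) \<gamma>)"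
  by (induction A rule: infinite_finite_induct) (simp_all add: evalp_add)

lemma laurent_eq_sum_single:
  "f = (\<Sum>m\<in>Poly_Mapping.keys f. Poly_Mapping.single m (Poly_Mapping.lookup f m))"
proof (rule poly_mapping_eqI)
  fix x
  show "Poly_Mapping.lookup f x = Poly_Mapping.lookup
      (\<Sum>m\<in>Poly_Mapping.keys f. Poly_Mapping.single m (Poly_Mapping.lookup f m)) x"
    unfolding lookup_sum lookup_single when_def
    by (cases "x \<in> Poly_Mapping.keys f") (simp_all add: in_keys_iff)
qed

lemma evalp_mult:
  assumes "\<gamma> \<in> chart D \<sigma>" "f \<in> coord_ring D \<sigma>" "g \<in> coord_ring D \<sigma>"
  shows "evalp (f * g) \<gamma> = evalp f \<gamma> * evalp g \<gamma>"
proof -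
  let ?F = "Poly_Mapping.keys f" and ?G = "Poly_Mapping.keys g"
  have "f * g = (\<Sum>m\<in>?F. \<Sum>m'\<in>?G.
      Poly_Mapping.single (m + m') (Poly_Mapping.lookup f m * Poly_Mapping.lookup g m'))"
  proof -
    have "f * g = (\<Sum>m\<in>?F. Poly_Mapping.single m (Poly_Mapping.lookup f m)) *
        (\<Sum>m'\<in>?G. Poly_Mapping.single m' (Poly_Mapping.lookup g m'))"
      using arg_cong2[where f = "(*)", OF laurent_eq_sum_single[of f] laurent_eq_sum_single[of g]] .
    then show ?thesis unfolding sum_product mult_single .
  qed
  then have "evalp (f * g) \<gamma> = (\<Sum>m\<in>?F. \<Sum>m'\<in>?G.
      Poly_Mapping.lookup f m * Poly_Mapping.lookup g m' * \<gamma> (m + m'))"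
    by (simp add: evalp_sum evalp_single)
  also have "\<dots> = (\<Sum>m\<in>?F. \<Sum>m'\<in>?G.
      (Poly_Mapping.lookup f m * \<gamma> m) * (Poly_Mapping.lookup g m' * \<gamma> m'))"
  proof (intro sum.cong refl)
    fix m m' assume "m \<in> ?F" "m' \<in> ?G"
    then have "\<gamma> (m + m') = \<gamma> m * \<gamma> m'"
      using assms unfolding chart_def coord_ring_def by blast
    then show "Poly_Mapping.lookup f m * Poly_Mapping.lookup g m' * \<gamma> (m + m') =
        (Poly_Mapping.lookup f m * \<gamma> m) * (Poly_Mapping.lookup g m' * \<gamma> m')" by simp
  qed
  also have "\<dots> = evalp f \<gamma> * evalp g \<gamma>"
    by (simp add: evalp_def sum_product)
  finally show ?thesis .
qed

lemma pairing_add: "pairing (m + m') v = pairing m v + pairing m' v"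
proof -
  let ?A = "Poly_Mapping.keys m \<union> Poly_Mapping.keys m'"
  have *: "pairing q v = (\<Sum>x\<in>?A. of_int (Poly_Mapping.lookup q x) * Poly_Mapping.lookup v x)"
    if "Poly_Mapping.keys q \<subseteq> ?A" for q
    unfolding pairing_def using that
    by (intro sum.mono_neutral_left) (auto simp: in_keys_iff)
  have "Poly_Mapping.keys (m + m') \<subseteq> ?A" by (rule Poly_Mapping.keys_add)
  then show ?thesis by (simp add: * lookup_add sum.distrib algebra_simps)
qed

lemma dual_monoid_add:
  "m \<in> dual_monoid D \<sigma> \<Longrightarrow> m' \<in> dual_monoid D \<sigma> \<Longrightarrow> m + m' \<in> dual_monoid D \<sigma>"
  using Poly_Mapping.keys_add[of m m']
  by (auto simp: dual_monoid_def dual_lattice_def pairing_add)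

lemma coord_ring_mult:
  "f \<in> coord_ring D \<sigma> \<Longrightarrow> g \<in> coord_ring D \<sigma> \<Longrightarrow> f * g \<in> coord_ring D \<sigma>"
  unfolding coord_ring_def using keys_mult[of f g] by (blast intro: dual_monoid_add)

lemma istopology_zariski_open: "istopology (zariski_open D \<Sigma>)"
  unfolding istopology_def
proof (intro conjI allI impI)
  fix S T
  assume S: "zariski_open D \<Sigma> S" and T: "zariski_open D \<Sigma> T"
  show "zariski_open D \<Sigma> (S \<inter> T)"
    unfolding zariski_open_def
  proof (intro conjI ballI)
    show "S \<inter> T \<subseteq> toric_variety D \<Sigma>" using S by (auto simp: zariski_open_def)
  next
    fix \<sigma> assume \<sigma>: "\<sigma> \<in> \<Sigma>"
    obtain F where F: "F \<subseteq> coord_ring D \<sigma>" "{\<gamma> \<in> chart D \<sigma>. toric_pt D \<Sigma> \<sigma> \<gamma> \<in> S} =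
        {\<gamma> \<in> chart D \<sigma>. \<exists>f\<in>F. evalp f \<gamma> \<noteq> 0}"
      using S \<sigma> unfolding zariski_open_def by blast
    obtain G where G: "G \<subseteq> coord_ring D \<sigma>" "{\<gamma> \<in> chart D \<sigma>. toric_pt D \<Sigma> \<sigma> \<gamma> \<in> T} =
        {\<gamma> \<in> chart D \<sigma>. \<exists>f\<in>G. evalp f \<gamma> \<noteq> 0}"
      using T \<sigma> unfolding zariski_open_def by blast
    let ?FG = "{f * g | f g. f \<in> F \<and> g \<in> G}"
    have "?FG \<subseteq> coord_ring D \<sigma>" using F(1) G(1) coord_ring_mult by blast
    moreover have "{\<gamma> \<in> chart D \<sigma>. toric_pt D \<Sigma> \<sigma> \<gamma> \<in> S \<inter> T} =
        {\<gamma> \<in> chart D \<sigma>. \<exists>f\<in>?FG. evalp f \<gamma> \<noteq> 0}"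
    proof -
      have "(\<exists>f\<in>?FG. evalp f \<gamma> \<noteq> 0) \<longleftrightarrow> (\<exists>f\<in>F. evalp f \<gamma> \<noteq> 0) \<and> (\<exists>g\<in>G. evalp g \<gamma> \<noteq> 0)"
        if "\<gamma> \<in> chart D \<sigma>" for \<gamma>
      proof -
        have "evalp (f * g) \<gamma> = evalp f \<gamma> * evalp g \<gamma>" if "f \<in> F" "g \<in> G" for f g
          using evalp_mult \<open>\<gamma> \<in> chart D \<sigma>\<close> that F(1) G(1) by blast
        then have "(\<exists>h\<in>?FG. evalp h \<gamma> \<noteq> 0) \<longleftrightarrow>
            (\<exists>f\<in>F. \<exists>g\<in>G. evalp f \<gamma> * evalp g \<gamma> \<noteq> 0)" by force
        then show ?thesis unfolding mult_eq_0_iff by blast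
      qed
      moreover have "toric_pt D \<Sigma> \<sigma> \<gamma> \<in> S \<longleftrightarrow> (\<exists>f\<in>F. evalp f \<gamma> \<noteq> 0)"
        if "\<gamma> \<in> chart D \<sigma>" for \<gamma>
        using F(2) that by (simp only: set_eq_iff mem_Collect_eq) metis
      moreover have "toric_pt D \<Sigma> \<sigma> \<gamma> \<in> T \<longleftrightarrow> (\<exists>f\<in>G. evalp f \<gamma> \<noteq> 0)"
        if "\<gamma> \<in> chart D \<sigma>" for \<gamma>
        using G(2) that by (simp only: set_eq_iff mem_Collect_eq) metis
      ultimately show ?thesis
        by (intro Collect_cong conj_cong refl) (simp only: Int_iff)
    qed
    ultimately show "\<exists>H\<subseteq>coord_ring D \<sigma>. {\<gamma> \<in> chart D \<sigma>. toric_pt D \<Sigma> \<sigma> \<gamma> \<in> S \<inter> T} =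
        {\<gamma> \<in> chart D \<sigma>. \<exists>f\<in>H. evalp f \<gamma> \<noteq> 0}" by blast
  qed
next
  fix \<K> assume K: "\<forall>K\<in>\<K>. zariski_open D \<Sigma> K"
  show "zariski_open D \<Sigma> (\<Union>\<K>)"
    unfolding zariski_open_def
  proof (intro conjI ballI)
    show "\<Union>\<K> \<subseteq> toric_variety D \<Sigma>" using K by (auto simp: zariski_open_def)
  next
    fix \<sigma> assume \<sigma>: "\<sigma> \<in> \<Sigma>"
    let ?H = "{f \<in> coord_ring D \<sigma>. \<forall>\<gamma>\<in>chart D \<sigma>. evalp f \<gamma> \<noteq> 0 \<longrightarrow> toric_pt D \<Sigma> \<sigma> \<gamma> \<in> \<Union>\<K>}"
    have "toric_pt D \<Sigma> \<sigma> \<gamma> \<in> \<Union>\<K> \<longleftrightarrow> (\<exists>f\<in>?H. evalp f \<gamma> \<noteq> 0)" if \<gamma>: "\<gamma> \<in> chart D \<sigma>" for \<gamma>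
    proof
      assume "toric_pt D \<Sigma> \<sigma> \<gamma> \<in> \<Union>\<K>"
      then obtain K where k: "K \<in> \<K>" "toric_pt D \<Sigma> \<sigma> \<gamma> \<in> K" by (rule UnionE)
      then have "zariski_open D \<Sigma> K" using K by simp
      then obtain F where F: "F \<subseteq> coord_ring D \<sigma>" "{\<gamma> \<in> chart D \<sigma>. toric_pt D \<Sigma> \<sigma> \<gamma> \<in> K} =
          {\<gamma> \<in> chart D \<sigma>. \<exists>f\<in>F. evalp f \<gamma> \<noteq> 0}"
        using \<sigma> unfolding zariski_open_def by blast
      have *: "toric_pt D \<Sigma> \<sigma> \<gamma>' \<in> K \<longleftrightarrow> (\<exists>f\<in>F. evalp f \<gamma>' \<noteq> 0)"
        if "\<gamma>' \<in> chart D \<sigma>" for \<gamma>'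
        using F(2) that by (simp only: set_eq_iff mem_Collect_eq) metis
      from iffD1[OF *[OF \<gamma>] k(2)] obtain f where f: "f \<in> F" "evalp f \<gamma> \<noteq> 0" by (rule bexE)
      have "f \<in> ?H"
      proof (intro CollectI conjI ballI impI)
        show "f \<in> coord_ring D \<sigma>" using F(1) f(1) by (rule subsetD)
      next
        fix \<gamma>' assume "\<gamma>' \<in> chart D \<sigma>" "evalp f \<gamma>' \<noteq> 0"
        then have "toric_pt D \<Sigma> \<sigma> \<gamma>' \<in> K" by (intro iffD2[OF *] bexI[OF _ f(1)])
        then show "toric_pt D \<Sigma> \<sigma> \<gamma>' \<in> \<Union>\<K>" by (rule UnionI[OF k(1)])
      qed
      then show "\<exists>f\<in>?H. evalp f \<gamma> \<noteq> 0" using f(2) by (intro bexI)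
    next
      assume "\<exists>f\<in>?H. evalp f \<gamma> \<noteq> 0"
      then show "toric_pt D \<Sigma> \<sigma> \<gamma> \<in> \<Union>\<K>" using \<gamma> by (elim bexE CollectE conjE) (rule mp, erule (1) bspec)
    qed
    then have "{\<gamma> \<in> chart D \<sigma>. toric_pt D \<Sigma> \<sigma> \<gamma> \<in> \<Union>\<K>} =
        {\<gamma> \<in> chart D \<sigma>. \<exists>f\<in>?H. evalp f \<gamma> \<noteq> 0}"
      by (intro Collect_cong conj_cong refl)
    moreover have "?H \<subseteq> coord_ring D \<sigma>" by (rule Collect_restrict)
    ultimately show "\<exists>H\<subseteq>coord_ring D \<sigma>. {\<gamma> \<in> chart D \<sigma>. toric_pt D \<Sigma> \<sigma> \<gamma> \<in> \<Union>\<K>} =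
        {\<gamma> \<in> chart D \<sigma>. \<exists>f\<in>H. evalp f \<gamma> \<noteq> 0}" by (intro exI[of _ ?H] conjI)
  qed
qed

lemma openin_zariski: "openin (zariski D \<Sigma>) = zariski_open D \<Sigma>"
  unfolding zariski_def using istopology_zariski_open by (rule topology_inverse')

text \<open>The torus \<open>Hom(M, C\<^sup>*)\<close> is the chart of the zero cone. The orbit of a cone \<open>\<sigma>\<close> is the
  orbit of the distinguished point of \<open>U\<^sub>\<sigma>\<close>.\<close>

definition torus :: "'v set \<Rightarrow> (('v \<Rightarrow>\<^sub>0 int) \<Rightarrow> complex) set" where
  "torus D = chart D {0}"

definition distinguished ::
    "'v set \<Rightarrow> ('v \<Rightarrow>\<^sub>0 real) set \<Rightarrow> (('v \<Rightarrow>\<^sub>0 int) \<Rightarrow> complex)" where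
  "distinguished D \<sigma> = (\<lambda>m\<in>dual_monoid D \<sigma>. if m \<in> perp D \<sigma> then 1 else 0)"

definition torus_orbit ::
    "'v set \<Rightarrow> ('v \<Rightarrow>\<^sub>0 real) set set \<Rightarrow> ('v \<Rightarrow>\<^sub>0 real) set \<Rightarrow> 'v toric_point set" where
  "torus_orbit D \<Sigma> \<sigma> =
     (\<lambda>t. toric_pt D \<Sigma> \<sigma> (\<lambda>m\<in>dual_monoid D \<sigma>. t m * distinguished D \<sigma> m)) ` torus D"

definition orbit_closure ::
    "'v set \<Rightarrow> ('v \<Rightarrow>\<^sub>0 real) set set \<Rightarrow> ('v \<Rightarrow>\<^sub>0 real) set \<Rightarrow> 'v toric_point set" where
  "orbit_closure D \<Sigma> \<sigma> = zariski D \<Sigma> closure_of torus_orbit D \<Sigma> \<sigma>"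

text \<open>The local ring of a point, as a subring of the function field \<open>Frac C[M]\<close>. Any chart
  containing the point gives the same fractions.\<close>

definition local_ring ::
    "'v::linorder set \<Rightarrow> 'v toric_point \<Rightarrow> 'v laurent fract ring" where
  "local_ring D p =
     \<lparr>carrier = {Fract f g | f g \<sigma> \<gamma>. (\<sigma>, \<gamma>) \<in> p \<and> f \<in> coord_ring D \<sigma> \<and> g \<in> coord_ring D \<sigma> \<and>
        evalp g \<gamma> \<noteq> 0},
      monoid.mult = (*), one = 1, zero = 0, add = (+)\<rparr>"

definition const_fun :: "complex \<Rightarrow> 'v::linorder laurent fract" where
  "const_fun c = Fract (Poly_Mapping.single 0 c) 1"

text \<open>The ideal of germs at \<open>p\<close> of regular functions vanishing on the closed set \<open>W\<close>.\<close>

definition germ_ideal ::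
    "'v::linorder set \<Rightarrow> ('v \<Rightarrow>\<^sub>0 real) set set \<Rightarrow> 'v toric_point set \<Rightarrow> 'v toric_point \<Rightarrow>
     'v laurent fract set" where
  "germ_ideal D \<Sigma> W p =
     {Fract f g | f g \<sigma> \<gamma>. (\<sigma>, \<gamma>) \<in> p \<and> f \<in> coord_ring D \<sigma> \<and> g \<in> coord_ring D \<sigma> \<and>
        evalp g \<gamma> \<noteq> 0 \<and>
        (\<forall>\<gamma>'\<in>chart D \<sigma>. toric_pt D \<Sigma> \<sigma> \<gamma>' \<in> W \<longrightarrow> evalp f \<gamma>' = 0)}"

definition singular_locus ::
    "'v::linorder set \<Rightarrow> ('v \<Rightarrow>\<^sub>0 real) set set \<Rightarrow> 'v toric_point set" where
  "singular_locus D \<Sigma> = {p \<in> toric_variety D \<Sigma>. \<not> regular_local (local_ring D p)}"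


section \<open>Transversal ordinary double points\<close>

definition poly_ring :: "nat \<Rightarrow> ((nat \<Rightarrow>\<^sub>0 nat) \<Rightarrow>\<^sub>0 complex) ring" where
  "poly_ring N =
     \<lparr>carrier = {f. \<forall>\<mu>\<in>Poly_Mapping.keys f. Poly_Mapping.keys \<mu> \<subseteq> {..<N}},
      monoid.mult = (*), one = 1, zero = 0, add = (+)\<rparr>"

definition var :: "nat \<Rightarrow> ((nat \<Rightarrow>\<^sub>0 nat) \<Rightarrow>\<^sub>0 complex)" where
  "var i = Poly_Mapping.single (Poly_Mapping.single i 1) 1"

text \<open>The coordinate ring of \<open>{xy = zw} \<times> C\<^sup>r\<close>, with \<open>x, y, z, w\<close> the variables of index
  \<open>0, 1, 2, 3\<close>.\<close>

definition node_ideal :: "nat \<Rightarrow> ((nat \<Rightarrow>\<^sub>0 nat) \<Rightarrow>\<^sub>0 complex) set" where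
  "node_ideal r = Idl\<^bsub>poly_ring (4 + r)\<^esub> {var 0 * var 1 - var 2 * var 3}"

definition node_ring :: "nat \<Rightarrow> ((nat \<Rightarrow>\<^sub>0 nat) \<Rightarrow>\<^sub>0 complex) set ring" where
  "node_ring r = poly_ring (4 + r) Quot node_ideal r"

definition node_class ::
    "nat \<Rightarrow> ((nat \<Rightarrow>\<^sub>0 nat) \<Rightarrow>\<^sub>0 complex) \<Rightarrow> ((nat \<Rightarrow>\<^sub>0 nat) \<Rightarrow>\<^sub>0 complex) set" where
  "node_class r f = node_ideal r +>\<^bsub>poly_ring (4 + r)\<^esub> f"

definition node_origin :: "nat \<Rightarrow> ((nat \<Rightarrow>\<^sub>0 nat) \<Rightarrow>\<^sub>0 complex) set set" where
  "node_origin r = Idl\<^bsub>node_ring r\<^esub> ((\<lambda>i. node_class r (var i)) ` {..<4 + r})"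

text \<open>The ideal of \<open>{0} \<times> C\<^sup>r\<close>.\<close>

definition node_axis :: "nat \<Rightarrow> ((nat \<Rightarrow>\<^sub>0 nat) \<Rightarrow>\<^sub>0 complex) set set" where
  "node_axis r = Idl\<^bsub>node_ring r\<^esub> ((\<lambda>i. node_class r (var i)) ` {..<4})"

text \<open>The variety is analytically isomorphic at \<open>p\<close> to \<open>{xy = zw} \<times> C\<^sup>r\<close> at the origin, in the
  sense that the completed local rings are isomorphic as \<open>C\<close>-algebras, and the isomorphism
  matches \<open>W\<close> with \<open>{0} \<times> C\<^sup>r\<close>. So a transversal slice to \<open>W\<close> at \<open>p\<close> is a 3-dimensional node.\<close>

definition transversal_node ::
    "'v::linorder set \<Rightarrow> ('v \<Rightarrow>\<^sub>0 real) set set \<Rightarrow> nat \<Rightarrow> 'v toric_point set \<Rightarrow> 'v toric_point \<Rightarrow>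
     bool" where
  "transversal_node D \<Sigma> r W p \<longleftrightarrow>
     (let A = local_ring D p; \<mm> = nonunits A; B = node_ring r; \<nn> = node_origin r in
      \<exists>h \<in> ring_iso (completion A \<mm>) (completion B \<nn>).
        (\<forall>c. h (to_completion A \<mm> (const_fun c)) =
              to_completion B \<nn> (node_class r (Poly_Mapping.single 0 c))) \<and>
        h ` completed_ideal A \<mm> (germ_ideal D \<Sigma> W p) = completed_ideal B \<nn> (node_axis r))"


section \<open>Ladder diagrams and the associated fan\<close>

text \<open>\<open>Cell a c\<close> stands for the point \<open>(a - 1/2, c - 1/2)\<close> of the plane.\<close>

datatype cell = Cell (col: nat) (row: nat)

instantiation cell :: linorder
begin

definition less_eq_cell :: "cell \<Rightarrow> cell \<Rightarrow> bool" where
  "x \<le> y \<longleftrightarrow> col x < col y \<or> col x = col y \<and> row x \<le> row y"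

definition less_cell :: "cell \<Rightarrow> cell \<Rightarrow> bool" where
  "x < y \<longleftrightarrow> col x < col y \<or> col x = col y \<and> row x < row y"

instance
  by standard (auto simp: less_eq_cell_def less_cell_def intro: cell.expand)

end

definition nsum :: "(nat \<Rightarrow> nat) \<Rightarrow> nat \<Rightarrow> nat" where
  "nsum k i = (\<Sum>j=1..i. k j)"

definition dots :: "nat \<Rightarrow> (nat \<Rightarrow> nat) \<Rightarrow> cell set" where
  "dots l k = {Cell a c | a c i. i \<in> {1..l+1} \<and> nsum k (i-1) < a \<and> a \<le> nsum k i \<and>
     1 \<le> c \<and> c \<le> nsum k (l+1) - nsum k i}"

definition stars :: "nat \<Rightarrow> (nat \<Rightarrow> nat) \<Rightarrow> cell set" where
  "stars l k = (\<lambda>i. Cell (nsum k (i-1) + 1) (nsum k (l+1) - nsum k i + 1)) ` {1..l+1}"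

type_synonym edge = "cell \<times> cell"

text \<open>An edge is the pair of its tail and its head.\<close>

definition edges :: "nat \<Rightarrow> (nat \<Rightarrow> nat) \<Rightarrow> edge set" where
  "edges l k = {(u, v). u \<in> dots l k \<union> stars l k \<and> v \<in> dots l k \<union> stars l k \<and>
     (col v = col u + 1 \<and> row v = row u \<or> col v = col u \<and> row u = row v + 1)}"

definition proj_dots :: "nat \<Rightarrow> (nat \<Rightarrow> nat) \<Rightarrow> (cell \<Rightarrow>\<^sub>0 real) \<Rightarrow> (cell \<Rightarrow>\<^sub>0 real)" where
  "proj_dots l k v = (\<Sum>x\<in>dots l k. Poly_Mapping.single x (Poly_Mapping.lookup v x))"

definition delta :: "nat \<Rightarrow> (nat \<Rightarrow> nat) \<Rightarrow> edge \<Rightarrow> (cell \<Rightarrow>\<^sub>0 real)" where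
  "delta l k e =
     proj_dots l k (Poly_Mapping.single (snd e) 1 - Poly_Mapping.single (fst e) 1)"

definition boxes :: "nat \<Rightarrow> (nat \<Rightarrow> nat) \<Rightarrow> edge set set" where
  "boxes l k = {b. b \<subseteq> edges l k \<and> (\<exists>a c.
     b = {(Cell a (c+1), Cell (a+1) (c+1)), (Cell (a+1) (c+1), Cell (a+1) c),
          (Cell a (c+1), Cell a c), (Cell a c, Cell (a+1) c)})}"

definition ladder_polytope :: "nat \<Rightarrow> (nat \<Rightarrow> nat) \<Rightarrow> (cell \<Rightarrow>\<^sub>0 real) set" where
  "ladder_polytope l k = convex hull (delta l k ` edges l k)"

text \<open>The empty face contributes the zero cone.\<close>

definition ladder_fan :: "nat \<Rightarrow> (nat \<Rightarrow> nat) \<Rightarrow> (cell \<Rightarrow>\<^sub>0 real) set set" where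
  "ladder_fan l k =
     {convex_cone hull F | F. F face_of ladder_polytope l k \<and> F \<noteq> ladder_polytope l k}"

definition box_cone :: "nat \<Rightarrow> (nat \<Rightarrow> nat) \<Rightarrow> edge set \<Rightarrow> (cell \<Rightarrow>\<^sub>0 real) set" where
  "box_cone l k b = convex_cone hull (delta l k ` b)"

definition box_stratum :: "nat \<Rightarrow> (nat \<Rightarrow> nat) \<Rightarrow> edge set \<Rightarrow> cell toric_point set" where
  "box_stratum l k b = orbit_closure (dots l k) (ladder_fan l k) (box_cone l k b)"

end

theory Submission
  imports Defs
begin

text \<open>
  \<^bold>\<open>The fan in terms of edges.\<close> An element of the dual lattice is an integer function \<open>u\<close> on the dots; extended by
  zero to the stars, it pairs with \<open>\<delta>(e)\<close> to the difference of its values at the ends of \<open>e\<close>. By Farkas' lemma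
  the proper faces of \<open>\<Delta>\<close> are cut out by integral \<open>u\<close> whose maximum \<open>N\<close> over the edges is positive, so the cones
  of the fan correspond to the sets \<open>F\<close> of edges where such a maximum is attained (\<open>ladder_fan_eq\<close>). Let \<open>S F\<close> be
  the monoid of the functionals that are nonnegative on \<open>F\<close> and \<open>T F\<close> its group of units, the functionals that
  vanish on \<open>F\<close>. Points of \<open>P\<close> are pairs of a cone \<open>F\<close> and a homomorphism on \<open>S F\<close> that is nonzero exactly on
  \<open>T F\<close> (\<open>toric_variety_eq\<close>), and such a point lies on the orbit closure of \<open>F'\<close> if and only if \<open>F' \<subseteq> F\<close>
  (\<open>W_iff\<close>). So the first claim says that a point on the orbit of \<open>F\<close> is singular exactly if \<open>F\<close> contains a box.

  \<^bold>\<open>Cones without a box.\<close> Suppose two edges of \<open>F\<close> have the same upper right end. They are two sides of a unit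
  square; \<open>u\<close> increases by \<open>N\<close> along both of them, hence by \<open>2 N\<close> in total along the other two sides and by at most
  \<open>N\<close> along each. So these belong to \<open>F\<close> too, and \<open>F\<close> contains a box. If it does not, every vertex has at most
  one edge of \<open>F\<close> to the left or downwards, and \<open>F\<close> is a forest. Along its edges \<open>u\<close> minus \<open>N\<close> times (column minus
  row) is constant; on the stars, where \<open>u = 0\<close>, this takes different values. So every tree contains at most one
  star, and the values on the edges of \<open>F\<close> together with the values at the roots of the trees without a star are
  coordinates of the dual lattice (\<open>forest.coord_basis\<close>). The chart is a product of lines and punctured lines
  (\<open>smooth_chart.regular\<close>).

  \<^bold>\<open>Cones with a box.\<close> Every point derivation kills the square of the maximal ideal. Derivations along the orbit
  and the derivations that read off the coefficient of an irreducible element of \<open>S F\<close> separate more than \<open>d\<close>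
  functions, where \<open>d\<close> is the number of dots (\<open>conifold.not_regular\<close>). On the other hand the Krull dimension is at most
  \<open>d\<close>: a chain of primes gives algebraically independent elements of the function field, and counting
  monomials bounds their number (\<open>krull_dim_le_card\<close>).

  \<^bold>\<open>The node.\<close> For a box \<open>b\<close> the monoid \<open>S b\<close> is the product of the group \<open>T b\<close>, which is free of rank \<open>d - 3\<close>, and
  the monoid of \<open>xy = zw\<close>. At a point of the open orbit of \<open>W\<^sub>b\<close> the local ring is therefore the localization of
  the coordinate ring of \<open>{xy = zw} \<times> C\<^bsup>d-3\<^esup>\<close> at the origin, after the units have been shifted by their
  values at the point. Localization at a maximal ideal does not change the completion
  (\<open>localization_pair.completion_pair\<close>), and the germs that vanish on \<open>W\<^sub>b\<close> are generated by \<open>x, y, z, w\<close>.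

  \<^bold>\<open>Codimension.\<close> The orbit closures of three faces of the cone of \<open>b\<close> give a chain of length \<open>3\<close>. A longer one is
  excluded by counting again: it would yield a chain of primes below the ideal of \<open>W\<^sub>b\<close>, modulo which \<open>d - 3\<close>
  characters stay independent (\<open>conifold.codim\<close>).
\<close>

abbreviation "lookup \<equiv> Poly_Mapping.lookup"
abbreviation "keys \<equiv> Poly_Mapping.keys"
abbreviation "single \<equiv> Poly_Mapping.single"

section \<open>Completion commutes with localization at a maximal ideal\<close>

lemma (in cring) ideal_power_ideal: "ideal I R \<Longrightarrow> ideal (ideal_power R I N) R"
  by (induction N) (auto simp: oneideal ideal_prod_is_ideal)

lemma (in cring) ideal_power_Suc_subset:
  assumes "ideal I R" shows "ideal_power R I (Suc N) \<subseteq> ideal_power R I N"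
  using ideal_prod_inter[OF assms ideal_power_ideal[OF assms]] by auto

lemma (in cring) ideal_prod_memI: "i \<in> I \<Longrightarrow> j \<in> J \<Longrightarrow> i \<otimes> j \<in> I \<cdot>\<^bsub>R\<^esub> J"
  by (rule ideal_prod.prod)

text \<open>Ring identities for approximate inverses: \<open>t\<close> is thought of as an inverse of \<open>s\<close> up to the error \<open>1 - s t\<close>.\<close>

lemma (in cring) newton_identity:
  "s \<in> carrier R \<Longrightarrow> t \<in> carrier R \<Longrightarrow> s' \<in> carrier R \<Longrightarrow>
    \<one> \<ominus> s \<otimes> (t \<oplus> s' \<otimes> (\<one> \<ominus> s \<otimes> t)) = (\<one> \<ominus> s \<otimes> s') \<otimes> (\<one> \<ominus> s \<otimes> t)"
  by algebra

lemma (in cring) split_by_approx_inverse: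
  "s \<in> carrier R \<Longrightarrow> t \<in> carrier R \<Longrightarrow> b \<in> carrier R \<Longrightarrow>
    b = t \<otimes> (b \<otimes> s) \<oplus> b \<otimes> (\<one> \<ominus> s \<otimes> t)"
  by algebra

lemma (in cring) diff_via:
  "x \<in> carrier R \<Longrightarrow> y \<in> carrier R \<Longrightarrow> z \<in> carrier R \<Longrightarrow> x \<ominus> z = (x \<ominus> y) \<oplus> (y \<ominus> z)"
  by algebra

lemma (in cring) approx_identity:
  "a \<in> carrier R \<Longrightarrow> x \<in> carrier R \<Longrightarrow> y \<in> carrier R \<Longrightarrow>
    (a \<ominus> (a \<otimes> x) \<otimes> y) \<otimes> x = (a \<otimes> x) \<otimes> (\<one> \<ominus> x \<otimes> y)"
  by algebra

lemma (in cring) diff_by_approx_inverse: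
  "b \<in> carrier R \<Longrightarrow> l \<in> carrier R \<Longrightarrow> s \<in> carrier R \<Longrightarrow> t \<in> carrier R \<Longrightarrow>
    t \<otimes> l \<ominus> b = t \<otimes> (l \<ominus> b \<otimes> s) \<oplus> (\<ominus> b) \<otimes> (\<one> \<ominus> s \<otimes> t)"
  by algebra

lemma (in cring) fraction_add:
  "a \<in> carrier R \<Longrightarrow> b \<in> carrier R \<Longrightarrow> s \<in> carrier R \<Longrightarrow> t \<in> carrier R \<Longrightarrow>
    (a \<oplus> b) \<otimes> (s \<otimes> t) = t \<otimes> (a \<otimes> s) \<oplus> s \<otimes> (b \<otimes> t)"
  by algebra

lemma (in cring) fraction_mult:
  "a \<in> carrier R \<Longrightarrow> b \<in> carrier R \<Longrightarrow> s \<in> carrier R \<Longrightarrow> t \<in> carrier R \<Longrightarrow>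
    (a \<otimes> b) \<otimes> (s \<otimes> t) = (a \<otimes> s) \<otimes> (b \<otimes> t)"
  by algebra

lemma (in cring) diff_mult:
  "a \<in> carrier R \<Longrightarrow> b \<in> carrier R \<Longrightarrow> s \<in> carrier R \<Longrightarrow>
    (a \<ominus> b) \<otimes> s = a \<otimes> s \<ominus> b \<otimes> s"
  by algebra

lemma (in ideal) coset_mem_iff:
  assumes "x \<in> carrier R" "y \<in> carrier R" shows "y \<in> I +> x \<longleftrightarrow> y \<ominus> x \<in> I"
  using a_rcos_module_minus[OF ring_axioms assms] .

lemma (in ideal) coset_eq:
  assumes "x \<in> carrier R" "y \<in> I +> x" shows "I +> x = I +> y"
  using assms by (rule a_repr_independence'[rotated])

lemma (in ideal) coset_sub: assumes "x \<in> carrier R" shows "I +> x \<subseteq> carrier R"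
  using a_r_coset_subset_G[OF a_subset assms] .

lemma (in ideal) quot_carrier: "carrier (R Quot I) = (\<lambda>x. I +> x) ` carrier R"
  by (auto simp: FactRing_simps)

lemma (in ideal) quot_mult:
  "x \<in> carrier R \<Longrightarrow> y \<in> carrier R \<Longrightarrow> (I +> x) \<otimes>\<^bsub>R Quot I\<^esub> (I +> y) = I +> (x \<otimes> y)"
  by (simp add: FactRing_def rcoset_mult_add)

lemma (in ideal) quot_add:
  "x \<in> carrier R \<Longrightarrow> y \<in> carrier R \<Longrightarrow> (I +> x) \<oplus>\<^bsub>R Quot I\<^esub> (I +> y) = I +> (x \<oplus> y)"
  by (simp add: FactRing_def a_rcos_sum)

lemma quot_one: "\<one>\<^bsub>R Quot I\<^esub> = I +>\<^bsub>R\<^esub> \<one>\<^bsub>R\<^esub>"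
  by (simp add: FactRing_def)

lemma completion_carrierI:
  assumes "\<And>N. s N \<in> carrier (R Quot ideal_power R I N)" "\<And>N. s (Suc N) \<subseteq> s N"
  shows "s \<in> carrier (completion R I)"
  using assms by (simp add: completion_def del: ideal_power.simps)

lemma completion_mem: "s \<in> carrier (completion R I) \<Longrightarrow> s N \<in> carrier (R Quot ideal_power R I N)"
  unfolding completion_def by simp

lemma completion_mult: "(s \<otimes>\<^bsub>completion R I\<^esub> t) N = s N \<otimes>\<^bsub>R Quot ideal_power R I N\<^esub> t N"
  by (simp add: completion_def)

lemma completion_add: "(s \<oplus>\<^bsub>completion R I\<^esub> t) N = s N \<oplus>\<^bsub>R Quot ideal_power R I N\<^esub> t N"
  by (simp add: completion_def)

text \<open>A homomorphism that induces isomorphisms \<open>B/J\<^sup>N \<cong> A/I\<^sup>N\<close> for all \<open>N\<close> identifies the completions.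
  The inverse isomorphism takes the preimage of each coset, which avoids choosing representatives.\<close>

locale completion_pair =
  A: cring A + B: cring B + IA: ideal I A + JB: ideal J B
  for A :: "'a ring" and B :: "'b ring" and \<phi> I J +
  assumes hom: "\<phi> \<in> ring_hom B A"
    and pre: "\<And>N b. b \<in> carrier B \<Longrightarrow> \<phi> b \<in> ideal_power A I N \<longleftrightarrow> b \<in> ideal_power B J N"
    and sur: "\<And>N a. a \<in> carrier A \<Longrightarrow> \<exists>b\<in>carrier B. a \<ominus>\<^bsub>A\<^esub> \<phi> b \<in> ideal_power A I N"
begin

definition pull :: "(nat \<Rightarrow> 'a set) \<Rightarrow> nat \<Rightarrow> 'b set" where
  "pull s = (\<lambda>N. {b \<in> carrier B. \<phi> b \<in> s N})"

abbreviation "PA \<equiv> ideal_power A I"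
abbreviation "PB \<equiv> ideal_power B J"

sublocale PA: ideal "PA N" A for N by (rule A.ideal_power_ideal[OF IA.ideal_axioms])
sublocale PB: ideal "PB N" B for N by (rule B.ideal_power_ideal[OF JB.ideal_axioms])
sublocale H: ring_hom_cring B A \<phi>
  by unfold_locales (rule hom)

lemma hom_diff: "b \<in> carrier B \<Longrightarrow> b' \<in> carrier B \<Longrightarrow> \<phi> (b \<ominus>\<^bsub>B\<^esub> b') = \<phi> b \<ominus>\<^bsub>A\<^esub> \<phi> b'"
  by (simp add: a_minus_def)

lemma pull_coset:
  assumes "b \<in> carrier B"
  shows "{b' \<in> carrier B. \<phi> b' \<in> PA N +>\<^bsub>A\<^esub> \<phi> b} = PB N +>\<^bsub>B\<^esub> b"
proof (intro Set.set_eqI iffI)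
  fix x assume "x \<in> {b' \<in> carrier B. \<phi> b' \<in> PA N +>\<^bsub>A\<^esub> \<phi> b}"
  then have x: "x \<in> carrier B" "\<phi> x \<in> PA N +>\<^bsub>A\<^esub> \<phi> b" by auto
  then have "\<phi> (x \<ominus>\<^bsub>B\<^esub> b) \<in> PA N" using assms by (simp add: PA.coset_mem_iff hom_diff)
  then show "x \<in> PB N +>\<^bsub>B\<^esub> b" using x assms by (simp add: PB.coset_mem_iff pre)
next
  fix x assume x: "x \<in> PB N +>\<^bsub>B\<^esub> b"
  then have xc: "x \<in> carrier B" using PB.coset_sub[OF assms] by auto
  then have "\<phi> (x \<ominus>\<^bsub>B\<^esub> b) \<in> PA N" using x assms by (simp add: PB.coset_mem_iff pre)
  then show "x \<in> {b' \<in> carrier B. \<phi> b' \<in> PA N +>\<^bsub>A\<^esub> \<phi> b}"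
    using xc assms by (simp add: PA.coset_mem_iff hom_diff)
qed

lemma coset_rep:
  assumes "X \<in> carrier (A Quot PA N)"
  obtains b where "b \<in> carrier B" "X = PA N +>\<^bsub>A\<^esub> \<phi> b"
proof -
  obtain a where a: "a \<in> carrier A" "X = PA N +>\<^bsub>A\<^esub> a" using assms PA.quot_carrier by auto
  obtain b where b: "b \<in> carrier B" "a \<ominus>\<^bsub>A\<^esub> \<phi> b \<in> PA N" using sur[OF a(1)] by blast
  then have "a \<in> PA N +>\<^bsub>A\<^esub> \<phi> b" using a by (simp add: PA.coset_mem_iff)
  then have "PA N +>\<^bsub>A\<^esub> \<phi> b = PA N +>\<^bsub>A\<^esub> a" using b by (intro PA.coset_eq) auto
  then show ?thesis using that a b by auto
qed

lemma coset_rep_B: "X \<in> carrier (B Quot PB N) \<Longrightarrow> \<exists>b. b \<in> carrier B \<and> X = PB N +>\<^bsub>B\<^esub> b"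
  unfolding PB.quot_carrier by (erule imageE) (intro exI conjI)

lemma completionD:
  assumes "s \<in> carrier (completion A I)"
  shows "s N \<in> carrier (A Quot PA N)" "s (Suc N) \<subseteq> s N"
  using assms unfolding completion_def by simp_all

lemma completionD_B: "s \<in> carrier (completion B J) \<Longrightarrow> s (Suc N) \<subseteq> s N"
  unfolding completion_def by simp

lemma pull_rep:
  assumes "s \<in> carrier (completion A I)"
  obtains b where "b \<in> carrier B" "s N = PA N +>\<^bsub>A\<^esub> \<phi> b" "pull s N = PB N +>\<^bsub>B\<^esub> b"
proof -
  obtain b where b: "b \<in> carrier B" "s N = PA N +>\<^bsub>A\<^esub> \<phi> b"
    using coset_rep[OF completionD(1)[OF assms, of N]] by blast
  have "pull s N = PB N +>\<^bsub>B\<^esub> b" unfolding pull_def b(2) by (rule pull_coset[OF b(1)])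
  then show ?thesis using that b by blast
qed

lemma pull_in: "s \<in> carrier (completion A I) \<Longrightarrow> pull s \<in> carrier (completion B J)"
proof -
  assume s: "s \<in> carrier (completion A I)"
  have "pull s N \<in> carrier (B Quot PB N)" for N
    by (rule pull_rep[OF s, of N]) (unfold PB.quot_carrier, blast)
  moreover have "pull s (Suc N) \<subseteq> pull s N" for N
    using completionD(2)[OF s, of N] unfolding pull_def by blast
  ultimately show ?thesis by (rule completion_carrierI)
qed

lemma pull_to_completion:
  assumes "b \<in> carrier B"
  shows "pull (to_completion A I (\<phi> b)) = to_completion B J b"
  unfolding pull_def to_completion_def by (rule ext, rule pull_coset[OF assms])

lemma pull_iso: "pull \<in> ring_iso (completion A I) (completion B J)"
proof -
  have "pull \<in> ring_hom (completion A I) (completion B J)"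
  proof (rule ring_hom_memI)
    fix s assume "s \<in> carrier (completion A I)"
    then show "pull s \<in> carrier (completion B J)" by (rule pull_in)
  next
    fix s t assume st: "s \<in> carrier (completion A I)" "t \<in> carrier (completion A I)"
    show "pull (s \<otimes>\<^bsub>completion A I\<^esub> t) = pull s \<otimes>\<^bsub>completion B J\<^esub> pull t"
    proof
      fix N
      obtain b where b: "b \<in> carrier B" "s N = PA N +>\<^bsub>A\<^esub> \<phi> b" "pull s N = PB N +>\<^bsub>B\<^esub> b"
        using pull_rep[OF st(1)] .
      obtain c where c: "c \<in> carrier B" "t N = PA N +>\<^bsub>A\<^esub> \<phi> c" "pull t N = PB N +>\<^bsub>B\<^esub> c"
        using pull_rep[OF st(2)] .
      have "(s \<otimes>\<^bsub>completion A I\<^esub> t) N = PA N +>\<^bsub>A\<^esub> \<phi> (b \<otimes>\<^bsub>B\<^esub> c)"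
        unfolding completion_mult b(2) c(2)
        using PA.quot_mult[OF H.hom_closed[OF b(1)] H.hom_closed[OF c(1)]] b(1) c(1) by simp
      then have "pull (s \<otimes>\<^bsub>completion A I\<^esub> t) N = PB N +>\<^bsub>B\<^esub> (b \<otimes>\<^bsub>B\<^esub> c)"
        unfolding pull_def using b(1) c(1) by (simp only: pull_coset B.m_closed B.a_closed)
      then show "pull (s \<otimes>\<^bsub>completion A I\<^esub> t) N = (pull s \<otimes>\<^bsub>completion B J\<^esub> pull t) N"
        unfolding completion_mult b(3) c(3) using PB.quot_mult[OF b(1) c(1)] by simp
    qed
    show "pull (s \<oplus>\<^bsub>completion A I\<^esub> t) = pull s \<oplus>\<^bsub>completion B J\<^esub> pull t"
    proof
      fix N
      obtain b where b: "b \<in> carrier B" "s N = PA N +>\<^bsub>A\<^esub> \<phi> b" "pull s N = PB N +>\<^bsub>B\<^esub> b"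
        using pull_rep[OF st(1)] .
      obtain c where c: "c \<in> carrier B" "t N = PA N +>\<^bsub>A\<^esub> \<phi> c" "pull t N = PB N +>\<^bsub>B\<^esub> c"
        using pull_rep[OF st(2)] .
      have "(s \<oplus>\<^bsub>completion A I\<^esub> t) N = PA N +>\<^bsub>A\<^esub> \<phi> (b \<oplus>\<^bsub>B\<^esub> c)"
        unfolding completion_add b(2) c(2)
        using PA.quot_add[OF H.hom_closed[OF b(1)] H.hom_closed[OF c(1)]] b(1) c(1) by simp
      then have "pull (s \<oplus>\<^bsub>completion A I\<^esub> t) N = PB N +>\<^bsub>B\<^esub> (b \<oplus>\<^bsub>B\<^esub> c)"
        unfolding pull_def using b(1) c(1) by (simp only: pull_coset B.m_closed B.a_closed)
      then show "pull (s \<oplus>\<^bsub>completion A I\<^esub> t) N = (pull s \<oplus>\<^bsub>completion B J\<^esub> pull t) N"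
        unfolding completion_add b(3) c(3) using PB.quot_add[OF b(1) c(1)] by simp
    qed
  next
    show "pull \<one>\<^bsub>completion A I\<^esub> = \<one>\<^bsub>completion B J\<^esub>"
      using pull_to_completion[OF B.one_closed] unfolding completion_def to_completion_def
      by (simp add: quot_one del: ideal_power.simps)
  qed
  moreover have "bij_betw pull (carrier (completion A I)) (carrier (completion B J))"
    unfolding bij_betw_def
  proof
    show "inj_on pull (carrier (completion A I))"
    proof (intro inj_onI ext)
      fix s t N assume st: "s \<in> carrier (completion A I)" "t \<in> carrier (completion A I)" "pull s = pull t"
      obtain b where b: "b \<in> carrier B" "s N = PA N +>\<^bsub>A\<^esub> \<phi> b" "pull s N = PB N +>\<^bsub>B\<^esub> b"
        using pull_rep[OF st(1)] .
      obtain c where c: "c \<in> carrier B" "t N = PA N +>\<^bsub>A\<^esub> \<phi> c" "pull t N = PB N +>\<^bsub>B\<^esub> c"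
        using pull_rep[OF st(2)] .
      have "b \<in> PB N +>\<^bsub>B\<^esub> b" using b(1) by (rule PB.a_rcos_self)
      then have "b \<in> pull t N" using b(3) st(3) by simp
      then have "\<phi> b \<in> t N" by (simp add: pull_def)
      then show "s N = t N" using b(1,2) c(1,2) PA.coset_eq[of "\<phi> c" "\<phi> b" N] by auto
    qed
    show "pull ` carrier (completion A I) = carrier (completion B J)"
    proof
      show "pull ` carrier (completion A I) \<subseteq> carrier (completion B J)" using pull_in by blast
      show "carrier (completion B J) \<subseteq> pull ` carrier (completion A I)"
      proof
        fix u assume u: "u \<in> carrier (completion B J)"
        then have *: "\<exists>b. b \<in> carrier B \<and> u N = PB N +>\<^bsub>B\<^esub> b" for N
          by (rule coset_rep_B[OF completion_mem])
        define b where "b N = (SOME b. b \<in> carrier B \<and> u N = PB N +>\<^bsub>B\<^esub> b)" for N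
        have bb: "b N \<in> carrier B \<and> u N = PB N +>\<^bsub>B\<^esub> b N" for N
          unfolding b_def by (rule someI_ex[OF *])
        note b = bb[THEN conjunct1] bb[THEN conjunct2]
        define s where "s = (\<lambda>N. PA N +>\<^bsub>A\<^esub> \<phi> (b N))"
        have "s (Suc N) \<subseteq> s N" for N
        proof
          fix x assume x: "x \<in> s (Suc N)"
          then have xc: "x \<in> carrier A" using PA.coset_sub[OF H.hom_closed[OF b(1)[of "Suc N"]], of "Suc N"]
            unfolding s_def by blast
          have "x \<ominus>\<^bsub>A\<^esub> \<phi> (b (Suc N)) \<in> PA (Suc N)"
            using x PA.coset_mem_iff[OF H.hom_closed[OF b(1)[of "Suc N"]] xc, of "Suc N"]
            unfolding s_def by blast
          then have 1: "x \<ominus>\<^bsub>A\<^esub> \<phi> (b (Suc N)) \<in> PA N"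
            using A.ideal_power_Suc_subset[OF IA.ideal_axioms, of N] by (rule rev_subsetD)
          have "b (Suc N) \<in> u (Suc N)" unfolding b(2)[of "Suc N"] by (rule PB.a_rcos_self[OF b(1)])
          then have "b (Suc N) \<in> PB N +>\<^bsub>B\<^esub> b N"
            using completionD_B[OF u, of N] unfolding b(2)[of N] by blast
          then have 2: "\<phi> (b (Suc N)) \<ominus>\<^bsub>A\<^esub> \<phi> (b N) \<in> PA N"
            using pre[of "b (Suc N) \<ominus>\<^bsub>B\<^esub> b N" N] PB.coset_mem_iff[OF b(1) b(1), of "Suc N" N N]
              hom_diff[OF b(1) b(1)] b(1) by simp
          have "x \<ominus>\<^bsub>A\<^esub> \<phi> (b N) = (x \<ominus>\<^bsub>A\<^esub> \<phi> (b (Suc N))) \<oplus>\<^bsub>A\<^esub> (\<phi> (b (Suc N)) \<ominus>\<^bsub>A\<^esub> \<phi> (b N))"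
            using xc b(1) by (intro A.diff_via) auto
          then have "x \<ominus>\<^bsub>A\<^esub> \<phi> (b N) \<in> PA N" using PA.a_closed[OF 1 2] by simp
          then show "x \<in> s N"
            using PA.coset_mem_iff[OF H.hom_closed[OF b(1)[of N]] xc, of N] unfolding s_def by blast
        qed
        moreover have "s N \<in> carrier (A Quot PA N)" for N
          unfolding PA.quot_carrier s_def using b(1) by blast
        ultimately have "s \<in> carrier (completion A I)"
          by (intro completion_carrierI)
        moreover have "pull s N = u N" for N
          unfolding pull_def s_def b(2) by (rule pull_coset[OF b(1)])
        ultimately show "u \<in> pull ` carrier (completion A I)" using ext[of "pull s" u] by blast
      qed
    qed
  qed
  ultimately show ?thesis by (simp add: ring_iso_def)
qed

text \<open>Ideals correspond as soon as they do so modulo all powers, because completed ideals are closures.\<close>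

lemma pull_completed_ideal:
  assumes KL: "\<And>N b. b \<in> carrier B \<Longrightarrow>
      (\<exists>k\<in>K. k \<in> PA N +>\<^bsub>A\<^esub> \<phi> b) \<longleftrightarrow> (\<exists>l\<in>L. l \<in> PB N +>\<^bsub>B\<^esub> b)"
  shows "pull ` completed_ideal A I K = completed_ideal B J L"
proof -
  have *: "s \<in> completed_ideal A I K \<longleftrightarrow> pull s \<in> completed_ideal B J L"
    if s: "s \<in> carrier (completion A I)" for s
  proof -
    have "s N \<inter> K \<noteq> {} \<longleftrightarrow> pull s N \<inter> L \<noteq> {}" for N
    proof -
      obtain b where b: "b \<in> carrier B" "s N = PA N +>\<^bsub>A\<^esub> \<phi> b" "pull s N = PB N +>\<^bsub>B\<^esub> b"
        using pull_rep[OF s] .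
      show ?thesis using KL[OF b(1), of N] unfolding b(2,3) by blast
    qed
    then show ?thesis using s pull_in[OF s] by (simp add: completed_ideal_def)
  qed
  have surj: "pull ` carrier (completion A I) = carrier (completion B J)"
    using pull_iso by (auto simp: ring_iso_def bij_betw_def)
  show ?thesis
  proof (intro Set.set_eqI iffI)
    fix u assume "u \<in> pull ` completed_ideal A I K"
    then obtain s where "s \<in> completed_ideal A I K" "u = pull s" by blast
    then show "u \<in> completed_ideal B J L" using * by (auto simp: completed_ideal_def)
  next
    fix u assume u: "u \<in> completed_ideal B J L"
    then obtain s where "s \<in> carrier (completion A I)" "u = pull s"
      using surj unfolding completed_ideal_def by blast
    then show "u \<in> pull ` completed_ideal A I K" using * u by blast
  qed
qed

end

text \<open>\<open>A\<close> is the localization of \<open>B\<close> at the maximal ideal \<open>J\<close>: every element of \<open>A\<close> is a fraction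
  of elements of \<open>B\<close> with denominator outside \<open>J\<close>.\<close>

locale localization_pair =
  A: cring A + B: cring B + JB: ideal J B + H: ring_hom_cring B A \<phi>
  for A :: "'a ring" and B :: "'b ring" and \<phi> J +
  assumes inj: "inj_on \<phi> (carrier B)"
    and proper: "\<one>\<^bsub>B\<^esub> \<notin> J"
    and unit: "\<And>s. s \<in> carrier B - J \<Longrightarrow> \<phi> s \<in> Units A"
    and frac: "\<And>a. a \<in> carrier A \<Longrightarrow> \<exists>b\<in>carrier B. \<exists>s\<in>carrier B - J. a \<otimes>\<^bsub>A\<^esub> \<phi> s = \<phi> b"
    and maxl: "\<And>s. s \<in> carrier B - J \<Longrightarrow> \<exists>t\<in>carrier B. \<one>\<^bsub>B\<^esub> \<ominus>\<^bsub>B\<^esub> s \<otimes>\<^bsub>B\<^esub> t \<in> J"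
begin

text \<open>The ideal that \<open>L\<close> generates in the localization.\<close>

definition ext :: "'b set \<Rightarrow> 'a set" where
  "ext L = {a \<in> carrier A. \<exists>b\<in>L. \<exists>s\<in>carrier B - J. a \<otimes>\<^bsub>A\<^esub> \<phi> s = \<phi> b}"

lemma PBi: "ideal (ideal_power B J N) B" by (rule B.ideal_power_ideal[OF JB.ideal_axioms])

lemma PBs: "b \<in> ideal_power B J N \<Longrightarrow> b \<in> carrier B" using PBi[of N] by (rule ideal.Icarr)

lemma J_prime:
  assumes s: "s \<in> carrier B - J" and t: "t \<in> carrier B - J"
  shows "s \<otimes>\<^bsub>B\<^esub> t \<in> carrier B - J"
proof -
  obtain s' where s': "s' \<in> carrier B" "\<one>\<^bsub>B\<^esub> \<ominus>\<^bsub>B\<^esub> s \<otimes>\<^bsub>B\<^esub> s' \<in> J" using maxl[OF s] by blast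
  have "t \<in> J" if "s \<otimes>\<^bsub>B\<^esub> t \<in> J"
  proof -
    have "t = s' \<otimes>\<^bsub>B\<^esub> (s \<otimes>\<^bsub>B\<^esub> t) \<oplus>\<^bsub>B\<^esub> t \<otimes>\<^bsub>B\<^esub> (\<one>\<^bsub>B\<^esub> \<ominus>\<^bsub>B\<^esub> s \<otimes>\<^bsub>B\<^esub> s')"
      using B.split_by_approx_inverse[of s s' t] s t s'(1) B.m_comm[of t s] by simp
    moreover have "s' \<otimes>\<^bsub>B\<^esub> (s \<otimes>\<^bsub>B\<^esub> t) \<oplus>\<^bsub>B\<^esub> t \<otimes>\<^bsub>B\<^esub> (\<one>\<^bsub>B\<^esub> \<ominus>\<^bsub>B\<^esub> s \<otimes>\<^bsub>B\<^esub> s') \<in> J"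
      using t by (intro JB.a_closed JB.I_l_closed[OF that s'(1)] JB.I_l_closed[OF s'(2)]) auto
    ultimately show ?thesis by simp
  qed
  then show ?thesis using s t by auto
qed

text \<open>Elements outside the maximal ideal \<open>J\<close> are invertible modulo all its powers, so denominators disappear in \<open>B/J\<^sup>N\<close>.\<close>

lemma inv_mod:
  assumes s: "s \<in> carrier B - J"
  shows "\<exists>t\<in>carrier B. \<one>\<^bsub>B\<^esub> \<ominus>\<^bsub>B\<^esub> s \<otimes>\<^bsub>B\<^esub> t \<in> ideal_power B J N"
proof (induction N)
  case 0 show ?case using s by (auto intro!: bexI[of _ "\<zero>\<^bsub>B\<^esub>"])
next
  case (Suc N)
  then obtain t where t: "t \<in> carrier B" "\<one>\<^bsub>B\<^esub> \<ominus>\<^bsub>B\<^esub> s \<otimes>\<^bsub>B\<^esub> t \<in> ideal_power B J N" by blast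
  obtain s' where s': "s' \<in> carrier B" "\<one>\<^bsub>B\<^esub> \<ominus>\<^bsub>B\<^esub> s \<otimes>\<^bsub>B\<^esub> s' \<in> J" using maxl[OF s] by blast
  \<comment> \<open>One Newton step: the error of the new inverse is the product of the two old errors.\<close>
  let ?t = "t \<oplus>\<^bsub>B\<^esub> s' \<otimes>\<^bsub>B\<^esub> (\<one>\<^bsub>B\<^esub> \<ominus>\<^bsub>B\<^esub> s \<otimes>\<^bsub>B\<^esub> t)"
  have "\<one>\<^bsub>B\<^esub> \<ominus>\<^bsub>B\<^esub> s \<otimes>\<^bsub>B\<^esub> ?t = (\<one>\<^bsub>B\<^esub> \<ominus>\<^bsub>B\<^esub> s \<otimes>\<^bsub>B\<^esub> s') \<otimes>\<^bsub>B\<^esub> (\<one>\<^bsub>B\<^esub> \<ominus>\<^bsub>B\<^esub> s \<otimes>\<^bsub>B\<^esub> t)"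
    using s t(1) s'(1) by (intro B.newton_identity) auto
  then have "\<one>\<^bsub>B\<^esub> \<ominus>\<^bsub>B\<^esub> s \<otimes>\<^bsub>B\<^esub> ?t \<in> ideal_power B J (Suc N)"
    using B.ideal_prod_memI[OF s'(2) t(2)] by simp
  then show ?case using s t(1) s'(1) by (intro bexI[of _ ?t]) auto
qed

lemma cancel_mod:
  assumes s: "s \<in> carrier B - J" and b: "b \<in> carrier B" and sb: "b \<otimes>\<^bsub>B\<^esub> s \<in> ideal_power B J N"
  shows "b \<in> ideal_power B J N"
proof -
  obtain t where t: "t \<in> carrier B" "\<one>\<^bsub>B\<^esub> \<ominus>\<^bsub>B\<^esub> s \<otimes>\<^bsub>B\<^esub> t \<in> ideal_power B J N" using inv_mod[OF s] by blast
  have "b = t \<otimes>\<^bsub>B\<^esub> (b \<otimes>\<^bsub>B\<^esub> s) \<oplus>\<^bsub>B\<^esub> b \<otimes>\<^bsub>B\<^esub> (\<one>\<^bsub>B\<^esub> \<ominus>\<^bsub>B\<^esub> s \<otimes>\<^bsub>B\<^esub> t)"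
    using s t(1) b by (intro B.split_by_approx_inverse) auto
  moreover have "\<dots> \<in> ideal_power B J N"
    by (intro additive_subgroup.a_closed[OF ideal.axioms(1)[OF PBi]] ideal.I_l_closed[OF PBi sb t(1)]
        ideal.I_l_closed[OF PBi t(2) b])
  ultimately show ?thesis by simp
qed

lemma ext_carrier: "ext L \<subseteq> carrier A" by (auto simp: ext_def)

lemma inj_eq: "\<phi> x = \<phi> y \<Longrightarrow> x \<in> carrier B \<Longrightarrow> y \<in> carrier B \<Longrightarrow> x = y"
  using inj by (rule inj_onD)

lemma ext_I:
  assumes "a \<in> carrier A" "b \<in> L" "s \<in> carrier B - J" "a \<otimes>\<^bsub>A\<^esub> \<phi> s = \<phi> b"
  shows "a \<in> ext L" using assms by (auto simp: ext_def)

lemma ext_phi: "L \<subseteq> carrier B \<Longrightarrow> b \<in> L \<Longrightarrow> \<phi> b \<in> ext L"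
  by (rule ext_I[of _ b _ "\<one>\<^bsub>B\<^esub>"]) (use proper in auto)

lemma ext_add:
  assumes L: "ideal L B" and a: "a \<in> ext L" and a': "a' \<in> ext L"
  shows "a \<oplus>\<^bsub>A\<^esub> a' \<in> ext L"
proof -
  obtain b s where b: "a \<in> carrier A" "b \<in> L" "s \<in> carrier B - J" "a \<otimes>\<^bsub>A\<^esub> \<phi> s = \<phi> b"
    using a by (auto simp: ext_def)
  obtain b' s' where b': "a' \<in> carrier A" "b' \<in> L" "s' \<in> carrier B - J" "a' \<otimes>\<^bsub>A\<^esub> \<phi> s' = \<phi> b'"
    using a' by (auto simp: ext_def)
  have bc: "b \<in> carrier B" "b' \<in> carrier B" using b b' L by (auto intro: ideal.Icarr)
  show ?thesis
  proof (rule ext_I)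
    show "s \<otimes>\<^bsub>B\<^esub> s' \<in> carrier B - J" using b b' J_prime by blast
    show "s' \<otimes>\<^bsub>B\<^esub> b \<oplus>\<^bsub>B\<^esub> s \<otimes>\<^bsub>B\<^esub> b' \<in> L"
      using b b' L by (intro additive_subgroup.a_closed[OF ideal.axioms(1)] ideal.I_l_closed) auto
    have cl: "\<phi> s \<in> carrier A" "\<phi> s' \<in> carrier A" using b b' by auto
    have "(a \<oplus>\<^bsub>A\<^esub> a') \<otimes>\<^bsub>A\<^esub> (\<phi> s \<otimes>\<^bsub>A\<^esub> \<phi> s') =
      \<phi> s' \<otimes>\<^bsub>A\<^esub> (a \<otimes>\<^bsub>A\<^esub> \<phi> s) \<oplus>\<^bsub>A\<^esub> \<phi> s \<otimes>\<^bsub>A\<^esub> (a' \<otimes>\<^bsub>A\<^esub> \<phi> s')"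
      using b(1) b'(1) cl by (intro A.fraction_add)
    then show "(a \<oplus>\<^bsub>A\<^esub> a') \<otimes>\<^bsub>A\<^esub> \<phi> (s \<otimes>\<^bsub>B\<^esub> s') = \<phi> (s' \<otimes>\<^bsub>B\<^esub> b \<oplus>\<^bsub>B\<^esub> s \<otimes>\<^bsub>B\<^esub> b')"
      using b b' bc by simp
    show "a \<oplus>\<^bsub>A\<^esub> a' \<in> carrier A" using b b' by auto
  qed
qed

lemma ext_mult:
  assumes L: "L \<subseteq> carrier B" "L' \<subseteq> carrier B" and a: "a \<in> ext L" and a': "a' \<in> ext L'"
    and LL: "\<And>b b'. b \<in> L \<Longrightarrow> b' \<in> L' \<Longrightarrow> b \<otimes>\<^bsub>B\<^esub> b' \<in> M"
  shows "a \<otimes>\<^bsub>A\<^esub> a' \<in> ext M"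
proof -
  obtain b s where b: "a \<in> carrier A" "b \<in> L" "s \<in> carrier B - J" "a \<otimes>\<^bsub>A\<^esub> \<phi> s = \<phi> b"
    using a by (auto simp: ext_def)
  obtain b' s' where b': "a' \<in> carrier A" "b' \<in> L'" "s' \<in> carrier B - J" "a' \<otimes>\<^bsub>A\<^esub> \<phi> s' = \<phi> b'"
    using a' by (auto simp: ext_def)
  have bc: "b \<in> carrier B" "b' \<in> carrier B" using b b' L by auto
  show ?thesis
  proof (rule ext_I)
    show "s \<otimes>\<^bsub>B\<^esub> s' \<in> carrier B - J" using b b' J_prime by blast
    show "b \<otimes>\<^bsub>B\<^esub> b' \<in> M" using b b' LL by blast
    have cl: "\<phi> s \<in> carrier A" "\<phi> s' \<in> carrier A" using b b' by auto
    have "(a \<otimes>\<^bsub>A\<^esub> a') \<otimes>\<^bsub>A\<^esub> (\<phi> s \<otimes>\<^bsub>A\<^esub> \<phi> s') = (a \<otimes>\<^bsub>A\<^esub> \<phi> s) \<otimes>\<^bsub>A\<^esub> (a' \<otimes>\<^bsub>A\<^esub> \<phi> s')"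
      using b(1) b'(1) cl by (intro A.fraction_mult)
    then show "(a \<otimes>\<^bsub>A\<^esub> a') \<otimes>\<^bsub>A\<^esub> \<phi> (s \<otimes>\<^bsub>B\<^esub> s') = \<phi> (b \<otimes>\<^bsub>B\<^esub> b')"
      using b b' bc by simp
    show "a \<otimes>\<^bsub>A\<^esub> a' \<in> carrier A" using b b' by auto
  qed
qed

lemma carrier_ext: "carrier A = ext (carrier B)"
  using frac by (auto simp: ext_def)

lemma ext_ideal: assumes L: "ideal L B" shows "ideal (ext L) A"
proof -
  have Lc: "L \<subseteq> carrier B" using L by (auto intro: ideal.Icarr)
  have mult: "x \<otimes>\<^bsub>A\<^esub> a \<in> ext L" if "a \<in> ext L" "x \<in> carrier A" for a x
    using ext_mult[OF _ Lc _ that(1), of "carrier B" x L] that(2) carrier_ext ideal.I_l_closed[OF L]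
    by auto
  have sub: "subgroup (ext L) (add_monoid A)"
  proof (rule subgroup.intro)
    show "ext L \<subseteq> carrier (add_monoid A)" using ext_carrier by simp
    show "x \<otimes>\<^bsub>add_monoid A\<^esub> y \<in> ext L" if "x \<in> ext L" "y \<in> ext L" for x y
      using ext_add[OF L that] by simp
    have "\<phi> \<zero>\<^bsub>B\<^esub> \<in> ext L"
      using Lc L by (intro ext_phi) (auto intro: additive_subgroup.zero_closed ideal.axioms(1))
    then show "\<one>\<^bsub>add_monoid A\<^esub> \<in> ext L" by simp
    show "inv\<^bsub>add_monoid A\<^esub> x \<in> ext L" if x: "x \<in> ext L" for x
    proof -
      have xc: "x \<in> carrier A" using x ext_carrier by auto
      have "(\<ominus>\<^bsub>A\<^esub> \<one>\<^bsub>A\<^esub>) \<otimes>\<^bsub>A\<^esub> x \<in> ext L" using mult[OF x] by simp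
      then have "\<ominus>\<^bsub>A\<^esub> x \<in> ext L" using xc by (simp add: A.l_minus)
      then show ?thesis by (simp add: a_inv_def)
    qed
  qed
  show ?thesis
    by (rule idealI[OF A.ring_axioms sub]) (use mult ext_carrier A.m_comm in \<open>auto, fastforce\<close>)
qed

lemma nonunits_eq: "nonunits A = ext J"
proof (intro Set.set_eqI iffI)
  fix a assume "a \<in> nonunits A"
  then have a: "a \<in> carrier A" "a \<notin> Units A" by (auto simp: nonunits_def)
  obtain b s where b: "b \<in> carrier B" "s \<in> carrier B - J" "a \<otimes>\<^bsub>A\<^esub> \<phi> s = \<phi> b" using frac[OF a(1)] by blast
  have "b \<in> J"
  proof (rule ccontr)
    assume "b \<notin> J"
    then have "\<phi> b \<in> Units A" using unit b by blast
    then have u: "inv\<^bsub>A\<^esub> \<phi> b \<in> carrier A" "\<phi> b \<otimes>\<^bsub>A\<^esub> inv\<^bsub>A\<^esub> \<phi> b = \<one>\<^bsub>A\<^esub>" by auto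
    have sc: "\<phi> s \<in> carrier A" using b(2) by auto
    have "a \<otimes>\<^bsub>A\<^esub> (\<phi> s \<otimes>\<^bsub>A\<^esub> inv\<^bsub>A\<^esub> \<phi> b) = \<one>\<^bsub>A\<^esub>"
      using A.m_assoc[OF a(1) sc u(1)] b(3) u(2) by simp
    then have "a \<in> Units A"
      using a(1) sc u(1) A.m_comm[of a "\<phi> s \<otimes>\<^bsub>A\<^esub> inv\<^bsub>A\<^esub> \<phi> b"] unfolding Units_def by auto
    then show False using a by simp
  qed
  then show "a \<in> ext J" using a b by (auto intro: ext_I)
next
  fix a assume a: "a \<in> ext J"
  then obtain b s where b: "a \<in> carrier A" "b \<in> J" "s \<in> carrier B - J" "a \<otimes>\<^bsub>A\<^esub> \<phi> s = \<phi> b"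
    by (auto simp: ext_def)
  have "a \<notin> Units A"
  proof
    assume "a \<in> Units A"
    then obtain x where x: "x \<in> carrier A" "a \<otimes>\<^bsub>A\<^esub> x = \<one>\<^bsub>A\<^esub>" by (auto simp: Units_def)
    have "a \<otimes>\<^bsub>A\<^esub> x \<in> ext J"
      using ideal.I_r_closed[OF ext_ideal[OF JB.ideal_axioms] a x(1)] .
    then have "\<one>\<^bsub>A\<^esub> \<in> ext J" using x by simp
    then obtain b s where b: "b \<in> J" "s \<in> carrier B - J" "\<one>\<^bsub>A\<^esub> \<otimes>\<^bsub>A\<^esub> \<phi> s = \<phi> b"
      by (auto simp: ext_def)
    then show False using inj_eq[of s b] by auto
  qed
  then show "a \<in> nonunits A" using b by (simp add: nonunits_def)
qed

lemma ideal_power_ext: "ideal_power A (ext J) N = ext (ideal_power B J N)"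
proof (induction N)
  case 0 show ?case using carrier_ext by simp
next
  case (Suc N)
  have Jc: "J \<subseteq> carrier B" "ideal_power B J N \<subseteq> carrier B" using PBs by auto
  have "x \<in> ext (ideal_power B J (Suc N))" if "x \<in> ext J \<cdot>\<^bsub>A\<^esub> ext (ideal_power B J N)" for x
    using that
  proof (induction rule: ideal_prod.induct)
    case (prod i j)
    show ?case by (rule ext_mult[OF Jc prod]) (simp add: B.ideal_prod_memI)
  next
    case (sum s1 s2) then show ?case using ext_add[OF PBi] by blast
  qed
  moreover have "x \<in> ext J \<cdot>\<^bsub>A\<^esub> ext (ideal_power B J N)" if x: "x \<in> ext (ideal_power B J (Suc N))" for x
  proof -
    have P: "ideal (ext J \<cdot>\<^bsub>A\<^esub> ext (ideal_power B J N)) A"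
      by (rule A.ideal_prod_is_ideal[OF ext_ideal[OF JB.ideal_axioms] ext_ideal[OF PBi]])
    obtain b s where b: "x \<in> carrier A" "b \<in> ideal_power B J (Suc N)" "s \<in> carrier B - J" "x \<otimes>\<^bsub>A\<^esub> \<phi> s = \<phi> b"
      using x unfolding ext_def by blast
    have "b \<in> J \<cdot>\<^bsub>B\<^esub> ideal_power B J N" using b by simp
    then have "\<phi> b \<in> ext J \<cdot>\<^bsub>A\<^esub> ext (ideal_power B J N) \<and> b \<in> carrier B"
    proof (induction rule: ideal_prod.induct)
      case (prod i j)
      have "\<phi> i \<otimes>\<^bsub>A\<^esub> \<phi> j \<in> ext J \<cdot>\<^bsub>A\<^esub> ext (ideal_power B J N)"
        by (rule A.ideal_prod_memI[OF ext_phi[OF Jc(1) prod(1)] ext_phi[OF Jc(2) prod(2)]])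
      then show ?case using prod Jc by auto
    next
      case (sum s1 s2) then show ?case using additive_subgroup.a_closed[OF ideal.axioms(1)[OF P]] by simp
    qed
    then have "\<phi> b \<otimes>\<^bsub>A\<^esub> inv\<^bsub>A\<^esub> \<phi> s \<in> ext J \<cdot>\<^bsub>A\<^esub> ext (ideal_power B J N)"
      using unit[OF b(3)] by (intro ideal.I_r_closed[OF P]) auto
    moreover have "\<phi> b \<otimes>\<^bsub>A\<^esub> inv\<^bsub>A\<^esub> \<phi> s = x"
      using b(1,3) unit[OF b(3)] A.m_assoc[of x "\<phi> s" "inv\<^bsub>A\<^esub> \<phi> s"] unfolding b(4)[symmetric] by simp
    ultimately show ?thesis by simp
  qed
  ultimately show ?case unfolding ideal_power.simps(2)[of A] Suc.IH by blast
qed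

lemma phi_ext_iff: assumes b: "b \<in> carrier B" shows "\<phi> b \<in> ext (ideal_power B J N) \<longleftrightarrow> b \<in> ideal_power B J N"
proof
  assume "\<phi> b \<in> ext (ideal_power B J N)"
  then obtain c s where c: "c \<in> ideal_power B J N" "s \<in> carrier B - J" "\<phi> b \<otimes>\<^bsub>A\<^esub> \<phi> s = \<phi> c"
    by (auto simp: ext_def)
  then have "b \<otimes>\<^bsub>B\<^esub> s = c" using b PBs[OF c(1)] by (intro inj_eq) auto
  then show "b \<in> ideal_power B J N" using cancel_mod[OF c(2) b] c by simp
qed (use PBs in \<open>auto intro: ext_phi\<close>)

lemma approx:
  assumes a: "a \<in> carrier A"
  shows "\<exists>b\<in>carrier B. a \<ominus>\<^bsub>A\<^esub> \<phi> b \<in> ext (ideal_power B J N)"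
proof -
  obtain b s where b: "b \<in> carrier B" "s \<in> carrier B - J" "a \<otimes>\<^bsub>A\<^esub> \<phi> s = \<phi> b" using frac[OF a] by blast
  obtain t where t: "t \<in> carrier B" "\<one>\<^bsub>B\<^esub> \<ominus>\<^bsub>B\<^esub> s \<otimes>\<^bsub>B\<^esub> t \<in> ideal_power B J N" using inv_mod[OF b(2)] by blast
  have cl: "\<phi> s \<in> carrier A" "\<phi> t \<in> carrier A" using b t by auto
  have "(a \<ominus>\<^bsub>A\<^esub> (a \<otimes>\<^bsub>A\<^esub> \<phi> s) \<otimes>\<^bsub>A\<^esub> \<phi> t) \<otimes>\<^bsub>A\<^esub> \<phi> s =
     (a \<otimes>\<^bsub>A\<^esub> \<phi> s) \<otimes>\<^bsub>A\<^esub> (\<one>\<^bsub>A\<^esub> \<ominus>\<^bsub>A\<^esub> \<phi> s \<otimes>\<^bsub>A\<^esub> \<phi> t)"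
    using a cl by (intro A.approx_identity)
  then have "(a \<ominus>\<^bsub>A\<^esub> \<phi> (b \<otimes>\<^bsub>B\<^esub> t)) \<otimes>\<^bsub>A\<^esub> \<phi> s = \<phi> (b \<otimes>\<^bsub>B\<^esub> (\<one>\<^bsub>B\<^esub> \<ominus>\<^bsub>B\<^esub> s \<otimes>\<^bsub>B\<^esub> t))"
    using b t by (simp add: a_minus_def)
  then have "a \<ominus>\<^bsub>A\<^esub> \<phi> (b \<otimes>\<^bsub>B\<^esub> t) \<in> ext (ideal_power B J N)"
    using a b t by (intro ext_I[OF _ ideal.I_l_closed[OF PBi t(2) b(1)] b(2)]) auto
  then show ?thesis using b t by (intro bexI[of _ "b \<otimes>\<^bsub>B\<^esub> t"]) auto
qed

text \<open>Localizing at \<open>J\<close> does not change the quotients by powers of \<open>J\<close>, where the denominators are invertible already.\<close>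

lemma completion_pair: "completion_pair A B \<phi> (nonunits A) J"
proof -
  interpret I: ideal "nonunits A" A unfolding nonunits_eq by (rule ext_ideal[OF JB.ideal_axioms])
  show ?thesis
  proof unfold_locales
    show "\<phi> \<in> ring_hom B A" by (rule H.homh)
    show "\<phi> b \<in> ideal_power A (nonunits A) N \<longleftrightarrow> b \<in> ideal_power B J N" if "b \<in> carrier B" for N b
      using phi_ext_iff[OF that] by (simp add: nonunits_eq ideal_power_ext)
    show "\<exists>b\<in>carrier B. a \<ominus>\<^bsub>A\<^esub> \<phi> b \<in> ideal_power A (nonunits A) N" if "a \<in> carrier A" for N a
      using approx[OF that] by (simp add: nonunits_eq ideal_power_ext)
  qed
qed

text \<open>Again because denominators are invertible modulo powers of \<open>J\<close>, an ideal and its extension have the same image in each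
  quotient.\<close>

lemma pull_ext:
  assumes L: "ideal L B"
  shows "completion_pair.pull B \<phi> ` completed_ideal A (nonunits A) (ext L) = completed_ideal B J L"
proof -
  interpret C: completion_pair A B \<phi> "nonunits A" J by (rule completion_pair)
  show ?thesis
proof (rule C.pull_completed_ideal)
  fix N b assume b: "b \<in> carrier B"
  have Lc: "L \<subseteq> carrier B" using L by (auto intro: ideal.Icarr)
  show "(\<exists>k\<in>ext L. k \<in> ideal_power A (nonunits A) N +>\<^bsub>A\<^esub> \<phi> b) \<longleftrightarrow> (\<exists>l\<in>L. l \<in> ideal_power B J N +>\<^bsub>B\<^esub> b)"
  proof
    assume "\<exists>l\<in>L. l \<in> ideal_power B J N +>\<^bsub>B\<^esub> b"
    then obtain l where l: "l \<in> L" "l \<in> ideal_power B J N +>\<^bsub>B\<^esub> b" by blast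
    then have "\<phi> l \<in> ideal_power A (nonunits A) N +>\<^bsub>A\<^esub> \<phi> b" using C.pull_coset[OF b, of N] by blast
    then show "\<exists>k\<in>ext L. k \<in> ideal_power A (nonunits A) N +>\<^bsub>A\<^esub> \<phi> b" using ext_phi[OF Lc l(1)] by blast
  next
    assume "\<exists>k\<in>ext L. k \<in> ideal_power A (nonunits A) N +>\<^bsub>A\<^esub> \<phi> b"
    then obtain k where k: "k \<in> ext L" "k \<in> ideal_power A (nonunits A) N +>\<^bsub>A\<^esub> \<phi> b" by blast
    then have kc: "k \<in> carrier A" using ext_carrier by blast
    have kd: "k \<ominus>\<^bsub>A\<^esub> \<phi> b \<in> ext (ideal_power B J N)"
      using k(2) kc b C.PA.coset_mem_iff[of "\<phi> b" k N] by (simp add: nonunits_eq ideal_power_ext)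
    obtain l s where l: "l \<in> L" "s \<in> carrier B - J" "k \<otimes>\<^bsub>A\<^esub> \<phi> s = \<phi> l" using k by (auto simp: ext_def)
    have lc: "l \<in> carrier B" "s \<in> carrier B" using l Lc by auto
    have "(k \<ominus>\<^bsub>A\<^esub> \<phi> b) \<otimes>\<^bsub>A\<^esub> \<phi> s = k \<otimes>\<^bsub>A\<^esub> \<phi> s \<ominus>\<^bsub>A\<^esub> \<phi> b \<otimes>\<^bsub>A\<^esub> \<phi> s"
      using kc b lc by (intro A.diff_mult) auto
    then have "(k \<ominus>\<^bsub>A\<^esub> \<phi> b) \<otimes>\<^bsub>A\<^esub> \<phi> s = \<phi> (l \<ominus>\<^bsub>B\<^esub> b \<otimes>\<^bsub>B\<^esub> s)"
      using l(3) b lc by (simp add: a_minus_def)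
    moreover have "(k \<ominus>\<^bsub>A\<^esub> \<phi> b) \<otimes>\<^bsub>A\<^esub> \<phi> s \<in> ext (ideal_power B J N)"
      using kd lc by (intro ideal.I_r_closed[OF ext_ideal[OF PBi]]) auto
    ultimately have 1: "l \<ominus>\<^bsub>B\<^esub> b \<otimes>\<^bsub>B\<^esub> s \<in> ideal_power B J N" using phi_ext_iff lc b by simp
    obtain t where t: "t \<in> carrier B" "\<one>\<^bsub>B\<^esub> \<ominus>\<^bsub>B\<^esub> s \<otimes>\<^bsub>B\<^esub> t \<in> ideal_power B J N" using inv_mod[OF l(2)] by blast
    have "t \<otimes>\<^bsub>B\<^esub> l \<ominus>\<^bsub>B\<^esub> b = t \<otimes>\<^bsub>B\<^esub> (l \<ominus>\<^bsub>B\<^esub> b \<otimes>\<^bsub>B\<^esub> s) \<oplus>\<^bsub>B\<^esub> (\<ominus>\<^bsub>B\<^esub> b) \<otimes>\<^bsub>B\<^esub> (\<one>\<^bsub>B\<^esub> \<ominus>\<^bsub>B\<^esub> s \<otimes>\<^bsub>B\<^esub> t)"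
      using b lc t(1) by (intro B.diff_by_approx_inverse)
    moreover have "\<dots> \<in> ideal_power B J N" using 1 t b by (intro C.PB.a_closed C.PB.I_l_closed) auto
    ultimately have "t \<otimes>\<^bsub>B\<^esub> l \<in> ideal_power B J N +>\<^bsub>B\<^esub> b" using b lc t(1) by (simp add: C.PB.coset_mem_iff)
    moreover have "t \<otimes>\<^bsub>B\<^esub> l \<in> L" using ideal.I_l_closed[OF L l(1) t(1)] .
    ultimately show "\<exists>l\<in>L. l \<in> ideal_power B J N +>\<^bsub>B\<^esub> b" by blast
  qed
qed
qed

end

section \<open>Linear algebra over a field\<close>

lemma exists_linear_relation:
  fixes a :: "'j \<Rightarrow> 'i \<Rightarrow> 'a::field"
  assumes "finite I" "finite J" "card I < card J"
  shows "\<exists>c. (\<exists>j\<in>J. c j \<noteq> 0) \<and> (\<forall>i\<in>I. (\<Sum>j\<in>J. c j * a j i) = 0)"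
  using assms
proof (induction I arbitrary: J a rule: finite_induct)
  case empty
  then have "J \<noteq> {}" by auto
  then show ?case by (intro exI[of _ "\<lambda>_. 1"]) auto
next
  case (insert i0 I)
  show ?case
  proof (cases "\<forall>j\<in>J. a j i0 = 0")
    case True
    have "card I < card J" using insert by simp
    from insert.IH[OF insert.prems(1) this, of a] obtain c where
      c: "\<exists>j\<in>J. c j \<noteq> 0" "\<forall>i\<in>I. (\<Sum>j\<in>J. c j * a j i) = 0" by blast
    have "(\<Sum>j\<in>J. c j * a j i0) = 0" using True by (intro sum.neutral) auto
    with c show ?thesis by (intro exI[of _ c]) auto
  next
    case False
    then obtain j0 where j0: "j0 \<in> J" "a j0 i0 \<noteq> 0" by blast
    define J' where "J' = J - {j0}"
    have J': "finite J'" "card I < card J'" "j0 \<notin> J'" "J = insert j0 J'"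
      using insert j0 by (auto simp: J'_def)
    \<comment> \<open>Gaussian elimination of the column \<open>i0\<close> with pivot \<open>j0\<close>.\<close>
    define a' where "a' j i = a j i - a j i0 / a j0 i0 * a j0 i" for j i
    from insert.IH[OF J'(1,2), of a'] obtain c where
      c: "\<exists>j\<in>J'. c j \<noteq> 0" "\<forall>i\<in>I. (\<Sum>j\<in>J'. c j * a' j i) = 0" by blast
    define d where "d j = (if j = j0 then - (\<Sum>j\<in>J'. c j * a j i0) / a j0 i0 else c j)" for j
    have sJ: "(\<Sum>j\<in>J. d j * a j i) = (\<Sum>j\<in>J'. c j * a' j i)" for i
    proof -
      have "(\<Sum>j\<in>J. d j * a j i) = d j0 * a j0 i + (\<Sum>j\<in>J'. d j * a j i)"
        using J' by simp
      also have "(\<Sum>j\<in>J'. d j * a j i) = (\<Sum>j\<in>J'. c j * a j i)"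
        using J'(3) by (intro sum.cong refl) (auto simp: d_def)
      also have "d j0 * a j0 i = - (\<Sum>j\<in>J'. c j * (a j i0 / a j0 i0 * a j0 i))"
        by (simp add: d_def sum_distrib_right sum_divide_distrib, intro sum.cong refl, simp add: mult.assoc)
      finally show ?thesis unfolding a'_def right_diff_distrib sum_subtractf by (simp only: uminus_add_conv_diff)
    qed
    have "(\<Sum>j\<in>J. d j * a j i) = 0" if "i \<in> insert i0 I" for i
    proof (cases "i = i0")
      case True
      have "a' j i0 = 0" for j using j0 by (simp add: a'_def)
      then show ?thesis unfolding sJ True by simp
    next
      case False then show ?thesis using that c(2) unfolding sJ by simp
    qed
    moreover have "\<exists>j\<in>J. d j \<noteq> 0" using c(1) J' by (auto simp: d_def)
    ultimately show ?thesis by (intro exI[of _ d]) blast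
  qed
qed

section \<open>Linear extension of functions on monomials\<close>

text \<open>Evaluation at points, derivations and substitutions are all maps of this form.\<close>

definition lin :: "(complex \<Rightarrow> 'b::comm_ring_1) \<Rightarrow> ('k \<Rightarrow> 'b) \<Rightarrow> ('k \<Rightarrow>\<^sub>0 complex) \<Rightarrow> 'b" where
  "lin \<kappa> \<phi> f = (\<Sum>m\<in>keys f. \<kappa> (lookup f m) * \<phi> m)"

lemma evalp_lin: "evalp f \<gamma> = lin (\<lambda>c. c) \<gamma> f"
  by (simp add: evalp_def lin_def)

locale scalars =
  fixes \<kappa> :: "complex \<Rightarrow> 'b::comm_ring_1"
  assumes \<kappa>_add: "\<kappa> (a + b) = \<kappa> a + \<kappa> b" and \<kappa>_mult: "\<kappa> (a * b) = \<kappa> a * \<kappa> b"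
    and \<kappa>_one: "\<kappa> 1 = 1"
begin

lemma \<kappa>_zero: "\<kappa> 0 = 0" using \<kappa>_add[of 0 0] by simp

lemma lin_superset:
  "finite A \<Longrightarrow> keys f \<subseteq> A \<Longrightarrow> lin \<kappa> \<phi> f = (\<Sum>m\<in>A. \<kappa> (lookup f m) * \<phi> m)"
  unfolding lin_def by (intro sum.mono_neutral_left) (auto simp: in_keys_iff \<kappa>_zero)

lemma lin_zero [simp]: "lin \<kappa> \<phi> 0 = 0" by (simp add: lin_def)

lemma lin_single [simp]: "lin \<kappa> \<phi> (single m c) = \<kappa> c * \<phi> m"
  by (simp add: lin_def \<kappa>_zero)

lemma lin_add: "lin \<kappa> \<phi> (f + g) = lin \<kappa> \<phi> f + lin \<kappa> \<phi> g"
proof -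
  let ?A = "keys f \<union> keys g"
  have "keys (f + g) \<subseteq> ?A" by (rule Poly_Mapping.keys_add)
  then show ?thesis
    by (simp add: lin_superset[of ?A] lookup_add \<kappa>_add sum.distrib algebra_simps)
qed

lemma lin_uminus: "lin \<kappa> \<phi> (- f) = - lin \<kappa> \<phi> f"
  using lin_add[of \<phi> f "- f"] by (simp add: add_eq_0_iff)

lemma lin_diff: "lin \<kappa> \<phi> (f - g) = lin \<kappa> \<phi> f - lin \<kappa> \<phi> g"
  using lin_add[of \<phi> f "- g"] by (simp add: lin_uminus)

lemma lin_sum: "lin \<kappa> \<phi> (\<Sum>i\<in>A. f i) = (\<Sum>i\<in>A. lin \<kappa> \<phi> (f i))"
  by (induction A rule: infinite_finite_induct) (simp_all add: lin_add)

lemma lin_one: "lin \<kappa> \<phi> 1 = \<phi> 0"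
  using lin_single[of \<phi> 0 1] by (simp add: \<kappa>_one)

end

lemma mult_eq_sum_single:
  fixes f g :: "'k::comm_monoid_add \<Rightarrow>\<^sub>0 complex"
  shows "f * g = (\<Sum>m\<in>keys f. \<Sum>m'\<in>keys g.
      single (m + m') (lookup f m * lookup g m'))"
proof -
  have "f * g = (\<Sum>m\<in>keys f. single m (lookup f m)) *
      (\<Sum>m'\<in>keys g. single m' (lookup g m'))"
    using arg_cong2[where f = "(*)", OF laurent_eq_sum_single[of f] laurent_eq_sum_single[of g]] .
  then show ?thesis unfolding sum_product mult_single .
qed

context scalars begin

text \<open>A linear functional that obeys the Leibniz rule on monomials obeys it on products; the plain
  multiplicative case is \<open>\<theta> = 0\<close>.\<close>

lemma lin_bilinear:
  fixes f g :: "'k::comm_monoid_add \<Rightarrow>\<^sub>0 complex"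
  assumes "\<And>m m'. m \<in> keys f \<Longrightarrow> m' \<in> keys g \<Longrightarrow>
     \<phi> (m + m') = \<alpha> m * \<beta> m' + \<gamma> m * \<delta> m'"
  shows "lin \<kappa> \<phi> (f * g) = lin \<kappa> \<alpha> f * lin \<kappa> \<beta> g + lin \<kappa> \<gamma> f * lin \<kappa> \<delta> g"
proof -
  let ?F = "keys f" and ?G = "keys g"
  have "lin \<kappa> \<phi> (f * g) = (\<Sum>m\<in>?F. \<Sum>m'\<in>?G.
      \<kappa> (lookup f m * lookup g m') * \<phi> (m + m'))"
    by (simp add: mult_eq_sum_single lin_sum)
  also have "\<dots> = (\<Sum>m\<in>?F. \<Sum>m'\<in>?G.
     (\<kappa> (lookup f m) * \<alpha> m) * (\<kappa> (lookup g m') * \<beta> m') +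
     (\<kappa> (lookup f m) * \<gamma> m) * (\<kappa> (lookup g m') * \<delta> m'))"
    by (intro sum.cong refl) (simp add: assms \<kappa>_mult algebra_simps)
  finally show ?thesis by (simp add: lin_def sum_product sum.distrib)
qed

lemma lin_mult:
  fixes f g :: "'k::comm_monoid_add \<Rightarrow>\<^sub>0 complex"
  assumes "\<And>m m'. m \<in> keys f \<Longrightarrow> m' \<in> keys g \<Longrightarrow> \<phi> (m + m') = \<phi> m * \<phi> m'"
  shows "lin \<kappa> \<phi> (f * g) = lin \<kappa> \<phi> f * lin \<kappa> \<phi> g"
  using lin_bilinear[of f g \<phi> \<phi> \<phi> "\<lambda>_. 0" "\<lambda>_. 0"] assms by (simp add: lin_def)

end

interpretation idc: scalars "\<lambda>c::complex. c" by unfold_locales auto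

interpretation sgl: scalars "\<lambda>c. single (0::'k::comm_monoid_add) c"
  by unfold_locales (auto simp: single_add mult_single)

interpretation cfn: scalars "const_fun :: complex \<Rightarrow> 'v::linorder laurent fract"
  by unfold_locales (simp_all add: const_fun_def single_add mult_single One_fract_def)

lemma evalp_diff: "evalp (f - g) \<gamma> = evalp f \<gamma> - evalp g \<gamma>"
  unfolding evalp_lin by (rule idc.lin_diff)

lemma lookup_scalar_mult: "lookup (single 0 c * f) m = c * lookup f m"
  for f :: "'k::comm_monoid_add \<Rightarrow>\<^sub>0 complex"
  unfolding mult_map_scale_conv_mult[symmetric] by (simp add: Poly_Mapping.map.rep_eq when_def)

section \<open>Subrings of a commutative ring type as ring records\<close>

definition cls_ring :: "'a::comm_ring_1 set \<Rightarrow> 'a ring" where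
  "cls_ring S = \<lparr>carrier = S, monoid.mult = (*), one = 1, zero = 0, add = (+)\<rparr>"

definition subring_set :: "'a::comm_ring_1 set \<Rightarrow> bool" where
  "subring_set S \<longleftrightarrow> 0 \<in> S \<and> 1 \<in> S \<and> (\<forall>a\<in>S. \<forall>b\<in>S. a + b \<in> S \<and> a * b \<in> S) \<and> (\<forall>a\<in>S. - a \<in> S)"

lemma subring_setD:
  assumes "subring_set S"
  shows "0 \<in> S" "1 \<in> S" "a \<in> S \<Longrightarrow> b \<in> S \<Longrightarrow> a + b \<in> S" "a \<in> S \<Longrightarrow> b \<in> S \<Longrightarrow> a * b \<in> S"
    "a \<in> S \<Longrightarrow> - a \<in> S"
  using assms by (auto simp: subring_set_def)

lemma subring_set_diff: "subring_set S \<Longrightarrow> a \<in> S \<Longrightarrow> b \<in> S \<Longrightarrow> a - b \<in> S"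
  using subring_setD(3,5) by (metis diff_conv_add_uminus)

lemma subring_set_power: "subring_set S \<Longrightarrow> a \<in> S \<Longrightarrow> a ^ n \<in> S"
  by (induction n) (auto simp: subring_setD)

lemma subring_set_sum: "subring_set S \<Longrightarrow> (\<And>i. i \<in> I \<Longrightarrow> f i \<in> S) \<Longrightarrow> sum f I \<in> S"
  by (induction I rule: infinite_finite_induct) (auto simp: subring_setD)

lemma cls_ring_simps [simp]:
  "carrier (cls_ring S) = S" "a \<otimes>\<^bsub>cls_ring S\<^esub> b = a * b" "a \<oplus>\<^bsub>cls_ring S\<^esub> b = a + b"
  "\<one>\<^bsub>cls_ring S\<^esub> = 1" "\<zero>\<^bsub>cls_ring S\<^esub> = 0"
  by (simp_all add: cls_ring_def)

lemma cring_cls_ring: assumes S: "subring_set S" shows "cring (cls_ring S)"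
proof (intro cringI)
  show "abelian_group (cls_ring S)"
  proof (rule abelian_groupI)
    fix x assume "x \<in> carrier (cls_ring S)"
    then show "\<exists>y\<in>carrier (cls_ring S). y \<oplus>\<^bsub>cls_ring S\<^esub> x = \<zero>\<^bsub>cls_ring S\<^esub>"
      using S by (intro bexI[of _ "- x"]) (auto simp: subring_setD)
  qed (use S in \<open>auto simp: subring_setD algebra_simps\<close>)
  show "Group.comm_monoid (cls_ring S)"
    by (rule comm_monoidI) (use S in \<open>auto simp: subring_setD algebra_simps\<close>)
qed (auto simp: algebra_simps)

lemma cls_ring_uminus: assumes S: "subring_set S" and a: "a \<in> S" shows "\<ominus>\<^bsub>cls_ring S\<^esub> a = - a"
proof -
  interpret cring "cls_ring S" by (rule cring_cls_ring[OF S])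
  show ?thesis using minus_equality[of "- a" a] S a by (auto simp: subring_setD)
qed

lemma cls_ring_minus: assumes S: "subring_set S" and "a \<in> S" "b \<in> S" shows "a \<ominus>\<^bsub>cls_ring S\<^esub> b = a - b"
  using assms by (simp add: a_minus_def cls_ring_uminus)

definition ideal_set :: "'a::comm_ring_1 set \<Rightarrow> 'a set \<Rightarrow> bool" where
  "ideal_set S I \<longleftrightarrow> I \<subseteq> S \<and> 0 \<in> I \<and> (\<forall>a\<in>I. \<forall>b\<in>I. a + b \<in> I) \<and> (\<forall>a\<in>I. \<forall>r\<in>S. r * a \<in> I)"

lemma ideal_setD:
  assumes "ideal_set S I"
  shows "I \<subseteq> S" "0 \<in> I" "a \<in> I \<Longrightarrow> b \<in> I \<Longrightarrow> a + b \<in> I" "a \<in> I \<Longrightarrow> r \<in> S \<Longrightarrow> r * a \<in> I"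
  using assms by (auto simp: ideal_set_def)

lemma ideal_set_uminus: "subring_set S \<Longrightarrow> ideal_set S I \<Longrightarrow> a \<in> I \<Longrightarrow> - a \<in> I"
  using ideal_setD(4)[of S I a "- 1"] subring_setD(2,5)[of S] by auto

lemma ideal_set_diff: "subring_set S \<Longrightarrow> ideal_set S I \<Longrightarrow> a \<in> I \<Longrightarrow> b \<in> I \<Longrightarrow> a - b \<in> I"
  using ideal_setD(3) ideal_set_uminus by (metis diff_conv_add_uminus)

lemma ideal_set_sum: "ideal_set S I \<Longrightarrow> (\<And>i. i \<in> A \<Longrightarrow> f i \<in> I) \<Longrightarrow> sum f A \<in> I"
  by (induction A rule: infinite_finite_induct) (auto simp: ideal_setD)

lemma ideal_cls_ring_iff:
  assumes S: "subring_set S" shows "ideal I (cls_ring S) \<longleftrightarrow> ideal_set S I"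
proof
  assume "ideal I (cls_ring S)"
  then have I: "ideal I (cls_ring S)" .
  show "ideal_set S I" unfolding ideal_set_def
    using additive_subgroup.zero_closed[OF ideal.axioms(1)[OF I]]
      additive_subgroup.a_closed[OF ideal.axioms(1)[OF I]] ideal.I_l_closed[OF I] ideal.Icarr[OF I] by auto
next
  assume I: "ideal_set S I"
  interpret cring "cls_ring S" by (rule cring_cls_ring[OF S])
  show "ideal I (cls_ring S)"
  proof (rule idealI)
    show "ring (cls_ring S)" by (rule ring_axioms)
    show "subgroup I (add_monoid (cls_ring S))"
    proof (rule subgroup.intro)
      show "inv\<^bsub>add_monoid (cls_ring S)\<^esub> x \<in> I" if "x \<in> I" for x
        using ideal_set_uminus[OF S I that] cls_ring_uminus[OF S, of x] ideal_setD(1)[OF I] that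
        by (auto simp: a_inv_def)
      show "I \<subseteq> carrier (add_monoid (cls_ring S))" using ideal_setD(1)[OF I] by simp
      show "x \<otimes>\<^bsub>add_monoid (cls_ring S)\<^esub> y \<in> I" if "x \<in> I" "y \<in> I" for x y
        using ideal_setD(3)[OF I that] by simp
      show "\<one>\<^bsub>add_monoid (cls_ring S)\<^esub> \<in> I" using ideal_setD(2)[OF I] by simp
    qed
    show "x \<otimes>\<^bsub>cls_ring S\<^esub> a \<in> I" if "a \<in> I" "x \<in> carrier (cls_ring S)" for a x
      using ideal_setD(4)[OF I, of a x] that by simp
    show "a \<otimes>\<^bsub>cls_ring S\<^esub> x \<in> I" if "a \<in> I" "x \<in> carrier (cls_ring S)" for a x
      using ideal_setD(4)[OF I, of a x] that by (simp add: mult.commute)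
  qed
qed

lemma Idl_cls_ring:
  assumes S: "subring_set S" and G: "finite G" "G \<subseteq> S"
  shows "Idl\<^bsub>cls_ring S\<^esub> G = {\<Sum>g\<in>G. a g * g | a. \<forall>g\<in>G. a g \<in> S}" (is "_ = ?I")
proof -
  interpret cring "cls_ring S" by (rule cring_cls_ring[OF S])
  have "ideal_set S ?I"
    unfolding ideal_set_def
  proof (intro conjI ballI)
    show "?I \<subseteq> S" using S G by (auto intro!: subring_set_sum subring_setD(4))
    have "(\<Sum>g\<in>G. 0 * g) = 0" by simp
    then show "0 \<in> ?I" using subring_setD(1)[OF S] by (intro CollectI exI[of _ "\<lambda>_. 0"]) auto
  next
    fix a b assume "a \<in> ?I" "b \<in> ?I"
    then obtain u v where uv: "a = (\<Sum>g\<in>G. u g * g)" "\<forall>g\<in>G. u g \<in> S" "b = (\<Sum>g\<in>G. v g * g)" "\<forall>g\<in>G. v g \<in> S"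
      by blast
    have "a + b = (\<Sum>g\<in>G. (u g + v g) * g)" by (simp add: uv sum.distrib algebra_simps)
    then show "a + b \<in> ?I" using uv S by (intro CollectI exI[of _ "\<lambda>g. u g + v g"]) (auto simp: subring_setD)
  next
    fix a r assume "a \<in> ?I" "r \<in> S"
    then obtain u where u: "a = (\<Sum>g\<in>G. u g * g)" "\<forall>g\<in>G. u g \<in> S" by blast
    have "r * a = (\<Sum>g\<in>G. (r * u g) * g)" by (simp add: u sum_distrib_left mult.assoc)
    then show "r * a \<in> ?I" using u S \<open>r \<in> S\<close> by (intro CollectI exI[of _ "\<lambda>g. r * u g"]) (auto simp: subring_setD)
  qed
  then have I: "ideal ?I (cls_ring S)" by (simp add: ideal_cls_ring_iff[OF S])
  have "G \<subseteq> ?I"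
  proof
    fix h assume h: "h \<in> G"
    have "(\<Sum>g\<in>G. (if g = h then 1 else 0) * g) = (\<Sum>g\<in>G. if g = h then g else 0)"
      by (intro sum.cong) auto
    then have "h = (\<Sum>g\<in>G. (if g = h then 1 else 0) * g)" using G h by simp
    then show "h \<in> ?I" using subring_setD(1,2)[OF S] by (intro CollectI exI[of _ "\<lambda>g. if g = h then 1 else 0"]) auto
  qed
  then have 1: "Idl\<^bsub>cls_ring S\<^esub> G \<subseteq> ?I" by (rule genideal_minimal[OF I])
  have "ideal (Idl\<^bsub>cls_ring S\<^esub> G) (cls_ring S)" using G by (intro genideal_ideal) auto
  then have J: "ideal_set S (Idl\<^bsub>cls_ring S\<^esub> G)" by (simp add: ideal_cls_ring_iff[OF S])
  have GJ: "G \<subseteq> Idl\<^bsub>cls_ring S\<^esub> G" using G by (intro genideal_self) auto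
  have "?I \<subseteq> Idl\<^bsub>cls_ring S\<^esub> G" using GJ J by (auto intro!: ideal_set_sum[OF J] ideal_setD(4)[OF J])
  with 1 show ?thesis by blast
qed

section \<open>Chains of primes and algebraic independence\<close>

fun mon :: "'a::comm_ring_1 list \<Rightarrow> nat list \<Rightarrow> 'a" where
  "mon [] \<alpha> = 1"
| "mon (y # ys) \<alpha> = y ^ hd \<alpha> * mon ys (tl \<alpha>)"

text \<open>Independence modulo \<open>Q\<close>: no nontrivial polynomial in the entries of the list lies in \<open>Q\<close>. For a prime \<open>Q\<close> this is
  algebraic independence in the residue ring.\<close>

definition algindep :: "(complex \<Rightarrow> 'a::comm_ring_1) \<Rightarrow> 'a list \<Rightarrow> 'a set \<Rightarrow> bool" where
  "algindep \<kappa> ys Q \<longleftrightarrow> (\<forall>A c. finite A \<longrightarrow> (\<forall>\<alpha>\<in>A. length \<alpha> = length ys) \<longrightarrow>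
     (\<Sum>\<alpha>\<in>A. \<kappa> (c \<alpha>) * mon ys \<alpha>) \<in> Q \<longrightarrow> (\<forall>\<alpha>\<in>A. c \<alpha> = 0))"

definition prime_set :: "'a::comm_ring_1 set \<Rightarrow> 'a set \<Rightarrow> bool" where
  "prime_set S Q \<longleftrightarrow> ideal_set S Q \<and> 1 \<notin> Q \<and> (\<forall>a\<in>S. \<forall>b\<in>S. a * b \<in> Q \<longrightarrow> a \<in> Q \<or> b \<in> Q)"

lemma mon_in: "subring_set S \<Longrightarrow> set ys \<subseteq> S \<Longrightarrow> mon ys \<alpha> \<in> S"
  by (induction ys arbitrary: \<alpha>) (auto simp: subring_setD subring_set_power)

lemma prime_set_power:
  assumes "prime_set S Q" "subring_set S" "y \<in> S" "y \<notin> Q" shows "y ^ n \<notin> Q"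
  using assms by (induction n) (auto simp: prime_set_def subring_set_power)

lemma primeideal_cls_ring:
  assumes S: "subring_set S" and "primeideal I (cls_ring S)" shows "prime_set S I"
proof -
  interpret primeideal I "cls_ring S" by fact
  have "ideal I (cls_ring S)" by (rule is_ideal)
  then have I: "ideal_set S I" by (simp add: ideal_cls_ring_iff[OF S])
  have "1 \<notin> I"
  proof
    assume "1 \<in> I"
    then have "S \<subseteq> I" using ideal_setD(4)[OF I, of 1] by auto
    then show False using I_notcarr ideal_setD(1)[OF I] by auto
  qed
  then show ?thesis using I I_prime by (auto simp: prime_set_def)
qed

text \<open>If \<open>Q \<subset> Q'\<close> are primes and \<open>y \<in> Q' - Q\<close>, elements independent modulo \<open>Q'\<close> stay independent
  modulo \<open>Q\<close> after adding \<open>y\<close>: divide a relation by the highest possible power of \<open>y\<close>; what remains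
  reduces modulo \<open>Q'\<close> to a relation without \<open>y\<close>.\<close>

lemma algindep_Cons:
  assumes \<kappa>: "scalars \<kappa>" "\<And>c. \<kappa> c \<in> S" and S: "subring_set S" and ys: "set ys \<subseteq> S"
    and y: "y \<in> Q'" "y \<notin> Q" and Q: "prime_set S Q" "prime_set S Q'" "Q \<subseteq> Q'"
    and ind: "algindep \<kappa> ys Q'"
  shows "algindep \<kappa> (y # ys) Q"
  unfolding algindep_def
proof (intro allI impI)
  fix A :: "nat list set" and c :: "nat list \<Rightarrow> complex"
  assume A: "finite A" "\<forall>\<alpha>\<in>A. length \<alpha> = length (y # ys)" and sum: "(\<Sum>\<alpha>\<in>A. \<kappa> (c \<alpha>) * mon (y # ys) \<alpha>) \<in> Q"
  interpret scalars \<kappa> by (rule \<kappa>(1))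
  have iQ: "ideal_set S Q" and iQ': "ideal_set S Q'" using Q by (auto simp: prime_set_def)
  have yS: "y \<in> S" using y ideal_setD(1)[OF iQ'] by auto
  define A' where "A' = {\<alpha>\<in>A. c \<alpha> \<noteq> 0}"
  show "\<forall>\<alpha>\<in>A. c \<alpha> = 0"
  proof (rule ccontr)
    assume "\<not> (\<forall>\<alpha>\<in>A. c \<alpha> = 0)"
    then have ne: "A' \<noteq> {}" and fin: "finite A'" using A by (auto simp: A'_def)
    define k where "k = Min (hd ` A')"
    have k: "k \<le> hd \<alpha>" if "\<alpha> \<in> A'" for \<alpha> using that fin by (auto simp: k_def)
    define Z where "Z = (\<Sum>\<alpha>\<in>A'. \<kappa> (c \<alpha>) * (y ^ (hd \<alpha> - k) * mon ys (tl \<alpha>)))"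
    have "(\<Sum>\<alpha>\<in>A. \<kappa> (c \<alpha>) * mon (y # ys) \<alpha>) = (\<Sum>\<alpha>\<in>A'. \<kappa> (c \<alpha>) * mon (y # ys) \<alpha>)"
      using A by (intro sum.mono_neutral_right) (auto simp: A'_def \<kappa>_zero)
    also have "\<dots> = (\<Sum>\<alpha>\<in>A'. y ^ k * (\<kappa> (c \<alpha>) * (y ^ (hd \<alpha> - k) * mon ys (tl \<alpha>))))"
    proof (intro sum.cong refl)
      fix \<alpha> assume "\<alpha> \<in> A'"
      then have "y ^ hd \<alpha> = y ^ k * y ^ (hd \<alpha> - k)" using k by (simp flip: power_add)
      then show "\<kappa> (c \<alpha>) * mon (y # ys) \<alpha> = y ^ k * (\<kappa> (c \<alpha>) * (y ^ (hd \<alpha> - k) * mon ys (tl \<alpha>)))"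
        by (simp add: algebra_simps)
    qed
    also have "\<dots> = y ^ k * Z" by (simp add: Z_def sum_distrib_left)
    finally have "y ^ k * Z \<in> Q" using sum by simp
    moreover have ZS: "Z \<in> S" unfolding Z_def
      using S \<kappa> yS ys by (intro subring_set_sum subring_setD(4) subring_set_power mon_in) auto
    ultimately have "Z \<in> Q"
      using prime_set_power[OF Q(1) S yS y(2), of k] Q(1) subring_set_power[OF S yS] unfolding prime_set_def by blast
    then have ZQ: "Z \<in> Q'" using Q by auto
    define A0 where "A0 = {\<alpha>\<in>A'. hd \<alpha> = k}"
    have "k \<in> hd ` A'" unfolding k_def using fin ne by (intro Min_in) auto
    then have ne0: "A0 \<noteq> {}" by (auto simp: A0_def)
    have rest: "(\<Sum>\<alpha>\<in>A' - A0. \<kappa> (c \<alpha>) * (y ^ (hd \<alpha> - k) * mon ys (tl \<alpha>))) \<in> Q'"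
    proof (intro ideal_set_sum[OF iQ'])
      fix \<alpha> assume "\<alpha> \<in> A' - A0"
      then have "k < hd \<alpha>" using k by (fastforce simp: A0_def)
      then have e: "y ^ (hd \<alpha> - k) = y ^ (hd \<alpha> - k - 1) * y"
        using power_minus_mult[of "hd \<alpha> - k" y] by simp
      have "(\<kappa> (c \<alpha>) * y ^ (hd \<alpha> - k - 1) * mon ys (tl \<alpha>)) * y \<in> Q'"
        using S \<kappa> yS ys by (intro ideal_setD(4)[OF iQ' y(1)] subring_setD(4) subring_set_power mon_in) auto
      then show "\<kappa> (c \<alpha>) * (y ^ (hd \<alpha> - k) * mon ys (tl \<alpha>)) \<in> Q'" unfolding e by (simp add: algebra_simps)
    qed
    have "Z = (\<Sum>\<alpha>\<in>A0. \<kappa> (c \<alpha>) * (y ^ (hd \<alpha> - k) * mon ys (tl \<alpha>))) +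
        (\<Sum>\<alpha>\<in>A' - A0. \<kappa> (c \<alpha>) * (y ^ (hd \<alpha> - k) * mon ys (tl \<alpha>)))"
      unfolding Z_def using fin by (subst sum.subset_diff[of A0]) (auto simp: A0_def add.commute)
    then have "(\<Sum>\<alpha>\<in>A0. \<kappa> (c \<alpha>) * (y ^ (hd \<alpha> - k) * mon ys (tl \<alpha>))) \<in> Q'"
      using ideal_set_diff[OF S iQ' ZQ rest] by simp
    moreover have "(\<Sum>\<alpha>\<in>A0. \<kappa> (c \<alpha>) * (y ^ (hd \<alpha> - k) * mon ys (tl \<alpha>))) =
        (\<Sum>\<beta>\<in>tl ` A0. \<kappa> (c (k # \<beta>)) * mon ys \<beta>)"
    proof -
      have cons: "k # tl \<alpha> = \<alpha>" if "\<alpha> \<in> A0" for \<alpha>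
        using that A by (cases \<alpha>) (auto simp: A0_def A'_def)
      then have inj: "inj_on tl A0" by (metis inj_onI)
      show ?thesis
        by (subst sum.reindex[OF inj]) (auto intro!: sum.cong simp: cons A0_def)
    qed
    moreover have "finite (tl ` A0)" "\<forall>\<beta>\<in>tl ` A0. length \<beta> = length ys"
      using fin A by (auto simp: A0_def A'_def)
    ultimately have z: "\<forall>\<beta>\<in>tl ` A0. c (k # \<beta>) = 0"
      using spec[OF spec[OF ind[unfolded algindep_def], of "tl ` A0"], of "\<lambda>\<beta>. c (k # \<beta>)"] by simp
    obtain \<alpha> where \<alpha>: "\<alpha> \<in> A0" using ne0 by blast
    then have cons: "k # tl \<alpha> = \<alpha>" using A by (cases \<alpha>) (auto simp: A0_def A'_def)
    have "c \<alpha> = 0" using bspec[OF z imageI[OF \<alpha>]] unfolding cons .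
    then show False using \<alpha> by (simp add: A0_def A'_def)
  qed
qed

lemma algindep_Nil:
  assumes \<kappa>: "scalars \<kappa>" "\<And>c. \<kappa> c \<in> S" and Q: "prime_set S Q"
  shows "algindep \<kappa> [] Q"
  unfolding algindep_def
proof (intro allI impI ballI)
  interpret scalars \<kappa> by (rule \<kappa>(1))
  fix A :: "nat list set" and c :: "nat list \<Rightarrow> complex" and \<alpha>
  assume A: "finite A" "\<forall>\<alpha>\<in>A. length \<alpha> = length []" "(\<Sum>\<alpha>\<in>A. \<kappa> (c \<alpha>) * mon [] \<alpha>) \<in> Q" "\<alpha> \<in> A"
  then have "A = {[]}" "\<alpha> = []" by auto
  then have in_Q: "\<kappa> (c []) \<in> Q" using A by simp
  have iQ: "ideal_set S Q" using Q by (simp add: prime_set_def)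
  show "c \<alpha> = 0"
  proof (rule ccontr)
    assume "c \<alpha> \<noteq> 0"
    then have "\<kappa> (1 / c []) * \<kappa> (c []) = 1" using \<open>\<alpha> = []\<close> by (simp add: \<kappa>_one flip: \<kappa>_mult)
    then have "1 \<in> Q" using ideal_setD(4)[OF iQ in_Q \<kappa>(2)[of "1 / c []"]] by simp
    then show False using Q by (simp add: prime_set_def)
  qed
qed

text \<open>Each step of a chain of primes contributes an independent element.\<close>

lemma algindep_chain:
  assumes \<kappa>: "scalars \<kappa>" "\<And>c. \<kappa> c \<in> S" and S: "subring_set S"
    and "\<And>i. i \<le> n \<Longrightarrow> prime_set S (Q i)" "\<And>i. i < n \<Longrightarrow> Q i \<subset> Q (Suc i)"
    and "set zs \<subseteq> S" "algindep \<kappa> zs (Q n)"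
  shows "\<exists>ys. length ys = n + length zs \<and> set ys \<subseteq> S \<and> algindep \<kappa> ys (Q 0)"
  using assms(4-)
proof (induction n arbitrary: Q)
  case 0 then show ?case by auto
next
  case (Suc n)
  have "\<exists>ys. length ys = n + length zs \<and> set ys \<subseteq> S \<and> algindep \<kappa> ys (Q (Suc 0))"
    using Suc.IH[of "\<lambda>i. Q (Suc i)"] Suc.prems by simp
  then obtain ys where ys: "length ys = n + length zs" "set ys \<subseteq> S" "algindep \<kappa> ys (Q (Suc 0))" by blast
  have "Q 0 \<subset> Q (Suc 0)" using Suc.prems by blast
  then obtain y where y: "y \<in> Q (Suc 0)" "y \<notin> Q 0" by blast
  have P: "prime_set S (Q 0)" "prime_set S (Q (Suc 0))" using Suc.prems by auto
  have "algindep \<kappa> (y # ys) (Q 0)"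
    by (rule algindep_Cons[OF \<kappa> S ys(2) y P _ ys(3)]) (use \<open>Q 0 \<subset> Q (Suc 0)\<close> in auto)
  moreover have "y \<in> S" using y P ideal_setD(1) unfolding prime_set_def by blast
  ultimately show ?case using ys by (intro exI[of _ "y # ys"]) auto
qed

section \<open>Counting monomials: the transcendence degree of the function field\<close>

text \<open>Support in a cube of exponents; the spaces of such Laurent polynomials have a dimension that can be counted.\<close>

definition bnd :: "'v set \<Rightarrow> nat \<Rightarrow> 'v laurent \<Rightarrow> bool" where
  "bnd D L f \<longleftrightarrow> (\<forall>m\<in>keys f. m \<in> dual_lattice D \<and> (\<forall>x. \<bar>lookup m x\<bar> \<le> int L))"

lemma dual_lattice_add: "m \<in> dual_lattice D \<Longrightarrow> m' \<in> dual_lattice D \<Longrightarrow> m + m' \<in> dual_lattice D"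
  using Poly_Mapping.keys_add[of m m'] by (auto simp: dual_lattice_def)

lemma bnd_mult: assumes "bnd D L f" "bnd D L' g" shows "bnd D (L + L') (f * g)"
  unfolding bnd_def
proof
  fix m assume "m \<in> keys (f * g)"
  then obtain a b where ab: "m = a + b" "a \<in> keys f" "b \<in> keys g"
    using keys_mult[of f g] by blast
  have "\<bar>lookup m x\<bar> \<le> int (L + L')" for x
  proof -
    have "\<bar>lookup a x\<bar> \<le> int L" "\<bar>lookup b x\<bar> \<le> int L'"
      using assms ab by (auto simp: bnd_def)
    then show ?thesis by (simp add: ab lookup_add)
  qed
  then show "m \<in> dual_lattice D \<and> (\<forall>x. \<bar>lookup m x\<bar> \<le> int (L + L'))"
    using ab assms by (auto simp: bnd_def dual_lattice_add)
qed

lemma bnd_one: "bnd D 0 1" by (simp add: bnd_def dual_lattice_def)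

lemma bnd_power: "bnd D L f \<Longrightarrow> bnd D (L * n) (f ^ n)"
  by (induction n) (auto simp: bnd_one dest: bnd_mult)

lemma bnd_mono: "bnd D L f \<Longrightarrow> L \<le> L' \<Longrightarrow> bnd D L' f"
  unfolding bnd_def by (meson of_nat_mono order_trans)

lemma bnd_mon:
  "(\<And>f. f \<in> set fs \<Longrightarrow> bnd D L f) \<Longrightarrow> length \<alpha> = length fs \<Longrightarrow> bnd D (L * sum_list \<alpha>) (mon fs \<alpha>)"
proof (induction fs arbitrary: \<alpha>)
  case Nil then show ?case by (simp add: bnd_one)
next
  case (Cons f fs)
  then obtain k \<beta> where \<alpha>: "\<alpha> = k # \<beta>" by (cases \<alpha>) auto
  have "bnd D (L * k + L * sum_list \<beta>) (f ^ k * mon fs \<beta>)"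
    using Cons \<alpha> by (intro bnd_mult bnd_power Cons.IH) auto
  then show ?case by (simp add: \<alpha> algebra_simps)
qed

lemma bnd_exists: assumes "keys f \<subseteq> dual_lattice D" shows "\<exists>L. bnd D L f"
proof -
  define b where "b m = (\<Sum>x\<in>keys m. nat \<bar>lookup m x\<bar>)" for m :: "'a \<Rightarrow>\<^sub>0 int"
  have b: "\<bar>lookup m x\<bar> \<le> int (b m)" for m x
  proof (cases "x \<in> keys m")
    case True
    then have "nat \<bar>lookup m x\<bar> \<le> b m" unfolding b_def by (intro member_le_sum) auto
    then show ?thesis by linarith
  qed (simp add: in_keys_iff)
  have "b m \<le> (\<Sum>m\<in>keys f. b m)" if "m \<in> keys f" for m
    using that by (intro member_le_sum) auto
  then have "bnd D (\<Sum>m\<in>keys f. b m) f"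
    unfolding bnd_def using b assms by (meson order_trans of_nat_mono subsetD)
  then show ?thesis ..
qed

lemma lattice_box:
  fixes D :: "'v set" and L :: nat
  assumes "finite D"
  defines "Bx \<equiv> {m \<in> dual_lattice D. \<forall>x. \<bar>lookup m x\<bar> \<le> int L}"
  shows "finite Bx" "card Bx \<le> (2 * L + 1) ^ card D"
proof -
  let ?r = "\<lambda>m. restrict (lookup m) D" and ?P = "PiE D (\<lambda>_. {- int L..int L})"
  have inj: "inj_on ?r Bx"
  proof (rule inj_onI)
    fix m m' assume m: "m \<in> Bx" "m' \<in> Bx" "?r m = ?r m'"
    show "m = m'"
    proof (rule poly_mapping_eqI)
      fix x
      show "lookup m x = lookup m' x"
      proof (cases "x \<in> D")
        case True then show ?thesis using fun_cong[OF m(3), of x] by simp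
      next
        case False
        then have "x \<notin> keys m" "x \<notin> keys m'"
          using m by (auto simp: Bx_def dual_lattice_def)
        then show ?thesis by (simp add: in_keys_iff)
      qed
    qed
  qed
  have sub: "?r ` Bx \<subseteq> ?P" by (auto simp: Bx_def abs_le_iff) (metis minus_le_iff)
  have fin: "finite ?P" using assms by (intro finite_PiE) auto
  then show "finite Bx" using inj sub by (meson finite_imageD finite_subset)
  have "card Bx = card (?r ` Bx)" using inj by (simp add: card_image)
  also have "\<dots> \<le> card ?P" using sub fin by (rule card_mono[rotated])
  also have "card {- int L..int L} = 2 * L + 1" unfolding card_atLeastAtMost_int by linarith
  then have "card ?P = (2 * L + 1) ^ card D" using assms by (simp add: card_PiE del: card_atLeastAtMost_int)
  finally show "card Bx \<le> (2 * L + 1) ^ card D" .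
qed

abbreviation fr :: "'v::linorder laurent \<Rightarrow> 'v laurent fract" where "fr f \<equiv> Fract f 1"

lemma fr_mult: "fr (f * g) = fr f * fr g" by simp

lemma fr_power: "fr (f ^ n) = fr f ^ n"
  by (induction n) (simp_all add: One_fract_def fr_mult del: mult_fract)

lemma fr_add: "fr (f + g) = fr f + fr g" by simp

lemma fr_zero: "fr 0 = 0" by (simp add: Zero_fract_def)

lemma fr_one: "fr 1 = 1" by (simp add: One_fract_def)

lemma fr_eq_iff: "fr f = fr g \<longleftrightarrow> f = g" by (simp add: eq_fract)

lemmas fr_simps = fr_mult fr_add fr_zero fr_one fr_eq_iff fr_power

lemma fr_sum: "fr (\<Sum>i\<in>A. f i) = (\<Sum>i\<in>A. fr (f i))"
  by (induction A rule: infinite_finite_induct) (simp_all add: fr_add fr_zero del: add_fract)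

definition fracs :: "'v::linorder set \<Rightarrow> 'v laurent fract set" where
  "fracs D = {Fract f g | f g. keys f \<subseteq> dual_lattice D \<and> keys g \<subseteq> dual_lattice D \<and> g \<noteq> 0}"

lemma keys_mult_lattice:
  "keys f \<subseteq> dual_lattice D \<Longrightarrow> keys g \<subseteq> dual_lattice D \<Longrightarrow>
   keys (f * g) \<subseteq> dual_lattice D"
  using keys_mult[of f g] by (blast intro: dual_lattice_add)

lemma common_denominator:
  assumes "set ys \<subseteq> fracs D"
  shows "\<exists>g fs. g \<noteq> 0 \<and> keys g \<subseteq> dual_lattice D \<and> (\<forall>f\<in>set fs. keys f \<subseteq> dual_lattice D) \<and>
    list_all2 (\<lambda>y f. y * fr g = fr f) ys fs"
  using assms
proof (induction ys)
  case Nil show ?case by (intro exI[of _ 1] exI[of _ "[]"]) (auto simp: dual_lattice_def)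
next
  case (Cons y ys)
  then obtain g fs where g: "g \<noteq> 0" "keys g \<subseteq> dual_lattice D"
    "\<forall>f\<in>set fs. keys f \<subseteq> dual_lattice D" "list_all2 (\<lambda>y f. y * fr g = fr f) ys fs" by auto
  obtain f0 g0 where y: "y = Fract f0 g0" "keys f0 \<subseteq> dual_lattice D"
    "keys g0 \<subseteq> dual_lattice D" "g0 \<noteq> 0" using Cons by (auto simp: fracs_def)
  have "list_all2 (\<lambda>y f. y * fr (g * g0) = fr f) ys (map (\<lambda>f. f * g0) fs)"
    unfolding list.rel_map
  proof (rule list_all2_mono[OF g(4)])
    fix y f assume e: "y * fr g = fr f"
    have "y * fr (g * g0) = (y * fr g) * fr g0" by (simp only: fr_simps mult.assoc)
    then show "y * fr (g * g0) = fr (f * g0)" unfolding e by (simp only: fr_simps)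
  qed
  moreover have "y * fr (g * g0) = fr (f0 * g)" using y g by (simp add: eq_fract algebra_simps)
  ultimately show ?case using g y
    by (intro exI[of _ "g * g0"] exI[of _ "f0 * g # map (\<lambda>f. f * g0) fs"]) (auto simp: keys_mult_lattice)
qed

lemma mon_clear_denominator:
  "list_all2 (\<lambda>y f. y * fr g = fr f) ys fs \<Longrightarrow> length \<alpha> = length ys \<Longrightarrow>
    mon ys \<alpha> * fr g ^ sum_list \<alpha> = fr (mon fs \<alpha>)"
proof (induction arbitrary: \<alpha> rule: list_all2_induct)
  case Nil then show ?case by (simp add: One_fract_def)
next
  case (Cons y ys f fs)
  then obtain k \<beta> where \<alpha>: "\<alpha> = k # \<beta>" by (cases \<alpha>) auto
  have "mon (y # ys) \<alpha> * fr g ^ sum_list \<alpha> = (y * fr g) ^ k * (mon ys \<beta> * fr g ^ sum_list \<beta>)"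
    by (simp only: \<alpha> mon.simps list.sel sum_list.Cons power_add power_mult_distrib) (simp only: mult_ac)
  also have "\<dots> = fr f ^ k * fr (mon fs \<beta>)" using Cons \<alpha> by simp
  finally show ?case by (simp only: \<alpha> mon.simps list.sel fr_simps)
qed

lemma counting_bound:
  fixes L q d :: nat assumes "d < q"
  shows "\<exists>N. (2 * (L * (q * N)) + 1) ^ d < N ^ q"
proof -
  define C where "C = 2 * L * q + 1"
  define N where "N = C ^ d + 1"
  have "2 * (L * (q * N)) + 1 \<le> C * N" by (simp add: C_def N_def algebra_simps)
  then have "(2 * (L * (q * N)) + 1) ^ d \<le> C ^ d * N ^ d"
    using power_mono[of "2 * (L * (q * N)) + 1" "C * N" d] by (simp add: power_mult_distrib)
  also have "\<dots> < N * N ^ d" by (intro mult_strict_right_mono) (auto simp: N_def)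
  also have "\<dots> = N ^ (Suc d)" by simp
  also have "\<dots> \<le> N ^ q" using assms by (intro power_increasing) (auto simp: N_def)
  finally show ?thesis by blast
qed

text \<open>The monomials of exponents below \<open>N\<close> in \<open>q\<close> elements are \<open>N\<^sup>q\<close> many, but after clearing
  denominators they live in a space of Laurent polynomials of dimension \<open>O(N\<^sup>d)\<close> with
  \<open>d = card D\<close>.\<close>

lemma algindep_length_le:
  fixes ys :: "'v::linorder laurent fract list"
  assumes D: "finite D" and ys: "set ys \<subseteq> fracs D" and ind: "algindep const_fun ys {0}"
  shows "length ys \<le> card D"
proof (rule ccontr)
  assume "\<not> length ys \<le> card D"
  then have dq: "card D < length ys" by simp
  define q where "q = length ys"
  obtain g fs where g: "g \<noteq> 0" "keys g \<subseteq> dual_lattice D"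
    and fs: "\<forall>f\<in>set fs. keys f \<subseteq> dual_lattice D" and la: "list_all2 (\<lambda>y f. y * fr g = fr f) ys fs"
    using common_denominator[OF ys] by blast
  have "\<exists>L. \<forall>f\<in>set (g # fs). bnd D L f"
  proof -
    have "\<forall>f\<in>set (g # fs). \<exists>L. bnd D L f" using bnd_exists g fs by auto
    then obtain b where b: "\<forall>f\<in>set (g # fs). bnd D (b f) f" by metis
    have "b f \<le> sum_list (map b (g # fs))" if "f \<in> set (g # fs)" for f
      using that by (intro member_le_sum_list) auto
    then show ?thesis using b bnd_mono by blast
  qed
  then obtain L where L: "\<forall>f\<in>set (g # fs). bnd D L f" by blast
  obtain N where N: "(2 * (L * (q * N)) + 1) ^ card D < N ^ q"
    using counting_bound[OF dq] q_def by blast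
  define J where "J = {\<alpha>. set \<alpha> \<subseteq> {..<N} \<and> length \<alpha> = q}"
  define Bx where "Bx = {m \<in> dual_lattice D. \<forall>x. \<bar>lookup m x\<bar> \<le> int (L * (q * N))}"
  have J: "finite J" "card J = N ^ q"
    using card_lists_length_eq[of "{..<N}" q] finite_lists_length_eq[of "{..<N}" q] by (auto simp: J_def)
  have Bx: "finite Bx" "card Bx < card J"
    using lattice_box[OF D, of "L * (q * N)"] N J unfolding Bx_def by auto
  have len: "length fs = q" using la by (simp add: q_def list_all2_lengthD)
  have sle: "sum_list \<alpha> \<le> q * N" if "\<alpha> \<in> J" for \<alpha>
  proof -
    have "sum_list \<alpha> \<le> length \<alpha> * N" using that sum_list_mono[of \<alpha> "\<lambda>x. x" "\<lambda>_. N"]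
      by (auto simp: J_def sum_list_triv subset_iff less_imp_le)
    then show ?thesis using that by (simp add: J_def)
  qed
  define H where "H \<alpha> = mon fs \<alpha> * g ^ (q * N - sum_list \<alpha>)" for \<alpha>
  have H: "bnd D (L * (q * N)) (H \<alpha>)" if "\<alpha> \<in> J" for \<alpha>
  proof -
    have "bnd D (L * sum_list \<alpha> + L * (q * N - sum_list \<alpha>)) (H \<alpha>)"
      unfolding H_def using L that len by (intro bnd_mult bnd_mon bnd_power) (auto simp: J_def)
    then show ?thesis using sle[OF that] by (simp flip: distrib_left)
  qed
  obtain c where c: "\<exists>\<alpha>\<in>J. c \<alpha> \<noteq> 0" "\<forall>m\<in>Bx. (\<Sum>\<alpha>\<in>J. c \<alpha> * lookup (H \<alpha>) m) = 0"
    using exists_linear_relation[OF Bx(1) J(1) Bx(2), of "\<lambda>\<alpha> m. lookup (H \<alpha>) m"] by blast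
  have zero: "(\<Sum>\<alpha>\<in>J. single 0 (c \<alpha>) * H \<alpha>) = 0"
  proof (rule poly_mapping_eqI)
    fix m
    have "(\<Sum>\<alpha>\<in>J. c \<alpha> * lookup (H \<alpha>) m) = 0"
    proof (cases "m \<in> Bx")
      case False
      have "m \<notin> keys (H \<alpha>)" if "\<alpha> \<in> J" for \<alpha>
        using H[OF that] False by (auto simp: bnd_def Bx_def)
      then show ?thesis by (simp add: in_keys_iff)
    qed (use c in auto)
    then show "lookup (\<Sum>\<alpha>\<in>J. single 0 (c \<alpha>) * H \<alpha>) m = lookup 0 m"
      by (simp add: lookup_sum lookup_scalar_mult)
  qed
  have "(\<Sum>\<alpha>\<in>J. const_fun (c \<alpha>) * mon ys \<alpha>) * fr g ^ (q * N) =
     (\<Sum>\<alpha>\<in>J. fr (single 0 (c \<alpha>) * H \<alpha>))"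
    unfolding sum_distrib_right
  proof (intro sum.cong refl)
    fix \<alpha> assume \<alpha>: "\<alpha> \<in> J"
    then have "length \<alpha> = length ys" by (simp add: J_def q_def)
    then have e: "mon ys \<alpha> * fr g ^ sum_list \<alpha> = fr (mon fs \<alpha>)" using mon_clear_denominator[OF la] by blast
    have "fr g ^ (q * N) = fr g ^ sum_list \<alpha> * fr g ^ (q * N - sum_list \<alpha>)"
      using sle[OF \<alpha>] by (simp flip: power_add del: mult_fract)
    then have "const_fun (c \<alpha>) * mon ys \<alpha> * fr g ^ (q * N) =
       const_fun (c \<alpha>) * ((mon ys \<alpha> * fr g ^ sum_list \<alpha>) * fr g ^ (q * N - sum_list \<alpha>))"
      by (simp only: mult_ac)
    then show "const_fun (c \<alpha>) * mon ys \<alpha> * fr g ^ (q * N) = fr (single 0 (c \<alpha>) * H \<alpha>)"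
      unfolding e by (simp only: H_def fr_simps const_fun_def)
  qed
  also have "\<dots> = 0" unfolding fr_sum[symmetric] zero by (simp only: fr_simps)
  finally have "(\<Sum>\<alpha>\<in>J. const_fun (c \<alpha>) * mon ys \<alpha>) = 0"
    using g(1) fr_simps(5)[of g 0] by (auto simp: fr_simps)
  moreover have lenJ: "\<forall>\<alpha>\<in>J. length \<alpha> = length ys" by (simp add: J_def q_def)
  ultimately have "\<forall>\<alpha>\<in>J. c \<alpha> = 0"
    using spec[OF spec[OF ind[unfolded algindep_def], of J], of c] J(1) lenJ by simp
  then show False using c by blast
qed

lemma algindep_mono: "algindep \<kappa> ys Q \<Longrightarrow> Q' \<subseteq> Q \<Longrightarrow> algindep \<kappa> ys Q'"
  unfolding algindep_def by blast

text \<open>A chain of primes has at most the length of an algebraically independent family in the function field.\<close>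

lemma krull_dim_le_card:
  fixes S :: "'v::linorder laurent fract set"
  assumes D: "finite D" and S: "subring_set S" "S \<subseteq> fracs D" "\<And>c. const_fun c \<in> S"
  shows "krull_dim (cls_ring S) \<le> enat (card D)"
  unfolding krull_dim_def
proof (rule Sup_least)
  fix x assume "x \<in> {enat n | n. \<exists>P. (\<forall>i\<le>n. primeideal (P i) (cls_ring S)) \<and> (\<forall>i<n. P i \<subset> P (Suc i))}"
  then obtain n P where x: "x = enat n" and P: "\<And>i. i \<le> n \<Longrightarrow> primeideal (P i) (cls_ring S)"
    "\<And>i. i < n \<Longrightarrow> P i \<subset> P (Suc i)" by blast
  have prime: "prime_set S (P i)" if "i \<le> n" for i using P(1)[OF that] by (rule primeideal_cls_ring[OF S(1)])
  obtain ys where ys: "length ys = n + length []" "set ys \<subseteq> S" "algindep const_fun ys (P 0)"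
    using algindep_chain[where Q = P and n = n and zs = "[]", OF cfn.scalars_axioms S(3) S(1) prime P(2)] algindep_Nil[OF cfn.scalars_axioms S(3) prime[OF order_refl]]
    by auto
  have "0 \<in> P 0" using prime[of 0] by (auto simp: prime_set_def ideal_set_def)
  then have "algindep const_fun ys {0}" using ys(3) by (auto intro: algindep_mono)
  then have "length ys \<le> card D" using algindep_length_le[OF D] ys S by blast
  then show "x \<le> enat (card D)" using x ys by simp
qed

section \<open>Points and charts of a toric variety\<close>

lemma pairing_superset:
  "finite A \<Longrightarrow> keys m \<subseteq> A \<Longrightarrow>
   pairing m v = (\<Sum>x\<in>A. of_int (lookup m x) * lookup v x)"
  unfolding pairing_def by (intro sum.mono_neutral_left) (auto simp: in_keys_iff)

lemma pairing_add_right: "pairing m (v + w) = pairing m v + pairing m w"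
  by (simp add: pairing_def lookup_add algebra_simps sum.distrib)

lemma pairing_scaleR: "pairing m (c *\<^sub>R v) = c * pairing m v"
  by (simp add: pairing_def scaleR_poly_mapping_def Poly_Mapping.map.rep_eq when_def sum_distrib_left)
    (intro sum.cong; simp)

lemma pairing_zero [simp]: "pairing m 0 = 0" "pairing 0 v = 0"
  by (simp_all add: pairing_def)

lemma pairing_cmul: "pairing (frag_cmul c m) v = of_int c * pairing m v"
  by (subst pairing_superset[of "keys m"])
     (auto simp: keys_cmul pairing_def sum_distrib_left algebra_simps intro!: sum.cong)

lemma convex_cone_pairing_nonneg: "convex_cone {v. 0 \<le> pairing m v}"
  unfolding convex_cone_iff by (auto simp: pairing_add_right pairing_scaleR)

lemma dual_lattice_cmul: "m \<in> dual_lattice D \<Longrightarrow> frag_cmul c m \<in> dual_lattice D"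
  using keys_cmul[of c m] by (auto simp: dual_lattice_def)

lemma dual_lattice_zero: "0 \<in> dual_lattice D" by (simp add: dual_lattice_def)

lemma dual_lattice_uminus: "m \<in> dual_lattice D \<Longrightarrow> - m \<in> dual_lattice D"
  by (simp add: dual_lattice_def)

lemma dual_lattice_diff: "m \<in> dual_lattice D \<Longrightarrow> m' \<in> dual_lattice D \<Longrightarrow> m - m' \<in> dual_lattice D"
  using dual_lattice_add[of m D "- m'"] dual_lattice_uminus[of m' D] by simp

lemma cmul_Suc: "frag_cmul (int (Suc n)) m = frag_cmul (int n) m + m"
  by (simp add: frag_cmul_distrib add.commute)

subsection \<open>Nonvanishing of Laurent polynomials on the torus\<close>

text \<open>A generic one-parameter subgroup of the torus separates finitely many characters.\<close>

lemma separating_functional: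
  assumes D: "finite D" and M: "finite M" "M \<subseteq> dual_lattice D"
  shows "\<exists>w::'v \<Rightarrow> int. inj_on (\<lambda>m. \<Sum>x\<in>D. lookup m x * w x) M"
proof -
  obtain idx :: "'v \<Rightarrow> nat" where idx: "inj_on idx D" using finite_imp_inj_to_nat_seg[OF D] by blast
  define p where "p m = (\<Sum>x\<in>D. monom (lookup m x) (idx x))" for m :: "'v \<Rightarrow>\<^sub>0 int"
  have coeff: "coeff (p m) (idx x) = lookup m x" if "x \<in> D" for m x
  proof -
    have "coeff (p m) (idx x) = (\<Sum>y\<in>D. if y = x then lookup m y else 0)"
      unfolding p_def coeff_sum using idx that by (intro sum.cong) (auto dest: inj_onD)
    then show ?thesis using that D by simp
  qed
  have inj: "p m \<noteq> p m'" if "m \<in> M" "m' \<in> M" "m \<noteq> m'" for m m'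
  proof
    assume e: "p m = p m'"
    have "m = m'"
    proof (rule poly_mapping_eqI)
      fix x
      show "lookup m x = lookup m' x"
      proof (cases "x \<in> D")
        case True then show ?thesis using coeff[OF True, of m] coeff[OF True, of m'] e by simp
      next
        case False
        then have "x \<notin> keys m" "x \<notin> keys m'"
          using that M by (auto simp: dual_lattice_def)
        then show ?thesis by (simp add: in_keys_iff)
      qed
    qed
    then show False using that by simp
  qed
  \<comment> \<open>Weights \<open>B\<^sup>i\<close> separate \<open>M\<close> unless \<open>B\<close> is a root of one of finitely many nonzero polynomials.\<close>
  define bad where "bad = (\<Union>m\<in>M. \<Union>m'\<in>M - {m}. {z. poly (p m - p m') z = 0})"
  have "finite bad" unfolding bad_def using M inj by (intro finite_UN_I finite_Diff poly_roots_finite) auto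
  then obtain B where B: "B \<notin> bad" using ex_new_if_finite[OF infinite_UNIV_int] by blast
  have ev: "poly (p m) B = (\<Sum>x\<in>D. lookup m x * B ^ idx x)" for m
    by (simp add: p_def poly_sum poly_monom)
  have "inj_on (\<lambda>m. \<Sum>x\<in>D. lookup m x * B ^ idx x) M"
    unfolding ev[symmetric] using B by (auto simp: inj_on_def bad_def)
  then show ?thesis by (rule exI[of _ "\<lambda>x. B ^ idx x"])
qed

lemma dual_monoid_zero_cone: "dual_monoid D {0} = dual_lattice D"
  by (auto simp: dual_monoid_def)

text \<open>On a one-parameter subgroup that separates the exponents, the Laurent polynomial restricts to a nonzero Laurent
  polynomial in one variable, which has finitely many zeros.\<close>

lemma torus_nonvanishing:
  assumes D: "finite D" and f: "f \<noteq> 0" "keys f \<subseteq> dual_lattice D"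
  shows "\<exists>t\<in>torus D. evalp f t \<noteq> 0"
proof -
  let ?M = "keys f"
  obtain w :: "'a \<Rightarrow> int" where w: "inj_on (\<lambda>m. \<Sum>x\<in>D. lookup m x * w x) ?M"
    using separating_functional[OF D finite_keys f(2)] by blast
  define \<phi> where "\<phi> m = (\<Sum>x\<in>D. lookup m x * w x)" for m :: "'a \<Rightarrow>\<^sub>0 int"
  have \<phi>_add: "\<phi> (m + m') = \<phi> m + \<phi> m'" for m m'
    by (simp add: \<phi>_def lookup_add algebra_simps sum.distrib)
  define K where "K = (\<Sum>m\<in>?M. \<bar>\<phi> m\<bar>)"
  have K: "0 \<le> \<phi> m + K" if "m \<in> ?M" for m
  proof -
    have "\<bar>\<phi> m\<bar> \<le> K" unfolding K_def using that by (intro member_le_sum) auto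
    then show ?thesis by linarith
  qed
  define P where "P = (\<Sum>m\<in>?M. monom (lookup f m) (nat (\<phi> m + K)))"
  obtain m0 where m0: "m0 \<in> ?M" using f(1) by (metis all_not_in_conv keys_eq_empty)
  have "coeff P (nat (\<phi> m0 + K)) = (\<Sum>m\<in>?M. if m = m0 then lookup f m else 0)"
    unfolding P_def coeff_sum
  proof (intro sum.cong refl)
    fix m assume m: "m \<in> ?M"
    have "nat (\<phi> m + K) = nat (\<phi> m0 + K) \<longleftrightarrow> m = m0"
      using K[OF m] K[OF m0] inj_onD[OF w, of m m0] m m0 by (auto simp: \<phi>_def)
    then show "coeff (monom (lookup f m) (nat (\<phi> m + K))) (nat (\<phi> m0 + K)) =
       (if m = m0 then lookup f m else 0)" by simp
  qed
  then have "coeff P (nat (\<phi> m0 + K)) \<noteq> 0" using m0 by (simp add: in_keys_iff)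
  then have "P \<noteq> 0" by auto
  then have "finite ({z. poly P z = 0} \<union> {0})" using poly_roots_finite by blast
  then obtain z where z: "poly P z \<noteq> 0" "z \<noteq> 0" using ex_new_if_finite[OF infinite_UNIV_char_0[where 'a = complex]] by blast
  define t where "t = (\<lambda>m\<in>dual_lattice D. z powi (\<phi> m))"
  have t: "t \<in> torus D"
    unfolding torus_def chart_def dual_monoid_zero_cone t_def
    using z(2) by (auto simp: dual_lattice_zero dual_lattice_add \<phi>_add power_int_add) (simp add: \<phi>_def)
  have "z powi K * evalp f t = (\<Sum>m\<in>?M. lookup f m * z ^ nat (\<phi> m + K))"
    unfolding evalp_def sum_distrib_left
  proof (intro sum.cong refl)
    fix m assume m: "m \<in> ?M"
    have "z ^ nat (\<phi> m + K) = z powi (\<phi> m + K)" using K[OF m] by (simp add: power_int_def)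
    also have "\<dots> = z powi (\<phi> m) * z powi K" using z(2) by (intro power_int_add) auto
    finally have "z ^ nat (\<phi> m + K) = z powi (\<phi> m) * z powi K" .
    then show "z powi K * (lookup f m * t m) = lookup f m * z ^ nat (\<phi> m + K)"
      using m f(2) by (auto simp: t_def)
  qed
  also have "\<dots> = poly P z" by (simp add: P_def poly_sum poly_monom)
  finally have "evalp f t \<noteq> 0" using z by auto
  then show ?thesis using t by blast
qed

subsection \<open>Fans indexed by finite sets of generators\<close>

text \<open>A cone of the fan is given by the finite set \<open>F\<close> of its generators. Faces are cut out by
  \<open>m\<close> that are nonnegative on the cone, and any two cones are separated by a hyperplane that
  meets both exactly in their common face.\<close>

locale toric =
  fixes D :: "'v::linorder set" and \<F> :: "'e set set" and \<beta> :: "'e \<Rightarrow> ('v \<Rightarrow>\<^sub>0 real)"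
    and ip :: "('v \<Rightarrow>\<^sub>0 int) \<Rightarrow> 'e \<Rightarrow> int"
  assumes finD: "finite D"
    and fin: "F \<in> \<F> \<Longrightarrow> finite F"
    and pair: "pairing m (\<beta> e) = of_int (ip m e)"
    and empty: "{} \<in> \<F>"
    and face: "F \<in> \<F> \<Longrightarrow> m \<in> dual_lattice D \<Longrightarrow> (\<And>e. e \<in> F \<Longrightarrow> 0 \<le> ip m e) \<Longrightarrow> {e \<in> F. ip m e = 0} \<in> \<F>"
    and sep: "F \<in> \<F> \<Longrightarrow> G \<in> \<F> \<Longrightarrow> \<exists>m\<in>dual_lattice D.
      (\<forall>e\<in>F. 0 \<le> ip m e \<and> (ip m e = 0 \<longleftrightarrow> e \<in> G)) \<and> (\<forall>e\<in>G. ip m e \<le> 0 \<and> (ip m e = 0 \<longleftrightarrow> e \<in> F))"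
begin

text \<open>The dual monoid of the cone, and its group of units.\<close>

definition S :: "'e set \<Rightarrow> ('v \<Rightarrow>\<^sub>0 int) set" where
  "S F = {m \<in> dual_lattice D. \<forall>e\<in>F. 0 \<le> ip m e}"

definition T :: "'e set \<Rightarrow> ('v \<Rightarrow>\<^sub>0 int) set" where
  "T F = {m \<in> dual_lattice D. \<forall>e\<in>F. ip m e = 0}"

definition cn :: "'e set \<Rightarrow> ('v \<Rightarrow>\<^sub>0 real) set" where "cn F = convex_cone hull (\<beta> ` F)"

abbreviation "\<Sigma> \<equiv> cn ` \<F>"
abbreviation "ch F \<equiv> chart D (cn F)"
abbreviation "CR F \<equiv> coord_ring D (cn F)"
abbreviation "Z \<equiv> zariski D \<Sigma>"

lemma ip_add: "ip (m + m') e = ip m e + ip m' e"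
  using pairing_add[of m m' "\<beta> e"] unfolding pair by linarith

lemma ip_zero [simp]: "ip 0 e = 0" using ip_add[of 0 0 e] by simp

lemma ip_cmul: "ip (frag_cmul c m) e = c * ip m e"
  using pairing_cmul[of c m "\<beta> e"] unfolding pair by (simp flip: of_int_mult)

lemma ip_uminus: "ip (- m) e = - ip m e" using ip_add[of m "- m" e] by simp

lemma ip_diff: "ip (m - m') e = ip m e - ip m' e"
  using ip_add[of m "- m'" e] by (simp add: ip_uminus)

lemma S_zero: "0 \<in> S F" by (simp add: S_def dual_lattice_zero)
lemma S_add: "m \<in> S F \<Longrightarrow> m' \<in> S F \<Longrightarrow> m + m' \<in> S F" by (auto simp: S_def dual_lattice_add ip_add)
lemma S_cmul: "m \<in> S F \<Longrightarrow> 0 \<le> c \<Longrightarrow> frag_cmul c m \<in> S F" by (auto simp: S_def dual_lattice_cmul ip_cmul)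
lemma S_anti: "G \<subseteq> F \<Longrightarrow> S F \<subseteq> S G" by (auto simp: S_def)
lemma T_anti: "G \<subseteq> F \<Longrightarrow> T F \<subseteq> T G" by (auto simp: T_def)
lemma T_S: "T F \<subseteq> S F" by (auto simp: S_def T_def)
lemma T_add: "m \<in> T F \<Longrightarrow> m' \<in> T F \<Longrightarrow> m + m' \<in> T F" by (auto simp: T_def dual_lattice_add ip_add)
lemma T_zero: "0 \<in> T F" by (simp add: T_def dual_lattice_zero)
lemma T_uminus: "m \<in> T F \<Longrightarrow> - m \<in> T F" by (auto simp: T_def dual_lattice_uminus ip_uminus)
lemma T_cmul: "m \<in> T F \<Longrightarrow> frag_cmul c m \<in> T F" by (auto simp: T_def dual_lattice_cmul ip_cmul)
lemma T_sum_iff: "m \<in> S F \<Longrightarrow> m' \<in> S F \<Longrightarrow> m + m' \<in> T F \<longleftrightarrow> m \<in> T F \<and> m' \<in> T F"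
  by (fastforce simp: S_def T_def dual_lattice_add ip_add)
lemma S_lattice: "S F \<subseteq> dual_lattice D" by (auto simp: S_def)

lemma dual_monoid_cn: "dual_monoid D (cn F) = S F"
proof (intro Set.set_eqI iffI)
  fix m assume m: "m \<in> dual_monoid D (cn F)"
  have "0 \<le> pairing m (\<beta> e)" if "e \<in> F" for e
    using m that hull_inc[of "\<beta> e" "\<beta> ` F" convex_cone] by (auto simp: dual_monoid_def cn_def)
  then show "m \<in> S F" using m by (auto simp: S_def pair dual_monoid_def)
next
  fix m assume m: "m \<in> S F"
  then have "cn F \<subseteq> {v. 0 \<le> pairing m v}"
    unfolding cn_def by (intro hull_minimal convex_cone_pairing_nonneg) (auto simp: S_def pair)
  then show "m \<in> dual_monoid D (cn F)" using m by (auto simp: dual_monoid_def S_def)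
qed

lemma perp_cn: "perp D (cn F) = T F"
proof -
  have "m \<in> perp D (cn F) \<longleftrightarrow> m \<in> dual_monoid D (cn F) \<and> - m \<in> dual_monoid D (cn F)" for m
  proof -
    have "pairing (- m) v = - pairing m v" for v using pairing_add[of m "- m" v] by simp
    then show ?thesis by (force simp: perp_def dual_monoid_def dual_lattice_def)
  qed
  then show ?thesis unfolding dual_monoid_cn by (force simp: S_def T_def ip_uminus dual_lattice_uminus)
qed

lemma CR_iff: "f \<in> CR F \<longleftrightarrow> keys f \<subseteq> S F"
  by (simp add: coord_ring_def dual_monoid_cn)

lemma ch_iff: "\<gamma> \<in> ch F \<longleftrightarrow> \<gamma> \<in> extensional (S F) \<and> \<gamma> 0 = 1 \<and>
   (\<forall>m\<in>S F. \<forall>m'\<in>S F. \<gamma> (m + m') = \<gamma> m * \<gamma> m')"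
  by (simp add: chart_def dual_monoid_cn)

lemma ch_add: "\<gamma> \<in> ch F \<Longrightarrow> m \<in> S F \<Longrightarrow> m' \<in> S F \<Longrightarrow> \<gamma> (m + m') = \<gamma> m * \<gamma> m'"
  unfolding ch_iff by blast

lemma ch_cmul:
  assumes "\<gamma> \<in> ch F" "m \<in> S F" shows "\<gamma> (frag_cmul (int n) m) = \<gamma> m ^ n"
proof (induction n)
  case 0 then show ?case using assms by (simp add: ch_iff)
next
  case (Suc n)
  have "frag_cmul (int n) m \<in> S F" using assms by (intro S_cmul) auto
  then show ?case unfolding cmul_Suc using ch_add[OF assms(1) _ assms(2)] Suc by simp
qed

text \<open>The monoid of a face is the localization of the monoid of the cone at an element \<open>m0\<close> that cuts out the face.\<close>

lemma shift_exists:
  assumes "finite F" "m0 \<in> S F" "m \<in> S {e \<in> F. ip m0 e = 0}"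
  shows "\<exists>K. \<forall>k\<ge>K. m + frag_cmul (int k) m0 \<in> S F"
proof -
  define K where "K = (\<Sum>e\<in>F. nat \<bar>ip m e\<bar>)"
  have "m + frag_cmul (int k) m0 \<in> S F" if k: "k \<ge> K" for k
  proof -
    have "0 \<le> ip m e + int k * ip m0 e" if e: "e \<in> F" for e
    proof (cases "ip m0 e = 0")
      case True then show ?thesis using assms e by (auto simp: S_def)
    next
      case False
      then have "1 \<le> ip m0 e" using assms e by (fastforce simp: S_def)
      have "nat \<bar>ip m e\<bar> \<le> K" unfolding K_def using assms e by (intro member_le_sum) auto
      then have "\<bar>ip m e\<bar> \<le> int k * 1" using k by linarith
      also have "\<dots> \<le> int k * ip m0 e" using \<open>1 \<le> ip m0 e\<close> by (intro mult_left_mono) auto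
      finally show ?thesis by linarith
    qed
    moreover have "m \<in> dual_lattice D" "m0 \<in> dual_lattice D" using assms by (auto simp: S_def)
    ultimately show ?thesis by (auto simp: S_def ip_add ip_cmul dual_lattice_add dual_lattice_cmul)
  qed
  then show ?thesis by blast
qed

lemma face_S: "F \<in> \<F> \<Longrightarrow> m \<in> S F \<Longrightarrow> {e \<in> F. ip m e = 0} \<in> \<F>"
  using face by (auto simp: S_def)

lemma face_exposed:
  assumes "F \<in> \<F>" "G \<in> \<F>"
  obtains m0 where "m0 \<in> S F" "\<And>e. e \<in> F \<Longrightarrow> ip m0 e = 0 \<longleftrightarrow> e \<in> G"
    "\<And>e. e \<in> G \<Longrightarrow> ip m0 e \<le> 0"
proof -
  obtain m where m: "m \<in> dual_lattice D" "\<forall>e\<in>F. 0 \<le> ip m e \<and> (ip m e = 0 \<longleftrightarrow> e \<in> G)"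
    "\<forall>e\<in>G. ip m e \<le> 0 \<and> (ip m e = 0 \<longleftrightarrow> e \<in> F)" using sep[OF assms] by blast
  show ?thesis by (rule that[of m]) (use m in \<open>auto simp: S_def\<close>)
qed

lemma Int_in: assumes "F \<in> \<F>" "G \<in> \<F>" shows "F \<inter> G \<in> \<F>"
proof -
  obtain m0 where m0: "m0 \<in> S F" "\<And>e. e \<in> F \<Longrightarrow> ip m0 e = 0 \<longleftrightarrow> e \<in> G" using face_exposed[OF assms] by metis
  have "F \<inter> G = {e \<in> F. ip m0 e = 0}" using m0(2) by auto
  then show ?thesis using face_S[OF assms(1) m0(1)] by simp
qed

lemma S_inj: assumes "F \<in> \<F>" "G \<in> \<F>" "S F = S G" shows "F = G"
proof -
  have "G \<subseteq> F" if FG: "F \<in> \<F>" "G \<in> \<F>" "S F = S G" for F G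
  proof
    fix e assume e: "e \<in> G"
    obtain m where m: "m \<in> dual_lattice D" "\<forall>e\<in>F. 0 \<le> ip m e \<and> (ip m e = 0 \<longleftrightarrow> e \<in> G)"
      "\<forall>e\<in>G. ip m e \<le> 0 \<and> (ip m e = 0 \<longleftrightarrow> e \<in> F)" using sep[OF FG(1,2)] by blast
    have "m \<in> S F" using m by (auto simp: S_def)
    then have "0 \<le> ip m e" using FG e by (auto simp: S_def)
    then show "e \<in> F" using m(3) e by force
  qed
  then show ?thesis using assms by blast
qed

text \<open>On the intersection of two cones of the fan the separating \<open>m0\<close> vanishes, and adding multiples
  of \<open>m0\<close> moves every element of the monoid of the common face into \<open>S F\<close>.\<close>

lemma dual_monoid_Int:
  assumes FG: "F \<in> \<F>" "G \<in> \<F>" shows "dual_monoid D (cn F \<inter> cn G) = S (F \<inter> G)"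
proof (intro Set.set_eqI iffI)
  fix m assume m: "m \<in> dual_monoid D (cn F \<inter> cn G)"
  have "\<beta> e \<in> cn F \<inter> cn G" if "e \<in> F \<inter> G" for e
    using that hull_inc[of "\<beta> e" _ convex_cone] by (auto simp: cn_def)
  then show "m \<in> S (F \<inter> G)" using m by (force simp: S_def dual_monoid_def pair)
next
  fix m assume m: "m \<in> S (F \<inter> G)"
  obtain m0 where m0: "m0 \<in> S F" "\<And>e. e \<in> F \<Longrightarrow> ip m0 e = 0 \<longleftrightarrow> e \<in> G" "\<And>e. e \<in> G \<Longrightarrow> ip m0 e \<le> 0"
    using face_exposed[OF FG] by metis
  have "{e \<in> F. ip m0 e = 0} = F \<inter> G" using m0(2) by auto
  then obtain K where K: "m + frag_cmul (int K) m0 \<in> S F"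
    using shift_exists[OF fin[OF FG(1)] m0(1), of m] m by auto
  have "0 \<le> pairing m v" if v: "v \<in> cn F \<inter> cn G" for v
  proof -
    have "- m0 \<in> S G" using m0 by (auto simp: S_def ip_uminus dual_lattice_uminus)
    then have "0 \<le> pairing (- m0) v" using v dual_monoid_cn[of G] by (auto simp: dual_monoid_def)
    moreover have "0 \<le> pairing m0 v" using v m0(1) dual_monoid_cn[of F] by (auto simp: dual_monoid_def)
    moreover have "pairing (- m0) v = - pairing m0 v" using pairing_add[of m0 "- m0" v] by simp
    ultimately have "pairing m0 v = 0" by simp
    moreover have "0 \<le> pairing (m + frag_cmul (int K) m0) v"
      using v K dual_monoid_cn[of F] by (auto simp: dual_monoid_def)
    ultimately show ?thesis by (simp add: pairing_add pairing_cmul)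
  qed
  then show "m \<in> dual_monoid D (cn F \<inter> cn G)" using m by (auto simp: dual_monoid_def S_def)
qed

lemma chart_Int: "F \<in> \<F> \<Longrightarrow> G \<in> \<F> \<Longrightarrow> chart D (cn F \<inter> cn G) = ch (F \<inter> G)"
  unfolding chart_def dual_monoid_Int dual_monoid_cn by (rule refl)

lemma restrict_ch:
  assumes "G \<subseteq> F" "c \<in> ch G" shows "restrict c (S F) \<in> ch F"
  using assms(2) S_anti[OF assms(1)] by (auto simp: ch_iff S_zero S_add subset_iff)

lemma restrict_restrict: "G \<subseteq> F \<Longrightarrow> restrict (restrict c (S G)) (S F) = restrict c (S F)"
  using S_anti[of G F] unfolding restrict_def by (intro ext) auto

subsection \<open>Orbits\<close>

text \<open>The points of the orbit of \<open>G\<close>, in the chart of \<open>G\<close>: those whose coordinates vanish exactly off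
  the units of the monoid.\<close>

definition can :: "'e set \<Rightarrow> (('v \<Rightarrow>\<^sub>0 int) \<Rightarrow> complex) set" where
  "can G = {c \<in> ch G. \<forall>m\<in>S G. c m \<noteq> 0 \<longleftrightarrow> m \<in> T G}"

lemma can_ch: "c \<in> can G \<Longrightarrow> c \<in> ch G" by (simp add: can_def)

lemma can_iff: "c \<in> can G \<Longrightarrow> m \<in> S G \<Longrightarrow> c m \<noteq> 0 \<longleftrightarrow> m \<in> T G" by (simp add: can_def)

text \<open>Accordingly a point of the chart where the character \<open>m0\<close> does not vanish lies in the chart of the face.\<close>

lemma extend_chart:
  assumes F: "finite F" and \<gamma>: "\<gamma> \<in> ch F" and m0: "m0 \<in> S F" "\<gamma> m0 \<noteq> 0"
  defines "F0 \<equiv> {e \<in> F. ip m0 e = 0}"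
  obtains \<omega> where "\<omega> \<in> ch F0" "restrict \<omega> (S F) = \<gamma>"
    "\<forall>m k. m \<in> S F0 \<longrightarrow> m + frag_cmul (int k) m0 \<in> S F \<longrightarrow> \<omega> m * \<gamma> m0 ^ k = \<gamma> (m + frag_cmul (int k) m0)"
proof -
  define Kf where "Kf m = (SOME k. m + frag_cmul (int k) m0 \<in> S F)" for m
  have Kf: "m + frag_cmul (int (Kf m)) m0 \<in> S F" if "m \<in> S F0" for m
  proof -
    have "\<exists>k. m + frag_cmul (int k) m0 \<in> S F" using shift_exists[OF F m0(1), of m] that unfolding F0_def by blast
    then show ?thesis unfolding Kf_def by (rule someI_ex)
  qed
  define \<omega> where "\<omega> = (\<lambda>m\<in>S F0. \<gamma> (m + frag_cmul (int (Kf m)) m0) / \<gamma> m0 ^ Kf m)"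
  have km: "frag_cmul (int k) m0 \<in> S F" for k using m0 by (intro S_cmul) auto
  have gk: "\<gamma> (frag_cmul (int k) m0) = \<gamma> m0 ^ k" for k using ch_cmul[OF \<gamma> m0(1)] .
  have key: "\<omega> m * \<gamma> m0 ^ k = \<gamma> (m + frag_cmul (int k) m0)"
    if m: "m \<in> S F0" "m + frag_cmul (int k) m0 \<in> S F" for m k
  proof -
    have e: "(m + frag_cmul (int (Kf m)) m0) + frag_cmul (int k) m0 = (m + frag_cmul (int k) m0) + frag_cmul (int (Kf m)) m0"
      by (simp add: algebra_simps)
    note 1 = ch_add[OF \<gamma> Kf[OF m(1)] km[of k], unfolded gk] and 2 = ch_add[OF \<gamma> m(2) km[of "Kf m"], unfolded gk]
    have "\<gamma> (m + frag_cmul (int (Kf m)) m0) * \<gamma> m0 ^ k = \<gamma> (m + frag_cmul (int k) m0) * \<gamma> m0 ^ Kf m"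
      by (rule trans[OF 1[symmetric, unfolded e] 2])
    then show ?thesis using m0(2) m(1) by (simp add: \<omega>_def field_simps)
  qed
  have sub: "S F \<subseteq> S F0" by (rule S_anti) (auto simp: F0_def)
  have "\<omega> m = \<gamma> m" if "m \<in> S F" for m using key[of m 0] that sub by auto
  then have res: "restrict \<omega> (S F) = \<gamma>"
    using \<gamma> by (auto simp: ch_iff restrict_def extensional_def)
  have "\<omega> \<in> ch F0"
    unfolding ch_iff
  proof (intro conjI ballI)
    show "\<omega> \<in> extensional (S F0)" by (simp add: \<omega>_def)
    show "\<omega> 0 = 1" using key[of 0 0] \<gamma> by (simp add: S_zero ch_iff)
    fix m m' assume m: "m \<in> S F0" "m' \<in> S F0"
    let ?k = "Kf m + Kf m'"
    have e: "(m + m') + frag_cmul (int ?k) m0 = (m + frag_cmul (int (Kf m)) m0) + (m' + frag_cmul (int (Kf m')) m0)"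
      by (simp add: frag_cmul_distrib algebra_simps)
    have "(m + m') + frag_cmul (int ?k) m0 \<in> S F" unfolding e by (rule S_add[OF Kf[OF m(1)] Kf[OF m(2)]])
    then have "\<omega> (m + m') * \<gamma> m0 ^ ?k = \<gamma> ((m + m') + frag_cmul (int ?k) m0)" by (rule key[OF S_add[OF m]])
    also have "\<dots> = (\<omega> m * \<gamma> m0 ^ Kf m) * (\<omega> m' * \<gamma> m0 ^ Kf m')"
      by (simp only: e ch_add[OF \<gamma> Kf[OF m(1)] Kf[OF m(2)]] key[OF m(1) Kf[OF m(1)]] key[OF m(2) Kf[OF m(2)]])
    finally show "\<omega> (m + m') = \<omega> m * \<omega> m'" using m0(2) by (simp add: power_add)
  qed
  then show ?thesis using that res key by simp
qed

text \<open>Characters that do not vanish at the point can be added up, so a single one can do the work of finitely many.\<close>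

lemma support_witness:
  assumes F: "finite F" and \<gamma>: "\<gamma> \<in> ch F"
  defines "G \<equiv> {e \<in> F. \<forall>m\<in>S F. \<gamma> m \<noteq> 0 \<longrightarrow> ip m e = 0}"
  obtains m0 where "m0 \<in> S F" "\<gamma> m0 \<noteq> 0" "{e \<in> F. ip m0 e = 0} = G"
proof -
  have "\<exists>m\<in>S F. \<gamma> m \<noteq> 0 \<and> (\<forall>e\<in>A. ip m e \<noteq> 0)" if "A \<subseteq> F - G" for A
    using finite_subset[OF that finite_Diff[OF F]] that
  proof (induction A rule: finite_induct)
    case empty then show ?case using \<gamma> by (intro bexI[of _ 0]) (auto simp: S_zero ch_iff)
  next
    case (insert e A)
    then obtain m where m: "m \<in> S F" "\<gamma> m \<noteq> 0" "\<forall>e\<in>A. ip m e \<noteq> 0" by auto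
    obtain m' where m': "m' \<in> S F" "\<gamma> m' \<noteq> 0" "ip m' e \<noteq> 0" using insert by (auto simp: G_def)
    have "\<gamma> (m + m') \<noteq> 0" using ch_add[OF \<gamma> m(1) m'(1)] m m' by simp
    moreover have "ip (m + m') e' \<noteq> 0" if "e' \<in> insert e A" for e'
    proof -
      have "0 \<le> ip m e'" "0 \<le> ip m' e'" using that insert.prems m m' by (auto simp: S_def)
      then show ?thesis using that m(3) m'(3) by (auto simp: ip_add add_nonneg_eq_0_iff)
    qed
    ultimately show ?case using S_add[OF m(1) m'(1)] by (intro bexI[of _ "m + m'"]) auto
  qed
  from this[of "F - G"] obtain m where m: "m \<in> S F" "\<gamma> m \<noteq> 0" "\<forall>e\<in>F - G. ip m e \<noteq> 0" by blast
  show ?thesis by (rule that[OF m(1,2)]) (use m in \<open>auto simp: G_def\<close>)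
qed

text \<open>A point of a chart lies on the orbit of the face on which all the characters that do not vanish at the point are zero.\<close>

lemma can_exists:
  assumes F: "F \<in> \<F>" and \<gamma>: "\<gamma> \<in> ch F"
  shows "\<exists>G\<in>\<F>. G \<subseteq> F \<and> (\<exists>c\<in>can G. restrict c (S F) = \<gamma>)"
proof -
  define G where "G = {e \<in> F. \<forall>m\<in>S F. \<gamma> m \<noteq> 0 \<longrightarrow> ip m e = 0}"
  obtain m0 where m0': "m0 \<in> S F" "\<gamma> m0 \<noteq> 0"
      "{e \<in> F. ip m0 e = 0} = {e \<in> F. \<forall>m\<in>S F. \<gamma> m \<noteq> 0 \<longrightarrow> ip m e = 0}"
    by (rule support_witness[OF fin[OF F] \<gamma>])
  note m0 = m0'(1,2) m0'(3)[folded G_def]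
  have GF: "G \<in> \<F>" using face_S[OF F m0(1)] m0(3) by simp
  have supp: "\<gamma> m \<noteq> 0 \<longleftrightarrow> m \<in> T G" if m: "m \<in> S F" for m
  proof
    assume "\<gamma> m \<noteq> 0" then show "m \<in> T G" using m by (auto simp: T_def G_def S_def)
  next
    assume mT: "m \<in> T G"
    have "- m \<in> S {e \<in> F. ip m0 e = 0}" unfolding m0(3) using T_uminus[OF mT] T_S by blast
    then obtain k where k: "- m + frag_cmul (int k) m0 \<in> S F" using shift_exists[OF fin[OF F] m0(1)] by blast
    have "\<gamma> (m + (- m + frag_cmul (int k) m0)) = \<gamma> m0 ^ k" using ch_cmul[OF \<gamma> m0(1)] by simp
    then have "\<gamma> m * \<gamma> (- m + frag_cmul (int k) m0) = \<gamma> m0 ^ k" by (simp only: ch_add[OF \<gamma> m k])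
    moreover have "\<gamma> m0 ^ k \<noteq> 0" using m0(2) by simp
    ultimately show "\<gamma> m \<noteq> 0" by auto
  qed
  obtain \<omega> where \<omega>': "\<omega> \<in> ch {e \<in> F. ip m0 e = 0}" "restrict \<omega> (S F) = \<gamma>"
    "\<forall>m k. m \<in> S {e \<in> F. ip m0 e = 0} \<longrightarrow> m + frag_cmul (int k) m0 \<in> S F \<longrightarrow>
      \<omega> m * \<gamma> m0 ^ k = \<gamma> (m + frag_cmul (int k) m0)"
    by (rule extend_chart[OF fin[OF F] \<gamma> m0(1,2)])
  note \<omega> = \<omega>'[unfolded m0(3)]
  have m0T: "m0 \<in> T G" using supp[OF m0(1)] m0(2) by blast
  have "\<omega> m \<noteq> 0 \<longleftrightarrow> m \<in> T G" if m: "m \<in> S G" for m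
  proof -
    obtain k where k: "m + frag_cmul (int k) m0 \<in> S F"
      using shift_exists[OF fin[OF F] m0(1), of m] m unfolding m0(3) by blast
    have "\<omega> m \<noteq> 0 \<longleftrightarrow> \<gamma> (m + frag_cmul (int k) m0) \<noteq> 0" using m0(2) by (simp flip: \<omega>(3)[rule_format, OF m k])
    also have "\<dots> \<longleftrightarrow> m \<in> T G"
      unfolding supp[OF k] using T_sum_iff[OF m, of "frag_cmul (int k) m0"] T_cmul[OF m0T, of "int k"] T_S by blast
    finally show ?thesis .
  qed
  then have "\<omega> \<in> can G" using \<omega>(1) by (simp add: can_def)
  then show ?thesis using GF \<omega>(2) by (intro bexI[of _ G]) (auto simp: G_def)
qed

text \<open>The set of characters that do not vanish at the point determines the face, and a character of the face is a quotient of
  characters of the cone.\<close>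

lemma can_unique:
  assumes F: "F \<in> \<F>" and G: "G \<in> \<F>" "G \<subseteq> F" "c \<in> can G" and G': "G' \<in> \<F>" "G' \<subseteq> F" "c' \<in> can G'"
    and eq: "restrict c (S F) = restrict c' (S F)"
  shows "G = G'" "c = c'"
proof -
  have cc: "c m = c' m" if "m \<in> S F" for m using fun_cong[OF eq, of m] that by simp
  have sub: "G' \<subseteq> G" if G: "G \<in> \<F>" "G \<subseteq> F" "c \<in> can G" and G': "G' \<in> \<F>" "G' \<subseteq> F" "c' \<in> can G'"
    and cc: "\<And>m. m \<in> S F \<Longrightarrow> c m = c' m" for G G' c c'
  proof
    fix e assume e: "e \<in> G'"
    obtain m0 where m0: "m0 \<in> S F" "\<And>e. e \<in> F \<Longrightarrow> ip m0 e = 0 \<longleftrightarrow> e \<in> G" using face_exposed[OF F G(1)] by metis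
    have "m0 \<in> T G" using m0 G(2) by (auto simp: T_def S_def)
    then have "c' m0 \<noteq> 0" using can_iff[OF G(3), of m0] m0(1) S_anti[OF G(2)] cc[OF m0(1)] by auto
    then have "m0 \<in> T G'" using can_iff[OF G'(3), of m0] m0(1) S_anti[OF G'(2)] by auto
    then show "e \<in> G" using e m0(2)[of e] G'(2) by (auto simp: T_def)
  qed
  show GG: "G = G'" using sub[OF G G' cc] sub[OF G' G] cc by auto
  obtain m0 where m0: "m0 \<in> S F" "\<And>e. e \<in> F \<Longrightarrow> ip m0 e = 0 \<longleftrightarrow> e \<in> G" using face_exposed[OF F G(1)] by metis
  have m0T: "m0 \<in> T G" using m0 G(2) by (auto simp: T_def S_def)
  have FG: "{e \<in> F. ip m0 e = 0} = G" using m0(2) G(2) by auto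
  have SFG: "S F \<subseteq> S G" by (rule S_anti[OF G(2)])
  show "c = c'"
  proof
    fix m
    show "c m = c' m"
    proof (cases "m \<in> S G")
      case True
      then obtain k where k: "m + frag_cmul (int k) m0 \<in> S F"
        using shift_exists[OF fin[OF F] m0(1), of m] unfolding FG by blast
      have km: "frag_cmul (int k) m0 \<in> S F" using m0 by (intro S_cmul) auto
      then have km': "frag_cmul (int k) m0 \<in> S G" using SFG by blast
      have "c (m + frag_cmul (int k) m0) = c m * c (frag_cmul (int k) m0)"
        by (rule ch_add[OF can_ch[OF G(3)] True km'])
      moreover have "c' (m + frag_cmul (int k) m0) = c' m * c' (frag_cmul (int k) m0)"
        using ch_add[OF can_ch[OF G'(3)]] True km' unfolding GG by blast
      moreover have "c (frag_cmul (int k) m0) \<noteq> 0"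
        using can_iff[OF G(3) km'] T_cmul[OF m0T] by blast
      ultimately show ?thesis using cc[OF k] cc[OF km] by simp
    next
      case False
      then show ?thesis using can_ch[OF G(3)] can_ch[OF G'(3)] unfolding ch_iff GG extensional_def by simp
    qed
  qed
qed

definition Pt :: "'e set \<Rightarrow> (('v \<Rightarrow>\<^sub>0 int) \<Rightarrow> complex) \<Rightarrow> 'v toric_point" where
  "Pt G c = {(cn F, restrict c (S F)) | F. F \<in> \<F> \<and> G \<subseteq> F}"

text \<open>Two points of charts are glued exactly if they lie on the same orbit and have the same coordinates there.
  In particular gluing is transitive, so its classes are the sets \<open>Pt G c\<close>.\<close>

lemma glue_iff:
  assumes F: "F \<in> \<F>" "F' \<in> \<F>"
  shows "((cn F, \<gamma>), (cn F', \<gamma>')) \<in> glue D \<Sigma> \<longleftrightarrow>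
    (\<exists>G\<in>\<F>. G \<subseteq> F \<inter> F' \<and> (\<exists>c\<in>can G. \<gamma> = restrict c (S F) \<and> \<gamma>' = restrict c (S F')))"
proof
  assume "((cn F, \<gamma>), (cn F', \<gamma>')) \<in> glue D \<Sigma>"
  then obtain \<omega> where \<omega>: "\<omega> \<in> ch (F \<inter> F')" "restrict \<omega> (S F) = \<gamma>" "restrict \<omega> (S F') = \<gamma>'"
    unfolding glue_def using chart_Int[OF F] by (auto simp: dual_monoid_cn)
  obtain G c where G: "G \<in> \<F>" "G \<subseteq> F \<inter> F'" "c \<in> can G" "restrict c (S (F \<inter> F')) = \<omega>"
    using can_exists[OF Int_in[OF F] \<omega>(1)] by blast
  have "\<gamma> = restrict c (S F)" "\<gamma>' = restrict c (S F')"
    using \<omega>(2,3) restrict_restrict[of "F \<inter> F'" F c] restrict_restrict[of "F \<inter> F'" F' c] unfolding G(4) by auto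
  then show "\<exists>G\<in>\<F>. G \<subseteq> F \<inter> F' \<and> (\<exists>c\<in>can G. \<gamma> = restrict c (S F) \<and> \<gamma>' = restrict c (S F'))" using G by blast
next
  assume "\<exists>G\<in>\<F>. G \<subseteq> F \<inter> F' \<and> (\<exists>c\<in>can G. \<gamma> = restrict c (S F) \<and> \<gamma>' = restrict c (S F'))"
  then obtain G c where G: "G \<in> \<F>" "G \<subseteq> F \<inter> F'" "c \<in> can G" "\<gamma> = restrict c (S F)" "\<gamma>' = restrict c (S F')"
    by (elim bexE conjE) (rule that)
  have "restrict c (S (F \<inter> F')) \<in> chart D (cn F \<inter> cn F')"
    unfolding chart_Int[OF F] by (rule restrict_ch[OF G(2) can_ch[OF G(3)]])
  moreover have "restrict (restrict c (S (F \<inter> F'))) (S F) = \<gamma>" unfolding G(4) by (rule restrict_restrict) blast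
  moreover have "restrict (restrict c (S (F \<inter> F'))) (S F') = \<gamma>'" unfolding G(5) by (rule restrict_restrict) blast
  ultimately have ex: "\<exists>\<omega>\<in>chart D (cn F \<inter> cn F'). restrict \<omega> (S F) = \<gamma> \<and> restrict \<omega> (S F') = \<gamma>'"
    by (intro bexI[of _ "restrict c (S (F \<inter> F'))"] conjI)
  have "\<gamma> \<in> ch F" "\<gamma>' \<in> ch F'" unfolding G(4,5) using G(2) by (auto intro!: restrict_ch[OF _ can_ch[OF G(3)]])
  moreover have "cn F \<in> \<Sigma>" "cn F' \<in> \<Sigma>" using F by auto
  ultimately show "((cn F, \<gamma>), (cn F', \<gamma>')) \<in> glue D \<Sigma>"
    unfolding glue_def mem_Collect_eq case_prod_conv dual_monoid_cn using ex by (intro conjI)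
qed

lemma toric_pt_eq:
  assumes F: "F \<in> \<F>" and G: "G \<in> \<F>" "G \<subseteq> F" "c \<in> can G"
  shows "toric_pt D \<Sigma> (cn F) (restrict c (S F)) = Pt G c"
proof (intro Set.set_eqI iffI)
  fix y assume y: "y \<in> toric_pt D \<Sigma> (cn F) (restrict c (S F))"
  then have gl: "((cn F, restrict c (S F)), y) \<in> glue D \<Sigma>" by (simp add: toric_pt_def)
  then obtain F' \<gamma>' where y': "y = (cn F', \<gamma>')" "F' \<in> \<F>" by (auto simp: glue_def)
  obtain G' c' where G': "G' \<in> \<F>" "G' \<subseteq> F \<inter> F'" "c' \<in> can G'" "restrict c (S F) = restrict c' (S F)" "\<gamma>' = restrict c' (S F')"
    using gl unfolding y'(1) glue_iff[OF F y'(2)] by blast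
  have "G = G'" "c = c'" using can_unique[OF F G G'(1) _ G'(3,4)] G'(2) by auto
  then show "y \<in> Pt G c" using y' G' by (auto simp: Pt_def)
next
  fix y assume "y \<in> Pt G c"
  then obtain F' where y: "y = (cn F', restrict c (S F'))" "F' \<in> \<F>" "G \<subseteq> F'" by (auto simp: Pt_def)
  have "((cn F, restrict c (S F)), y) \<in> glue D \<Sigma>" unfolding y(1) glue_iff[OF F y(2)] using G y by blast
  then show "y \<in> toric_pt D \<Sigma> (cn F) (restrict c (S F))" by (simp add: toric_pt_def)
qed

lemma restrict_can: "c \<in> can G \<Longrightarrow> restrict c (S G) = c"
  by (auto simp: can_def ch_iff restrict_def extensional_def)

lemma Pt_self: "G \<in> \<F> \<Longrightarrow> c \<in> can G \<Longrightarrow> (cn G, c) \<in> Pt G c"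
  unfolding Pt_def using restrict_can by (metis (mono_tags, lifting) CollectI order_refl)

lemma Pt_inj:
  assumes G: "G \<in> \<F>" "c \<in> can G" and G': "G' \<in> \<F>" "c' \<in> can G'" and eq: "Pt G c = Pt G' c'"
  shows "G = G'" "c = c'"
proof -
  have "(cn G, c) \<in> Pt G' c'" using Pt_self[OF G] eq by simp
  then obtain F where F: "cn G = cn F" "c = restrict c' (S F)" "F \<in> \<F>" "G' \<subseteq> F" by (auto simp: Pt_def)
  have "G = F" using S_inj[OF G(1) F(3)] F(1) dual_monoid_cn by metis
  then have r: "restrict c (S G) = restrict c' (S G)" using F(2) restrict_can[OF G(2)] by simp
  show "G = G'" "c = c'" using can_unique[OF G(1) G(1) order_refl G(2) G'(1) _ G'(2) r] F(4) \<open>G = F\<close> by auto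
qed

lemma toric_variety_eq: "toric_variety D \<Sigma> = {Pt G c | G c. G \<in> \<F> \<and> c \<in> can G}"
proof (intro Set.set_eqI iffI)
  fix p assume "p \<in> toric_variety D \<Sigma>"
  then obtain F \<gamma> where F: "F \<in> \<F>" "\<gamma> \<in> ch F" "p = toric_pt D \<Sigma> (cn F) \<gamma>"
    by (auto simp: toric_variety_def quotient_def toric_pt_def)
  obtain G c where "G \<in> \<F>" "G \<subseteq> F" "c \<in> can G" "restrict c (S F) = \<gamma>" using can_exists[OF F(1,2)] by blast
  then show "p \<in> {Pt G c | G c. G \<in> \<F> \<and> c \<in> can G}" using toric_pt_eq[OF F(1)] F(3) by blast
next
  fix p assume "p \<in> {Pt G c | G c. G \<in> \<F> \<and> c \<in> can G}"
  then obtain G c where G: "G \<in> \<F>" "c \<in> can G" "p = Pt G c" by blast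
  have "p = glue D \<Sigma> `` {(cn G, c)}"
    using toric_pt_eq[OF G(1) G(1) order_refl G(2)] restrict_can[OF G(2)] G(3) by (simp add: toric_pt_def)
  then show "p \<in> toric_variety D \<Sigma>"
    unfolding toric_variety_def using G can_ch by (auto intro!: quotientI)
qed

subsection \<open>Open sets and orbit closures\<close>

lemma evalp_cong: "(\<And>m. m \<in> keys f \<Longrightarrow> \<gamma> m = \<gamma>' m) \<Longrightarrow> evalp f \<gamma> = evalp f \<gamma>'"
  by (auto simp: evalp_def intro!: sum.cong)

lemma evalp_restrict: "f \<in> CR F \<Longrightarrow> evalp f (restrict c (S F)) = evalp f c"
  by (rule evalp_cong) (auto simp: CR_iff)

lemma CR_anti: assumes "G \<subseteq> F" shows "CR F \<subseteq> CR G"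
  using S_anti[OF assms] by (auto simp: CR_iff)

definition U :: "'e set \<Rightarrow> 'v laurent \<Rightarrow> 'v toric_point set" where
  "U F f = {Pt G c | G c. G \<in> \<F> \<and> G \<subseteq> F \<and> c \<in> can G \<and> evalp f c \<noteq> 0}"

lemma Pt_in_U: "G \<in> \<F> \<Longrightarrow> c \<in> can G \<Longrightarrow> Pt G c \<in> U F f \<longleftrightarrow> G \<subseteq> F \<and> evalp f c \<noteq> 0"
proof
  assume G: "G \<in> \<F>" "c \<in> can G" and "Pt G c \<in> U F f"
  then obtain G' c' where G': "Pt G c = Pt G' c'" "G' \<in> \<F>" "G' \<subseteq> F" "c' \<in> can G'" "evalp f c' \<noteq> 0"
    unfolding U_def mem_Collect_eq by (elim exE conjE) (rule that)
  have "G = G'" "c = c'" by (rule Pt_inj[OF G G'(2,4,1)])+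
  then show "G \<subseteq> F \<and> evalp f c \<noteq> 0" using G' by simp
next
  assume "G \<in> \<F>" "c \<in> can G" "G \<subseteq> F \<and> evalp f c \<noteq> 0"
  then show "Pt G c \<in> U F f" unfolding U_def by blast
qed

text \<open>Openness is tested in every chart \<open>F'\<close>. There \<open>f\<close> may have poles along the complement of the common chart, which are cleared
  by powers of a character that vanishes there.\<close>

lemma openin_U:
  assumes F: "F \<in> \<F>" and f: "f \<in> CR F" shows "openin Z (U F f)"
  unfolding openin_zariski zariski_open_def
proof (intro conjI ballI)
  show "U F f \<subseteq> toric_variety D \<Sigma>" unfolding toric_variety_eq U_def by blast
  fix \<sigma> assume "\<sigma> \<in> \<Sigma>"
  then obtain F' where F': "\<sigma> = cn F'" "F' \<in> \<F>" by blast
  obtain m0 where m0: "m0 \<in> S F'" "\<And>e. e \<in> F' \<Longrightarrow> ip m0 e = 0 \<longleftrightarrow> e \<in> F" "\<And>e. e \<in> F \<Longrightarrow> ip m0 e \<le> 0"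
    using face_exposed[OF F'(2) F] by metis
  have F0: "{e \<in> F'. ip m0 e = 0} = F' \<inter> F" using m0(2) by auto
  have "\<exists>K. \<forall>m\<in>keys f. m + frag_cmul (int K) m0 \<in> S F'"
  proof -
    have "\<forall>m\<in>keys f. \<exists>K. \<forall>k\<ge>K. m + frag_cmul (int k) m0 \<in> S F'"
      using shift_exists[OF fin[OF F'(2)] m0(1)] f S_anti[of "F' \<inter> F" F] unfolding F0 CR_iff by blast
    then obtain K where K: "\<forall>m\<in>keys f. \<forall>k\<ge>K m. m + frag_cmul (int k) m0 \<in> S F'" by metis
    have "K m \<le> (\<Sum>m\<in>keys f. K m)" if "m \<in> keys f" for m
      using that by (intro member_le_sum) auto
    then show ?thesis using K by blast
  qed
  then obtain K where K: "\<And>m. m \<in> keys f \<Longrightarrow> m + frag_cmul (int K) m0 \<in> S F'" by blast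
  \<comment> \<open>The extra factor \<open>m0\<close> makes \<open>h\<close> vanish on the part of the chart of \<open>F'\<close> outside that of \<open>F\<close>.\<close>
  define h where "h = (\<Sum>m\<in>keys f.
    single ((m + frag_cmul (int K) m0) + m0) (lookup f m))"
  have "keys h \<subseteq> (\<Union>m\<in>keys f. {(m + frag_cmul (int K) m0) + m0})"
    unfolding h_def by (rule order_trans[OF keys_sum]) (auto split: if_splits)
  then have h: "h \<in> CR F'" unfolding CR_iff using K m0(1) S_add by blast
  have "toric_pt D \<Sigma> \<sigma> \<gamma> \<in> U F f \<longleftrightarrow> evalp h \<gamma> \<noteq> 0" if \<gamma>: "\<gamma> \<in> chart D \<sigma>" for \<gamma>
  proof -
    obtain G c where G: "G \<in> \<F>" "G \<subseteq> F'" "c \<in> can G" "restrict c (S F') = \<gamma>"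
      using can_exists[OF F'(2)] \<gamma> F'(1) by blast
    have SG: "S F' \<subseteq> S G" by (rule S_anti[OF G(2)])
    have pt: "toric_pt D \<Sigma> \<sigma> \<gamma> = Pt G c" using toric_pt_eq[OF F'(2) G(1-3)] G(4) F'(1) by simp
    have ev: "evalp h \<gamma> = (\<Sum>m\<in>keys f. lookup f m * (c (m + frag_cmul (int K) m0) * c m0))"
    proof -
      have "evalp h \<gamma> = evalp h c" using evalp_restrict[OF h, of c] G(4) by simp
      also have "\<dots> = (\<Sum>m\<in>keys f. lookup f m * c ((m + frag_cmul (int K) m0) + m0))"
        by (simp add: h_def evalp_sum evalp_single)
      also have "\<dots> = (\<Sum>m\<in>keys f. lookup f m * (c (m + frag_cmul (int K) m0) * c m0))"
      proof (intro sum.cong refl)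
        fix m assume "m \<in> keys f"
        then have "c ((m + frag_cmul (int K) m0) + m0) = c (m + frag_cmul (int K) m0) * c m0"
          by (intro ch_add[OF can_ch[OF G(3)]] subsetD[OF SG] K m0(1))
        then show "lookup f m * c ((m + frag_cmul (int K) m0) + m0) =
          lookup f m * (c (m + frag_cmul (int K) m0) * c m0)" by simp
      qed
      finally show ?thesis .
    qed
    have GF: "c m0 \<noteq> 0 \<longleftrightarrow> G \<subseteq> F"
    proof -
      have "c m0 \<noteq> 0 \<longleftrightarrow> m0 \<in> T G" using can_iff[OF G(3)] m0(1) SG by blast
      also have "\<dots> \<longleftrightarrow> G \<subseteq> F" using m0(1,2) G(2) by (auto simp: T_def S_def)
      finally show ?thesis .
    qed
    show ?thesis
    proof (cases "G \<subseteq> F")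
      case False
      then have "evalp h \<gamma> = 0" unfolding ev using GF by simp
      then show ?thesis unfolding pt Pt_in_U[OF G(1,3)] using False by simp
    next
      case True
      have m0G: "frag_cmul (int K) m0 \<in> S G" using S_cmul[of m0 G "int K"] m0(1) SG by auto
      have "evalp h \<gamma> = (\<Sum>m\<in>keys f. (lookup f m * c m) * c m0 ^ Suc K)"
        unfolding ev
      proof (intro sum.cong refl)
        fix m assume "m \<in> keys f"
        then have "m \<in> S G" using f S_anti[OF True] by (auto simp: CR_iff)
        then have "c (m + frag_cmul (int K) m0) = c m * c m0 ^ K"
          using ch_add[OF can_ch[OF G(3)] _ m0G] ch_cmul[OF can_ch[OF G(3)]] m0(1) SG by auto
        then show "lookup f m * (c (m + frag_cmul (int K) m0) * c m0) = lookup f m * c m * c m0 ^ Suc K" by simp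
      qed
      also have "\<dots> = evalp f c * c m0 ^ Suc K" by (simp add: evalp_def sum_distrib_right)
      finally show ?thesis unfolding pt Pt_in_U[OF G(1,3)] using GF True by simp
    qed
  qed
  then show "\<exists>H\<subseteq>coord_ring D \<sigma>. {\<gamma> \<in> chart D \<sigma>. toric_pt D \<Sigma> \<sigma> \<gamma> \<in> U F f} = {\<gamma> \<in> chart D \<sigma>. \<exists>f\<in>H. evalp f \<gamma> \<noteq> 0}"
    using h F'(1) by (intro exI[of _ "{h}"]) auto
qed

lemma one_CR: "1 \<in> CR F" by (simp add: CR_iff S_zero)

lemma evalp_one: "c \<in> ch G \<Longrightarrow> evalp 1 c = 1"
  using evalp_single[of 0 1 c] by (simp add: ch_iff)

text \<open>The sets \<open>U F h\<close> are a basis of the topology.\<close>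

lemma open_contains_U:
  assumes V: "openin Z V" and F: "F \<in> \<F>" and G: "G \<in> \<F>" "G \<subseteq> F" "c \<in> can G" "Pt G c \<in> V"
  obtains h where "h \<in> CR F" "evalp h c \<noteq> 0" "U F h \<subseteq> V"
proof -
  have "cn F \<in> \<Sigma>" using F by blast
  then obtain H where H: "H \<subseteq> CR F"
    "{\<gamma> \<in> ch F. toric_pt D \<Sigma> (cn F) \<gamma> \<in> V} = {\<gamma> \<in> ch F. \<exists>f\<in>H. evalp f \<gamma> \<noteq> 0}"
    using V unfolding openin_zariski zariski_open_def by blast
  have iff: "Pt G' c' \<in> V \<longleftrightarrow> (\<exists>f\<in>H. evalp f c' \<noteq> 0)" if G': "G' \<in> \<F>" "G' \<subseteq> F" "c' \<in> can G'" for G' c'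
  proof -
    have r: "restrict c' (S F) \<in> ch F" using G' by (intro restrict_ch can_ch)
    have er: "evalp f (restrict c' (S F)) = evalp f c'" if "f \<in> H" for f
      using evalp_restrict[OF subsetD[OF H(1) that]] .
    have "Pt G' c' \<in> V \<longleftrightarrow> restrict c' (S F) \<in> {\<gamma> \<in> ch F. toric_pt D \<Sigma> (cn F) \<gamma> \<in> V}"
      using r toric_pt_eq[OF F G'] by simp
    also have "\<dots> \<longleftrightarrow> (\<exists>f\<in>H. evalp f (restrict c' (S F)) \<noteq> 0)" unfolding H(2) using r by simp
    also have "\<dots> \<longleftrightarrow> (\<exists>f\<in>H. evalp f c' \<noteq> 0)" by (simp add: er cong: bex_cong)
    finally show ?thesis .
  qed
  obtain f where f: "f \<in> H" "evalp f c \<noteq> 0" using iff[OF G(1-3)] G(4) by blast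
  have "U F f \<subseteq> V" unfolding U_def using iff f(1) by blast
  then show ?thesis using that f H(1) by blast
qed

lemma topspace_Z: "topspace Z = toric_variety D \<Sigma>"
proof
  have "zariski_open D \<Sigma> (topspace Z)" using openin_topspace[of Z] unfolding openin_zariski .
  then show "topspace Z \<subseteq> toric_variety D \<Sigma>" by (simp add: zariski_open_def)
  show "toric_variety D \<Sigma> \<subseteq> topspace Z"
  proof
    fix p assume "p \<in> toric_variety D \<Sigma>"
    then obtain G c where G: "G \<in> \<F>" "c \<in> can G" "p = Pt G c" unfolding toric_variety_eq by blast
    have "p \<in> U G 1" unfolding G(3) Pt_in_U[OF G(1,2)] using evalp_one[OF can_ch[OF G(2)]] by simp
    then show "p \<in> topspace Z" using openin_subset[OF openin_U[OF G(1) one_CR]] by blast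
  qed
qed

text \<open>The translate of the distinguished point of the orbit of \<open>F\<close> by the torus element \<open>t\<close>.\<close>

definition orb :: "'e set \<Rightarrow> (('v \<Rightarrow>\<^sub>0 int) \<Rightarrow> complex) \<Rightarrow> ('v \<Rightarrow>\<^sub>0 int) \<Rightarrow> complex" where
  "orb F t = (\<lambda>m\<in>S F. if m \<in> T F then t m else 0)"

lemma torus_nz: assumes "t \<in> torus D" "m \<in> dual_lattice D" shows "t m \<noteq> 0"
proof -
  have "t (m + - m) = t m * t (- m)"
    using assms dual_lattice_uminus[OF assms(2)] unfolding torus_def chart_def dual_monoid_zero_cone by blast
  moreover have "t 0 = 1" using assms by (simp add: torus_def chart_def)
  ultimately show ?thesis by auto
qed

lemma torus_add: "t \<in> torus D \<Longrightarrow> m \<in> dual_lattice D \<Longrightarrow> m' \<in> dual_lattice D \<Longrightarrow> t (m + m') = t m * t m'"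
  unfolding torus_def chart_def dual_monoid_zero_cone by blast

lemma orb_can: assumes t: "t \<in> torus D" shows "orb F t \<in> can F"
proof -
  have 1: "t 0 = 1" using t by (simp add: torus_def chart_def)
  have TD: "T F \<subseteq> dual_lattice D" by (auto simp: T_def)
  have "orb F t \<in> ch F"
    unfolding ch_iff
  proof (intro conjI ballI)
    show "orb F t \<in> extensional (S F)" by (simp add: orb_def)
    show "orb F t 0 = 1" by (simp add: orb_def S_zero T_zero 1)
    fix m m' assume m: "m \<in> S F" "m' \<in> S F"
    then show "orb F t (m + m') = orb F t m * orb F t m'"
      using T_sum_iff[OF m] S_add[OF m] torus_add[OF t, of m m'] TD by (auto simp: orb_def)
  qed
  then show ?thesis using torus_nz[OF t] TD by (auto simp: can_def orb_def)
qed

lemma torus_orbit_eq: assumes F: "F \<in> \<F>" shows "torus_orbit D \<Sigma> (cn F) = (\<lambda>t. Pt F (orb F t)) ` torus D"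
proof -
  have "toric_pt D \<Sigma> (cn F) (\<lambda>m\<in>dual_monoid D (cn F). t m * distinguished D (cn F) m) = Pt F (orb F t)"
    if t: "t \<in> torus D" for t
  proof -
    have "(\<lambda>m\<in>dual_monoid D (cn F). t m * distinguished D (cn F) m) = restrict (orb F t) (S F)"
      by (auto simp: orb_def distinguished_def dual_monoid_cn perp_cn restrict_def)
    then show ?thesis using toric_pt_eq[OF F F order_refl orb_can[OF t]] by simp
  qed
  then show ?thesis unfolding torus_orbit_def by (intro image_cong) auto
qed

text \<open>The part of a function that survives on the orbit of \<open>F\<close>, where all monomials other than units vanish.\<close>

definition resT :: "'e set \<Rightarrow> 'v laurent \<Rightarrow> 'v laurent" where
  "resT F h = (\<Sum>m\<in>keys h \<inter> T F. single m (lookup h m))"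

lemma lookup_resT: "lookup (resT F h) m = (if m \<in> T F then lookup h m else 0)"
  unfolding resT_def lookup_sum lookup_single when_def by (simp add: in_keys_iff)

lemma keys_resT: "keys (resT F h) = keys h \<inter> T F"
  by (rule Set.set_eqI) (auto simp: in_keys_iff lookup_resT split: if_splits)

lemma T_lattice: "T F \<subseteq> dual_lattice D" by (auto simp: T_def)

lemma evalp_orb:
  assumes h: "h \<in> CR F" shows "evalp h (orb F t) = evalp (resT F h) t"
proof -
  have "evalp h (orb F t) = (\<Sum>m\<in>keys h. if m \<in> T F then lookup h m * t m else 0)"
    unfolding evalp_def using h by (intro sum.cong) (auto simp: orb_def CR_iff)
  also have "\<dots> = evalp (resT F h) t"
    unfolding evalp_def keys_resT by (auto simp: sum.inter_restrict lookup_resT intro!: sum.cong)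
  finally show ?thesis .
qed

lemma orb_nonvanishing:
  assumes h: "h \<in> CR F" and m: "m \<in> keys h" "m \<in> T F"
  obtains t where "t \<in> torus D" "evalp h (orb F t) \<noteq> 0"
proof -
  have "resT F h \<noteq> 0" using m keys_resT[of F h] by auto
  then obtain t where "t \<in> torus D" "evalp (resT F h) t \<noteq> 0"
    using torus_nonvanishing[OF finD, of "resT F h"] keys_resT[of F h] T_lattice by blast
  then show ?thesis using that evalp_orb[OF h] by simp
qed

lemma evalp_key_T:
  assumes "h \<in> CR G" "c \<in> can G" "evalp h c \<noteq> 0" obtains m where "m \<in> keys h" "m \<in> T G"
proof -
  obtain m where "m \<in> keys h" "lookup h m * c m \<noteq> 0"
    using assms(3) unfolding evalp_def by (meson sum.neutral)
  then show ?thesis using that can_iff[OF assms(2)] assms(1) by (auto simp: CR_iff)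
qed

abbreviation "W F \<equiv> orbit_closure D \<Sigma> (cn F)"

text \<open>A neighbourhood of a point on the orbit of \<open>G\<close> contains the set \<open>h \<noteq> 0\<close> for some \<open>h\<close> with a monomial in \<open>T G\<close>. For
  \<open>F \<subseteq> G\<close> this monomial lies in \<open>T F\<close>, so \<open>h\<close> does not vanish identically on the orbit of \<open>F\<close>. Conversely the chart of
  \<open>G\<close> is a neighbourhood that meets only the orbits of subsets of \<open>G\<close>.\<close>

lemma W_iff:
  assumes F: "F \<in> \<F>" and G: "G \<in> \<F>" "c \<in> can G" shows "Pt G c \<in> W F \<longleftrightarrow> F \<subseteq> G"
proof
  assume "Pt G c \<in> W F"
  moreover have "Pt G c \<in> U G 1" using Pt_in_U[OF G] evalp_one[OF can_ch[OF G(2)]] by simp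
  ultimately obtain p where p: "p \<in> torus_orbit D \<Sigma> (cn F)" "p \<in> U G 1"
    using openin_U[OF G(1) one_CR] unfolding orbit_closure_def closure_of_def by blast
  then obtain t where t: "t \<in> torus D" "p = Pt F (orb F t)" unfolding torus_orbit_eq[OF F] by blast
  then show "F \<subseteq> G" using p(2) Pt_in_U[OF F orb_can[OF t(1)]] by simp
next
  assume FG: "F \<subseteq> G"
  have "\<exists>y. y \<in> torus_orbit D \<Sigma> (cn F) \<and> y \<in> V" if V: "openin Z V" "Pt G c \<in> V" for V
  proof -
    obtain h where h: "h \<in> CR G" "evalp h c \<noteq> 0" "U G h \<subseteq> V"
      using open_contains_U[OF V(1) G(1) G(1) order_refl G(2) V(2)] by metis
    obtain m where m: "m \<in> keys h" "m \<in> T G" using evalp_key_T[OF h(1) G(2) h(2)] by metis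
    have "h \<in> CR F" using h(1) CR_anti[OF FG] by blast
    then obtain t where t: "t \<in> torus D" "evalp h (orb F t) \<noteq> 0"
      using orb_nonvanishing[OF _ m(1)] m(2) T_anti[OF FG] by blast
    have "Pt F (orb F t) \<in> U G h" using Pt_in_U[OF F orb_can[OF t(1)]] FG t(2) by simp
    then show ?thesis using h(3) t(1) unfolding torus_orbit_eq[OF F] by blast
  qed
  moreover have "Pt G c \<in> topspace Z" unfolding topspace_Z toric_variety_eq using G by blast
  ultimately show "Pt G c \<in> W F" unfolding orbit_closure_def closure_of_def by blast
qed

lemma W_sub: "W F \<subseteq> toric_variety D \<Sigma>"
  unfolding orbit_closure_def using closure_of_subset_topspace[of Z] topspace_Z by blast

end

section \<open>Local rings\<close>

context toric begin

definition LR :: "'e set \<Rightarrow> (('v \<Rightarrow>\<^sub>0 int) \<Rightarrow> complex) \<Rightarrow> 'v laurent fract set" where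
  "LR G c = {Fract f g | f g. f \<in> CR G \<and> g \<in> CR G \<and> evalp g c \<noteq> 0}"

text \<open>The fractions that define the local ring may be taken in any chart that contains the point; the chart of
  its orbit contains the coordinate rings of all the others.\<close>

lemma local_ring_eq:
  assumes G: "G \<in> \<F>" "c \<in> can G"
  shows "local_ring D (Pt G c) = cls_ring (LR G c)"
proof -
  have "{Fract f g | f g \<sigma> \<gamma>. (\<sigma>, \<gamma>) \<in> Pt G c \<and> f \<in> coord_ring D \<sigma> \<and> g \<in> coord_ring D \<sigma> \<and> evalp g \<gamma> \<noteq> 0} = LR G c"
    (is "?A = _")
  proof (rule Set.equalityI; rule subsetI)
    fix x assume "x \<in> ?A"
    then obtain f g \<sigma> \<gamma> where x: "x = Fract f g" "(\<sigma>, \<gamma>) \<in> Pt G c" "f \<in> coord_ring D \<sigma>" "g \<in> coord_ring D \<sigma>" "evalp g \<gamma> \<noteq> 0"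
      by blast
    obtain F where F: "\<sigma> = cn F" "\<gamma> = restrict c (S F)" "F \<in> \<F>" "G \<subseteq> F" using x(2) by (auto simp: Pt_def)
    have "evalp g c \<noteq> 0" using x(4,5) evalp_restrict[of g F c] unfolding F by simp
    then show "x \<in> LR G c" unfolding LR_def using x(1,3,4) CR_anti[OF F(4)] unfolding F(1) by blast
  next
    fix x assume "x \<in> LR G c"
    then show "x \<in> ?A" unfolding LR_def using Pt_self[OF G] by blast
  qed
  then show ?thesis unfolding local_ring_def cls_ring_def by simp
qed

lemma CR_mult: "f \<in> CR F \<Longrightarrow> g \<in> CR F \<Longrightarrow> f * g \<in> CR F" by (rule coord_ring_mult)

lemma CR_add: "f \<in> CR F \<Longrightarrow> g \<in> CR F \<Longrightarrow> f + g \<in> CR F"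
  using Poly_Mapping.keys_add[of f g] by (auto simp: CR_iff)

lemma CR_uminus: "f \<in> CR F \<Longrightarrow> - f \<in> CR F" by (simp add: CR_iff in_keys_iff subset_iff)

lemma CR_diff: "f \<in> CR F \<Longrightarrow> g \<in> CR F \<Longrightarrow> f - g \<in> CR F"
  using CR_add[of f F "- g"] CR_uminus[of g F] by simp

lemma CR_single: "m \<in> S F \<Longrightarrow> single m a \<in> CR F" by (simp add: CR_iff)

lemma CR_zero: "0 \<in> CR F" by (simp add: CR_iff)

lemma CR_sum: "(\<And>i. i \<in> A \<Longrightarrow> f i \<in> CR F) \<Longrightarrow> sum f A \<in> CR F"
  by (induction A rule: infinite_finite_induct) (auto simp: CR_zero CR_add)

lemma CR_subring: "subring_set (CR F)"
  by (auto simp: subring_set_def CR_zero one_CR CR_add CR_mult CR_uminus)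

lemma evalp_ne: "evalp g c \<noteq> 0 \<Longrightarrow> g \<noteq> 0" by auto

lemma Fract_eqD: "Fract f g = Fract f' g' \<Longrightarrow> g \<noteq> 0 \<Longrightarrow> g' \<noteq> 0 \<Longrightarrow> f * g' = f' * g"
  by (simp add: eq_fract)

lemma LR_I: "f \<in> CR G \<Longrightarrow> g \<in> CR G \<Longrightarrow> evalp g c \<noteq> 0 \<Longrightarrow> Fract f g \<in> LR G c"
  unfolding LR_def by blast

lemma LR_E:
  assumes "x \<in> LR G c" obtains f g where "x = Fract f g" "f \<in> CR G" "g \<in> CR G" "evalp g c \<noteq> 0" "g \<noteq> 0"
  using assms evalp_ne unfolding LR_def by blast

lemma LR_fr: "c \<in> ch G \<Longrightarrow> f \<in> CR G \<Longrightarrow> fr f \<in> LR G c"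
  by (rule LR_I) (auto simp: one_CR evalp_one)

lemma LR_subring: assumes c: "c \<in> ch G" shows "subring_set (LR G c)"
  unfolding subring_set_def
proof (intro conjI ballI)
  show "0 \<in> LR G c" using LR_fr[OF c CR_zero] by (simp add: Zero_fract_def)
  show "1 \<in> LR G c" using LR_fr[OF c one_CR] by (simp add: One_fract_def)
  fix x assume "x \<in> LR G c"
  then obtain f g where x: "x = Fract f g" "f \<in> CR G" "g \<in> CR G" "evalp g c \<noteq> 0" "g \<noteq> 0" by (rule LR_E)
  show "- x \<in> LR G c" using x by (auto intro: LR_I CR_uminus)
  fix y assume "y \<in> LR G c"
  then obtain f' g' where y: "y = Fract f' g'" "f' \<in> CR G" "g' \<in> CR G" "evalp g' c \<noteq> 0" "g' \<noteq> 0" by (rule LR_E)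
  have gg: "g * g' \<in> CR G" "evalp (g * g') c \<noteq> 0" using x y evalp_mult[OF c] by (auto simp: CR_mult)
  show "x + y \<in> LR G c" using x y gg by (auto intro!: LR_I CR_add CR_mult)
  show "x * y \<in> LR G c" using x y gg by (auto intro!: LR_I CR_mult)
qed

lemma LR_const: "c \<in> ch G \<Longrightarrow> const_fun a \<in> LR G c"
  unfolding const_fun_def by (rule LR_fr) (auto intro: CR_single S_zero)

lemma CR_lattice: "f \<in> CR F \<Longrightarrow> keys f \<subseteq> dual_lattice D"
  using S_lattice by (auto simp: CR_iff)

lemma LR_fracs: "LR G c \<subseteq> fracs D"
  unfolding LR_def fracs_def using CR_lattice evalp_ne by blast

lemma krull_dim_LR: "c \<in> ch G \<Longrightarrow> krull_dim (cls_ring (LR G c)) \<le> enat (card D)"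
  by (rule krull_dim_le_card[OF finD LR_subring LR_fracs LR_const])

subsection \<open>Values at the point and the maximal ideal\<close>

text \<open>The residue map of the local ring.\<close>

definition rv :: "'e set \<Rightarrow> (('v \<Rightarrow>\<^sub>0 int) \<Rightarrow> complex) \<Rightarrow> 'v laurent fract \<Rightarrow> complex" where
  "rv G c x = (THE v. \<exists>f g. x = Fract f g \<and> f \<in> CR G \<and> g \<in> CR G \<and> evalp g c \<noteq> 0 \<and> v = evalp f c / evalp g c)"

lemma rv_Fract:
  assumes c: "c \<in> ch G" and f: "f \<in> CR G" "g \<in> CR G" "evalp g c \<noteq> 0"
  shows "rv G c (Fract f g) = evalp f c / evalp g c"
  unfolding rv_def
proof (rule the_equality)
  show "\<exists>f' g'. Fract f g = Fract f' g' \<and> f' \<in> CR G \<and> g' \<in> CR G \<and> evalp g' c \<noteq> 0 \<and> evalp f c / evalp g c = evalp f' c / evalp g' c"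
    using f by blast
  fix v assume "\<exists>f' g'. Fract f g = Fract f' g' \<and> f' \<in> CR G \<and> g' \<in> CR G \<and> evalp g' c \<noteq> 0 \<and> v = evalp f' c / evalp g' c"
  then obtain f' g' where v: "Fract f g = Fract f' g'" "f' \<in> CR G" "g' \<in> CR G" "evalp g' c \<noteq> 0" "v = evalp f' c / evalp g' c"
    by (elim exE conjE) (rule that)
  have "f * g' = f' * g" by (rule Fract_eqD[OF v(1) evalp_ne[OF f(3)] evalp_ne[OF v(4)]])
  then have "evalp f c * evalp g' c = evalp f' c * evalp g c"
    using evalp_mult[OF c f(1) v(3)] evalp_mult[OF c v(2) f(2)] by simp
  then show "v = evalp f c / evalp g c" unfolding v(5) by (simp add: frac_eq_eq[OF v(4) f(3)])
qed

lemma rv_hom: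
  assumes c: "c \<in> ch G"
  shows "x \<in> LR G c \<Longrightarrow> y \<in> LR G c \<Longrightarrow> rv G c (x + y) = rv G c x + rv G c y"
    "x \<in> LR G c \<Longrightarrow> y \<in> LR G c \<Longrightarrow> rv G c (x * y) = rv G c x * rv G c y"
    "f \<in> CR G \<Longrightarrow> rv G c (fr f) = evalp f c"
proof -
  have *: "rv G c (x + y) = rv G c x + rv G c y \<and> rv G c (x * y) = rv G c x * rv G c y"
    if "x \<in> LR G c" "y \<in> LR G c"
  proof -
    obtain f g where x: "x = Fract f g" "f \<in> CR G" "g \<in> CR G" "evalp g c \<noteq> 0" "g \<noteq> 0" using \<open>x \<in> LR G c\<close> by (rule LR_E)
    obtain f' g' where y: "y = Fract f' g'" "f' \<in> CR G" "g' \<in> CR G" "evalp g' c \<noteq> 0" "g' \<noteq> 0" using \<open>y \<in> LR G c\<close> by (rule LR_E)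
    have gg: "g * g' \<in> CR G" "evalp (g * g') c = evalp g c * evalp g' c" using x y evalp_mult[OF c] by (auto simp: CR_mult)
    have "rv G c (x + y) = evalp (f * g' + f' * g) c / evalp (g * g') c"
      using x y gg by (simp add: rv_Fract[OF c] CR_add CR_mult)
    also have "\<dots> = rv G c x + rv G c y"
      using x y gg by (simp add: rv_Fract[OF c] evalp_add evalp_mult[OF c] add_frac_eq)
    finally have 1: "rv G c (x + y) = rv G c x + rv G c y" .
    have "rv G c (x * y) = evalp (f * f') c / evalp (g * g') c"
      using x y gg by (simp add: rv_Fract[OF c] CR_mult)
    also have "\<dots> = rv G c x * rv G c y"
      using x y gg by (simp add: rv_Fract[OF c] evalp_mult[OF c])
    finally show ?thesis using 1 by blast
  qed
  show "x \<in> LR G c \<Longrightarrow> y \<in> LR G c \<Longrightarrow> rv G c (x + y) = rv G c x + rv G c y"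
    "x \<in> LR G c \<Longrightarrow> y \<in> LR G c \<Longrightarrow> rv G c (x * y) = rv G c x * rv G c y" using * by auto
  show "f \<in> CR G \<Longrightarrow> rv G c (fr f) = evalp f c"
    using rv_Fract[OF c _ one_CR, of f] evalp_one[OF c] by simp
qed

lemma rv_zero: "c \<in> ch G \<Longrightarrow> rv G c 0 = 0"
  using rv_hom(3)[of c G 0] CR_zero by (simp add: Zero_fract_def)

lemma rv_sum:
  assumes c: "c \<in> ch G" and "\<And>i. i \<in> A \<Longrightarrow> f i \<in> LR G c"
  shows "rv G c (sum f A) = (\<Sum>i\<in>A. rv G c (f i))"
  using assms(2)
proof (induction A rule: infinite_finite_induct)
  case (insert i A)
  have "sum f A \<in> LR G c" using insert by (intro subring_set_sum[OF LR_subring[OF c]]) auto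
  then show ?case using insert rv_hom(1)[OF c, of "f i" "sum f A"] by simp
qed (simp_all add: rv_zero[OF c])

lemma nonunits_LR:
  assumes c: "c \<in> ch G" shows "nonunits (cls_ring (LR G c)) = {x \<in> LR G c. rv G c x = 0}"
proof -
  have "x \<in> Units (cls_ring (LR G c)) \<longleftrightarrow> rv G c x \<noteq> 0" if x: "x \<in> LR G c" for x
  proof
    assume "x \<in> Units (cls_ring (LR G c))"
    then obtain y where y: "y \<in> LR G c" "x * y = 1" by (auto simp: Units_def)
    have "rv G c x * rv G c y = rv G c (fr 1)" using rv_hom(2)[OF c x y(1)] y(2) by (simp add: One_fract_def)
    then show "rv G c x \<noteq> 0" using rv_hom(3)[OF c one_CR] evalp_one[OF c] by auto
  next
    assume nz: "rv G c x \<noteq> 0"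
    obtain f g where fg: "x = Fract f g" "f \<in> CR G" "g \<in> CR G" "evalp g c \<noteq> 0" "g \<noteq> 0" using x by (rule LR_E)
    then have "evalp f c \<noteq> 0" using nz rv_Fract[OF c fg(2-4)] by auto
    then have "Fract g f \<in> LR G c" "f \<noteq> 0" using fg by (auto intro: LR_I)
    moreover have "x * Fract g f = 1" using fg \<open>f \<noteq> 0\<close> by (simp add: One_fract_def eq_fract)
    ultimately show "x \<in> Units (cls_ring (LR G c))" using x by (auto simp: Units_def mult.commute)
  qed
  then show ?thesis by (auto simp: nonunits_def)
qed

lemma fr_chi_nonunit:
  assumes c: "c \<in> ch G" and m: "m \<in> S G"
  shows "fr (single m 1 - single 0 (c m)) \<in> nonunits (cls_ring (LR G c))"
proof -
  have "single m 1 - single 0 (c m) \<in> CR G" using m by (intro CR_diff CR_single S_zero)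
  moreover have "evalp (single m 1 - single 0 (c m)) c = 0"
    using c by (simp add: evalp_diff evalp_single ch_iff)
  ultimately show ?thesis unfolding nonunits_LR[OF c] by (simp add: LR_fr[OF c] rv_hom(3)[OF c])
qed

section \<open>Regularity when the generators are part of a lattice basis\<close>

text \<open>A ring homomorphism on the coordinate ring that does not kill any function invertible at the point
  has a kernel that extends to a prime of the local ring.\<close>

lemma kernel_prime:
  assumes c: "c \<in> ch G"
    and add: "\<And>f g. f \<in> CR G \<Longrightarrow> g \<in> CR G \<Longrightarrow> \<theta> (f + g) = \<theta> f + (\<theta> g :: 'w::idom)"
    and mult: "\<And>f g. f \<in> CR G \<Longrightarrow> g \<in> CR G \<Longrightarrow> \<theta> (f * g) = \<theta> f * \<theta> g"
    and nz: "\<And>g. g \<in> CR G \<Longrightarrow> evalp g c \<noteq> 0 \<Longrightarrow> \<theta> g \<noteq> 0"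
  defines "P \<equiv> {Fract f g | f g. f \<in> CR G \<and> g \<in> CR G \<and> evalp g c \<noteq> 0 \<and> \<theta> f = 0}"
  shows "primeideal P (cls_ring (LR G c))"
    "\<And>f g. f \<in> CR G \<Longrightarrow> g \<in> CR G \<Longrightarrow> evalp g c \<noteq> 0 \<Longrightarrow> Fract f g \<in> P \<longleftrightarrow> \<theta> f = 0"
proof -
  show iff: "Fract f g \<in> P \<longleftrightarrow> \<theta> f = 0" if f: "f \<in> CR G" "g \<in> CR G" "evalp g c \<noteq> 0" for f g
  proof
    assume "Fract f g \<in> P"
    then obtain f' g' where f': "Fract f g = Fract f' g'" "f' \<in> CR G" "g' \<in> CR G" "evalp g' c \<noteq> 0" "\<theta> f' = 0"
      unfolding P_def mem_Collect_eq by (elim exE conjE) (rule that)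
    have "f * g' = f' * g" by (rule Fract_eqD[OF f'(1) evalp_ne[OF f(3)] evalp_ne[OF f'(4)]])
    then have "\<theta> f * \<theta> g' = 0" using mult[OF f(1) f'(3)] mult[OF f'(2) f(2)] f'(5) by simp
    then show "\<theta> f = 0" using nz f' by auto
  qed (use f in \<open>auto simp: P_def\<close>)
  interpret cring "cls_ring (LR G c)" by (rule cring_cls_ring[OF LR_subring[OF c]])
  have "\<theta> 0 + 0 = \<theta> 0 + \<theta> 0" using add[OF CR_zero CR_zero] by (simp only: add_0_right)
  then have z: "\<theta> 0 = 0" by (simp only: add_left_cancel)
  have sub: "P \<subseteq> LR G c" unfolding P_def LR_def by blast
  have rule: "\<exists>f g. x = Fract f g \<and> f \<in> CR G \<and> g \<in> CR G \<and> evalp g c \<noteq> 0 \<and> g \<noteq> 0 \<and> \<theta> f = 0" if "x \<in> P" for x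
    using that evalp_ne unfolding P_def by blast
  have "ideal_set (LR G c) P"
    unfolding ideal_set_def
  proof (intro conjI ballI sub)
    show "0 \<in> P" using iff[OF CR_zero one_CR] z evalp_one[OF c] by (simp add: Zero_fract_def)
    fix x assume x: "x \<in> P"
    obtain f g where f: "x = Fract f g" "f \<in> CR G" "g \<in> CR G" "evalp g c \<noteq> 0" "g \<noteq> 0" "\<theta> f = 0" using rule[OF x] by blast
    { fix y assume y: "y \<in> P"
      obtain f' g' where f': "y = Fract f' g'" "f' \<in> CR G" "g' \<in> CR G" "evalp g' c \<noteq> 0" "g' \<noteq> 0" "\<theta> f' = 0" using rule[OF y] by blast
      have "Fract (f * g' + f' * g) (g * g') \<in> P"
        using f f' by (subst iff) (auto simp: CR_add CR_mult evalp_mult[OF c] add mult)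
      then show "x + y \<in> P" using f f' by simp }
    { fix y assume y: "y \<in> LR G c"
      obtain f' g' where f': "y = Fract f' g'" "f' \<in> CR G" "g' \<in> CR G" "evalp g' c \<noteq> 0" "g' \<noteq> 0" using y by (rule LR_E)
      have "Fract (f' * f) (g' * g) \<in> P"
        using f f' by (subst iff) (auto simp: CR_add CR_mult evalp_mult[OF c] add mult)
      then show "y * x \<in> P" using f f' by simp }
  qed
  then have id: "ideal P (cls_ring (LR G c))" using ideal_cls_ring_iff[OF LR_subring[OF c]] by blast
  show "primeideal P (cls_ring (LR G c))"
  proof (rule primeidealI[OF id])
    show "cring (cls_ring (LR G c))" by (rule is_cring)
    show "carrier (cls_ring (LR G c)) \<noteq> P"
    proof
      assume "carrier (cls_ring (LR G c)) = P"
      then have "fr 1 \<in> P" using LR_fr[OF c one_CR] by simp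
      then show False using iff[OF one_CR one_CR] nz[OF one_CR] evalp_one[OF c] by simp
    qed
    fix x y assume "x \<in> carrier (cls_ring (LR G c))" "y \<in> carrier (cls_ring (LR G c))"
      and xy: "x \<otimes>\<^bsub>cls_ring (LR G c)\<^esub> y \<in> P"
    then have x: "x \<in> LR G c" and y: "y \<in> LR G c" by auto
    obtain f g where f: "x = Fract f g" "f \<in> CR G" "g \<in> CR G" "evalp g c \<noteq> 0" "g \<noteq> 0" using x by (rule LR_E)
    obtain f' g' where f': "y = Fract f' g'" "f' \<in> CR G" "g' \<in> CR G" "evalp g' c \<noteq> 0" "g' \<noteq> 0" using y by (rule LR_E)
    have "Fract (f * f') (g * g') \<in> P" using xy f f' by simp
    then have "\<theta> (f * f') = 0" using f f' by (subst (asm) iff) (auto simp: CR_mult evalp_mult[OF c])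
    then have "\<theta> f = 0 \<or> \<theta> f' = 0" using mult[OF f(2) f'(2)] by simp
    then show "x \<in> P \<or> y \<in> P" using f f' iff by auto
  qed
qed

end

lemma cmul_minus: "frag_cmul c (- m) = frag_cmul (- c) m" by (rule poly_mapping_eqI) simp

lemma inverse_identity: "(a * b) * x - b * (x * y) = - (b * x) * (y - a)" for a b x y :: "'a::comm_ring"
  by (simp add: algebra_simps)

text \<open>A basis \<open>w\<close> of the dual lattice with coordinates \<open>co\<close>, the first \<open>s\<close> of which cut out the monoid of the cone: the
  chart is a product of \<open>s\<close> lines and \<open>d - s\<close> punctured lines.\<close>

locale smooth_chart = toric D \<F> \<beta> ip
  for D :: "'v::linorder set" and \<F> :: "'e set set" and \<beta> ip +
  fixes G :: "'e set" and c :: "('v \<Rightarrow>\<^sub>0 int) \<Rightarrow> complex"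
    and w :: "nat \<Rightarrow> ('v \<Rightarrow>\<^sub>0 int)" and co :: "nat \<Rightarrow> ('v \<Rightarrow>\<^sub>0 int) \<Rightarrow> int" and s d :: nat
  assumes G: "G \<in> \<F>" and c: "c \<in> can G"
    and w: "\<And>i. i < d \<Longrightarrow> w i \<in> dual_lattice D"
    and co_add: "\<And>i m m'. co i (m + m') = co i m + co i m'"
    and co_w: "\<And>i j. i < d \<Longrightarrow> j < d \<Longrightarrow> co i (w j) = (if i = j then 1 else 0)"
    and expand: "\<And>m. m \<in> dual_lattice D \<Longrightarrow> m = (\<Sum>i<d. frag_cmul (co i m) (w i))"
    and S_co: "\<And>m. m \<in> dual_lattice D \<Longrightarrow> m \<in> S G \<longleftrightarrow> (\<forall>i<s. 0 \<le> co i m)"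
    and sd: "s \<le> d" and d: "d = card D"
begin

lemma cch: "c \<in> ch G" using c by (rule can_ch)

lemma co_zero: "co i 0 = 0" using co_add[of i 0 0] by simp

lemma co_uminus: "co i (- m) = - co i m" using co_add[of i m "- m"] by (simp add: co_zero)

lemma co_diff: "co i (m - m') = co i m - co i m'" using co_add[of i m "- m'"] by (simp add: co_uminus)

lemma co_cmul: "co i (frag_cmul n m) = n * co i m"
proof -
  have nat: "co i (frag_cmul (int k) m) = int k * co i m" for k
  proof (induction k)
    case (Suc k) then show ?case unfolding cmul_Suc co_add by (simp add: algebra_simps)
  qed (simp add: co_zero)
  show ?thesis
  proof (cases "0 \<le> n")
    case True then show ?thesis using nat[of "nat n"] by simp
  next
    case False
    then have "frag_cmul n m = - frag_cmul (int (nat (- n))) m" by simp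
    then show ?thesis using nat[of "nat (- n)"] False co_uminus[of i "frag_cmul (int (nat (- n))) m"] by simp
  qed
qed

lemma co_sum: "co i (\<Sum>j\<in>A. f j) = (\<Sum>j\<in>A. co i (f j))"
  by (induction A rule: infinite_finite_induct) (simp_all add: co_zero co_add)

lemma w_S: "i < d \<Longrightarrow> w i \<in> S G" using S_co[OF w] co_w sd by auto

definition pr :: "nat \<Rightarrow> ('v \<Rightarrow>\<^sub>0 int) \<Rightarrow> ('v \<Rightarrow>\<^sub>0 int)" where
  "pr k m = (\<Sum>i<k. frag_cmul (co i m) (w i))"

lemma pr_add: "pr k (m + m') = pr k m + pr k m'"
  by (simp add: pr_def co_add frag_cmul_distrib sum.distrib)

lemma pr_lattice: "k \<le> d \<Longrightarrow> pr k m \<in> dual_lattice D"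
proof (induction k)
  case 0 then show ?case by (simp add: pr_def dual_lattice_zero)
next
  case (Suc k) then show ?case using w[of k] by (auto simp: pr_def intro!: dual_lattice_add dual_lattice_cmul)
qed

lemma co_pr: assumes "k \<le> d" "i < d" shows "co i (pr k m) = (if i < k then co i m else 0)"
proof -
  have "co i (pr k m) = (\<Sum>j<k. if j = i then co i m else 0)"
    unfolding pr_def co_sum co_cmul using assms co_w by (intro sum.cong) auto
  then show ?thesis by simp
qed

lemma pr_S: assumes "k \<le> d" "m \<in> S G" shows "pr k m \<in> S G" "m - pr k m \<in> S G"
proof -
  have m: "m \<in> dual_lattice D" "\<forall>i<s. 0 \<le> co i m" using assms(2) S_co S_lattice by auto
  show "pr k m \<in> S G" using m S_co[OF pr_lattice[OF assms(1)]] co_pr[OF assms(1)] sd by auto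
  show "m - pr k m \<in> S G"
    using m S_co[OF dual_lattice_diff[OF m(1) pr_lattice[OF assms(1)]]] co_pr[OF assms(1)] sd by (auto simp: co_diff)
qed

lemma pr_mono:
  assumes "k \<le> d" and that: "Suc k \<le> d" shows "pr (Suc k) m = pr k m + pr (Suc k) (m - pr k m)"
proof -
  have "pr (Suc k) (pr k m) = pr k m"
  proof -
    have "pr (Suc k) (pr k m) = (\<Sum>i<Suc k. frag_cmul (if i < k then co i m else 0) (w i))"
      unfolding pr_def[of "Suc k"] using co_pr[OF assms(1)] that by (intro sum.cong) auto
    then show ?thesis by (simp add: pr_def)
  qed
  moreover have "pr (Suc k) m = pr (Suc k) (pr k m) + pr (Suc k) (m - pr k m)" by (simp flip: pr_add)
  ultimately show ?thesis by simp
qed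

text \<open>Restriction to the subvariety on which the first \<open>k\<close> coordinates take their values at the point.\<close>

definition \<theta> :: "nat \<Rightarrow> 'v laurent \<Rightarrow> 'v laurent" where
  "\<theta> k f = lin (single 0) (\<lambda>m. single (m - pr k m) (c (pr k m))) f"

lemma \<theta>_mult: assumes "k \<le> d" "f \<in> CR G" "g \<in> CR G" shows "\<theta> k (f * g) = \<theta> k f * \<theta> k g"
  unfolding \<theta>_def
proof (rule sgl.lin_mult)
  fix m m' assume "m \<in> keys f" "m' \<in> keys g"
  then have "m \<in> S G" "m' \<in> S G" using assms by (auto simp: CR_iff)
  then have "c (pr k (m + m')) = c (pr k m) * c (pr k m')"
    using ch_add[OF cch pr_S(1)[OF assms(1)] pr_S(1)[OF assms(1)]] by (simp add: pr_add)
  then show "single (m + m' - pr k (m + m')) (c (pr k (m + m'))) =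
      single (m - pr k m) (c (pr k m)) * single (m' - pr k m') (c (pr k m'))"
    by (simp add: mult_single pr_add algebra_simps)
qed

lemma evalp_\<theta>: assumes k: "k \<le> d" and f: "f \<in> CR G" shows "evalp (\<theta> k f) c = evalp f c"
proof -
  have "evalp (\<theta> k f) c = (\<Sum>m\<in>keys f. lookup f m * c (pr k m) * c (m - pr k m))"
    unfolding \<theta>_def lin_def evalp_sum by (simp add: mult_single evalp_single)
  also have "\<dots> = evalp f c"
    unfolding evalp_def
  proof (intro sum.cong refl)
    fix m assume "m \<in> keys f"
    then have "m \<in> S G" using f by (auto simp: CR_iff)
    then have "c (pr k m + (m - pr k m)) = c (pr k m) * c (m - pr k m)"
      by (intro ch_add[OF cch] pr_S[OF k])
    then show "lookup f m * c (pr k m) * c (m - pr k m) = lookup f m * c m" by simp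
  qed
  finally show ?thesis .
qed

lemma \<theta>_Suc: assumes k: "Suc k \<le> d" and f: "f \<in> CR G" "\<theta> k f = 0" shows "\<theta> (Suc k) f = 0"
proof -
  define \<psi> where "\<psi> m = single (m - pr (Suc k) m) (c (pr (Suc k) m))" for m
  have "lin (single 0) \<psi> (\<theta> k f) = (\<Sum>m\<in>keys f.
      lin (single 0) \<psi> (single (m - pr k m) (lookup f m * c (pr k m))))"
    unfolding \<theta>_def lin_def[of _ _ f] sgl.lin_sum by (simp only: mult_single add_0)
  also have "\<dots> = \<theta> (Suc k) f"
    unfolding \<theta>_def lin_def[of _ _ f]
  proof (intro sum.cong refl)
    fix m assume "m \<in> keys f"
    then have m: "m \<in> S G" using f by (auto simp: CR_iff)
    have k': "k \<le> d" using k by simp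
    let ?m' = "m - pr k m"
    have e: "pr (Suc k) m = pr k m + pr (Suc k) ?m'" by (rule pr_mono[OF k' k])
    have cc: "c (pr (Suc k) m) = c (pr k m) * c (pr (Suc k) ?m')"
      unfolding e by (intro ch_add[OF cch] pr_S(1)[OF k] pr_S[OF k'] m)
    have dd: "?m' - pr (Suc k) ?m' = m - pr (Suc k) m" unfolding e by (simp add: algebra_simps)
    show "lin (single 0) \<psi> (single ?m' (lookup f m * c (pr k m))) =
       single 0 (lookup f m) * single (m - pr (Suc k) m) (c (pr (Suc k) m))"
      by (simp only: sgl.lin_single \<psi>_def mult_single add_0 cc dd mult.assoc)
  qed
  finally show ?thesis using f by simp
qed

text \<open>The kernels of the restrictions \<open>\<theta> k\<close> form a chain of primes, with \<open>\<chi>\<^sup>w - c(w)\<close> for \<open>w = w k\<close> entering at step \<open>k\<close>.\<close>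

lemma krull_ge: "enat d \<le> krull_dim (cls_ring (LR G c))"
proof -
  define P where "P k = {Fract f g | f g. f \<in> CR G \<and> g \<in> CR G \<and> evalp g c \<noteq> 0 \<and> \<theta> k f = 0}" for k
  have add: "\<theta> k (f + g) = \<theta> k f + \<theta> k g" for k f g unfolding \<theta>_def by (rule sgl.lin_add)
  have nz: "\<theta> k g \<noteq> 0" if "k \<le> d" "g \<in> CR G" "evalp g c \<noteq> 0" for k g
    using evalp_\<theta>[OF that(1,2)] that(3) by auto
  have prime: "primeideal (P k) (cls_ring (LR G c))" if "k \<le> d" for k
    unfolding P_def by (rule kernel_prime(1)[OF cch]) (use add \<theta>_mult nz that in auto)
  have iff: "Fract f g \<in> P k \<longleftrightarrow> \<theta> k f = 0" if "k \<le> d" "f \<in> CR G" "g \<in> CR G" "evalp g c \<noteq> 0" for k f g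
    unfolding P_def by (rule kernel_prime(2)[OF cch]) (use add \<theta>_mult nz that in auto)
  have chain: "P k \<subset> P (Suc k)" if k: "k < d" for k
  proof
    show "P k \<subseteq> P (Suc k)" unfolding P_def using \<theta>_Suc[of k] k by auto
    have wk: "w k \<in> S G" by (rule w_S[OF k])
    let ?f = "single (w k) 1 - single 0 (c (w k))"
    have f: "?f \<in> CR G" using wk by (intro CR_diff CR_single S_zero)
    have pw: "pr j (w k) = (if k < j then w k else 0)" if "j \<le> d" for j
    proof -
      have "pr j (w k) = (\<Sum>i<j. if i = k then w k else 0)"
        unfolding pr_def using co_w k that by (intro sum.cong) auto
      then show ?thesis by simp
    qed
    have p0: "pr j 0 = 0" for j by (simp add: pr_def co_zero)
    have c0: "c 0 = 1" using cch by (simp add: ch_iff)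
    have "\<theta> (Suc k) ?f = 0"
      using k by (simp add: \<theta>_def sgl.lin_diff pw p0 mult_single c0)
    then have 1: "fr ?f \<in> P (Suc k)" using iff[of "Suc k" ?f 1] k f one_CR evalp_one[OF cch] by simp
    have "w k \<noteq> 0" using co_w[OF k k] co_zero[of k] by auto
    then have "\<theta> k ?f \<noteq> 0"
      using k by (simp add: \<theta>_def sgl.lin_diff pw p0 mult_single c0) (metis lookup_single_eq lookup_single_not_eq zero_neq_one)
    then have "fr ?f \<notin> P k" using iff[of k ?f 1] k f one_CR evalp_one[OF cch] by simp
    then show "P k \<noteq> P (Suc k)" using 1 by blast
  qed
  show ?thesis unfolding krull_dim_def
    by (rule Sup_upper) (use prime chain in auto)
qed

text \<open>Modulo the ideal generated by the \<open>d\<close> functions \<open>\<chi>\<^sup>w - c(w)\<close>, \<open>w\<close> in the basis, every monomial is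
  congruent to its value at the point, because this holds for a set of monoid generators.\<close>

lemma maximal_generated:
  "Idl\<^bsub>cls_ring (LR G c)\<^esub> ((\<lambda>i. fr (single (w i) 1 - single 0 (c (w i)))) ` {..<d}) =
    nonunits (cls_ring (LR G c))" (is "Idl\<^bsub>?R\<^esub> ?X = _")
proof
  interpret cring ?R by (rule cring_cls_ring[OF LR_subring[OF cch]])
  note SR = LR_subring[OF cch]
  have X: "?X \<subseteq> nonunits ?R" using fr_chi_nonunit[OF cch w_S] by auto
  have "ideal_set (LR G c) (nonunits ?R)"
    unfolding ideal_set_def nonunits_LR[OF cch]
    using rv_hom(1,2)[OF cch] subring_setD[OF SR] rv_zero[OF cch] by auto
  then have "ideal (nonunits ?R) ?R" using ideal_cls_ring_iff[OF SR] by blast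
  then show "Idl\<^bsub>?R\<^esub> ?X \<subseteq> nonunits ?R" using X by (rule genideal_minimal)
  have XL: "?X \<subseteq> LR G c" using X unfolding nonunits_LR[OF cch] by blast
  define I where "I = Idl\<^bsub>?R\<^esub> ?X"
  have "ideal I ?R" unfolding I_def using XL by (intro genideal_ideal) simp
  then have I: "ideal_set (LR G c) I" using ideal_cls_ring_iff[OF SR] by blast
  have XI: "?X \<subseteq> I" unfolding I_def using XL by (intro genideal_self) simp
  let ?\<chi> = "\<lambda>m. fr (single m 1)" and ?\<kappa> = "\<lambda>a. fr (single 0 a)"
  have \<chi>L: "?\<chi> m \<in> LR G c" if "m \<in> S G" for m using LR_fr[OF cch CR_single[OF that]] .
  have \<kappa>L: "?\<kappa> a \<in> LR G c" for a using LR_fr[OF cch CR_single[OF S_zero]] .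
  have frd: "fr (f - g) = fr f - fr g" for f g :: "'v laurent" by simp
  define M where "M = {m \<in> S G. ?\<chi> m - ?\<kappa> (c m) \<in> I}"
  have \<chi>_add: "?\<chi> (m + m') = ?\<chi> m * ?\<chi> m'" for m m' by (simp add: mult_single flip: fr_mult del: mult_fract)
  have \<kappa>_mult: "?\<kappa> (a * a') = ?\<kappa> a * ?\<kappa> a'" for a a' by (simp add: mult_single flip: fr_mult del: mult_fract)
  have c0: "c 0 = 1" using cch by (simp add: ch_iff)
  have M0: "0 \<in> M" using ideal_setD(2)[OF I] S_zero by (simp only: M_def mem_Collect_eq c0 diff_self simp_thms)
  have Madd: "m + m' \<in> M" if "m \<in> M" "m' \<in> M" for m m'
  proof -
    have m: "m \<in> S G" "m' \<in> S G" "?\<chi> m - ?\<kappa> (c m) \<in> I" "?\<chi> m' - ?\<kappa> (c m') \<in> I" using that by (auto simp: M_def)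
    have "?\<chi> (m + m') - ?\<kappa> (c (m + m')) = ?\<chi> m * (?\<chi> m' - ?\<kappa> (c m')) + ?\<kappa> (c m') * (?\<chi> m - ?\<kappa> (c m))"
      unfolding \<chi>_add ch_add[OF cch m(1,2)] \<kappa>_mult by (simp only: algebra_simps)
    also have "\<dots> \<in> I" by (intro ideal_setD(3)[OF I] ideal_setD(4)[OF I] m \<chi>L \<kappa>L)
    finally show ?thesis using S_add[OF m(1,2)] by (simp only: M_def mem_Collect_eq)
  qed
  have Mcmul: "frag_cmul (int n) m \<in> M" if "m \<in> M" for n m
  proof (induction n)
    case 0 show ?case using M0 by simp
  next
    case (Suc n) show ?case unfolding cmul_Suc by (rule Madd[OF Suc that])
  qed
  have Mw: "w i \<in> M" if "i < d" for i
  proof -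
    have "fr (single (w i) 1 - single 0 (c (w i))) \<in> I" using XI that by blast
    then show ?thesis unfolding frd M_def using w_S[OF that] by blast
  qed
  have Mw': "- w i \<in> M" if i: "i < d" "s \<le> i" for i
  proof -
    have mS: "- w i \<in> S G"
      using S_co[OF dual_lattice_uminus[OF w[OF i(1)]]] co_w[OF _ i(1)] sd i by (auto simp: co_uminus)
    have "c (w i + - w i) = c (w i) * c (- w i)" by (rule ch_add[OF cch w_S[OF i(1)] mS])
    then have cw: "c (w i) * c (- w i) = 1" using cch by (simp add: ch_iff)
    have \<kappa>1: "?\<kappa> (c (w i)) * ?\<kappa> (c (- w i)) = 1" unfolding \<kappa>_mult[symmetric] cw by (simp add: One_fract_def)
    have \<chi>1: "?\<chi> (- w i) * ?\<chi> (w i) = 1" unfolding \<chi>_add[symmetric] by (simp add: One_fract_def)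
    have "?\<chi> (- w i) - ?\<kappa> (c (- w i)) = (?\<kappa> (c (w i)) * ?\<kappa> (c (- w i))) * ?\<chi> (- w i) - ?\<kappa> (c (- w i)) * (?\<chi> (- w i) * ?\<chi> (w i))"
      unfolding \<kappa>1 \<chi>1 by (simp only: mult_1_left mult_1_right)
    also have "\<dots> = - (?\<kappa> (c (- w i)) * ?\<chi> (- w i)) * (?\<chi> (w i) - ?\<kappa> (c (w i)))"
      by (rule inverse_identity)
    also have "\<dots> \<in> I"
      using Mw[OF i(1)] by (intro ideal_setD(4)[OF I] subring_setD(5)[OF SR] subring_setD(4)[OF SR] \<chi>L \<kappa>L mS) (simp add: M_def)
    finally show ?thesis using mS by (simp only: M_def mem_Collect_eq)
  qed
  have MS: "m \<in> M" if m: "m \<in> S G" for m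
  proof -
    have "frag_cmul (co i m) (w i) \<in> M" if i: "i < d" for i
    proof (cases "0 \<le> co i m")
      case True then show ?thesis using Mcmul[OF Mw[OF i], of "nat (co i m)"] by simp
    next
      case False
      then have "s \<le> i" using m S_co S_lattice i by (metis not_le subsetD)
      then have "frag_cmul (int (nat (- co i m))) (- w i) \<in> M" using Mcmul Mw' i by blast
      then show ?thesis using False by (simp add: cmul_minus)
    qed
    then have "pr k m \<in> M" if "k \<le> d" for k using that
    proof (induction k)
      case 0 then show ?case using M0 by (simp add: pr_def)
    next
      case (Suc k) then show ?case using Madd[of "pr k m" "frag_cmul (co k m) (w k)"] by (simp add: pr_def)
    qed
    then show ?thesis using expand[of m] m S_lattice by (metis order_refl pr_def subsetD)
  qed
  show "nonunits ?R \<subseteq> Idl\<^bsub>?R\<^esub> ?X"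
  proof
    fix x assume "x \<in> nonunits ?R"
    then have x: "x \<in> LR G c" "rv G c x = 0" unfolding nonunits_LR[OF cch] by auto
    obtain f g where f: "x = Fract f g" "f \<in> CR G" "g \<in> CR G" "evalp g c \<noteq> 0" "g \<noteq> 0" using x(1) by (rule LR_E)
    have ev: "evalp f c = 0" using x(2) f rv_Fract[OF cch f(2-4)] by simp
    have "f = (\<Sum>m\<in>keys f. single 0 (lookup f m) *
        (single m 1 - single 0 (c m)))"
    proof -
      have "(\<Sum>m\<in>keys f. single 0 (lookup f m) *
          (single m 1 - single 0 (c m))) =
        (\<Sum>m\<in>keys f. single m (lookup f m)) -
        (\<Sum>m\<in>keys f. single 0 (lookup f m * c m))"
        by (simp add: right_diff_distrib mult_single sum_subtractf)
      also have "(\<Sum>m\<in>keys f. single (0::'v \<Rightarrow>\<^sub>0 int) (lookup f m * c m)) =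
          single 0 (evalp f c)"
        unfolding evalp_def by (induction "keys f" rule: infinite_finite_induct)
          (auto simp: single_add intro!: poly_mapping_eqI simp: lookup_sum lookup_single when_def)
      finally show ?thesis using ev laurent_eq_sum_single[of f] by simp
    qed
    then have "fr f = (\<Sum>m\<in>keys f. ?\<kappa> (lookup f m) * (?\<chi> m - ?\<kappa> (c m)))"
      by (metis (no_types, lifting) fr_mult fr_sum frd sum.cong)
    also have "\<dots> \<in> I"
    proof (rule ideal_set_sum[OF I])
      fix m assume "m \<in> keys f"
      then have "m \<in> M" using f(2) MS by (auto simp: CR_iff)
      then have "?\<chi> m - ?\<kappa> (c m) \<in> I" unfolding M_def by blast
      then show "?\<kappa> (lookup f m) * (?\<chi> m - ?\<kappa> (c m)) \<in> I" by (rule ideal_setD(4)[OF I _ \<kappa>L])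
    qed
    finally have "fr f \<in> I" .
    moreover have "Fract 1 g \<in> LR G c" using f one_CR by (intro LR_I)
    ultimately have "Fract 1 g * fr f \<in> I" by (rule ideal_setD(4)[OF I])
    then show "x \<in> Idl\<^bsub>?R\<^esub> ?X" using f by (simp add: I_def)
  qed
qed

lemma regular: "regular_local (local_ring D (Pt G c))"
  unfolding local_ring_eq[OF G c] regular_local_def
proof (intro exI conjI)
  let ?X = "(\<lambda>i. fr (single (w i) 1 - single 0 (c (w i)))) ` {..<d}"
  show "?X \<subseteq> carrier (cls_ring (LR G c))" using fr_chi_nonunit[OF cch w_S] by (auto simp: nonunits_def)
  show "finite ?X" by simp
  have "card ?X \<le> d" using card_image_le[of "{..<d}"] by simp
  then show "enat (card ?X) \<le> krull_dim (cls_ring (LR G c))" using krull_ge by (meson enat_ord_simps(1) order_trans)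
  show "Idl\<^bsub>cls_ring (LR G c)\<^esub> ?X = nonunits (cls_ring (LR G c))" by (rule maximal_generated)
qed

end

section \<open>Singularity along a conifold stratum\<close>

subsection \<open>Real span of lattice vectors\<close>

text \<open>The embedding of the dual lattice into a real vector space, where linear independence is available.\<close>

definition rl :: "('v \<Rightarrow>\<^sub>0 int) \<Rightarrow> ('v \<Rightarrow>\<^sub>0 real)" where
  "rl m = Poly_Mapping.map real_of_int m"

lemma lookup_rl [simp]: "lookup (rl m) x = real_of_int (lookup m x)"
  by (simp add: rl_def Poly_Mapping.map.rep_eq when_def)

lemma lookup_scaleR [simp]: "lookup (a *\<^sub>R v) x = a * lookup (v :: 'v \<Rightarrow>\<^sub>0 real) x"
  by (simp add: scaleR_poly_mapping_def Poly_Mapping.map.rep_eq when_def)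

lemma rl_add: "rl (m + m') = rl m + rl m'" by (rule poly_mapping_eqI) (simp add: lookup_add)
lemma rl_diff: "rl (m - m') = rl m - rl m'" by (rule poly_mapping_eqI) (simp add: lookup_minus)
lemma rl_cmul: "rl (frag_cmul k m) = real_of_int k *\<^sub>R rl m" by (rule poly_mapping_eqI) simp
lemma rl_inj: "rl m = rl m' \<longleftrightarrow> m = m'"
proof
  assume e: "rl m = rl m'"
  show "m = m'"
  proof (rule poly_mapping_eqI)
    fix x
    have "lookup (rl m) x = lookup (rl m') x" unfolding e ..
    then show "lookup m x = lookup m' x" by simp
  qed
qed simp

lemma rl_in_span:
  assumes D: "finite D" and m: "m \<in> dual_lattice D"
  shows "rl m \<in> span ((\<lambda>x. single x (1::real)) ` D)"
proof -
  have "rl m = (\<Sum>x\<in>D. real_of_int (lookup m x) *\<^sub>R single x 1)"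
  proof (rule poly_mapping_eqI)
    fix y
    have "lookup (\<Sum>x\<in>D. real_of_int (lookup m x) *\<^sub>R single x (1::real)) y =
       (\<Sum>x\<in>D. if x = y then real_of_int (lookup m x) else 0)"
      unfolding lookup_sum by (intro sum.cong) (auto simp: lookup_single when_def)
    also have "\<dots> = lookup (rl m) y"
    proof (cases "y \<in> D")
      case False
      then have "y \<notin> keys m" using m by (auto simp: dual_lattice_def)
      then show ?thesis using False D by (simp add: in_keys_iff)
    qed (use D in simp)
    finally show "lookup (rl m) y =
      lookup (\<Sum>x\<in>D. real_of_int (lookup m x) *\<^sub>R single x (1::real)) y" by simp
  qed
  then show ?thesis by (simp add: span_sum span_scale span_base)
qed

lemma complex_independence:
  fixes B :: "('v \<Rightarrow>\<^sub>0 real) set" and \<beta> :: "('v \<Rightarrow>\<^sub>0 real) \<Rightarrow> complex"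
  assumes B: "finite B" "independent B"
    and zero: "\<And>x. (\<Sum>v\<in>B. \<beta> v * of_real (lookup v x)) = 0" and v: "v \<in> B"
  shows "\<beta> v = 0"
proof -
  have "(\<Sum>v\<in>B. Re (\<beta> v) *\<^sub>R v) = 0"
  proof (rule poly_mapping_eqI)
    fix x
    have "Re (\<Sum>v\<in>B. \<beta> v * of_real (lookup v x)) = 0" using zero[of x] by simp
    then show "lookup (\<Sum>v\<in>B. Re (\<beta> v) *\<^sub>R v) x = lookup 0 x"
      by (simp add: lookup_sum)
  qed
  from independentD[OF B(2,1) order_refl this v] have 1: "Re (\<beta> v) = 0" .
  have "(\<Sum>v\<in>B. Im (\<beta> v) *\<^sub>R v) = 0"
  proof (rule poly_mapping_eqI)
    fix x
    have "Im (\<Sum>v\<in>B. \<beta> v * of_real (lookup v x)) = 0" using zero[of x] by simp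
    then show "lookup (\<Sum>v\<in>B. Im (\<beta> v) *\<^sub>R v) x = lookup 0 x"
      by (simp add: lookup_sum)
  qed
  from independentD[OF B(2,1) order_refl this v] have 2: "Im (\<beta> v) = 0" .
  show ?thesis using 1 2 by (simp add: complex_eq_iff)
qed

context toric begin

subsection \<open>Irreducible elements of the monoid modulo its units\<close>

text \<open>Irreducible elements of \<open>S G\<close> modulo the group of units \<open>T G\<close>; their classes generate the quotient.\<close>

definition irr :: "'e set \<Rightarrow> ('v \<Rightarrow>\<^sub>0 int) \<Rightarrow> bool" where
  "irr G h \<longleftrightarrow> h \<in> S G \<and> h \<notin> T G \<and> (\<forall>a\<in>S G. \<forall>a'\<in>S G. a + a' - h \<in> T G \<longrightarrow> a \<in> T G \<or> a' \<in> T G)"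

text \<open>The sum of the values on the generators is additive, nonnegative, and zero only on units.\<close>

lemma S_induct [consumes 2, case_names unit irr step]:
  assumes G: "finite G" and m: "m \<in> S G"
    and unit: "\<And>m. m \<in> T G \<Longrightarrow> P m" and irr: "\<And>h. irr G h \<Longrightarrow> P h"
    and step: "\<And>m a a'. m \<in> S G \<Longrightarrow> a \<in> S G \<Longrightarrow> a' \<in> S G \<Longrightarrow> a + a' - m \<in> T G \<Longrightarrow> P a \<Longrightarrow> P a' \<Longrightarrow> P m"
  shows "P m"
  using m
proof (induction "nat (\<Sum>e\<in>G. ip m e)" arbitrary: m rule: less_induct)
  case less
  show ?case
  proof (cases "m \<in> T G \<or> irr G m")
    case True then show ?thesis using unit irr by blast
  next
    case False
    then obtain a a' where a: "a \<in> S G" "a' \<in> S G" "a + a' - m \<in> T G" "a \<notin> T G" "a' \<notin> T G"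
      using less.prems by (auto simp: irr_def)
    have pos: "0 < (\<Sum>e\<in>G. ip q e)" if q: "q \<in> S G" "q \<notin> T G" for q
    proof -
      obtain e where "e \<in> G" "ip q e \<noteq> 0" using q by (auto simp: S_def T_def)
      then show ?thesis using q G by (intro sum_pos2[of _ e]) (auto simp: S_def less_le)
    qed
    have "(\<Sum>e\<in>G. ip a e) + (\<Sum>e\<in>G. ip a' e) = (\<Sum>e\<in>G. ip m e)"
      unfolding sum.distrib[symmetric] using a(3) by (intro sum.cong) (auto simp: T_def ip_add ip_diff)
    then have "nat (\<Sum>e\<in>G. ip a e) < nat (\<Sum>e\<in>G. ip m e)" "nat (\<Sum>e\<in>G. ip a' e) < nat (\<Sum>e\<in>G. ip m e)"
      using pos[OF a(1,4)] pos[OF a(2,5)] by auto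
    then show ?thesis using less.hyps a step[OF less.prems a(1-3)] by blast
  qed
qed

subsection \<open>Point derivations\<close>

text \<open>Derivations of the coordinate ring at the point \<open>c\<close>, given by their values on monomials.\<close>

definition pder :: "'e set \<Rightarrow> (('v \<Rightarrow>\<^sub>0 int) \<Rightarrow> complex) \<Rightarrow> (('v \<Rightarrow>\<^sub>0 int) \<Rightarrow> complex) \<Rightarrow> bool" where
  "pder G c \<theta> \<longleftrightarrow> (\<forall>m\<in>S G. \<forall>m'\<in>S G. \<theta> (m + m') = \<theta> m * c m' + c m * \<theta> m')"

lemma pder_mult:
  assumes "pder G c \<theta>" "f \<in> CR G" "g \<in> CR G"
  shows "evalp (f * g) \<theta> = evalp f \<theta> * evalp g c + evalp f c * evalp g \<theta>"
  unfolding evalp_lin using assms by (intro idc.lin_bilinear) (auto simp: pder_def CR_iff)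

text \<open>Derivatives along the orbit.\<close>

lemma pder_tangent:
  assumes c: "c \<in> can G"
  shows "pder G c (\<lambda>m. if m \<in> T G then c m * of_int (lookup m x) else 0)"
  unfolding pder_def
proof (intro ballI)
  fix m m' assume m: "m \<in> S G" "m' \<in> S G"
  have z: "c q = 0" if "q \<in> S G" "q \<notin> T G" for q using can_iff[OF c that(1)] that(2) by blast
  show "(if m + m' \<in> T G then c (m + m') * of_int (lookup (m + m') x) else 0) =
      (if m \<in> T G then c m * of_int (lookup m x) else 0) * c m' +
      c m * (if m' \<in> T G then c m' * of_int (lookup m' x) else 0)"
    using T_sum_iff[OF m] z[OF m(1)] z[OF m(2)] ch_add[OF can_ch[OF c] m]
    by (auto simp: lookup_add algebra_simps)
qed

text \<open>The coefficient of an irreducible \<open>h\<close>: as \<open>h\<close> is not a sum of two non-units, it does not occur in a product of two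
  non-unit monomials.\<close>

lemma pder_irr:
  assumes c: "c \<in> can G" and h: "irr G h"
  shows "pder G c (\<lambda>m. if m - h \<in> T G then c (m - h) else 0)"
  unfolding pder_def
proof (intro ballI)
  fix m m' assume m: "m \<in> S G" "m' \<in> S G"
  have z: "c q = 0" if "q \<in> S G" "q \<notin> T G" for q using can_iff[OF c that(1)] that(2) by blast
  have hT: "h \<notin> T G" using h by (simp add: irr_def)
  have noth: "q - h \<notin> T G" if q: "q \<in> T G" for q
  proof
    assume "q - h \<in> T G"
    then have "q + - (q - h) \<in> T G" using q T_add T_uminus by blast
    then show False using hT by simp
  qed
  have key: "(if a + a' - h \<in> T G then c (a + a' - h) else 0) =
     (if a - h \<in> T G then c (a - h) else 0) * c a' + c a * (if a' - h \<in> T G then c (a' - h) else 0)"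
    if a: "a \<in> S G" "a' \<in> S G" "a \<in> T G" for a a'
  proof -
    have "a + a' - h \<in> T G \<longleftrightarrow> a' - h \<in> T G"
    proof
      assume "a + a' - h \<in> T G"
      then have "- a + (a + a' - h) \<in> T G" using T_add T_uminus[OF a(3)] by blast
      then show "a' - h \<in> T G" by simp
    next
      assume "a' - h \<in> T G"
      then have "a + (a' - h) \<in> T G" using T_add a(3) by blast
      then show "a + a' - h \<in> T G" by (simp add: algebra_simps)
    qed
    moreover have "c (a + a' - h) = c a * c (a' - h)" if "a' - h \<in> T G"
      using ch_add[OF can_ch[OF c] a(1), of "a' - h"] that T_S by (auto simp: algebra_simps)
    ultimately show ?thesis using noth[OF a(3)] by simp
  qed
  show "(if m + m' - h \<in> T G then c (m + m' - h) else 0) =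
     (if m - h \<in> T G then c (m - h) else 0) * c m' + c m * (if m' - h \<in> T G then c (m' - h) else 0)"
  proof (cases "m \<in> T G \<or> m' \<in> T G")
    case True
    then show ?thesis
    proof
      assume "m \<in> T G" then show ?thesis by (rule key[OF m])
    next
      assume "m' \<in> T G"
      from key[OF m(2,1) this] show ?thesis unfolding add.commute[of m' m] by (simp only: ac_simps)
    qed
  next
    case False
    then have "m + m' - h \<notin> T G" using h m unfolding irr_def by blast
    then show ?thesis using z[OF m(1)] z[OF m(2)] False by simp
  qed
qed

text \<open>Point derivations vanish on the square of the maximal ideal.\<close>

lemma pder_square:
  assumes c: "c \<in> ch G" and \<theta>: "pder G c \<theta>"
    and X: "finite X" "\<And>g. g \<in> X \<Longrightarrow> a g \<in> nonunits (cls_ring (LR G c))" "X \<subseteq> nonunits (cls_ring (LR G c))"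
    and Y: "Y \<in> CR G" "fr Y = (\<Sum>g\<in>X. a g * g)"
  shows "evalp Y \<theta> = 0"
proof -
  define M where "M = {y. \<exists>p q. y = Fract p q \<and> p \<in> CR G \<and> q \<in> CR G \<and> evalp q c \<noteq> 0 \<and> evalp p c = 0 \<and> evalp p \<theta> = 0}"
  have M_add: "x + y \<in> M" if xy: "x \<in> M" "y \<in> M" for x y
  proof -
    obtain p q where p: "x = Fract p q" "p \<in> CR G" "q \<in> CR G" "evalp q c \<noteq> 0" "evalp p c = 0" "evalp p \<theta> = 0"
      using xy(1) unfolding M_def mem_Collect_eq by (elim exE conjE) (rule that)
    obtain p' q' where p': "y = Fract p' q'" "p' \<in> CR G" "q' \<in> CR G" "evalp q' c \<noteq> 0" "evalp p' c = 0" "evalp p' \<theta> = 0"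
      using xy(2) unfolding M_def mem_Collect_eq by (elim exE conjE) (rule that)
    show ?thesis unfolding M_def mem_Collect_eq
    proof (intro exI conjI)
      show "x + y = Fract (p * q' + p' * q) (q * q')" using p p' evalp_ne[OF p(4)] evalp_ne[OF p'(4)] by simp
      show "p * q' + p' * q \<in> CR G" "q * q' \<in> CR G" using p p' by (auto intro: CR_add CR_mult)
      show "evalp (q * q') c \<noteq> 0" using p p' by (simp add: evalp_mult[OF c])
      show "evalp (p * q' + p' * q) c = 0" using p p' by (simp add: evalp_mult[OF c] evalp_add)
      show "evalp (p * q' + p' * q) \<theta> = 0" using p p' by (simp add: pder_mult[OF \<theta>] evalp_add)
    qed
  qed
  have nu: "\<exists>p q. x = Fract p q \<and> p \<in> CR G \<and> q \<in> CR G \<and> evalp q c \<noteq> 0 \<and> evalp p c = 0"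
    if x: "x \<in> nonunits (cls_ring (LR G c))" for x
  proof -
    have x': "x \<in> LR G c" "rv G c x = 0" using x unfolding nonunits_LR[OF c] by auto
    obtain p q where p: "x = Fract p q" "p \<in> CR G" "q \<in> CR G" "evalp q c \<noteq> 0" using x'(1) by (rule LR_E)
    then show ?thesis using x'(2) rv_Fract[OF c p(2-4)] by auto
  qed
  have M_mult: "x * y \<in> M" if xy: "x \<in> nonunits (cls_ring (LR G c))" "y \<in> nonunits (cls_ring (LR G c))" for x y
  proof -
    obtain p q where p: "x = Fract p q" "p \<in> CR G" "q \<in> CR G" "evalp q c \<noteq> 0" "evalp p c = 0"
      using nu[OF xy(1)] by (elim exE conjE) (rule that)
    obtain p' q' where p': "y = Fract p' q'" "p' \<in> CR G" "q' \<in> CR G" "evalp q' c \<noteq> 0" "evalp p' c = 0"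
      using nu[OF xy(2)] by (elim exE conjE) (rule that)
    show ?thesis unfolding M_def mem_Collect_eq
    proof (intro exI conjI)
      show "x * y = Fract (p * p') (q * q')" using p p' by simp
      show "p * p' \<in> CR G" "q * q' \<in> CR G" using p p' by (auto intro: CR_mult)
      show "evalp (q * q') c \<noteq> 0" "evalp (p * p') c = 0" using p p' by (simp_all add: evalp_mult[OF c])
      show "evalp (p * p') \<theta> = 0" using p p' by (simp add: pder_mult[OF \<theta>])
    qed
  qed
  have M0: "0 \<in> M" unfolding M_def mem_Collect_eq
    by (intro exI[of _ 0] exI[of _ 1]) (simp add: Zero_fract_def CR_zero one_CR evalp_one[OF c])
  have "(\<Sum>g\<in>X. a g * g) \<in> M"
    using X
  proof (induction X rule: finite_induct)
    case empty then show ?case using M0 by simp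
  next
    case (insert g X)
    then have "a g * g \<in> M" "(\<Sum>g\<in>X. a g * g) \<in> M" by (auto intro: M_mult)
    then show ?case using insert.hyps by (simp add: M_add)
  qed
  then obtain p q where p: "fr Y = Fract p q" "p \<in> CR G" "q \<in> CR G" "evalp q c \<noteq> 0" "evalp p c = 0" "evalp p \<theta> = 0"
    unfolding Y(2)[symmetric] M_def mem_Collect_eq by (elim exE conjE) (rule that)
  have "Y * q = p" using Fract_eqD[OF p(1) _ evalp_ne[OF p(4)]] by simp
  then have "evalp Y c * evalp q c = 0" "evalp Y \<theta> * evalp q c + evalp Y c * evalp q \<theta> = 0"
    using evalp_mult[OF c Y(1) p(3)] pder_mult[OF \<theta> Y(1) p(3)] p by auto
  then show ?thesis using p(4) by auto
qed

text \<open>The differentials of the functions \<open>\<chi>\<^sup>m - c(m)\<close>, \<open>m \<in> J\<close>, are independent as soon as no nontrivial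
  combination is killed by all point derivations; then the maximal ideal needs \<open>card J\<close> generators.\<close>

lemma not_regular_if_independent:
  assumes G: "G \<in> \<F>" "c \<in> can G" and J: "finite J" "J \<subseteq> S G" "card D < card J"
    and ind: "\<And>\<alpha>. (\<And>\<theta>. pder G c \<theta> \<Longrightarrow> (\<Sum>m\<in>J. \<alpha> m * (\<theta> m - c m * \<theta> 0)) = 0) \<Longrightarrow> \<forall>m\<in>J. \<alpha> m = 0"
  shows "\<not> regular_local (local_ring D (Pt G c))"
proof
  let ?R = "cls_ring (LR G c)"
  have c: "c \<in> ch G" using G(2) by (rule can_ch)
  note SR = LR_subring[OF c]
  assume "regular_local (local_ring D (Pt G c))"
  then obtain X where X: "X \<subseteq> LR G c" "finite X" "enat (card X) \<le> krull_dim ?R" "Idl\<^bsub>?R\<^esub> X = nonunits ?R"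
    unfolding local_ring_eq[OF G] regular_local_def by auto
  have "enat (card X) \<le> enat (card D)" using X(3) krull_dim_LR[OF c] by (rule order_trans)
  then have "card X < card J" using J(3) by simp
  have Idl: "nonunits ?R = {\<Sum>g\<in>X. a g * g | a. \<forall>g\<in>X. a g \<in> LR G c}"
    using Idl_cls_ring[OF SR X(2,1)] X(4) by simp
  interpret cring ?R by (rule cring_cls_ring[OF SR])
  have Xn: "X \<subseteq> nonunits ?R" unfolding X(4)[symmetric] using X(1) by (intro genideal_self) simp
  define x where "x m = single m 1 - single 0 (c m)" for m :: "'v \<Rightarrow>\<^sub>0 int"
  have x: "x m \<in> CR G" if "m \<in> J" for m unfolding x_def using that J(2) by (intro CR_diff CR_single S_zero) auto
  have "\<exists>a. (\<forall>g\<in>X. a g \<in> LR G c) \<and> fr (x m) = (\<Sum>g\<in>X. a g * g)" if m: "m \<in> J" for m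
  proof -
    have "fr (x m) \<in> nonunits ?R" unfolding x_def using m J(2) by (intro fr_chi_nonunit[OF c]) auto
    then show ?thesis unfolding Idl by blast
  qed
  then have "\<forall>m\<in>J. \<exists>a. (\<forall>g\<in>X. a g \<in> LR G c) \<and> fr (x m) = (\<Sum>g\<in>X. a g * g)" by blast
  from bchoice[OF this] obtain a where a: "\<And>m g. m \<in> J \<Longrightarrow> g \<in> X \<Longrightarrow> a m g \<in> LR G c" "\<And>m. m \<in> J \<Longrightarrow> fr (x m) = (\<Sum>g\<in>X. a m g * g)"
    by auto
  obtain \<alpha> where \<alpha>: "\<exists>m\<in>J. \<alpha> m \<noteq> 0" "\<forall>g\<in>X. (\<Sum>m\<in>J. \<alpha> m * rv G c (a m g)) = 0"
    using exists_linear_relation[OF X(2) J(1) \<open>card X < card J\<close>, of "\<lambda>m g. rv G c (a m g)"] by blast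
  define Y where "Y = (\<Sum>m\<in>J. single 0 (\<alpha> m) * x m)"
  define A where "A g = (\<Sum>m\<in>J. fr (single 0 (\<alpha> m)) * a m g)" for g
  have \<kappa>L: "fr (single 0 b) \<in> LR G c" "rv G c (fr (single 0 b)) = b" for b
    using LR_fr[OF c CR_single[OF S_zero]] rv_hom(3)[OF c CR_single[OF S_zero]] c by (auto simp: evalp_single ch_iff)
  have Am: "A g \<in> nonunits ?R" if g: "g \<in> X" for g
  proof -
    have t: "fr (single 0 (\<alpha> m)) * a m g \<in> LR G c" if "m \<in> J" for m
      using subring_setD(4)[OF SR \<kappa>L(1) a(1)[OF that g]] .
    have "rv G c (A g) = (\<Sum>m\<in>J. rv G c (fr (single 0 (\<alpha> m)) * a m g))"
      unfolding A_def by (rule rv_sum[OF c t])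
    also have "\<dots> = (\<Sum>m\<in>J. \<alpha> m * rv G c (a m g))"
      using rv_hom(2)[OF c \<kappa>L(1) a(1)[OF _ g]] \<kappa>L(2) by (intro sum.cong refl) simp
    finally have "rv G c (A g) = 0" using \<alpha>(2) g by simp
    moreover have "A g \<in> LR G c" unfolding A_def by (rule subring_set_sum[OF SR t])
    ultimately show ?thesis unfolding nonunits_LR[OF c] by blast
  qed
  have YC: "Y \<in> CR G" unfolding Y_def by (intro CR_sum CR_mult CR_single S_zero x)
  have "fr Y = (\<Sum>m\<in>J. fr (single 0 (\<alpha> m)) * (\<Sum>g\<in>X. a m g * g))"
    unfolding Y_def fr_sum by (intro sum.cong refl) (simp only: fr_mult a(2))
  also have "\<dots> = (\<Sum>m\<in>J. \<Sum>g\<in>X. fr (single 0 (\<alpha> m)) * a m g * g)"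
    by (simp only: sum_distrib_left mult.assoc)
  also have "\<dots> = (\<Sum>g\<in>X. A g * g)"
    unfolding A_def sum_distrib_right by (rule sum.swap)
  finally have Yr: "fr Y = (\<Sum>g\<in>X. A g * g)" .
  have "(\<Sum>m\<in>J. \<alpha> m * (\<theta> m - c m * \<theta> 0)) = 0" if \<theta>: "pder G c \<theta>" for \<theta>
  proof -
    have "evalp Y \<theta> = 0" by (rule pder_square[OF c \<theta> X(2) Am Xn YC Yr])
    moreover have "evalp Y \<theta> = (\<Sum>m\<in>J. \<alpha> m * (\<theta> m - c m * \<theta> 0))"
      unfolding Y_def evalp_sum x_def right_diff_distrib
      by (intro sum.cong refl) (simp add: evalp_diff mult_single evalp_single algebra_simps)
    ultimately show ?thesis by simp
  qed
  then have "\<forall>m\<in>J. \<alpha> m = 0" by (rule ind)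
  then show False using \<alpha>(1) by blast
qed

end

text \<open>A conifold cone \<open>b\<close> of the fan: four generators with the relation \<open>e1 + e2 = e3 + e4\<close>, four elements
  of its dual monoid that pair with the generators like the generators of the node do, and a family
  \<open>v x\<close>, \<open>x \<in> X\<close>, of \<open>card D - 3\<close> units that is dual to the entries at \<open>X\<close>.\<close>

locale conifold = toric D \<F> \<beta> ip
  for D :: "'v::linorder set" and \<F> :: "'e set set" and \<beta> ip +
  fixes b :: "'e set" and e1 e2 e3 e4 :: 'e and X :: "'v set" and v :: "'v \<Rightarrow> ('v \<Rightarrow>\<^sub>0 int)"
    and u :: "nat \<Rightarrow> ('v \<Rightarrow>\<^sub>0 int)"
  assumes b: "b \<in> \<F>" and b_def: "b = {e1, e2, e3, e4}"
    and rel: "\<And>m. ip m e1 + ip m e2 = ip m e3 + ip m e4"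
    and u_S: "\<And>i. i < 4 \<Longrightarrow> u i \<in> S b"
    and u_ip: "ip (u 0) e1 = 0" "ip (u 0) e2 = 1" "ip (u 0) e3 = 0" "ip (u 0) e4 = 1"
      "ip (u 1) e1 = 1" "ip (u 1) e2 = 0" "ip (u 1) e3 = 1" "ip (u 1) e4 = 0"
      "ip (u 2) e1 = 1" "ip (u 2) e2 = 0" "ip (u 2) e3 = 0" "ip (u 2) e4 = 1"
      "ip (u 3) e1 = 0" "ip (u 3) e2 = 1" "ip (u 3) e3 = 1" "ip (u 3) e4 = 0"
    and X: "X \<subseteq> D" "card X = card D - 3" "3 \<le> card D"
    and v_T: "\<And>x. x \<in> X \<Longrightarrow> v x \<in> T b"
    and v_X: "\<And>x x'. x \<in> X \<Longrightarrow> x' \<in> X \<Longrightarrow> lookup (v x) x' = (if x = x' then 1 else 0)"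
begin

lemma finX: "finite X" using X(1) finD by (rule finite_subset)

lemma u_values:
  assumes "i < 4"
  shows "ip (u i) e1 = (if i = 1 \<or> i = 2 then 1 else 0)" "ip (u i) e3 = (if i = 1 \<or> i = 3 then 1 else 0)"
    "ip (u i) e1 + ip (u i) e2 = 1"
proof -
  from assms consider "i = 0" | "i = 1" | "i = 2" | "i = 3" by linarith
  then have "ip (u i) e1 = (if i = 1 \<or> i = 2 then 1 else 0) \<and> ip (u i) e3 = (if i = 1 \<or> i = 3 then 1 else 0) \<and>
    ip (u i) e1 + ip (u i) e2 = 1"
  proof cases
    case 1 then show ?thesis using u_ip(1-4) by simp
  next
    case 2 then show ?thesis using u_ip(5-8) by simp
  next
    case 3 then show ?thesis using u_ip(9-12) by simp
  next
    case 4 then show ?thesis using u_ip(13-16) by simp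
  qed
  then show "ip (u i) e1 = (if i = 1 \<or> i = 2 then 1 else 0)" "ip (u i) e3 = (if i = 1 \<or> i = 3 then 1 else 0)"
    "ip (u i) e1 + ip (u i) e2 = 1" by blast+
qed

lemmas u_sum = u_values(3)

lemma u_distinct:
  assumes ij: "i < 4" "j < 4" and eq: "\<forall>e\<in>b. ip (u i) e = ip (u j) e" shows "i = j"
proof -
  have "ip (u i) e1 = ip (u j) e1" "ip (u i) e3 = ip (u j) e3" using eq by (auto simp: b_def)
  then have "(i = 1 \<or> i = 2) = (j = 1 \<or> j = 2)" "(i = 1 \<or> i = 3) = (j = 1 \<or> j = 3)"
    unfolding u_values(1,2)[OF ij(1)] u_values(1,2)[OF ij(2)] by (metis zero_neq_one)+
  then show ?thesis using ij by presburger
qed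

lemma v_independent: "independent ((\<lambda>x. rl (v x)) ` X)" "card ((\<lambda>x. rl (v x)) ` X) = card X"
proof -
  have inj: "inj_on (\<lambda>x. rl (v x)) X"
  proof (rule inj_onI)
    fix x y assume xy: "x \<in> X" "y \<in> X" "rl (v x) = rl (v y)"
    then have "lookup (v x) x = lookup (v y) x" by (simp add: rl_inj)
    then show "x = y" using v_X[OF xy(1,1)] v_X[OF xy(2,1)] by (auto split: if_splits)
  qed
  then show "card ((\<lambda>x. rl (v x)) ` X) = card X" by (rule card_image)
  show "independent ((\<lambda>x. rl (v x)) ` X)"
  proof (rule independent_if_scalars_zero)
    show "finite ((\<lambda>x. rl (v x)) ` X)" using finX by simp
    fix f y assume z: "(\<Sum>y\<in>(\<lambda>x. rl (v x)) ` X. f y *\<^sub>R y) = 0" and y: "y \<in> (\<lambda>x. rl (v x)) ` X"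
    obtain x0 where x0: "x0 \<in> X" "y = rl (v x0)" using y by blast
    have "(\<Sum>x\<in>X. f (rl (v x)) *\<^sub>R rl (v x)) = 0" using z unfolding sum.reindex[OF inj] by simp
    then have "0 = (\<Sum>x\<in>X. lookup (f (rl (v x)) *\<^sub>R rl (v x)) x0)"
      by (simp only: lookup_zero flip: lookup_sum)
    also have "\<dots> = (\<Sum>x\<in>X. if x = x0 then f (rl (v x)) else 0)"
      by (intro sum.cong refl) (simp add: v_X[OF _ x0(1)])
    also have "\<dots> = f (rl (v x0))" using x0 finX by simp
    finally show "f y = 0" using x0 by simp
  qed
qed

text \<open>The cotangent space at a point of an orbit in the closure of the stratum is too big: it contains
  independent classes from a basis of the real span of \<open>T b\<close>, which consists of units and irreducible
  elements since \<open>T b \<inter> S G\<close> is a face of \<open>S G\<close>, and four more irreducible elements that restrict to the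
  generators of the node.\<close>

lemma not_regular:
  assumes G: "G \<in> \<F>" "c \<in> can G" and bG: "b \<subseteq> G"
  shows "\<not> regular_local (local_ring D (Pt G c))"
proof -
  have c: "c \<in> ch G" using G(2) by (rule can_ch)
  have fG: "finite G" using fin[OF G(1)] .
  have TbG: "T G \<subseteq> T b" by (rule T_anti[OF bG])
  have SGb: "S G \<subseteq> S b" by (rule S_anti[OF bG])
  obtain m0 where m0: "m0 \<in> S G" "\<And>e. e \<in> G \<Longrightarrow> ip m0 e = 0 \<longleftrightarrow> e \<in> b" "\<And>e. e \<in> b \<Longrightarrow> ip m0 e \<le> 0"
    using face_exposed[OF G(1) b] by metis
  have F0: "{e \<in> G. ip m0 e = 0} = b" using m0(2) bG by auto
  have m0b: "ip m0 e = 0" if "e \<in> b" for e using m0(2) that bG by auto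
  then have m0T: "m0 \<in> T b" using m0(1) by (auto simp: T_def S_def)
  define H0 where "H0 = {h. irr G h \<and> h \<in> T b}"
  define V where "V = rl ` (T G \<union> H0)"
  \<comment> \<open>\<open>V\<close> spans the real span of \<open>T b\<close>.\<close>
  have spanS: "m \<in> T b \<longrightarrow> rl m \<in> span V" if "m \<in> S G" for m
    using fG that
  proof (induction rule: S_induct)
    case (unit m) then show ?case by (auto simp: V_def intro: span_base)
  next
    case (irr h) then show ?case by (auto simp: V_def H0_def intro!: span_base)
  next
    case (step m a a')
    show ?case
    proof
      assume m: "m \<in> T b"
      have "m + (a + a' - m) \<in> T b" using m step(4) TbG by (intro T_add) auto
      then have "a + a' \<in> T b" by simp
      then have "a \<in> T b" "a' \<in> T b" using T_sum_iff[of a b a'] step(2,3) SGb by auto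
      then have "rl a \<in> span V" "rl a' \<in> span V" using step by auto
      moreover have "rl (a + a' - m) \<in> span V" using step(4) by (auto simp: V_def intro: span_base)
      ultimately have "rl a + rl a' - rl (a + a' - m) \<in> span V" by (intro span_add span_diff)
      then show "rl m \<in> span V" by (simp add: rl_diff rl_add)
    qed
  qed
  have spanT: "rl m \<in> span V" if m: "m \<in> T b" for m
  proof -
    have "m \<in> S {e \<in> G. ip m0 e = 0}" unfolding F0 using m T_S by blast
    then obtain k where k: "m + frag_cmul (int k) m0 \<in> S G" using shift_exists[OF fG m0(1)] by blast
    have 1: "rl (m + frag_cmul (int k) m0) \<in> span V" using spanS[OF k] T_add[OF m T_cmul[OF m0T]] by blast
    have 2: "rl m0 \<in> span V" using spanS[OF m0(1)] m0T by blast
    have "rl m = rl (m + frag_cmul (int k) m0) - real k *\<^sub>R rl m0" by (simp add: rl_add rl_cmul)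
    then show ?thesis using span_diff[OF 1 span_scale[OF 2, of "real k"]] by simp
  qed
  obtain B1 where B1: "B1 \<subseteq> rl ` T G" "independent B1" "rl ` T G \<subseteq> span B1"
    using maximal_independent_subset[of "rl ` T G"] by blast
  have "B1 \<subseteq> V" using B1(1) by (auto simp: V_def)
  then obtain B where B: "B1 \<subseteq> B" "B \<subseteq> V" "independent B" "V \<subseteq> span B"
    using maximal_independent_subset_extend[OF _ B1(2)] by metis
  have H0S: "H0 \<subseteq> S G" by (auto simp: H0_def irr_def)
  have VS: "V \<subseteq> span ((\<lambda>x. single x (1::real)) ` D)"
    unfolding V_def using rl_in_span[OF finD] T_lattice S_lattice H0S by blast
  have finB: "finite B" using independent_span_bound[OF finite_imageI[OF finD] B(3)] B(2) VS by blast
  have "(\<lambda>x. rl (v x)) ` X \<subseteq> span B"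
    using spanT v_T span_mono[OF B(4)] span_span by blast
  then have "card ((\<lambda>x. rl (v x)) ` X) \<le> card B" using independent_span_bound[OF finB v_independent(1)] by blast
  then have cardB: "card D - 3 \<le> card B" using v_independent(2) X(2) by simp
  have "\<forall>y\<in>B. \<exists>m. rl m = y \<and> (if y \<in> B1 then m \<in> T G else m \<in> H0)"
  proof
    fix y assume y: "y \<in> B"
    show "\<exists>m. rl m = y \<and> (if y \<in> B1 then m \<in> T G else m \<in> H0)"
    proof (cases "y \<in> B1")
      case True then show ?thesis using B1(1) by auto
    next
      case False
      have "y \<notin> rl ` T G"
      proof
        assume "y \<in> rl ` T G"
        then have "y \<in> span (B - {y})" using B1(3) span_mono[of B1 "B - {y}"] B(1) False by blast
        then show False using B(3) y dependent_def by blast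
      qed
      then show ?thesis using B(2) y False by (auto simp: V_def)
    qed
  qed
  from bchoice[OF this] obtain \<mu> where \<mu>0: "\<forall>y\<in>B. rl (\<mu> y) = y \<and> (if y \<in> B1 then \<mu> y \<in> T G else \<mu> y \<in> H0)"
    by (elim exE) (rule that)
  have \<mu>: "\<And>y. y \<in> B \<Longrightarrow> rl (\<mu> y) = y"
    "\<And>y. y \<in> B1 \<Longrightarrow> \<mu> y \<in> T G" "\<And>y. y \<in> B - B1 \<Longrightarrow> \<mu> y \<in> H0"
    subgoal for y using \<mu>0 by blast
    subgoal for y using bspec[OF \<mu>0, of y] B(1) by auto
    subgoal for y using bspec[OF \<mu>0, of y] by auto
    done
  have \<mu>inj: "inj_on \<mu> B" by (rule inj_on_inverseI[of _ rl]) (rule \<mu>(1))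
  have \<mu>T: "\<mu> y \<in> T b" if "y \<in> B" for y using that \<mu>(2,3) TbG by (cases "y \<in> B1") (auto simp: H0_def)
  have \<mu>S: "\<mu> y \<in> S G" if "y \<in> B" for y using that \<mu>(2,3) T_S H0S by (cases "y \<in> B1") auto
  \<comment> \<open>An element of degree one on \<open>b\<close> splits into summands of which only one is nonzero on \<open>b\<close>.\<close>
  have hd: "\<exists>h. irr G h \<and> (\<forall>e\<in>b. ip h e = ip m e)" if "m \<in> S G" "ip m e1 + ip m e2 = 1" for m
  proof -
    have "ip m e1 + ip m e2 = 1 \<longrightarrow> (\<exists>h. irr G h \<and> (\<forall>e\<in>b. ip h e = ip m e))"
      using fG that(1)
    proof (induction rule: S_induct)
      case (unit m) then show ?case using bG by (auto simp: T_def b_def)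
    next
      case (irr h) then show ?case by auto
    next
      case (step m a a')
      show ?case
      proof
        assume one: "ip m e1 + ip m e2 = 1"
        have split: "ip a e + ip a' e = ip m e" if "e \<in> b" for e
          using step(4) that bG by (auto simp: T_def ip_add ip_diff)
        have nn: "0 \<le> ip a e" "0 \<le> ip a' e" if "e \<in> b" for e using step(2,3) that bG by (auto simp: S_def)
        have z: "(\<forall>e\<in>b. ip q e = 0)" if "ip q e1 + ip q e2 = 0" "\<forall>e\<in>b. 0 \<le> ip q e" for q
          using that rel[of q] unfolding b_def by auto
        have "ip a e1 + ip a e2 + (ip a' e1 + ip a' e2) = 1"
          using one split[of e1] split[of e2] by (simp add: b_def)
        moreover have "0 \<le> ip a e1" "0 \<le> ip a e2" "0 \<le> ip a' e1" "0 \<le> ip a' e2" by (auto intro!: nn simp: b_def)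
        ultimately consider "ip a e1 + ip a e2 = 0" "ip a' e1 + ip a' e2 = 1" | "ip a' e1 + ip a' e2 = 0" "ip a e1 + ip a e2 = 1"
          by linarith
        then show "\<exists>h. irr G h \<and> (\<forall>e\<in>b. ip h e = ip m e)"
        proof cases
          case 1
          have "ip m e = ip a' e" if "e \<in> b" for e
            using bspec[OF z[OF 1(1)] that] nn(1) split[OF that] by simp
          then show ?thesis using step(6) 1 by auto
        next
          case 2
          have "ip m e = ip a e" if "e \<in> b" for e
            using bspec[OF z[OF 2(1)] that] nn(2) split[OF that] by simp
          then show ?thesis using step(5) 2 by auto
        qed
      qed
    qed
    then show ?thesis using that(2) by blast
  qed
  have "\<forall>i\<in>{..<4}. \<exists>h. irr G h \<and> (\<forall>e\<in>b. ip h e = ip (u i) e)"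
  proof
    fix i :: nat assume i: "i \<in> {..<4}"
    then have "u i \<in> S {e \<in> G. ip m0 e = 0}" unfolding F0 using u_S by auto
    then obtain k where k: "u i + frag_cmul (int k) m0 \<in> S G" using shift_exists[OF fG m0(1)] by blast
    have ipk: "ip (u i + frag_cmul (int k) m0) e = ip (u i) e" if "e \<in> b" for e
      using m0b[OF that] by (simp add: ip_add ip_cmul)
    have "ip (u i + frag_cmul (int k) m0) e1 + ip (u i + frag_cmul (int k) m0) e2 = 1"
      using ipk[of e1] ipk[of e2] u_sum[of i] i by (simp add: b_def)
    from hd[OF k this] show "\<exists>h. irr G h \<and> (\<forall>e\<in>b. ip h e = ip (u i) e)" using ipk by auto
  qed
  from bchoice[OF this] obtain h where h0: "\<forall>i\<in>{..<4}. irr G (h i) \<and> (\<forall>e\<in>b. ip (h i) e = ip (u i) e)"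
    by (elim exE) (rule that)
  then have h: "\<And>i. i < 4 \<Longrightarrow> irr G (h i)" "\<And>i e. i < 4 \<Longrightarrow> e \<in> b \<Longrightarrow> ip (h i) e = ip (u i) e"
    by auto
  have hS: "h i \<in> S G" if "i < 4" for i using h(1)[OF that] by (simp add: irr_def)
  have hTb: "h i \<notin> T b" if i: "i < 4" for i
    using h(2)[OF i, of e1] h(2)[OF i, of e2] u_sum[OF i] by (auto simp: T_def b_def)
  have hdiff: "i = j" if "i < 4" "j < 4" "h i - h j \<in> T b" for i j
    using that h(2) u_distinct[OF that(1,2)] by (auto simp: T_def ip_diff)
  have hinj: "inj_on h {..<4}"
  proof (rule inj_onI)
    fix i j assume ij: "i \<in> {..<4}" "j \<in> {..<4}" "h i = h j"
    then have "h i - h j \<in> T b" by (simp add: T_zero)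
    then show "i = j" using hdiff[of i j] ij by simp
  qed
  define J where "J = \<mu> ` B \<union> h ` {..<4}"
  have disj: "\<mu> ` B \<inter> h ` {..<4} = {}"
  proof -
    have "\<mu> y \<noteq> h i" if "y \<in> B" "i < 4" for y i using \<mu>T[OF that(1)] hTb[OF that(2)] by metis
    then show ?thesis by blast
  qed
  have finJ: "finite J" using finB by (simp add: J_def)
  have "card J = card B + 4"
    unfolding J_def using finB disj by (subst card_Un_disjoint) (auto simp: card_image[OF \<mu>inj] card_image[OF hinj])
  then have cardJ: "card D < card J" using cardB X(3) by linarith
  have JS: "J \<subseteq> S G" using \<mu>S hS by (auto simp: J_def)
  define K where "K = \<mu> ` (B - B1) \<union> h ` {..<4}"
  have K_irr: "irr G q" if "q \<in> K" for q using that \<mu>(3) h(1) by (auto simp: K_def H0_def)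
  have J_split: "J = \<mu> ` B1 \<union> K" using B(1) by (auto simp: J_def K_def)
  have K_inj: "m = q" if q: "q \<in> K" and m: "m \<in> J" and mq: "m - q \<in> T G" for m q
  proof -
    have qT: "q \<notin> T G" using K_irr[OF q] by (simp add: irr_def)
    have sw: "q - m \<in> T G" using T_uminus[OF mq] by simp
    have b': "m \<in> T b \<longleftrightarrow> q \<in> T b"
      using T_add[of m b "q - m"] T_add[of q b "m - q"] mq sw TbG by auto
    show "m = q"
    proof (cases "q \<in> T b")
      case False
      then obtain i j where ij: "q = h i" "i < 4" "m = h j" "j < 4"
        using q m b' \<mu>T by (auto simp: K_def J_def)
      then show ?thesis using hdiff[of j i] mq TbG by auto
    next
      case True
      then obtain y y' where y: "q = \<mu> y" "y \<in> B - B1" "m = \<mu> y'" "y' \<in> B"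
        using q m b' hTb by (auto simp: K_def J_def)
      show ?thesis
      proof (rule ccontr)
        assume "m \<noteq> q"
        then have ne: "y' \<noteq> y" using y by auto
        have "rl (q - m) \<in> span B1" using B1(3) sw by blast
        then have 1: "rl (q - m) \<in> span (B - {y})" using span_mono[of B1 "B - {y}"] B(1) y(2) by blast
        have 2: "y' \<in> span (B - {y})" using ne y(4) by (auto intro: span_base)
        have "y = rl (q - m) + y'" using \<mu>(1)[of y] \<mu>(1)[of y'] y by (simp add: rl_diff)
        then have "y \<in> span (B - {y})" using span_add[OF 1 2] by simp
        then show False using B(3) y(2) dependent_def by blast
      qed
    qed
  qed
  show ?thesis
  proof (rule not_regular_if_independent[OF G finJ JS cardJ])
    fix \<alpha> :: "('v \<Rightarrow>\<^sub>0 int) \<Rightarrow> complex"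
    assume hyp: "\<And>\<theta>. pder G c \<theta> \<Longrightarrow> (\<Sum>m\<in>J. \<alpha> m * (\<theta> m - c m * \<theta> 0)) = 0"
    \<comment> \<open>The derivation of an irreducible element isolates its coefficient; what remains are units, on which the
      derivatives along the orbit are independent.\<close>
    have aK: "\<alpha> q = 0" if q: "q \<in> K" for q
    proof -
      have qJ: "q \<in> J" using q J_split by blast
      have q0: "- q \<notin> T G" using K_irr[OF q] T_uminus[of "- q"] by (auto simp: irr_def)
      have "0 = (\<Sum>m\<in>J. \<alpha> m * ((if m - q \<in> T G then c (m - q) else 0) - c m * (if 0 - q \<in> T G then c (0 - q) else 0)))"
        using hyp[OF pder_irr[OF G(2) K_irr[OF q]]] by simp
      also have "\<dots> = (\<Sum>m\<in>J. if m = q then \<alpha> m else 0)"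
      proof (intro sum.cong refl)
        fix m assume m: "m \<in> J"
        show "\<alpha> m * ((if m - q \<in> T G then c (m - q) else 0) - c m * (if 0 - q \<in> T G then c (0 - q) else 0)) = (if m = q then \<alpha> m else 0)"
          using K_inj[OF q m] q0 T_zero c by (auto simp: ch_iff)
      qed
      also have "\<dots> = \<alpha> q" using qJ finJ by simp
      finally show ?thesis by simp
    qed
    have tangent: "(\<Sum>y\<in>B1. (\<alpha> (\<mu> y) * c (\<mu> y)) * of_real (lookup y x)) = 0" for x
    proof -
      have "0 = (\<Sum>m\<in>J. \<alpha> m * ((if m \<in> T G then c m * of_int (lookup m x) else 0) -
          c m * (if 0 \<in> T G then c 0 * of_int (lookup 0 x) else 0)))"
        using hyp[OF pder_tangent[OF G(2), of x]] by simp
      also have "\<dots> = (\<Sum>m\<in>J. \<alpha> m * (if m \<in> T G then c m * of_int (lookup m x) else 0))" by simp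
      also have "\<dots> = (\<Sum>m\<in>\<mu> ` B1. \<alpha> m * (if m \<in> T G then c m * of_int (lookup m x) else 0))"
        using finJ aK unfolding J_split by (intro sum.mono_neutral_right) auto
      also have "\<dots> = (\<Sum>y\<in>B1. \<alpha> (\<mu> y) * (if \<mu> y \<in> T G then c (\<mu> y) * of_int (lookup (\<mu> y) x) else 0))"
        using inj_on_subset[OF \<mu>inj B(1)] by (simp add: sum.reindex)
      also have "\<dots> = (\<Sum>y\<in>B1. (\<alpha> (\<mu> y) * c (\<mu> y)) * of_real (lookup y x))"
      proof (intro sum.cong refl)
        fix y assume y: "y \<in> B1"
        have "lookup y x = real_of_int (lookup (\<mu> y) x)"
        proof -
          have e: "rl (\<mu> y) = y" using \<mu>(1) y B(1) by blast
          show ?thesis using lookup_rl[of "\<mu> y" x] unfolding e .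
        qed
        then show "\<alpha> (\<mu> y) * (if \<mu> y \<in> T G then c (\<mu> y) * of_int (lookup (\<mu> y) x) else 0) =
           (\<alpha> (\<mu> y) * c (\<mu> y)) * of_real (lookup y x)" using \<mu>(2)[OF y] by simp
      qed
      finally show ?thesis by simp
    qed
    have aB: "\<alpha> (\<mu> y) = 0" if y: "y \<in> B1" for y
    proof -
      have "\<alpha> (\<mu> y) * c (\<mu> y) = 0"
        using complex_independence[OF finite_subset[OF B(1) finB] B1(2) tangent y] .
      moreover have "c (\<mu> y) \<noteq> 0" using can_iff[OF G(2)] \<mu>(2)[OF y] T_S by blast
      ultimately show ?thesis by simp
    qed
    show "\<forall>m\<in>J. \<alpha> m = 0" using aK aB unfolding J_split by auto
  qed
qed

end

section \<open>Irreducibility and codimension of strata\<close>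

context toric begin

lemma torus_one: "(\<lambda>m\<in>dual_lattice D. 1) \<in> torus D"
  by (auto simp: torus_def chart_def dual_monoid_zero_cone dual_lattice_zero dual_lattice_add)

lemma orbit_in_W: "F \<in> \<F> \<Longrightarrow> t \<in> torus D \<Longrightarrow> Pt F (orb F t) \<in> W F"
  by (simp add: W_iff orb_can)

lemma W_mem: "p \<in> W F \<Longrightarrow> \<exists>G c. p = Pt G c \<and> G \<in> \<F> \<and> c \<in> can G"
  using W_sub[of F] unfolding toric_variety_eq by blast

lemma W_mono: assumes "F \<in> \<F>" "F' \<in> \<F>" "F' \<subseteq> F" shows "W F \<subseteq> W F'"
proof
  fix p assume p: "p \<in> W F"
  then obtain G c where G: "p = Pt G c" "G \<in> \<F>" "c \<in> can G" using W_mem by blast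
  then show "p \<in> W F'" using p assms W_iff[OF assms(1) G(2,3)] W_iff[OF assms(2) G(2,3)] by auto
qed

lemma W_strict: assumes F: "F \<in> \<F>" "F' \<in> \<F>" "F' \<subset> F" shows "W F \<subset> W F'"
proof
  show "W F \<subseteq> W F'" using F by (intro W_mono) auto
  have "Pt F' (orb F' (\<lambda>m\<in>dual_lattice D. 1)) \<in> W F'" by (rule orbit_in_W[OF F(2) torus_one])
  moreover have "Pt F' (orb F' (\<lambda>m\<in>dual_lattice D. 1)) \<notin> W F"
    using W_iff[OF F(1,2) orb_can[OF torus_one]] F(3) by blast
  ultimately show "W F \<noteq> W F'" by blast
qed

lemma resT_coord: "resT F h \<in> coord_ring D {0}"
  unfolding coord_ring_def dual_monoid_zero_cone using keys_resT[of F h] T_lattice by blast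

lemma torus_chart: "t \<in> torus D \<Longrightarrow> t \<in> chart D {0}" by (simp add: torus_def)

text \<open>An orbit closure is irreducible because the torus is: two nonzero Laurent polynomials have a common
  point of the torus where both do not vanish.\<close>

lemma irreducible_W: assumes F: "F \<in> \<F>" shows "irreducible_closed Z (W F)"
  unfolding irreducible_closed_def
proof (intro conjI allI impI)
  show "closedin Z (W F)" unfolding orbit_closure_def by (rule closedin_closure_of)
  show "W F \<noteq> {}" using orbit_in_W[OF F torus_one] by blast
  fix A B assume AB: "closedin Z A" "closedin Z B" "W F \<subseteq> A \<union> B"
  have nbh: "\<exists>h t. h \<in> CR F \<and> t \<in> torus D \<and> evalp h (orb F t) \<noteq> 0 \<and> U F h \<inter> A = {}"
    if A: "closedin Z A" "\<not> W F \<subseteq> A" for A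
  proof -
    have V: "openin Z (topspace Z - A)" using A(1) by blast
    have "\<not> torus_orbit D \<Sigma> (cn F) \<subseteq> A" using closure_of_minimal[OF _ A(1)] A(2) unfolding orbit_closure_def by blast
    then obtain t where t: "t \<in> torus D" "Pt F (orb F t) \<notin> A" unfolding torus_orbit_eq[OF F] by blast
    have "Pt F (orb F t) \<in> topspace Z - A"
      using t orb_can[OF t(1)] F unfolding topspace_Z toric_variety_eq by blast
    then obtain h where "h \<in> CR F" "evalp h (orb F t) \<noteq> 0" "U F h \<subseteq> topspace Z - A"
      using open_contains_U[OF V F F order_refl orb_can[OF t(1)]] by metis
    then show ?thesis using t(1) by blast
  qed
  show "W F \<subseteq> A \<or> W F \<subseteq> B"
  proof (rule ccontr)
    assume "\<not> (W F \<subseteq> A \<or> W F \<subseteq> B)"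
    then obtain h1 t1 h2 t2 where h: "h1 \<in> CR F" "evalp h1 (orb F t1) \<noteq> 0" "U F h1 \<inter> A = {}"
      "h2 \<in> CR F" "evalp h2 (orb F t2) \<noteq> 0" "U F h2 \<inter> B = {}" using nbh[OF AB(1)] nbh[OF AB(2)] by blast
    have "resT F h1 \<noteq> 0" using h(2) evalp_orb[OF h(1)] by auto
    moreover have "resT F h2 \<noteq> 0" using h(5) evalp_orb[OF h(4)] by auto
    ultimately have nz: "resT F h1 * resT F h2 \<noteq> 0" by simp
    have "keys (resT F h1 * resT F h2) \<subseteq> dual_lattice D"
      using keys_resT T_lattice by (intro keys_mult_lattice) blast+
    then obtain t where t: "t \<in> torus D" "evalp (resT F h1 * resT F h2) t \<noteq> 0"
      using torus_nonvanishing[OF finD nz] by blast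
    then have "evalp h1 (orb F t) \<noteq> 0" "evalp h2 (orb F t) \<noteq> 0"
      using evalp_mult[OF torus_chart[OF t(1)] resT_coord resT_coord] evalp_orb[OF h(1)] evalp_orb[OF h(4)] by auto
    then have "Pt F (orb F t) \<in> U F h1 \<inter> U F h2" using Pt_in_U[OF F orb_can[OF t(1)]] by simp
    moreover have "Pt F (orb F t) \<in> A \<union> B" using orbit_in_W[OF F t(1)] AB(3) by blast
    ultimately show False using h(3,6) by blast
  qed
qed

subsection \<open>Vanishing ideals in a chart\<close>

text \<open>The ideal of a closed set in the chart of \<open>F\<close>.\<close>

definition VI :: "'e set \<Rightarrow> 'v toric_point set \<Rightarrow> 'v laurent set" where
  "VI F Y = {f \<in> CR F. \<forall>G c. G \<in> \<F> \<longrightarrow> G \<subseteq> F \<longrightarrow> c \<in> can G \<longrightarrow> Pt G c \<in> Y \<longrightarrow> evalp f c = 0}"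

lemma ch_of_can: "G \<subseteq> F \<Longrightarrow> c \<in> can G \<Longrightarrow> f \<in> CR F \<Longrightarrow> g \<in> CR F \<Longrightarrow> evalp (f * g) c = evalp f c * evalp g c"
  using evalp_mult[OF can_ch] CR_anti by blast

lemma closedin_compl_U: "F \<in> \<F> \<Longrightarrow> f \<in> CR F \<Longrightarrow> closedin Z (topspace Z - U F f)"
  using openin_U by blast

lemma VI_prime:
  assumes F: "F \<in> \<F>" and Y: "irreducible_closed Z Y" "W F \<subseteq> Y" shows "prime_set (CR F) (VI F Y)"
  unfolding prime_set_def
proof (intro conjI ballI impI)
  show "ideal_set (CR F) (VI F Y)"
    unfolding ideal_set_def
  proof (intro conjI ballI)
    show "VI F Y \<subseteq> CR F" by (auto simp: VI_def)
    show "0 \<in> VI F Y" by (simp add: VI_def CR_zero)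
    show "a + b \<in> VI F Y" if "a \<in> VI F Y" "b \<in> VI F Y" for a b
      using that by (auto simp: VI_def CR_add evalp_add)
    show "r * a \<in> VI F Y" if "a \<in> VI F Y" "r \<in> CR F" for a r
      using that by (auto simp: VI_def CR_mult ch_of_can)
  qed
  show "1 \<notin> VI F Y"
  proof
    assume "1 \<in> VI F Y"
    then have "evalp 1 (orb F (\<lambda>m\<in>dual_lattice D. 1)) = 0"
      using orbit_in_W[OF F torus_one] Y(2) orb_can[OF torus_one, of F] F unfolding VI_def by blast
    then show False using evalp_one[OF can_ch[OF orb_can[OF torus_one, of F]]] by simp
  qed
  fix f g assume f: "f \<in> CR F" "g \<in> CR F" "f * g \<in> VI F Y"
  have "Y \<subseteq> (topspace Z - U F f) \<union> (topspace Z - U F g)"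
  proof
    fix p assume p: "p \<in> Y"
    have "p \<in> topspace Z" using Y(1) p closedin_subset unfolding irreducible_closed_def by blast
    moreover have False if q: "p \<in> U F f" "p \<in> U F g"
    proof -
      obtain G c where G: "p = Pt G c" "G \<in> \<F>" "G \<subseteq> F" "c \<in> can G" "evalp f c \<noteq> 0"
        using q(1) unfolding U_def mem_Collect_eq by (elim exE conjE) (rule that)
      have "evalp g c \<noteq> 0" using q(2) Pt_in_U[OF G(2,4)] G(1) by simp
      then have "evalp (f * g) c \<noteq> 0" using ch_of_can[OF G(3,4) f(1,2)] G(5) by simp
      then show False using f(3) p G unfolding VI_def by blast
    qed
    ultimately show "p \<in> (topspace Z - U F f) \<union> (topspace Z - U F g)" by blast
  qed
  then have "Y \<subseteq> topspace Z - U F f \<or> Y \<subseteq> topspace Z - U F g"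
    using Y(1) closedin_compl_U[OF F f(1)] closedin_compl_U[OF F f(2)] unfolding irreducible_closed_def by blast
  moreover have "q \<in> VI F Y" if q: "q \<in> CR F" "Y \<subseteq> topspace Z - U F q" for q
    unfolding VI_def
  proof (intro CollectI conjI allI impI q(1))
    fix G c assume G: "G \<in> \<F>" "G \<subseteq> F" "c \<in> can G" "Pt G c \<in> Y"
    then have "Pt G c \<notin> U F q" using q(2) by blast
    then show "evalp q c = 0" using Pt_in_U[OF G(1,3)] G(2) by simp
  qed
  ultimately show "f \<in> VI F Y \<or> g \<in> VI F Y" using f by blast
qed

text \<open>An irreducible set that meets the chart is not contained in the union of a smaller closed set and the complement of the
  chart, so the two sets differ inside the chart.\<close>

lemma VI_strict:
  assumes F: "F \<in> \<F>" and Y: "irreducible_closed Z Y" and Y': "irreducible_closed Z Y'" "W F \<subseteq> Y'"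
    and sub: "Y \<subset> Y'"
  shows "VI F Y' \<subset> VI F Y"
proof
  show "VI F Y' \<subseteq> VI F Y" using sub by (auto simp: VI_def)
  have cY: "closedin Z Y" using Y by (simp add: irreducible_closed_def)
  have "\<not> Y' \<subseteq> topspace Z - U F 1"
  proof -
    have "Pt F (orb F (\<lambda>m\<in>dual_lattice D. 1)) \<in> U F 1"
      using Pt_in_U[OF F orb_can[OF torus_one]] evalp_one[OF can_ch[OF orb_can[OF torus_one, of F]]] by simp
    then show ?thesis using orbit_in_W[OF F torus_one] Y'(2) by blast
  qed
  then have "\<not> Y' \<subseteq> Y \<union> (topspace Z - U F 1)"
    using Y'(1) cY closedin_compl_U[OF F one_CR] sub unfolding irreducible_closed_def by blast
  then obtain p where p: "p \<in> Y'" "p \<notin> Y" "p \<notin> topspace Z - U F 1" by blast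
  have "p \<in> topspace Z" using Y'(1) p closedin_subset unfolding irreducible_closed_def by blast
  then have "p \<in> U F 1" using p by blast
  then obtain G c where G: "p = Pt G c" "G \<in> \<F>" "G \<subseteq> F" "c \<in> can G"
    unfolding U_def mem_Collect_eq by (elim exE conjE) (rule that)
  have V: "openin Z (topspace Z - Y)" using cY by blast
  have "Pt G c \<in> topspace Z - Y" using p(2) \<open>p \<in> topspace Z\<close> G(1) by blast
  then obtain h where h: "h \<in> CR F" "evalp h c \<noteq> 0" "U F h \<subseteq> topspace Z - Y"
    using open_contains_U[OF V F G(2,3,4)] by metis
  have "h \<in> VI F Y"
    unfolding VI_def
  proof (intro CollectI conjI allI impI h(1))
    fix G c assume G: "G \<in> \<F>" "G \<subseteq> F" "c \<in> can G" "Pt G c \<in> Y"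
    then have "Pt G c \<notin> U F h" using h(3) by blast
    then show "evalp h c = 0" using Pt_in_U[OF G(1,3)] G(2) by simp
  qed
  moreover have "h \<notin> VI F Y'" using h(2) p(1) G unfolding VI_def by blast
  ultimately show "VI F Y' \<noteq> VI F Y" by blast
qed

lemma VI_W_T:
  assumes F: "F \<in> \<F>" and f: "f \<in> VI F (W F)" and m: "m \<in> T F" shows "lookup f m = 0"
proof (rule ccontr)
  assume "lookup f m \<noteq> 0"
  then have "m \<in> keys f" by (simp add: in_keys_iff)
  then obtain t where t: "t \<in> torus D" "evalp f (orb F t) \<noteq> 0"
    using orb_nonvanishing[OF _ _ m] f unfolding VI_def by blast
  then show False using f orbit_in_W[OF F t(1)] orb_can[OF t(1), of F] F unfolding VI_def by blast
qed

end

context conifold begin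

text \<open>The exponent of a monomial in the units \<open>v x\<close>.\<close>

primrec Lf :: "'v list \<Rightarrow> nat list \<Rightarrow> ('v \<Rightarrow>\<^sub>0 int)" where
  "Lf [] \<alpha> = 0"
| "Lf (x # xs) \<alpha> = frag_cmul (int (hd \<alpha>)) (v x) + Lf xs (tl \<alpha>)"

lemma Lf_T: "set xs \<subseteq> X \<Longrightarrow> Lf xs \<alpha> \<in> T b"
  by (induction xs arbitrary: \<alpha>) (auto simp: T_zero v_T intro!: T_add T_cmul)

lemma Lf_off: "set xs \<subseteq> X \<Longrightarrow> x \<in> X - set xs \<Longrightarrow> lookup (Lf xs \<alpha>) x = 0"
  by (induction xs arbitrary: \<alpha>) (auto simp: lookup_add v_X)

lemma Lf_inj:
  "set xs \<subseteq> X \<Longrightarrow> distinct xs \<Longrightarrow> length \<alpha> = length xs \<Longrightarrow> length \<alpha>' = length xs \<Longrightarrow> Lf xs \<alpha> = Lf xs \<alpha>' \<Longrightarrow> \<alpha> = \<alpha>'"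
proof (induction xs arbitrary: \<alpha> \<alpha>')
  case (Cons x xs)
  obtain k \<beta> k' \<beta>' where \<alpha>: "\<alpha> = k # \<beta>" "\<alpha>' = k' # \<beta>'" using Cons.prems by (cases \<alpha>; cases \<alpha>') auto
  have off: "lookup (Lf xs \<gamma>) x = 0" for \<gamma> using Cons.prems by (intro Lf_off) auto
  have "lookup (Lf (x # xs) \<alpha>) x = lookup (Lf (x # xs) \<alpha>') x" using Cons.prems by simp
  then have "k = k'" using Cons.prems(1) by (simp add: \<alpha> lookup_add off v_X)
  moreover have "Lf xs \<beta> = Lf xs \<beta>'" using Cons.prems(5) \<open>k = k'\<close> by (simp add: \<alpha>)
  then have "\<beta> = \<beta>'" using Cons.IH[of \<beta> \<beta>'] Cons.prems \<alpha> by simp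
  ultimately show ?case by (simp add: \<alpha>)
qed simp

lemma single_power: "single m (1::complex) ^ n = single (frag_cmul (int n) m) 1"
proof (induction n)
  case (Suc n) then show ?case unfolding cmul_Suc by (simp add: mult_single add.commute)
qed simp

lemma mon_units: "mon (map (\<lambda>x. single (v x) (1::complex)) xs) \<alpha> = single (Lf xs \<alpha>) 1"
  by (induction xs arbitrary: \<alpha>) (simp_all add: single_power mult_single)

text \<open>The units \<open>v x\<close> restrict to independent characters on the open orbit of the stratum.\<close>

lemma units_algindep:
  assumes xs: "set xs \<subseteq> X" "distinct xs"
  shows "algindep (single 0) (map (\<lambda>x. single (v x) 1) xs) (VI b (W b))"
  unfolding algindep_def
proof (intro allI impI ballI)
  let ?zs = "map (\<lambda>x. single (v x) (1::complex)) xs"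
  fix A :: "nat list set" and a :: "nat list \<Rightarrow> complex" and \<alpha>
  assume A: "finite A" "\<forall>\<alpha>\<in>A. length \<alpha> = length ?zs"
    "(\<Sum>\<alpha>\<in>A. single 0 (a \<alpha>) * mon ?zs \<alpha>) \<in> VI b (W b)" "\<alpha> \<in> A"
  define f where "f = (\<Sum>\<alpha>\<in>A. single 0 (a \<alpha>) * mon ?zs \<alpha>)"
  have "f = (\<Sum>\<alpha>\<in>A. single (Lf xs \<alpha>) (a \<alpha>))" unfolding f_def mon_units by (simp add: mult_single)
  then have "lookup f (Lf xs \<alpha>) = (\<Sum>\<alpha>'\<in>A. if \<alpha>' = \<alpha> then a \<alpha>' else 0)"
    using A(2,4) Lf_inj[OF xs] by (auto simp: lookup_sum lookup_single when_def intro!: sum.cong)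
  then have "lookup f (Lf xs \<alpha>) = a \<alpha>" using A(1,4) by simp
  moreover have "lookup f (Lf xs \<alpha>) = 0"
    using VI_W_T[OF b _ Lf_T[OF xs(1)]] A(3) unfolding f_def by blast
  ultimately show "a \<alpha> = 0" by simp
qed

lemma mon_map_fr: "mon (map fr ys) \<alpha> = fr (mon ys \<alpha>)"
proof (induction ys arbitrary: \<alpha>)
  case Nil show ?case by (simp add: One_fract_def)
next
  case (Cons y ys) then show ?case by (simp only: list.map mon.simps fr_mult fr_power)
qed

text \<open>A chain of irreducible closed sets above the stratum gives a chain of primes below the vanishing ideal
  of the stratum in the chart of \<open>b\<close>; together with the \<open>card D - 3\<close> units, which are independent on the
  stratum, elements of the chain are algebraically independent.\<close>

lemma codim_upper:
  assumes Y: "Y 0 = W b" "\<And>i. i \<le> n \<Longrightarrow> irreducible_closed Z (Y i)" "\<And>i. i < n \<Longrightarrow> Y i \<subset> Y (Suc i)"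
  shows "n \<le> 3"
proof -
  have WY: "W b \<subseteq> Y i" if "i \<le> n" for i using that
  proof (induction i)
    case (Suc i) then show ?case using Y(3)[of i] by auto
  qed (simp add: Y(1))
  define Q where "Q i = VI b (Y (n - i))" for i
  obtain xs where xs: "set xs = X" "distinct xs" using finite_distinct_list[OF finX] by blast
  let ?zs = "map (\<lambda>x. single (v x) (1::complex)) xs"
  have prime: "prime_set (CR b) (Q i)" if "i \<le> n" for i
    unfolding Q_def using Y(2) WY by (intro VI_prime b) auto
  have strict: "Q i \<subset> Q (Suc i)" if i: "i < n" for i
  proof -
    have e: "n - i = Suc (n - Suc i)" using i by simp
    have "Y (n - Suc i) \<subset> Y (n - i)" unfolding e using Y(3)[of "n - Suc i"] i by simp
    then show ?thesis unfolding Q_def using Y(2) WY by (intro VI_strict b) auto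
  qed
  have zs: "set ?zs \<subseteq> CR b" using xs v_T T_S by (auto intro!: CR_single)
  have zQ: "algindep (single 0) ?zs (Q n)" unfolding Q_def using units_algindep[of xs] xs Y(1) by simp
  obtain ys where ys: "length ys = n + length ?zs" "set ys \<subseteq> CR b" "algindep (single 0) ys (Q 0)"
    using algindep_chain[OF sgl.scalars_axioms CR_single[OF S_zero] CR_subring prime strict zs zQ] by blast
  have Q0: "0 \<in> Q 0" using prime[of 0] by (auto simp: prime_set_def ideal_set_def)
  have "algindep const_fun (map fr ys) {0}"
    unfolding algindep_def
  proof (intro allI impI)
    fix A :: "nat list set" and a :: "nat list \<Rightarrow> complex"
    assume A: "finite A" "\<forall>\<alpha>\<in>A. length \<alpha> = length (map fr ys)" "(\<Sum>\<alpha>\<in>A. const_fun (a \<alpha>) * mon (map fr ys) \<alpha>) \<in> {0}"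
    have "fr (\<Sum>\<alpha>\<in>A. single 0 (a \<alpha>) * mon ys \<alpha>) = fr 0"
      using A(3) unfolding fr_sum fr_mult const_fun_def mon_map_fr by (simp only: singleton_iff fr_zero)
    then have "(\<Sum>\<alpha>\<in>A. single 0 (a \<alpha>) * mon ys \<alpha>) = 0" by (simp only: fr_eq_iff)
    then have "(\<Sum>\<alpha>\<in>A. single 0 (a \<alpha>) * mon ys \<alpha>) \<in> Q 0" using Q0 by simp
    then show "\<forall>\<alpha>\<in>A. a \<alpha> = 0"
      using spec[OF spec[OF ys(3)[unfolded algindep_def], of A], of a] A(1,2) by simp
  qed
  moreover have "set (map fr ys) \<subseteq> fracs D"
  proof
    fix y assume "y \<in> set (map fr ys)"
    then obtain f where f: "f \<in> CR b" "y = fr f" using ys(2) by auto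
    then show "y \<in> fracs D" unfolding fracs_def using CR_lattice[OF f(1)] dual_lattice_zero[of D]
      by (intro CollectI exI[of _ f] exI[of _ 1]) simp
  qed
  ultimately have "length (map fr ys) \<le> card D" by (intro algindep_length_le[OF finD])
  moreover have "length ?zs = card D - 3" using xs X(2) distinct_card by fastforce
  ultimately show ?thesis using ys(1) X(3) by simp
qed

lemma e13: "{e \<in> b. ip (u 0) e = 0} = {e1, e3}" "{e \<in> {e1, e3}. ip (u 2) e = 0} = {e3}"
  "{e \<in> {e3}. ip (u 3) e = 0} = {}"
  using u_ip by (auto simp: b_def)

text \<open>The faces \<open>{e1, e3}\<close>, \<open>{e3}\<close> and \<open>{}\<close> of the conifold cone give a chain of three larger orbit closures.\<close>

lemma codim: "codim_in Z (W b) = 3"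
proof (rule antisym)
  show "codim_in Z (W b) \<le> 3"
    unfolding codim_in_def
  proof (rule Sup_least)
    fix x assume "x \<in> {enat n | n. \<exists>Y. Y 0 = W b \<and> (\<forall>i\<le>n. irreducible_closed Z (Y i)) \<and> (\<forall>i<n. Y i \<subset> Y (Suc i))}"
    then obtain n Y where n: "x = enat n" "Y 0 = W b" "\<forall>i\<le>n. irreducible_closed Z (Y i)" "\<forall>i<n. Y i \<subset> Y (Suc i)" by blast
    then have "n \<le> 3" using codim_upper[of Y n] by blast
    then show "x \<le> 3" using n(1) by (simp add: numeral_eq_enat)
  qed
  have S13: "u 0 \<in> S b" "u 2 \<in> S {e1, e3}" "u 3 \<in> S {e3}"
    using u_S[of 0] u_S[of 2] u_S[of 3] S_anti[of "{e1,e3}" b] S_anti[of "{e3}" b] by (auto simp: b_def)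
  have F1: "{e1, e3} \<in> \<F>" using face_S[OF b S13(1)] e13(1) by simp
  have F2: "{e3} \<in> \<F>" using face_S[OF F1 S13(2)] e13(2) by simp
  define Fs where "Fs i = (if i = 0 then b else if i = 1 then {e1, e3} else if i = 2 then {e3} else {})" for i :: nat
  have Fs: "Fs i \<in> \<F>" for i using b F1 F2 empty by (simp add: Fs_def)
  have "e1 \<noteq> e3" using u_ip by auto
  moreover have "e2 \<noteq> e1" "e2 \<noteq> e3" using u_ip by auto
  ultimately have dec: "Fs (Suc i) \<subset> Fs i" if "i < 3" for i
    using that by (cases "i = 0"; cases "i = 1"; cases "i = 2") (auto simp: Fs_def b_def)
  have "\<exists>Y. Y 0 = W b \<and> (\<forall>i\<le>3. irreducible_closed Z (Y i)) \<and> (\<forall>i<3. Y i \<subset> Y (Suc i))"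
    by (intro exI[of _ "\<lambda>i. W (Fs i)"]) (use irreducible_W[OF Fs] W_strict[OF Fs Fs dec] in \<open>auto simp: Fs_def\<close>)
  then show "3 \<le> codim_in Z (W b)"
    unfolding codim_in_def numeral_eq_enat by (intro Sup_upper) blast
qed

end

section \<open>Polynomial rings and the node\<close>

type_synonym mpoly = "(nat \<Rightarrow>\<^sub>0 nat) \<Rightarrow>\<^sub>0 complex"

definition PR :: "nat \<Rightarrow> mpoly set" where
  "PR N = {f. \<forall>\<mu>\<in>keys f. keys \<mu> \<subseteq> {..<N}}"

lemma poly_ring_eq: "poly_ring N = cls_ring (PR N)"
  by (simp add: poly_ring_def cls_ring_def PR_def)

lemma PR_single: "keys \<mu> \<subseteq> {..<N} \<Longrightarrow> single \<mu> a \<in> PR N"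
  by (auto simp: PR_def)

lemma PR_subring: "subring_set (PR N)"
  unfolding subring_set_def
proof (intro conjI ballI)
  show "0 \<in> PR N" "1 \<in> PR N" by (auto simp: PR_def)
  fix f assume f: "f \<in> PR N"
  then show "- f \<in> PR N" by (auto simp: PR_def in_keys_iff)
  fix g assume g: "g \<in> PR N"
  show "f + g \<in> PR N" using f g Poly_Mapping.keys_add[of f g] by (auto simp: PR_def)
  show "f * g \<in> PR N"
    unfolding PR_def
  proof (intro CollectI ballI)
    fix \<mu> assume "\<mu> \<in> keys (f * g)"
    then obtain a b where ab: "\<mu> = a + b" "a \<in> keys f" "b \<in> keys g" using keys_mult[of f g] by blast
    have "keys a \<subseteq> {..<N}" "keys b \<subseteq> {..<N}" using ab f g by (auto simp: PR_def)
    then show "keys \<mu> \<subseteq> {..<N}" using Poly_Mapping.keys_add[of a b] ab(1) by blast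
  qed
qed

lemma PR_var: "i < N \<Longrightarrow> var i \<in> PR N" unfolding var_def by (rule PR_single) auto

definition pw :: "(nat \<Rightarrow> 'b::comm_ring_1) \<Rightarrow> (nat \<Rightarrow>\<^sub>0 nat) \<Rightarrow> 'b" where
  "pw \<rho> \<mu> = (\<Prod>i\<in>keys \<mu>. \<rho> i ^ lookup \<mu> i)"

lemma pw_superset: "finite A \<Longrightarrow> keys \<mu> \<subseteq> A \<Longrightarrow> pw \<rho> \<mu> = (\<Prod>i\<in>A. \<rho> i ^ lookup \<mu> i)"
  unfolding pw_def by (intro prod.mono_neutral_left) (auto simp: in_keys_iff)

lemma pw_zero [simp]: "pw \<rho> 0 = 1" by (simp add: pw_def)

lemma pw_add: "pw \<rho> (\<mu> + \<nu>) = pw \<rho> \<mu> * pw \<rho> \<nu>"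
proof -
  let ?A = "keys \<mu> \<union> keys \<nu>"
  have "keys (\<mu> + \<nu>) \<subseteq> ?A" by (rule Poly_Mapping.keys_add)
  then show ?thesis by (simp add: pw_superset[of ?A] lookup_add power_add prod.distrib)
qed

lemma pw_single: "pw \<rho> (single i n) = \<rho> i ^ n"
  by (subst pw_superset[of "{i}"]) auto

definition ev :: "(complex \<Rightarrow> 'b::comm_ring_1) \<Rightarrow> (nat \<Rightarrow> 'b) \<Rightarrow> mpoly \<Rightarrow> 'b" where
  "ev \<kappa> \<rho> = lin \<kappa> (pw \<rho>)"

context scalars begin

lemma ev_mult: "ev \<kappa> \<rho> (f * g) = ev \<kappa> \<rho> f * ev \<kappa> \<rho> g"
  unfolding ev_def by (rule lin_mult) (rule pw_add)

lemma ev_add: "ev \<kappa> \<rho> (f + g) = ev \<kappa> \<rho> f + ev \<kappa> \<rho> g" unfolding ev_def by (rule lin_add)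

lemma ev_diff: "ev \<kappa> \<rho> (f - g) = ev \<kappa> \<rho> f - ev \<kappa> \<rho> g" unfolding ev_def by (rule lin_diff)

lemma ev_const: "ev \<kappa> \<rho> (single 0 a) = \<kappa> a" unfolding ev_def by simp

lemma ev_one: "ev \<kappa> \<rho> 1 = 1" unfolding ev_def by (simp add: lin_one)

lemma ev_var: "ev \<kappa> \<rho> (var i) = \<rho> i"
  unfolding ev_def var_def by (simp add: \<kappa>_one pw_single)

lemma ev_in:
  assumes S: "subring_set S" and "\<And>a. \<kappa> a \<in> S" "\<And>i. \<rho> i \<in> S" shows "ev \<kappa> \<rho> f \<in> S"
proof -
  have "pw \<rho> \<mu> \<in> S" for \<mu>
  proof -
    have "(\<Prod>i\<in>A. \<rho> i ^ lookup \<mu> i) \<in> S" for A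
      by (induction A rule: infinite_finite_induct) (auto simp: assms subring_setD[OF S] subring_set_power[OF S])
    then show ?thesis by (simp add: pw_def)
  qed
  then show ?thesis unfolding ev_def lin_def using assms by (auto intro!: subring_set_sum[OF S] subring_setD(4)[OF S])
qed

text \<open>A ring homomorphism commutes with the evaluation of polynomials.\<close>

lemma hom_ev:
  assumes S: "subring_set S" and \<kappa>: "\<And>a. \<kappa> a \<in> S" and \<rho>: "\<And>i. \<rho> i \<in> S"
    and add: "\<And>x y. x \<in> S \<Longrightarrow> y \<in> S \<Longrightarrow> \<tau> (x + y) = \<tau> x + (\<tau> y :: 'c::comm_ring_1)"
    and mult: "\<And>x y. x \<in> S \<Longrightarrow> y \<in> S \<Longrightarrow> \<tau> (x * y) = \<tau> x * \<tau> y" and one: "\<tau> 1 = 1"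
  shows "\<tau> (ev \<kappa> \<rho> f) = ev (\<lambda>a. \<tau> (\<kappa> a)) (\<lambda>i. \<tau> (\<rho> i)) f"
proof -
  have "\<tau> 0 + 0 = \<tau> 0 + \<tau> 0" using add[of 0 0] subring_setD(1)[OF S] by (simp only: add_0_right)
  then have z: "\<tau> 0 = 0" by (simp only: add_left_cancel)
  have pow: "\<tau> (x ^ n) = \<tau> x ^ n" if "x \<in> S" for x n
    by (induction n) (auto simp: one mult that subring_set_power[OF S])
  have prodS: "(\<Prod>i\<in>A. \<rho> i ^ lookup \<mu> i) \<in> S" for A \<mu>
    by (induction A rule: infinite_finite_induct) (auto simp: \<rho> subring_setD[OF S] subring_set_power[OF S])
  have prod: "\<tau> (\<Prod>i\<in>A. \<rho> i ^ lookup \<mu> i) = (\<Prod>i\<in>A. \<tau> (\<rho> i) ^ lookup \<mu> i)" if "finite A" for A \<mu>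
    using that by (induction A rule: finite_induct) (auto simp: one mult prodS \<rho> subring_set_power[OF S] pow)
  have "\<tau> (\<Sum>\<mu>\<in>A. \<kappa> (lookup f \<mu>) * pw \<rho> \<mu>) =
      (\<Sum>\<mu>\<in>A. \<tau> (\<kappa> (lookup f \<mu>)) * pw (\<lambda>i. \<tau> (\<rho> i)) \<mu>) \<and> (\<Sum>\<mu>\<in>A. \<kappa> (lookup f \<mu>) * pw \<rho> \<mu>) \<in> S"
    if "finite A" for A
    using that
  proof (induction A rule: finite_induct)
    case empty then show ?case using z subring_setD(1)[OF S] by simp
  next
    case (insert \<mu> A)
    have p: "pw \<rho> \<mu> \<in> S" "\<tau> (pw \<rho> \<mu>) = pw (\<lambda>i. \<tau> (\<rho> i)) \<mu>" by (simp_all add: pw_def prodS prod)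
    then show ?case using insert by (simp add: add mult \<kappa> subring_setD[OF S])
  qed
  then show ?thesis by (simp add: ev_def lin_def)
qed

end

lemma pw_var: "pw var \<mu> = single \<mu> 1"
proof -
  have pow: "(var i :: mpoly) ^ n = single (single i n) 1" for i n
    by (induction n) (auto simp: var_def mult_single simp flip: single_add)
  have "(\<Prod>i\<in>A. single (f i) (1::complex)) = single (\<Sum>i\<in>A. f i) 1" if "finite A"
    for A and f :: "nat \<Rightarrow> nat \<Rightarrow>\<^sub>0 nat"
    using that by (induction A rule: finite_induct) (auto simp: mult_single)
  then have "pw var \<mu> = single (\<Sum>i\<in>keys \<mu>. single i (lookup \<mu> i)) 1"
    by (simp add: pw_def pow)
  also have "(\<Sum>i\<in>keys \<mu>. single i (lookup \<mu> i)) = \<mu>"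
  proof (rule poly_mapping_eqI)
    fix x
    show "lookup (\<Sum>i\<in>keys \<mu>. single i (lookup \<mu> i)) x = lookup \<mu> x"
      unfolding lookup_sum lookup_single when_def by (cases "x \<in> keys \<mu>") (simp_all add: in_keys_iff)
  qed
  finally show ?thesis .
qed

lemma ev_id: "ev (single 0) var f = f"
proof -
  have "ev (single 0) var f = (\<Sum>\<mu>\<in>keys f. single \<mu> (lookup f \<mu>))"
    unfolding ev_def lin_def pw_var by (simp add: mult_single)
  then show ?thesis using laurent_eq_sum_single[of f] by simp
qed

lemma ev_zero: "ev (\<lambda>a. a) (\<lambda>_. 0) f = lookup f 0"
proof -
  have pwz: "pw (\<lambda>_. 0::complex) \<mu> = (if \<mu> = 0 then 1 else 0)" for \<mu> :: "nat \<Rightarrow>\<^sub>0 nat"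
  proof (cases "\<mu> = 0")
    case False
    then obtain i where "i \<in> keys \<mu>" by (metis all_not_in_conv keys_eq_empty)
    then have "(\<Prod>i\<in>keys \<mu>. (0::complex) ^ lookup \<mu> i) = 0"
      by (intro prod_zero bexI[of _ i]) (auto simp: in_keys_iff)
    then show ?thesis using False by (simp add: pw_def)
  qed simp
  have "ev (\<lambda>a. a) (\<lambda>_. 0) f = (\<Sum>\<mu>\<in>keys f. if \<mu> = 0 then lookup f \<mu> else 0)"
    unfolding ev_def lin_def pwz by (intro sum.cong refl) simp
  then show ?thesis by (simp add: in_keys_iff)
qed

text \<open>The automorphism of the polynomial ring that translates affine space by \<open>a\<close>.\<close>

definition sh :: "(nat \<Rightarrow> complex) \<Rightarrow> mpoly \<Rightarrow> mpoly" where
  "sh a = ev (single 0) (\<lambda>i. var i + single 0 (a i))"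

lemma sh_inverse: assumes "\<And>i. b i = - a i" shows "sh a (sh b f) = f"
proof -
  have "sh a (sh b f) = ev (\<lambda>c. sh a (single 0 c)) (\<lambda>i. sh a (var i + single 0 (b i))) f"
    unfolding sh_def[of b]
    by (rule sgl.hom_ev[where S = UNIV]) (auto simp: subring_set_def sh_def sgl.ev_add sgl.ev_mult sgl.ev_one)
  also have "(\<lambda>c. sh a (single 0 c)) = single 0" by (simp add: sh_def sgl.ev_const)
  also have "(\<lambda>i. sh a (var i + single 0 (b i))) = var"
    by (rule ext) (simp add: sh_def sgl.ev_add sgl.ev_const sgl.ev_var assms add.assoc flip: single_add)
  finally show ?thesis by (simp add: ev_id)
qed

lemma sh_PR: assumes "f \<in> PR N" and a: "\<And>i. N \<le> i \<Longrightarrow> a i = 0" shows "sh a f \<in> PR N"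
proof -
  have "pw (\<lambda>i. var i + single 0 (a i)) \<mu> \<in> PR N" if "\<mu> \<in> keys f" for \<mu>
  proof -
    have k: "keys \<mu> \<subseteq> {..<N}" using that assms(1) by (auto simp: PR_def)
    have "(\<Prod>i\<in>A. (var i + single 0 (a i)) ^ lookup \<mu> i) \<in> PR N" if "A \<subseteq> {..<N}" for A
      using that
    proof (induction A rule: infinite_finite_induct)
      case (insert i A)
      have "var i + single 0 (a i) \<in> PR N"
        using insert by (intro subring_setD(3)[OF PR_subring] PR_var PR_single) auto
      then show ?case using insert by (simp add: subring_setD[OF PR_subring] subring_set_power[OF PR_subring])
    qed (auto simp: subring_setD[OF PR_subring])
    then show ?thesis using k by (simp add: pw_def)
  qed
  moreover have "single 0 x \<in> PR N" for x by (rule PR_single) simp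
  ultimately show ?thesis unfolding sh_def ev_def lin_def
    by (intro subring_set_sum[OF PR_subring] subring_setD(4)[OF PR_subring])
qed

lemma sh_var: "a i = 0 \<Longrightarrow> sh a (var i) = var i" by (simp add: sh_def sgl.ev_var)

lemma sh_mult: "sh a (f * g) = sh a f * sh a g" unfolding sh_def by (rule sgl.ev_mult)
lemma sh_add: "sh a (f + g) = sh a f + sh a g" unfolding sh_def by (rule sgl.ev_add)
lemma sh_diff: "sh a (f - g) = sh a f - sh a g" unfolding sh_def by (rule sgl.ev_diff)

abbreviation nodeq :: mpoly where "nodeq \<equiv> var 0 * var 1 - var 2 * var 3"

lemma nodeq_PR: "nodeq \<in> PR (4 + r)"
  by (intro subring_set_diff[OF PR_subring] subring_setD(4)[OF PR_subring] PR_var) auto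

lemma node_ideal_eq: "node_ideal r = {a * nodeq | a. a \<in> PR (4 + r)}"
proof -
  have "node_ideal r = {\<Sum>g\<in>{nodeq}. a g * g | a. \<forall>g\<in>{nodeq}. a g \<in> PR (4 + r)}"
    unfolding node_ideal_def poly_ring_eq using nodeq_PR[of r] by (intro Idl_cls_ring PR_subring) simp_all
  also have "\<dots> = {a * nodeq | a. a \<in> PR (4 + r)}"
  proof (rule Set.equalityI; rule subsetI)
    fix x assume "x \<in> {\<Sum>g\<in>{nodeq}. a g * g | a. \<forall>g\<in>{nodeq}. a g \<in> PR (4 + r)}"
    then show "x \<in> {a * nodeq | a. a \<in> PR (4 + r)}" by auto
  next
    fix x assume "x \<in> {a * nodeq | a. a \<in> PR (4 + r)}"
    then obtain a where "x = a * nodeq" "a \<in> PR (4 + r)" by blast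
    then show "x \<in> {\<Sum>g\<in>{nodeq}. a g * g | a. \<forall>g\<in>{nodeq}. a g \<in> PR (4 + r)}"
      by (intro CollectI exI[of _ "\<lambda>_. a"]) simp
  qed
  finally show ?thesis .
qed

lemma node_ideal_ideal: "ideal (node_ideal r) (poly_ring (4 + r))"
proof -
  interpret cring "poly_ring (4 + r)" unfolding poly_ring_eq by (rule cring_cls_ring[OF PR_subring])
  show ?thesis unfolding node_ideal_def using nodeq_PR[of r] by (intro genideal_ideal) (simp add: poly_ring_eq)
qed

lemma node_ideal_set: "ideal_set (PR (4 + r)) (node_ideal r)"
  using node_ideal_ideal[of r] unfolding poly_ring_eq by (simp add: ideal_cls_ring_iff[OF PR_subring])

lemma power_diff_node: "(var 0 * var 1) ^ k - (var 2 * var 3) ^ k \<in> node_ideal r"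
proof (induction k)
  case 0 then show ?case using ideal_setD(2)[OF node_ideal_set] by simp
next
  case (Suc k)
  let ?A = "var 0 * var 1 :: mpoly" and ?B = "var 2 * var 3 :: mpoly"
  have P: "?A \<in> PR (4 + r)" "?B \<in> PR (4 + r)" by (intro subring_setD(4)[OF PR_subring] PR_var; simp)+
  have q: "nodeq \<in> node_ideal r"
    unfolding node_ideal_eq using subring_setD(2)[OF PR_subring] by (intro CollectI exI[of _ 1]) simp
  have "?A ^ Suc k - ?B ^ Suc k = ?A * (?A ^ k - ?B ^ k) + ?B ^ k * nodeq" by (simp add: algebra_simps)
  also have "\<dots> \<in> node_ideal r"
    by (intro ideal_setD(3)[OF node_ideal_set] ideal_setD(4)[OF node_ideal_set] Suc q P subring_set_power[OF PR_subring])
  finally show ?case .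
qed

text \<open>Modulo \<open>xy = zw\<close> every monomial is equal to one that is not divisible by \<open>xy\<close>.\<close>

definition red :: "(nat \<Rightarrow>\<^sub>0 nat) \<Rightarrow> (nat \<Rightarrow>\<^sub>0 nat)" where
  "red \<mu> = (let k = min (lookup \<mu> 0) (lookup \<mu> 1) in
     (\<mu> - (single 0 k + single 1 k)) + (single 2 k + single 3 k))"

lemma lookup_red: "lookup (red \<mu>) i =
   (let k = min (lookup \<mu> 0) (lookup \<mu> 1) in
    if i = 0 \<or> i = 1 then lookup \<mu> i - k
    else if i = 2 \<or> i = 3 then lookup \<mu> i + k else lookup \<mu> i)"
  by (auto simp: red_def Let_def lookup_add lookup_minus lookup_single when_def)

lemma red_zero: "lookup (red \<mu>) 0 = 0 \<or> lookup (red \<mu>) 1 = 0"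
  by (auto simp: lookup_red Let_def)

lemma red_keys: "keys \<mu> \<subseteq> {..<4 + r} \<Longrightarrow> keys (red \<mu>) \<subseteq> {..<4 + r}"
  by (auto simp: in_keys_iff subset_iff lookup_red Let_def split: if_splits)

lemma single_as_pw: "single \<mu> (a::complex) = single 0 a * pw var \<mu>"
  by (simp add: pw_var mult_single)

lemma red_congruent:
  assumes k: "keys \<mu> \<subseteq> {..<4 + r}"
  shows "single \<mu> a - single (red \<mu>) a \<in> node_ideal r"
proof -
  define k where "k = min (lookup \<mu> 0) (lookup \<mu> 1)"
  define \<nu> where "\<nu> = \<mu> - (single 0 k + single 1 k)"
  have 1: "\<mu> = \<nu> + (single 0 k + single 1 k)"
    by (rule poly_mapping_eqI) (auto simp: \<nu>_def k_def lookup_add lookup_minus lookup_single when_def)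
  have 2: "red \<mu> = \<nu> + (single 2 k + single 3 k)" by (simp add: red_def \<nu>_def k_def Let_def)
  have "pw var \<mu> - pw var (red \<mu>) = pw var \<nu> * ((var 0 * var 1) ^ k - (var 2 * var 3) ^ k)"
    unfolding 2 by (subst 1) (simp add: pw_add pw_single power_mult_distrib algebra_simps)
  then have e: "single \<mu> a - single (red \<mu>) a =
     (single 0 a * pw var \<nu>) * ((var 0 * var 1) ^ k - (var 2 * var 3) ^ k)"
    unfolding single_as_pw[of \<mu>] single_as_pw[of "red \<mu>"] by (simp only: mult.assoc flip: right_diff_distrib)
  have "keys \<nu> \<subseteq> {..<4 + r}"
    using assms by (auto simp: \<nu>_def in_keys_iff lookup_minus subset_iff)
  then have "single 0 a * pw var \<nu> \<in> PR (4 + r)"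
    unfolding single_as_pw[symmetric] by (rule PR_single)
  then show ?thesis unfolding e by (intro ideal_setD(4)[OF node_ideal_set power_diff_node])
qed

text \<open>A map to Laurent polynomials that sends variables to characters and kills \<open>xy - zw\<close> has no other
  kernel if it is injective on reduced monomials.\<close>

lemma node_kernel:
  fixes L :: "(nat \<Rightarrow>\<^sub>0 nat) \<Rightarrow> ('v::linorder \<Rightarrow>\<^sub>0 int)"
  assumes \<rho>: "\<And>\<mu>. keys \<mu> \<subseteq> {..<4 + r} \<Longrightarrow> pw \<rho> \<mu> = single (L \<mu>) 1"
    and zero: "ev (single 0) \<rho> nodeq = 0"
    and inj: "\<And>\<mu> \<nu>. keys \<mu> \<subseteq> {..<4 + r} \<Longrightarrow> keys \<nu> \<subseteq> {..<4 + r} \<Longrightarrow>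
      lookup \<mu> 0 = 0 \<or> lookup \<mu> 1 = 0 \<Longrightarrow>
      lookup \<nu> 0 = 0 \<or> lookup \<nu> 1 = 0 \<Longrightarrow> L \<mu> = L \<nu> \<Longrightarrow> \<mu> = \<nu>"
    and f: "f \<in> PR (4 + r)" "ev (single 0) \<rho> f = 0"
  shows "f \<in> node_ideal r"
proof -
  let ?E = "ev (single 0) \<rho> :: mpoly \<Rightarrow> 'v laurent"
  define f' where "f' = (\<Sum>\<mu>\<in>keys f. single (red \<mu>) (lookup f \<mu>))"
  have "f - f' = (\<Sum>\<mu>\<in>keys f. single \<mu> (lookup f \<mu>) -
      single (red \<mu>) (lookup f \<mu>))"
    unfolding f'_def sum_subtractf using laurent_eq_sum_single[of f] by simp
  also have "\<dots> \<in> node_ideal r"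
    using f(1) by (intro ideal_set_sum[OF node_ideal_set] red_congruent) (auto simp: PR_def)
  finally have ff': "f - f' \<in> node_ideal r" .
  then obtain a where a: "f - f' = a * nodeq" unfolding node_ideal_eq by blast
  have "?E (f - f') = 0" by (simp only: a sgl.ev_mult zero mult_zero_right)
  then have E0: "?E f' = 0" using f(2) by (simp add: sgl.ev_diff)
  have keys: "keys f' \<subseteq> red ` keys f"
    unfolding f'_def by (rule order_trans[OF keys_sum]) (auto split: if_splits)
  have kf: "keys \<nu> \<subseteq> {..<4 + r} \<and> (lookup \<nu> 0 = 0 \<or> lookup \<nu> 1 = 0)"
    if \<nu>: "\<nu> \<in> keys f'" for \<nu>
  proof -
    obtain \<mu> where \<mu>: "\<nu> = red \<mu>" "\<mu> \<in> keys f" using \<nu> keys by blast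
    have k: "keys \<mu> \<subseteq> {..<4 + r}" using f(1) \<mu>(2) unfolding PR_def by blast
    show ?thesis unfolding \<mu>(1) by (intro conjI red_keys[OF k] red_zero)
  qed
  have E: "?E f' = (\<Sum>\<nu>\<in>keys f'. single (L \<nu>) (lookup f' \<nu>))"
    unfolding ev_def lin_def using kf \<rho> by (intro sum.cong refl) (simp add: mult_single)
  have "keys f' = {}"
  proof (rule ccontr)
    assume "keys f' \<noteq> {}"
    then obtain \<nu> where \<nu>: "\<nu> \<in> keys f'" by blast
    have "lookup (?E f') (L \<nu>) = (\<Sum>\<nu>'\<in>keys f'. if \<nu>' = \<nu> then lookup f' \<nu>' else 0)"
      unfolding E lookup_sum lookup_single when_def
    proof (intro sum.cong refl)
      fix \<nu>' assume \<nu>': "\<nu>' \<in> keys f'"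
      have "L \<nu>' = L \<nu> \<longleftrightarrow> \<nu>' = \<nu>"
      proof
        assume e: "L \<nu>' = L \<nu>"
        show "\<nu>' = \<nu>"
          by (rule inj[OF kf[OF \<nu>', THEN conjunct1] kf[OF \<nu>, THEN conjunct1] kf[OF \<nu>', THEN conjunct2] kf[OF \<nu>, THEN conjunct2] e])
      qed simp
      then show "(if L \<nu>' = L \<nu> then lookup f' \<nu>' else 0) = (if \<nu>' = \<nu> then lookup f' \<nu>' else 0)" by simp
    qed
    also have "\<dots> = lookup f' \<nu>" using \<nu> by simp
    finally show False using E0 \<nu> by (simp add: in_keys_iff)
  qed
  then have "f' = 0" by simp
  then show ?thesis using ff' by simp
qed

subsection \<open>The coordinate ring of the node\<close>

lemma node_cring: "cring (node_ring r)"
proof -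
  interpret ideal "node_ideal r" "poly_ring (4 + r)" by (rule node_ideal_ideal)
  have "cring (poly_ring (4 + r))" unfolding poly_ring_eq by (rule cring_cls_ring[OF PR_subring])
  then show ?thesis unfolding node_ring_def by (rule quotient_is_cring)
qed

lemma node_carrier: "carrier (node_ring r) = node_class r ` PR (4 + r)"
  using ideal.quot_carrier[OF node_ideal_ideal, of r] unfolding node_ring_def node_class_def by (simp add: poly_ring_eq)

lemma node_class_mult:
  "f \<in> PR (4 + r) \<Longrightarrow> g \<in> PR (4 + r) \<Longrightarrow> node_class r f \<otimes>\<^bsub>node_ring r\<^esub> node_class r g = node_class r (f * g)"
  using ideal.quot_mult[OF node_ideal_ideal, of f r g] unfolding node_ring_def node_class_def by (simp add: poly_ring_eq)

lemma node_class_add: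
  "f \<in> PR (4 + r) \<Longrightarrow> g \<in> PR (4 + r) \<Longrightarrow> node_class r f \<oplus>\<^bsub>node_ring r\<^esub> node_class r g = node_class r (f + g)"
  using ideal.quot_add[OF node_ideal_ideal, of f r g] unfolding node_ring_def node_class_def by (simp add: poly_ring_eq)

lemma node_class_one: "\<one>\<^bsub>node_ring r\<^esub> = node_class r 1"
  unfolding node_ring_def node_class_def quot_one by (simp add: poly_ring_eq)

lemma node_class_mem:
  assumes "f \<in> PR (4 + r)" shows "g \<in> node_class r f \<longleftrightarrow> g \<in> PR (4 + r) \<and> g - f \<in> node_ideal r"
proof (cases "g \<in> PR (4 + r)")
  case True
  then show ?thesis using assms ideal.coset_mem_iff[OF node_ideal_ideal, of f r g]
    unfolding node_class_def by (simp add: poly_ring_eq cls_ring_minus[OF PR_subring])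
next
  case False
  then show ?thesis using ideal.coset_sub[OF node_ideal_ideal, of f r] assms unfolding node_class_def by (auto simp: poly_ring_eq)
qed

lemma node_class_eq:
  assumes "f \<in> PR (4 + r)" "g \<in> PR (4 + r)" shows "node_class r f = node_class r g \<longleftrightarrow> f - g \<in> node_ideal r"
proof
  assume "node_class r f = node_class r g"
  moreover have "f \<in> node_class r f" unfolding node_class_mem[OF assms(1)] using assms ideal_setD(2)[OF node_ideal_set] by simp
  ultimately have "f \<in> node_class r g" by simp
  then show "f - g \<in> node_ideal r" using node_class_mem[OF assms(2)] by blast
next
  assume "f - g \<in> node_ideal r"
  then have "f \<in> node_ideal r +>\<^bsub>poly_ring (4 + r)\<^esub> g"
    using node_class_mem[OF assms(2), of f] assms(1) unfolding node_class_def by simp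
  then show "node_class r f = node_class r g"
    unfolding node_class_def using ideal.coset_eq[OF node_ideal_ideal, of g r f] assms by (simp add: poly_ring_eq)
qed

lemma node_class_minus:
  assumes f: "f \<in> PR (4 + r)" "g \<in> PR (4 + r)"
  shows "node_class r f \<ominus>\<^bsub>node_ring r\<^esub> node_class r g = node_class r (f - g)"
proof -
  interpret cring "node_ring r" by (rule node_cring)
  have fg: "f - g \<in> PR (4 + r)" using f by (rule subring_set_diff[OF PR_subring])
  have cl: "node_class r h \<in> carrier (node_ring r)" if "h \<in> PR (4 + r)" for h using that node_carrier by blast
  have "node_class r (f - g) \<oplus>\<^bsub>node_ring r\<^esub> node_class r g = node_class r f" using node_class_add[OF fg f(2)] by simp
  then have "node_class r f \<ominus>\<^bsub>node_ring r\<^esub> node_class r g =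
     (node_class r (f - g) \<oplus>\<^bsub>node_ring r\<^esub> node_class r g) \<ominus>\<^bsub>node_ring r\<^esub> node_class r g" by simp
  also have "\<dots> = node_class r (f - g)"
    using cl[OF fg] cl[OF f(2)] by (simp add: a_minus_def a_assoc r_neg)
  finally show ?thesis .
qed

text \<open>An ideal of the node is given by an ideal of the polynomial ring that contains the equation.\<close>

lemma node_ideal_image:
  assumes I: "ideal_set (PR (4 + r)) I"
  shows "ideal (node_class r ` I) (node_ring r)"
proof -
  interpret cring "node_ring r" by (rule node_cring)
  note IP = ideal_setD(1)[OF I]
  have sub: "node_class r ` I \<subseteq> carrier (node_ring r)" using IP node_carrier by blast
  show ?thesis
  proof (rule idealI)
    show "ring (node_ring r)" by (rule ring_axioms)
    show "subgroup (node_class r ` I) (add_monoid (node_ring r))"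
    proof (rule subgroup.intro)
      show "node_class r ` I \<subseteq> carrier (add_monoid (node_ring r))" using sub by simp
      fix x y assume "x \<in> node_class r ` I" "y \<in> node_class r ` I"
      then obtain f g where fg: "x = node_class r f" "f \<in> I" "y = node_class r g" "g \<in> I" by blast
      have "x \<oplus>\<^bsub>node_ring r\<^esub> y = node_class r (f + g)" unfolding fg(1,3) using IP fg by (intro node_class_add) auto
      then show "x \<otimes>\<^bsub>add_monoid (node_ring r)\<^esub> y \<in> node_class r ` I" using ideal_setD(3)[OF I fg(2,4)] by simp
    next
      have "\<zero>\<^bsub>node_ring r\<^esub> = node_class r 0"
      proof -
        have P0: "0 \<in> PR (4 + r)" by (rule subring_setD(1)[OF PR_subring])
        have c0: "node_class r 0 \<in> carrier (node_ring r)" using P0 node_carrier by blast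
        have "node_class r 0 \<oplus>\<^bsub>node_ring r\<^esub> node_class r 0 = node_class r 0" using node_class_add[OF P0 P0] by simp
        then show ?thesis using c0 by (metis add.l_cancel_one' )
      qed
      then show "\<one>\<^bsub>add_monoid (node_ring r)\<^esub> \<in> node_class r ` I" using ideal_setD(2)[OF I] by auto
      fix x assume "x \<in> node_class r ` I"
      then obtain f where f: "x = node_class r f" "f \<in> I" by blast
      have P: "f \<in> PR (4 + r)" "0 \<in> PR (4 + r)" using IP f subring_setD(1)[OF PR_subring] by auto
      have "\<ominus>\<^bsub>node_ring r\<^esub> x = \<zero>\<^bsub>node_ring r\<^esub> \<ominus>\<^bsub>node_ring r\<^esub> x"
      proof -
        have xc: "x \<in> carrier (node_ring r)" using f P node_carrier by blast
        show ?thesis using l_zero[OF a_inv_closed[OF xc]] by (simp add: a_minus_def)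
      qed
      then have "\<ominus>\<^bsub>node_ring r\<^esub> x = node_class r (0 - f)"
        unfolding \<open>\<zero>\<^bsub>node_ring r\<^esub> = node_class r 0\<close> f(1) by (simp only: node_class_minus[OF P(2,1)])
      moreover have "0 - f \<in> I" using ideal_set_uminus[OF PR_subring I f(2)] by simp
      ultimately show "inv\<^bsub>add_monoid (node_ring r)\<^esub> x \<in> node_class r ` I" by (simp add: a_inv_def)
    qed
    fix a x assume "a \<in> node_class r ` I" "x \<in> carrier (node_ring r)"
    then obtain f g where fg: "a = node_class r f" "f \<in> I" "x = node_class r g" "g \<in> PR (4 + r)" unfolding node_carrier by blast
    have P: "f \<in> PR (4 + r)" using IP fg by auto
    have gf: "g * f \<in> I" using ideal_setD(4)[OF I fg(2,4)] .
    show "x \<otimes>\<^bsub>node_ring r\<^esub> a \<in> node_class r ` I" unfolding fg(1,3) node_class_mult[OF fg(4) P] using gf by blast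
    show "a \<otimes>\<^bsub>node_ring r\<^esub> x \<in> node_class r ` I" unfolding fg(1,3) node_class_mult[OF P fg(4)] mult.commute[of f] using gf by blast
  qed
qed

text \<open>The ideal generated by the variables with index in \<open>V\<close>.\<close>

definition mono_ideal :: "nat \<Rightarrow> nat set \<Rightarrow> mpoly set" where
  "mono_ideal r V = {g \<in> PR (4 + r). \<forall>\<mu>\<in>keys g. \<exists>i\<in>V. 0 < lookup \<mu> i}"

lemma mono_ideal_set: "ideal_set (PR (4 + r)) (mono_ideal r V)"
  unfolding ideal_set_def
proof (intro conjI ballI)
  show "mono_ideal r V \<subseteq> PR (4 + r)" by (auto simp: mono_ideal_def)
  show "0 \<in> mono_ideal r V" using subring_setD(1)[OF PR_subring] by (auto simp: mono_ideal_def)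
  fix f assume f: "f \<in> mono_ideal r V"
  { fix g assume "g \<in> mono_ideal r V"
    then show "f + g \<in> mono_ideal r V"
      using f Poly_Mapping.keys_add[of f g] subring_setD(3)[OF PR_subring, of f "4 + r" g] by (auto simp: mono_ideal_def) }
  { fix g assume g: "g \<in> PR (4 + r)"
    have "\<exists>i\<in>V. 0 < lookup \<mu> i" if \<mu>: "\<mu> \<in> keys (g * f)" for \<mu>
    proof -
      obtain a b where ab: "\<mu> = a + b" "b \<in> keys f" using \<mu> keys_mult[of g f] by blast
      then obtain i where "i \<in> V" "0 < lookup b i" using f by (auto simp: mono_ideal_def)
      then show ?thesis unfolding ab(1) lookup_add by auto
    qed
    moreover have "g * f \<in> PR (4 + r)" using g f subring_setD(4)[OF PR_subring] by (auto simp: mono_ideal_def)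
    ultimately show "g * f \<in> mono_ideal r V" by (simp add: mono_ideal_def) }
qed

lemma var_mono: "i \<in> V \<Longrightarrow> i < 4 + r \<Longrightarrow> var i \<in> mono_ideal r V"
  using PR_var[of i "4 + r"] by (auto simp: mono_ideal_def var_def intro!: bexI[of _ i])

lemma node_ideal_mono: assumes V: "{..<4} \<subseteq> V" shows "node_ideal r \<subseteq> mono_ideal r V"
proof -
  have v: "var i \<in> mono_ideal r V" if "i < 4" for i using that V by (intro var_mono) auto
  have "nodeq \<in> mono_ideal r V"
    by (intro ideal_set_diff[OF PR_subring mono_ideal_set] ideal_setD(4)[OF mono_ideal_set] v PR_var) auto
  then show ?thesis unfolding node_ideal_eq using ideal_setD(4)[OF mono_ideal_set] by blast
qed

lemma class_in_mono:
  assumes V: "{..<4} \<subseteq> V" and f: "f \<in> PR (4 + r)"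
  shows "node_class r f \<in> node_class r ` mono_ideal r V \<longleftrightarrow> f \<in> mono_ideal r V"
proof
  assume "node_class r f \<in> node_class r ` mono_ideal r V"
  then obtain g where g: "g \<in> mono_ideal r V" "node_class r f = node_class r g" by blast
  have "g \<in> PR (4 + r)" using g ideal_setD(1)[OF mono_ideal_set] by blast
  then have "f - g \<in> mono_ideal r V" using g(2) node_class_eq[OF f] node_ideal_mono[OF V] by blast
  then show "f \<in> mono_ideal r V" using ideal_setD(3)[OF mono_ideal_set _ g(1)] by fastforce
qed simp

text \<open>Each monomial of an element of \<open>mono_ideal\<close> is divisible by one of the variables; conversely the equation of the node lies
  in the ideal, which therefore descends to the quotient.\<close>

lemma node_Idl:
  assumes V: "{..<4} \<subseteq> V" "V \<subseteq> {..<4 + r}"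
  shows "Idl\<^bsub>node_ring r\<^esub> ((\<lambda>i. node_class r (var i)) ` V) = node_class r ` mono_ideal r V"
proof
  interpret cring "node_ring r" by (rule node_cring)
  let ?X = "(\<lambda>i. node_class r (var i)) ` V"
  have X: "?X \<subseteq> node_class r ` mono_ideal r V" using V var_mono by blast
  then show "Idl\<^bsub>node_ring r\<^esub> ?X \<subseteq> node_class r ` mono_ideal r V"
    by (rule genideal_minimal[OF node_ideal_image[OF mono_ideal_set]])
  have Xc: "?X \<subseteq> carrier (node_ring r)" using V PR_var unfolding node_carrier by blast
  have I: "ideal (Idl\<^bsub>node_ring r\<^esub> ?X) (node_ring r)" by (rule genideal_ideal[OF Xc])
  have XI: "?X \<subseteq> Idl\<^bsub>node_ring r\<^esub> ?X" by (rule genideal_self[OF Xc])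
  show "node_class r ` mono_ideal r V \<subseteq> Idl\<^bsub>node_ring r\<^esub> ?X"
  proof
    fix y assume "y \<in> node_class r ` mono_ideal r V"
    then obtain g where g: "y = node_class r g" "g \<in> mono_ideal r V" by blast
    have mono: "node_class r (single \<mu> a) \<in> Idl\<^bsub>node_ring r\<^esub> ?X \<and> single \<mu> a \<in> PR (4 + r)"
      if \<mu>: "\<mu> \<in> keys g" for \<mu> a
    proof -
      obtain i where i: "i \<in> V" "0 < lookup \<mu> i" using g(2) \<mu> by (auto simp: mono_ideal_def)
      have k: "keys \<mu> \<subseteq> {..<4 + r}" using g(2) \<mu> by (auto simp: mono_ideal_def PR_def)
      define \<nu> where "\<nu> = \<mu> - single i 1"
      have e: "\<mu> = \<nu> + single i 1"
        using i(2) by (intro poly_mapping_eqI) (auto simp: \<nu>_def lookup_add lookup_minus lookup_single when_def)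
      have "keys \<nu> \<subseteq> {..<4 + r}" using k by (auto simp: \<nu>_def in_keys_iff lookup_minus subset_iff)
      then have P: "single \<nu> a \<in> PR (4 + r)" by (rule PR_single)
      have Pv: "var i \<in> PR (4 + r)" using i(1) V by (intro PR_var) auto
      have "single \<mu> a = single \<nu> a * var i" unfolding var_def e by (simp add: mult_single)
      then have "node_class r (single \<mu> a) =
          node_class r (single \<nu> a) \<otimes>\<^bsub>node_ring r\<^esub> node_class r (var i)"
        by (simp add: node_class_mult[OF P Pv])
      moreover have "node_class r (var i) \<in> Idl\<^bsub>node_ring r\<^esub> ?X" using XI i(1) by blast
      moreover have "node_class r (single \<nu> a) \<in> carrier (node_ring r)" using P node_carrier by blast
      ultimately show ?thesis using ideal.I_l_closed[OF I] PR_single[OF k] by simp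
    qed
    have "node_class r (\<Sum>\<mu>\<in>A. single \<mu> (lookup g \<mu>)) \<in> Idl\<^bsub>node_ring r\<^esub> ?X \<and>
        (\<Sum>\<mu>\<in>A. single \<mu> (lookup g \<mu>)) \<in> PR (4 + r)"
      if "finite A" "A \<subseteq> keys g" for A
      using that
    proof (induction A rule: finite_induct)
      case empty
      have P0: "0 \<in> PR (4 + r)" by (rule subring_setD(1)[OF PR_subring])
      have "node_class r 0 \<oplus>\<^bsub>node_ring r\<^esub> node_class r 0 = node_class r 0" using node_class_add[OF P0 P0] by simp
      moreover have "node_class r 0 \<in> carrier (node_ring r)" using P0 node_carrier by blast
      ultimately have "node_class r 0 = \<zero>\<^bsub>node_ring r\<^esub>" by (metis add.l_cancel_one')
      then show ?case using P0 additive_subgroup.zero_closed[OF ideal.axioms(1)[OF I]] by simp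
    next
      case (insert \<mu> A)
      have m: "\<mu> \<in> keys g" using insert by simp
      let ?s = "single \<mu> (lookup g \<mu>)" and ?t = "\<Sum>\<mu>\<in>A. single \<mu> (lookup g \<mu>)"
      have t: "node_class r ?t \<in> Idl\<^bsub>node_ring r\<^esub> ?X" "?t \<in> PR (4 + r)" using insert by auto
      have s: "node_class r ?s \<in> Idl\<^bsub>node_ring r\<^esub> ?X" "?s \<in> PR (4 + r)" using mono[OF m] by auto
      have "node_class r (?s + ?t) \<in> Idl\<^bsub>node_ring r\<^esub> ?X"
        using additive_subgroup.a_closed[OF ideal.axioms(1)[OF I] s(1) t(1)] node_class_add[OF s(2) t(2)] by simp
      then show ?case using insert.hyps subring_setD(3)[OF PR_subring s(2) t(2)] by simp
    qed
    then have "node_class r (\<Sum>\<mu>\<in>keys g. single \<mu> (lookup g \<mu>)) \<in> Idl\<^bsub>node_ring r\<^esub> ?X"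
      by simp
    then show "y \<in> Idl\<^bsub>node_ring r\<^esub> ?X" unfolding g(1) laurent_eq_sum_single[symmetric] .
  qed
qed

lemma node_origin_eq: "node_origin r = node_class r ` mono_ideal r {..<4 + r}"
  unfolding node_origin_def by (rule node_Idl) auto

lemma node_axis_eq: "node_axis r = node_class r ` mono_ideal r {..<4}"
  unfolding node_axis_def by (rule node_Idl) auto

section \<open>The transversal node\<close>

lemma sum_lessThan_4: "(\<Sum>i<4. f i) = f 0 + f 1 + f 2 + f (3::nat)" for f :: "nat \<Rightarrow> 'a::comm_monoid_add"
  by (simp add: eval_nat_numeral)

lemma sum_lessThan_4_add: "(\<Sum>i<4 + n. f i) = (\<Sum>i<4. f i) + (\<Sum>j<n. f (4 + j))"
  for f :: "nat \<Rightarrow> 'a::comm_monoid_add"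
proof (induction n)
  case (Suc n)
  have "(\<Sum>i<4 + Suc n. f i) = (\<Sum>i<4 + n. f i) + f (4 + n)" unfolding add_Suc_right sum.lessThan_Suc ..
  then show ?case using Suc by (simp add: add.assoc)
qed simp

lemma exists_exponent: "\<exists>\<nu>::nat \<Rightarrow>\<^sub>0 nat. keys \<nu> \<subseteq> {..<N} \<and> (\<forall>i<N. lookup \<nu> i = g i)"
proof -
  define \<nu> where "\<nu> = (\<Sum>i<N. single i (g i))"
  have "lookup \<nu> j = (if j < N then g j else 0)" for j
    unfolding \<nu>_def lookup_sum lookup_single when_def by simp
  then show ?thesis by (intro exI[of _ \<nu>]) (auto simp: in_keys_iff split: if_splits)
qed

context toric begin

lemma ip_sum: "ip (\<Sum>i\<in>A. f i) e = (\<Sum>i\<in>A. ip (f i) e)"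
  by (induction A rule: infinite_finite_induct) (simp_all add: ip_add)

lemma T_sum: "(\<And>i. i \<in> A \<Longrightarrow> f i \<in> T F) \<Longrightarrow> sum f A \<in> T F"
  by (induction A rule: infinite_finite_induct) (auto simp: T_zero T_add)

text \<open>A regular function vanishes on an orbit closure exactly if it has no monomial that is invertible there.\<close>

lemma germ_ideal_eq:
  assumes F: "F \<in> \<F>" and c: "c \<in> can F"
  shows "germ_ideal D \<Sigma> (W F) (Pt F c) =
    {Fract f g | f g. f \<in> CR F \<and> g \<in> CR F \<and> evalp g c \<noteq> 0 \<and> keys f \<inter> T F = {}}" (is "_ = ?R")
proof (rule Set.equalityI; rule subsetI)
  fix x assume "x \<in> germ_ideal D \<Sigma> (W F) (Pt F c)"
  then obtain f g \<sigma> \<gamma> where x: "x = Fract f g" "(\<sigma>, \<gamma>) \<in> Pt F c" "f \<in> coord_ring D \<sigma>" "g \<in> coord_ring D \<sigma>"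
    "evalp g \<gamma> \<noteq> 0" "\<forall>\<gamma>'\<in>chart D \<sigma>. toric_pt D \<Sigma> \<sigma> \<gamma>' \<in> W F \<longrightarrow> evalp f \<gamma>' = 0"
    unfolding germ_ideal_def mem_Collect_eq by (elim exE conjE) (rule that)
  obtain F' where F': "\<sigma> = cn F'" "\<gamma> = restrict c (S F')" "F' \<in> \<F>" "F \<subseteq> F'" using x(2) by (auto simp: Pt_def)
  have fg: "f \<in> CR F'" "g \<in> CR F'" using x(3,4) F'(1) by auto
  then have fg': "f \<in> CR F" "g \<in> CR F" using CR_anti[OF F'(4)] by auto
  have "evalp g c \<noteq> 0" using x(5) evalp_restrict[OF fg(2)] unfolding F'(2) by simp
  moreover have "keys f \<inter> T F = {}"
  proof (rule ccontr)
    assume "keys f \<inter> T F \<noteq> {}"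
    then obtain m where "m \<in> keys f" "m \<in> T F" by blast
    then obtain t where t: "t \<in> torus D" "evalp f (orb F t) \<noteq> 0" using orb_nonvanishing[OF fg'(1)] by blast
    have "restrict (orb F t) (S F') \<in> chart D \<sigma>" unfolding F'(1) by (rule restrict_ch[OF F'(4) can_ch[OF orb_can[OF t(1)]]])
    moreover have "toric_pt D \<Sigma> \<sigma> (restrict (orb F t) (S F')) \<in> W F"
      unfolding F'(1) toric_pt_eq[OF F'(3) F F'(4) orb_can[OF t(1)]] by (rule orbit_in_W[OF F t(1)])
    ultimately have "evalp f (restrict (orb F t) (S F')) = 0" using x(6) by blast
    then show False using t(2) evalp_restrict[OF fg(1)] by simp
  qed
  ultimately show "x \<in> ?R" using x(1) fg' by blast
next
  fix x assume "x \<in> ?R"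
  then obtain f g where x: "x = Fract f g" "f \<in> CR F" "g \<in> CR F" "evalp g c \<noteq> 0" "keys f \<inter> T F = {}" by blast
  have "evalp f \<gamma>' = 0" if g: "\<gamma>' \<in> ch F" "toric_pt D \<Sigma> (cn F) \<gamma>' \<in> W F" for \<gamma>'
  proof -
    obtain G c' where G: "G \<in> \<F>" "G \<subseteq> F" "c' \<in> can G" "restrict c' (S F) = \<gamma>'" using can_exists[OF F g(1)] by blast
    have "Pt G c' \<in> W F" using g(2) toric_pt_eq[OF F G(1-3)] G(4) by simp
    then have GF: "G = F" using W_iff[OF F G(1,3)] G(2) by blast
    then have c': "c' \<in> can F" "\<gamma>' = c'" using G(3,4) restrict_can[of c' F] by auto
    have "c' m = 0" if "m \<in> keys f" for m
      using can_iff[OF c'(1), of m] that x(2,5) by (auto simp: CR_iff)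
    then show ?thesis unfolding c'(2) evalp_def by simp
  qed
  then show "x \<in> germ_ideal D \<Sigma> (W F) (Pt F c)"
    unfolding germ_ideal_def using x(1-4) Pt_self[OF F c] by blast
qed

end

text \<open>In addition the relation between the \<open>u i\<close> holds in the whole lattice and the units \<open>v x\<close> are a basis of \<open>T b\<close>, so that
  \<open>S b\<close> is the product of the monoid of the node and a free abelian group.\<close>

locale conifold_node = conifold D \<F> \<beta> ip b e1 e2 e3 e4 X v u
  for D :: "'v::linorder set" and \<F> :: "'e set set" and \<beta> ip b e1 e2 e3 e4 X v u +
  assumes u_rel: "u 0 + u 1 = u 2 + u 3"
    and u_X: "\<And>i x. i < 4 \<Longrightarrow> x \<in> X \<Longrightarrow> lookup (u i) x = 0"
    and T_span: "\<And>m. m \<in> T b \<Longrightarrow> m = (\<Sum>x\<in>X. frag_cmul (lookup m x) (v x))"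
begin

definition r :: nat where "r = card D - 3"

definition xs :: "nat \<Rightarrow> 'v" where "xs j = sorted_list_of_set X ! j"

text \<open>The characters to which the variables of the node are sent.\<close>

definition l :: "nat \<Rightarrow> ('v \<Rightarrow>\<^sub>0 int)" where "l i = (if i < 4 then u i else v (xs (i - 4)))"

definition Lx :: "(nat \<Rightarrow>\<^sub>0 nat) \<Rightarrow> ('v \<Rightarrow>\<^sub>0 int)" where
  "Lx \<nu> = (\<Sum>i<4 + r. frag_cmul (int (lookup \<nu> i)) (l i))"

definition \<rho>0 :: "nat \<Rightarrow> 'v laurent" where
  "\<rho>0 i = (if i < 4 + r then single (l i) 1 else 0)"

lemma xs_bij: "bij_betw xs {..<r} X"
proof -
  have "bij_betw ((!) (sorted_list_of_set X)) {..<length (sorted_list_of_set X)} (set (sorted_list_of_set X))"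
    by (rule bij_betw_nth) simp_all
  then show ?thesis using finX X(2) by (simp add: xs_def[abs_def] r_def)
qed

lemma xs_X: "j < r \<Longrightarrow> xs j \<in> X" using xs_bij by (auto simp: bij_betw_def)

lemma sum_xs: "(\<Sum>j<r. f (xs j)) = sum f X" by (rule sum.reindex_bij_betw[OF xs_bij])

lemma l_S: "i < 4 + r \<Longrightarrow> l i \<in> S b"
  unfolding l_def using u_S subsetD[OF T_S v_T[OF xs_X[of "i - 4"]]] by auto

lemma Lx_split: "Lx \<nu> = (\<Sum>i<4. frag_cmul (int (lookup \<nu> i)) (u i)) +
    (\<Sum>j<r. frag_cmul (int (lookup \<nu> (4 + j))) (v (xs j)))"
  unfolding Lx_def sum_lessThan_4_add by (simp add: l_def)

lemma lookup_Lx: assumes j: "j < r" shows "lookup (Lx \<nu>) (xs j) = int (lookup \<nu> (4 + j))"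
proof -
  have "lookup (Lx \<nu>) (xs j) = (\<Sum>j'<r. if j' = j then int (lookup \<nu> (4 + j')) else 0)"
  proof -
    have "lookup (\<Sum>i<4. frag_cmul (int (lookup \<nu> i)) (u i)) (xs j) = 0"
      unfolding lookup_sum using u_X[OF _ xs_X[OF j]] by (intro sum.neutral) simp
    moreover have "lookup (v (xs j')) (xs j) = (if j' = j then 1 else 0)" if "j' < r" for j'
      using v_X[OF xs_X[OF that] xs_X[OF j]] xs_bij that j by (auto simp: bij_betw_def inj_on_def)
    then have "lookup (\<Sum>j'<r. frag_cmul (int (lookup \<nu> (4 + j'))) (v (xs j'))) (xs j) =
      (\<Sum>j'<r. if j' = j then int (lookup \<nu> (4 + j')) else 0)"
      unfolding lookup_sum by (intro sum.cong refl) simp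
    ultimately show ?thesis unfolding Lx_split lookup_add by linarith
  qed
  then show ?thesis using j by simp
qed

lemma ip_Lx: assumes "e \<in> b" shows "ip (Lx \<nu>) e = (\<Sum>i<4. int (lookup \<nu> i) * ip (u i) e)"
proof -
  have "ip (v (xs j)) e = 0" if "j < r" for j using v_T[OF xs_X[OF that]] assms by (auto simp: T_def)
  then show ?thesis unfolding Lx_split by (simp add: ip_add ip_sum ip_cmul)
qed

lemma ip_Lx_values:
  "ip (Lx \<nu>) e1 = int (lookup \<nu> 1) + int (lookup \<nu> 2)"
  "ip (Lx \<nu>) e2 = int (lookup \<nu> 0) + int (lookup \<nu> 3)"
  "ip (Lx \<nu>) e3 = int (lookup \<nu> 1) + int (lookup \<nu> 3)"
  "ip (Lx \<nu>) e4 = int (lookup \<nu> 0) + int (lookup \<nu> 2)"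
  using ip_Lx[of e1 \<nu>] ip_Lx[of e2 \<nu>] ip_Lx[of e3 \<nu>] ip_Lx[of e4 \<nu>] u_ip
  unfolding sum_lessThan_4 by (simp_all add: b_def)

text \<open>The values on \<open>b\<close> determine the first four exponents of a reduced monomial, the entries at \<open>X\<close> the remaining ones.\<close>

lemma Lx_inj:
  assumes k: "keys \<mu> \<subseteq> {..<4 + r}" "keys \<nu> \<subseteq> {..<4 + r}"
    and red: "lookup \<mu> 0 = 0 \<or> lookup \<mu> 1 = 0" "lookup \<nu> 0 = 0 \<or> lookup \<nu> 1 = 0"
    and eq: "Lx \<mu> = Lx \<nu>"
  shows "\<mu> = \<nu>"
proof (rule poly_mapping_eqI)
  fix i
  have v: "int (lookup \<mu> 1) + int (lookup \<mu> 2) = int (lookup \<nu> 1) + int (lookup \<nu> 2)"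
    "int (lookup \<mu> 0) + int (lookup \<mu> 3) = int (lookup \<nu> 0) + int (lookup \<nu> 3)"
    "int (lookup \<mu> 1) + int (lookup \<mu> 3) = int (lookup \<nu> 1) + int (lookup \<nu> 3)"
    "int (lookup \<mu> 0) + int (lookup \<mu> 2) = int (lookup \<nu> 0) + int (lookup \<nu> 2)"
    using ip_Lx_values[of \<mu>] ip_Lx_values[of \<nu>] unfolding eq by simp_all
  have q: "lookup \<mu> 0 = lookup \<nu> 0" "lookup \<mu> 1 = lookup \<nu> 1"
    "lookup \<mu> 2 = lookup \<nu> 2" "lookup \<mu> 3 = lookup \<nu> 3"
    using v red by linarith+
  consider "i = 0" | "i = 1" | "i = 2" | "i = 3" | "4 \<le> i" "i < 4 + r" | "4 + r \<le> i" by linarith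
  then show "lookup \<mu> i = lookup \<nu> i"
  proof cases
    case 5
    then obtain j where j: "i = 4 + j" "j < r" by (metis add_less_cancel_left le_Suc_ex)
    have "int (lookup \<mu> i) = int (lookup \<nu> i)"
      unfolding j(1) lookup_Lx[OF j(2), symmetric] eq ..
    then show ?thesis by simp
  next
    case 6
    then have "i \<notin> keys \<mu>" "i \<notin> keys \<nu>" using k by auto
    then show ?thesis by (simp add: in_keys_iff)
  qed (use q in simp_all)
qed

lemma pw_\<rho>0: assumes "keys \<nu> \<subseteq> {..<4 + r}" shows "pw \<rho>0 \<nu> = single (Lx \<nu>) 1"
proof -
  have "pw \<rho>0 \<nu> = (\<Prod>i<4 + r. single (frag_cmul (int (lookup \<nu> i)) (l i)) 1)"
    using assms by (subst pw_superset[of "{..<4 + r}"]) (auto simp: \<rho>0_def single_power intro!: prod.cong)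
  also have "\<dots> = single (Lx \<nu>) 1"
  proof -
    have "(\<Prod>i<n. single (h i) (1::complex)) = single (\<Sum>i<n. h i) 1"
      for h :: "nat \<Rightarrow> ('v \<Rightarrow>\<^sub>0 int)" and n
      by (induction n) (simp_all add: mult_single)
    then show ?thesis by (simp add: Lx_def)
  qed
  finally show ?thesis .
qed

lemma \<rho>0_CR: "\<rho>0 i \<in> CR b" unfolding \<rho>0_def using l_S by (auto intro: CR_single CR_zero)

lemma ev_\<rho>0_nodeq: "ev (single 0) \<rho>0 nodeq = 0"
proof -
  have "ev (single 0) \<rho>0 nodeq = \<rho>0 0 * \<rho>0 1 - \<rho>0 2 * \<rho>0 3"
    unfolding sgl.ev_diff sgl.ev_mult sgl.ev_var ..
  also have "\<dots> = single (u 0 + u 1) 1 - single (u 2 + u 3) 1"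
    by (simp add: \<rho>0_def l_def mult_single)
  finally show ?thesis unfolding u_rel by simp
qed

text \<open>The values of \<open>m\<close> on \<open>b\<close> are nonnegative integers with the relation \<open>rel\<close>, so they are a combination of those of the \<open>u i\<close>;
  which of \<open>u 2\<close> and \<open>u 3\<close> occurs depends on the order of the values at \<open>e2\<close> and \<open>e4\<close>.\<close>

lemma decompose:
  assumes m: "m \<in> S b"
  shows "\<exists>a. m - (\<Sum>i<4. frag_cmul (int (a i)) (u i)) \<in> T b \<and> (m \<notin> T b \<longrightarrow> (\<exists>i<4. 0 < a i))"
proof -
  have k: "0 \<le> ip m e1" "0 \<le> ip m e2" "0 \<le> ip m e3" "0 \<le> ip m e4" using m by (auto simp: S_def b_def)
  note rel = rel[of m]
  define a :: "nat \<Rightarrow> nat" where "a i = nat (if ip m e2 \<le> ip m e4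
    then (if i = 0 then ip m e2 else if i = 1 then ip m e3 else if i = 2 then ip m e4 - ip m e2 else 0)
    else (if i = 0 then ip m e4 else if i = 1 then ip m e1 else if i = 2 then 0 else ip m e2 - ip m e4))" for i
  have u_D: "u i \<in> dual_lattice D" if "i < 4" for i using u_S[OF that] S_lattice by auto
  have mD: "m \<in> dual_lattice D" using m S_lattice by auto
  have sD: "(\<Sum>i<4. frag_cmul (int (a i)) (u i)) \<in> dual_lattice D"
    unfolding sum_lessThan_4 by (intro dual_lattice_add dual_lattice_cmul u_D) simp_all
  have ips: "ip (\<Sum>i<4. frag_cmul (int (a i)) (u i)) e =
      int (a 0) * ip (u 0) e + int (a 1) * ip (u 1) e + int (a 2) * ip (u 2) e + int (a 3) * ip (u 3) e" for e
    unfolding sum_lessThan_4 by (simp only: ip_add ip_cmul)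
  have z: "ip (\<Sum>i<4. frag_cmul (int (a i)) (u i)) e = ip m e" if "e \<in> b" for e
  proof -
    have a: "int (a 1) + int (a 2) = ip m e1" "int (a 0) + int (a 3) = ip m e2"
      "int (a 1) + int (a 3) = ip m e3" "int (a 0) + int (a 2) = ip m e4"
      using k rel by (auto simp: a_def)
    from that consider "e = e1" | "e = e2" | "e = e3" | "e = e4" by (auto simp: b_def)
    then show ?thesis unfolding ips by cases (use a u_ip in simp_all)
  qed
  show ?thesis
  proof (intro exI[of _ a] conjI impI)
    show "m - (\<Sum>i<4. frag_cmul (int (a i)) (u i)) \<in> T b"
      using dual_lattice_diff[OF mD sD] z by (auto simp: T_def ip_diff)
    assume "m \<notin> T b"
    then obtain e where e: "e \<in> b" "ip m e \<noteq> 0" using mD by (auto simp: T_def)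
    show "\<exists>i<4. 0 < a i"
    proof (rule ccontr)
      assume "\<not> (\<exists>i<4. 0 < a i)"
      then have "a 0 = 0" "a 1 = 0" "a 2 = 0" "a 3 = 0" by auto
      then show False using z[OF e(1)] e(2) unfolding ips by simp
    qed
  qed
qed

text \<open>Multiplying by a unit moves any finite set of monomials into the image of the polynomial ring; here
  non-units involve one of the four node variables.\<close>

lemma clear_units:
  assumes M: "finite M" "M \<subseteq> S b"
  shows "\<exists>\<mu>\<in>T b. \<forall>m\<in>M. \<exists>\<nu>. keys \<nu> \<subseteq> {..<4 + r} \<and> m + \<mu> = Lx \<nu> \<and>
     (m \<notin> T b \<longrightarrow> (\<exists>i<4. 0 < lookup \<nu> i))"
proof -
  have "\<forall>m\<in>M. \<exists>a. m - (\<Sum>i<4. frag_cmul (int (a i)) (u i)) \<in> T b \<and> (m \<notin> T b \<longrightarrow> (\<exists>i<4. 0 < a i))"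
  proof
    fix m assume "m \<in> M"
    then have "m \<in> S b" using M by blast
    then show "\<exists>a. m - (\<Sum>i<4. frag_cmul (int (a i)) (u i)) \<in> T b \<and> (m \<notin> T b \<longrightarrow> (\<exists>i<4. 0 < a i))"
      by (rule decompose)
  qed
  from bchoice[OF this] obtain a where a: "\<forall>m\<in>M. m - (\<Sum>i<4. frag_cmul (int (a m i)) (u i)) \<in> T b \<and> (m \<notin> T b \<longrightarrow> (\<exists>i<4. 0 < a m i))"
    by (elim exE) (rule that)
  define t where "t m = m - (\<Sum>i<4. frag_cmul (int (a m i)) (u i))" for m
  have t: "t m \<in> T b" if "m \<in> M" for m using a that by (simp add: t_def)
  define K where "K = (\<Sum>m\<in>M. \<Sum>x\<in>X. \<bar>lookup (t m) x\<bar>)"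
  have K: "0 \<le> lookup (t m) x + K" if "m \<in> M" "x \<in> X" for m x
  proof -
    have "\<bar>lookup (t m) x\<bar> \<le> (\<Sum>x\<in>X. \<bar>lookup (t m) x\<bar>)"
      using that finX by (intro member_le_sum) auto
    also have "\<dots> \<le> K" unfolding K_def using that M(1) by (intro member_le_sum sum_nonneg) auto
    finally show ?thesis by linarith
  qed
  define \<mu> where "\<mu> = (\<Sum>x\<in>X. frag_cmul K (v x))"
  have "\<mu> \<in> T b" unfolding \<mu>_def using v_T by (intro T_sum T_cmul)
  moreover have "\<exists>\<nu>. keys \<nu> \<subseteq> {..<4 + r} \<and> m + \<mu> = Lx \<nu> \<and> (m \<notin> T b \<longrightarrow> (\<exists>i<4. 0 < lookup \<nu> i))"
    if m: "m \<in> M" for m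
  proof -
    obtain \<nu> where \<nu>: "keys \<nu> \<subseteq> {..<4 + r}"
      "\<forall>i<4 + r. lookup \<nu> i = (if i < 4 then a m i else nat (lookup (t m) (xs (i - 4)) + K))"
      using exists_exponent[of "4 + r" "\<lambda>i. if i < 4 then a m i else nat (lookup (t m) (xs (i - 4)) + K)"] by blast
    have "(\<Sum>j<r. frag_cmul (int (lookup \<nu> (4 + j))) (v (xs j))) =
       (\<Sum>j<r. frag_cmul (lookup (t m) (xs j) + K) (v (xs j)))"
      using \<nu>(2) K[OF m xs_X] by (intro sum.cong refl) simp
    also have "\<dots> = (\<Sum>x\<in>X. frag_cmul (lookup (t m) x + K) (v x))"
      by (rule sum_xs)
    also have "\<dots> = t m + \<mu>"
      unfolding frag_cmul_distrib sum.distrib \<mu>_def using T_span[OF t[OF m]] by simp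
    finally have 1: "(\<Sum>j<r. frag_cmul (int (lookup \<nu> (4 + j))) (v (xs j))) = t m + \<mu>" .
    have 2: "(\<Sum>i<4. frag_cmul (int (lookup \<nu> i)) (u i)) = m - t m"
      using \<nu>(2) unfolding t_def by simp
    have "Lx \<nu> = m + \<mu>" unfolding Lx_split 1 2 by simp
    moreover have "m \<notin> T b \<longrightarrow> (\<exists>i<4. 0 < lookup \<nu> i)"
    proof
      assume "m \<notin> T b"
      then obtain i where i: "i < 4" "0 < a m i" using a m by blast
      then show "\<exists>i<4. 0 < lookup \<nu> i" using \<nu>(2) by (intro exI[of _ i]) simp
    qed
    ultimately show ?thesis using \<nu>(1) by (intro exI[of _ \<nu>]) simp
  qed
  ultimately show ?thesis by blast
qed

end

locale node_point = conifold_node D \<F> \<beta> ip b e1 e2 e3 e4 X v u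
  for D :: "'v::linorder set" and \<F> :: "'e set set" and \<beta> ip b e1 e2 e3 e4 X v u +
  fixes c :: "('v \<Rightarrow>\<^sub>0 int) \<Rightarrow> complex"
  assumes c: "c \<in> can b"
begin

lemma cch: "c \<in> ch b" using c by (rule can_ch)

text \<open>The polynomial variables beyond the first four are the units shifted by their values at the point, so that
  the point corresponds to the origin.\<close>

definition aa :: "nat \<Rightarrow> complex" where "aa i = (if 4 \<le> i \<and> i < 4 + r then c (l i) else 0)"

definition \<psi> :: "mpoly \<Rightarrow> 'v laurent" where
  "\<psi> f = ev (single 0) \<rho>0 (sh (\<lambda>i. - aa i) f)"

lemma \<psi>_add: "\<psi> (f + g) = \<psi> f + \<psi> g" by (simp add: \<psi>_def sh_add sgl.ev_add)
lemma \<psi>_diff: "\<psi> (f - g) = \<psi> f - \<psi> g" by (simp add: \<psi>_def sh_diff sgl.ev_diff)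
lemma \<psi>_mult: "\<psi> (f * g) = \<psi> f * \<psi> g" by (simp add: \<psi>_def sh_mult sgl.ev_mult)
lemma \<psi>_const: "\<psi> (single 0 a) = single 0 a"
  unfolding \<psi>_def sh_def sgl.ev_const ..
lemma \<psi>_one: "\<psi> 1 = 1" unfolding \<psi>_def sh_def sgl.ev_one ..

lemma \<psi>_CR: "\<psi> f \<in> CR b"
  unfolding \<psi>_def by (intro sgl.ev_in CR_subring CR_single S_zero \<rho>0_CR)

lemma \<psi>_value: "evalp (\<psi> f) c = lookup f 0"
proof -
  let ?\<epsilon> = "\<lambda>i. evalp (\<rho>0 i) c"
  have c0: "c 0 = 1" using cch by (simp add: ch_iff)
  have id: "(\<lambda>a. evalp (single 0 a) c) = (\<lambda>a. a)" by (simp add: evalp_single c0)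
  have "evalp (\<psi> f) c = ev (\<lambda>a. evalp (single 0 a) c) ?\<epsilon> (sh (\<lambda>i. - aa i) f)"
    unfolding \<psi>_def
    by (rule sgl.hom_ev[OF CR_subring CR_single[OF S_zero] \<rho>0_CR])
       (auto simp: evalp_add evalp_mult[OF cch] evalp_one[OF cch])
  also have "\<dots> = ev (\<lambda>a. a) ?\<epsilon> (sh (\<lambda>i. - aa i) f)" unfolding id ..
  also have "\<dots> = ev (\<lambda>a. ev (\<lambda>a. a) ?\<epsilon> (single 0 a)) (\<lambda>i. ev (\<lambda>a. a) ?\<epsilon> (var i + single 0 (- aa i))) f"
    unfolding sh_def
    by (rule sgl.hom_ev[where S = UNIV and \<tau> = "ev (\<lambda>a. a) ?\<epsilon>"]) (auto simp: subring_set_def idc.ev_add idc.ev_mult idc.ev_one)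
  also have "(\<lambda>a. ev (\<lambda>a. a) ?\<epsilon> (single 0 a)) = (\<lambda>a. a)" unfolding idc.ev_const ..
  also have "(\<lambda>i. ev (\<lambda>a. a) ?\<epsilon> (var i + single 0 (- aa i))) = (\<lambda>_. 0)"
  proof
    fix i
    have "?\<epsilon> i = aa i"
    proof -
      have "c (u i) = 0" if "i < 4"
      proof -
        have "u i \<notin> T b" using u_sum[OF that] by (auto simp: T_def b_def)
        then show ?thesis using can_iff[OF c u_S[OF that]] by blast
      qed
      then show ?thesis by (auto simp: \<rho>0_def aa_def l_def evalp_single)
    qed
    then show "ev (\<lambda>a. a) ?\<epsilon> (var i + single 0 (- aa i)) = 0"
      unfolding idc.ev_add idc.ev_var idc.ev_const by simp
  qed
  finally show ?thesis unfolding ev_zero .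
qed

lemma aa_zero: "4 + r \<le> i \<Longrightarrow> aa i = 0" "i < 4 \<Longrightarrow> aa i = 0" by (auto simp: aa_def)

lemma sh_node: "a 0 = 0 \<Longrightarrow> a 1 = 0 \<Longrightarrow> a 2 = 0 \<Longrightarrow> a 3 = 0 \<Longrightarrow> sh a nodeq = nodeq"
  unfolding sh_diff sh_mult sh_var by simp

lemma \<psi>_kernel: assumes f: "f \<in> PR (4 + r)" shows "\<psi> f = 0 \<longleftrightarrow> f \<in> node_ideal r"
proof
  assume z: "\<psi> f = 0"
  have s: "sh (\<lambda>i. - aa i) f \<in> PR (4 + r)" using f aa_zero by (intro sh_PR) simp_all
  have "sh (\<lambda>i. - aa i) f \<in> node_ideal r"
    by (rule node_kernel[OF pw_\<rho>0 ev_\<rho>0_nodeq Lx_inj s z[unfolded \<psi>_def]])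
  then obtain a where a: "sh (\<lambda>i. - aa i) f = a * nodeq" "a \<in> PR (4 + r)" unfolding node_ideal_eq by blast
  have "f = sh aa (a * nodeq)" unfolding a(1)[symmetric] by (simp add: sh_inverse)
  also have "\<dots> = sh aa a * nodeq"
    unfolding sh_mult[of aa a] by (subst sh_node) (simp_all add: aa_zero(2))
  finally have "f = sh aa a * nodeq" .
  moreover have "sh aa a \<in> PR (4 + r)" by (rule sh_PR[OF a(2)]) (rule aa_zero(1))
  ultimately show "f \<in> node_ideal r" unfolding node_ideal_eq by blast
next
  assume "f \<in> node_ideal r"
  then obtain a where a: "f = a * nodeq" unfolding node_ideal_eq by blast
  have "\<psi> nodeq = 0"
  proof -
    have "sh (\<lambda>i. - aa i) nodeq = nodeq" by (rule sh_node) (simp_all add: aa_zero)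
    then show ?thesis unfolding \<psi>_def using ev_\<rho>0_nodeq by simp
  qed
  then show "\<psi> f = 0" unfolding a \<psi>_mult by simp
qed

lemma \<psi>_surj:
  assumes f: "f \<in> CR b" and g: "g \<in> CR b"
  obtains \<mu> f' g' where "\<mu> \<in> T b" "f' \<in> PR (4 + r)" "g' \<in> PR (4 + r)"
    "\<psi> f' = f * single \<mu> 1" "\<psi> g' = g * single \<mu> 1"
    "keys f \<inter> T b = {} \<Longrightarrow> f' \<in> mono_ideal r {..<4}"
proof -
  obtain \<mu> where \<mu>: "\<mu> \<in> T b" "\<forall>m\<in>keys f \<union> keys g. \<exists>\<nu>. keys \<nu> \<subseteq> {..<4 + r} \<and> m + \<mu> = Lx \<nu> \<and>
     (m \<notin> T b \<longrightarrow> (\<exists>i<4. 0 < lookup \<nu> i))"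
    using clear_units[of "keys f \<union> keys g"] f g by (auto simp: CR_iff)
  from bchoice[OF \<mu>(2)] obtain \<nu> where \<nu>: "\<forall>m\<in>keys f \<union> keys g. keys (\<nu> m) \<subseteq> {..<4 + r} \<and> m + \<mu> = Lx (\<nu> m) \<and>
     (m \<notin> T b \<longrightarrow> (\<exists>i<4. 0 < lookup (\<nu> m) i))" by (elim exE) (rule that)
  define P where "P h = (\<Sum>m\<in>keys h. sh aa (single (\<nu> m) (lookup h m)))" for h :: "'v laurent"
  have PP: "P h \<in> PR (4 + r)" "\<psi> (P h) = h * single \<mu> 1"
    if h: "keys h \<subseteq> keys f \<union> keys g" for h
  proof -
    have s: "sh aa (single (\<nu> m) x) \<in> PR (4 + r)" if "m \<in> keys h" for m x
      using that h \<nu> by (intro sh_PR PR_single aa_zero(1)) auto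
    then show "P h \<in> PR (4 + r)" unfolding P_def by (intro subring_set_sum[OF PR_subring])
    have \<psi>0: "\<psi> 0 = 0" using \<psi>_add[of 0 0] by simp
    have \<psi>_sum: "\<psi> (\<Sum>i\<in>A. q i) = (\<Sum>i\<in>A. \<psi> (q i))" for A and q :: "('v \<Rightarrow>\<^sub>0 int) \<Rightarrow> mpoly"
      by (induction A rule: infinite_finite_induct) (simp_all add: \<psi>0 \<psi>_add)
    have "\<psi> (P h) = (\<Sum>m\<in>keys h. single (m + \<mu>) (lookup h m))"
      unfolding P_def \<psi>_sum
    proof (intro sum.cong refl)
      fix m assume "m \<in> keys h"
      then have m: "keys (\<nu> m) \<subseteq> {..<4 + r}" "m + \<mu> = Lx (\<nu> m)" using h \<nu> by auto
      have "\<psi> (sh aa (single (\<nu> m) (lookup h m))) =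
          ev (single 0) \<rho>0 (single (\<nu> m) (lookup h m))"
        unfolding \<psi>_def by (simp add: sh_inverse)
      also have "\<dots> = single (m + \<mu>) (lookup h m)"
        unfolding ev_def sgl.lin_single pw_\<rho>0[OF m(1)] m(2) by (simp add: mult_single)
      finally show "\<psi> (sh aa (single (\<nu> m) (lookup h m))) = single (m + \<mu>) (lookup h m)" .
    qed
    also have "\<dots> = (\<Sum>m\<in>keys h. single m (lookup h m)) * single \<mu> 1"
      unfolding sum_distrib_right by (simp add: mult_single)
    finally show "\<psi> (P h) = h * single \<mu> 1" unfolding laurent_eq_sum_single[symmetric] .
  qed
  have mono: "P f \<in> mono_ideal r {..<4}" if dis: "keys f \<inter> T b = {}"
    unfolding P_def
  proof (rule ideal_set_sum[OF mono_ideal_set])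
    fix m assume m: "m \<in> keys f"
    then have k: "keys (\<nu> m) \<subseteq> {..<4 + r}" using \<nu> by auto
    have "m \<notin> T b" using m dis by auto
    then obtain i where i: "i < 4" "0 < lookup (\<nu> m) i" using \<nu> m by blast
    define \<nu>' where "\<nu>' = \<nu> m - single i 1"
    have e: "\<nu> m = \<nu>' + single i 1"
      using i(2) by (intro poly_mapping_eqI) (auto simp: \<nu>'_def lookup_add lookup_minus lookup_single when_def)
    have k': "keys \<nu>' \<subseteq> {..<4 + r}" using k by (auto simp: \<nu>'_def in_keys_iff lookup_minus subset_iff)
    have "single (\<nu> m) (lookup f m) = single \<nu>' (lookup f m) * var i"
      unfolding var_def e by (simp add: mult_single)
    then have "sh aa (single (\<nu> m) (lookup f m)) = sh aa (single \<nu>' (lookup f m)) * var i"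
      using aa_zero(2)[OF i(1)] by (simp add: sh_mult sh_var)
    also have "\<dots> \<in> mono_ideal r {..<4}"
      using i(1) by (intro ideal_setD(4)[OF mono_ideal_set] var_mono sh_PR PR_single k' aa_zero(1)) auto
    finally show "sh aa (single (\<nu> m) (lookup f m)) \<in> mono_ideal r {..<4}" .
  qed
  show ?thesis by (rule that[OF \<mu>(1) PP(1) PP(1) PP(2) PP(2) mono]) auto
qed

definition \<phi> :: "mpoly set \<Rightarrow> 'v laurent fract" where
  "\<phi> Y = fr (\<psi> (SOME f. f \<in> PR (4 + r) \<and> Y = node_class r f))"

lemma \<phi>_class: assumes f: "f \<in> PR (4 + r)" shows "\<phi> (node_class r f) = fr (\<psi> f)"
proof -
  define g where "g = (SOME g. g \<in> PR (4 + r) \<and> node_class r f = node_class r g)"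
  have g: "g \<in> PR (4 + r) \<and> node_class r f = node_class r g" unfolding g_def by (rule someI[of _ f]) (use f in simp)
  then have "f - g \<in> node_ideal r" using node_class_eq[OF f] by blast
  then have "\<psi> (f - g) = 0" using \<psi>_kernel subring_set_diff[OF PR_subring f] g by blast
  then have "\<psi> f = \<psi> g" unfolding \<psi>_diff by simp
  then show ?thesis unfolding \<phi>_def g_def[symmetric] by simp
qed

lemma lookup_not_origin: assumes f: "f \<in> PR (4 + r)"
  shows "node_class r f \<in> node_origin r \<longleftrightarrow> lookup f 0 = 0"
proof -
  have "f \<in> mono_ideal r {..<4 + r} \<longleftrightarrow> lookup f 0 = 0"
  proof
    assume "f \<in> mono_ideal r {..<4 + r}"
    then have "0 \<notin> keys f" unfolding mono_ideal_def by auto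
    then show "lookup f 0 = 0" by (simp add: in_keys_iff)
  next
    assume z: "lookup f 0 = 0"
    have "\<exists>i\<in>{..<4 + r}. 0 < lookup \<mu> i" if \<mu>: "\<mu> \<in> keys f" for \<mu>
    proof -
      have "\<mu> \<noteq> 0" using \<mu> z by (auto simp: in_keys_iff)
      then obtain i where i: "i \<in> keys \<mu>" by (metis all_not_in_conv keys_eq_empty)
      moreover have "keys \<mu> \<subseteq> {..<4 + r}" using f \<mu> unfolding PR_def by blast
      ultimately have "i < 4 + r" by blast
      moreover have "0 < lookup \<mu> i" using i by (simp add: in_keys_iff)
      ultimately show ?thesis by (intro bexI[of _ i]) simp_all
    qed
    then show "f \<in> mono_ideal r {..<4 + r}" using f by (simp add: mono_ideal_def)
  qed
  then show ?thesis unfolding node_origin_eq using class_in_mono[OF _ f, of "{..<4 + r}"] by auto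
qed

lemma node_origin_ideal: "ideal (node_origin r) (node_ring r)"
  unfolding node_origin_eq by (rule node_ideal_image[OF mono_ideal_set])

lemma node_axis_ideal: "ideal (node_axis r) (node_ring r)"
  unfolding node_axis_eq by (rule node_ideal_image[OF mono_ideal_set])

lemma compl_originE:
  assumes "s \<in> carrier (node_ring r) - node_origin r"
  obtains f where "s = node_class r f" "f \<in> PR (4 + r)" "lookup f 0 \<noteq> 0"
proof -
  obtain f where "s = node_class r f" "f \<in> PR (4 + r)" using assms unfolding node_carrier by blast
  then show ?thesis using that lookup_not_origin assms by blast
qed

text \<open>Every regular function becomes a polynomial in the characters of the node after multiplication by a unit, and the
  polynomials outside the ideal of the origin do not vanish at the point.\<close>

lemma localization: "localization_pair (cls_ring (LR b c)) (node_ring r) \<phi> (node_origin r)"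
proof -
  interpret A: cring "cls_ring (LR b c)" by (rule cring_cls_ring[OF LR_subring[OF cch]])
  interpret B: cring "node_ring r" by (rule node_cring)
  interpret JB: ideal "node_origin r" "node_ring r" by (rule node_origin_ideal)
  have hom: "\<phi> \<in> ring_hom (node_ring r) (cls_ring (LR b c))"
  proof (rule ring_hom_memI)
    fix x assume "x \<in> carrier (node_ring r)"
    then obtain f where f: "x = node_class r f" "f \<in> PR (4 + r)" unfolding node_carrier by blast
    show "\<phi> x \<in> carrier (cls_ring (LR b c))" unfolding f(1) \<phi>_class[OF f(2)] using LR_fr[OF cch \<psi>_CR] by simp
    fix y assume "y \<in> carrier (node_ring r)"
    then obtain g where g: "y = node_class r g" "g \<in> PR (4 + r)" unfolding node_carrier by blast
    have fg: "f * g \<in> PR (4 + r)" "f + g \<in> PR (4 + r)" using f g subring_setD[OF PR_subring] by auto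
    show "\<phi> (x \<otimes>\<^bsub>node_ring r\<^esub> y) = \<phi> x \<otimes>\<^bsub>cls_ring (LR b c)\<^esub> \<phi> y"
      unfolding f(1) g(1) node_class_mult[OF f(2) g(2)] \<phi>_class[OF f(2)] \<phi>_class[OF g(2)] \<phi>_class[OF fg(1)]
      by (simp only: cls_ring_simps \<psi>_mult fr_mult)
    show "\<phi> (x \<oplus>\<^bsub>node_ring r\<^esub> y) = \<phi> x \<oplus>\<^bsub>cls_ring (LR b c)\<^esub> \<phi> y"
      unfolding f(1) g(1) node_class_add[OF f(2) g(2)] \<phi>_class[OF f(2)] \<phi>_class[OF g(2)] \<phi>_class[OF fg(2)]
      by (simp only: cls_ring_simps \<psi>_add fr_add)
  next
    show "\<phi> \<one>\<^bsub>node_ring r\<^esub> = \<one>\<^bsub>cls_ring (LR b c)\<^esub>"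
      unfolding node_class_one \<phi>_class[OF subring_setD(2)[OF PR_subring]] \<psi>_one by (simp add: One_fract_def)
  qed
  show ?thesis
  proof (unfold_locales)
    show "\<phi> \<in> ring_hom (node_ring r) (cls_ring (LR b c))" by (rule hom)
    show "inj_on \<phi> (carrier (node_ring r))"
    proof (rule inj_onI)
      fix x y assume "x \<in> carrier (node_ring r)" "y \<in> carrier (node_ring r)" and e: "\<phi> x = \<phi> y"
      then obtain f g where f: "x = node_class r f" "f \<in> PR (4 + r)" "y = node_class r g" "g \<in> PR (4 + r)" unfolding node_carrier by blast
      have "\<psi> (f - g) = 0" using e unfolding f(1,3) \<phi>_class[OF f(2)] \<phi>_class[OF f(4)] fr_eq_iff \<psi>_diff by simp
      then have "f - g \<in> node_ideal r" using \<psi>_kernel[OF subring_set_diff[OF PR_subring f(2,4)]] by blast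
      then show "x = y" unfolding f(1,3) using node_class_eq[OF f(2,4)] by blast
    qed
    show "\<one>\<^bsub>node_ring r\<^esub> \<notin> node_origin r"
      unfolding node_class_one lookup_not_origin[OF subring_setD(2)[OF PR_subring]] by simp
    fix s assume "s \<in> carrier (node_ring r) - node_origin r"
    then obtain f where f: "s = node_class r f" "f \<in> PR (4 + r)" "lookup f 0 \<noteq> 0" by (rule compl_originE)
    have "rv b c (fr (\<psi> f)) \<noteq> 0" using rv_hom(3)[OF cch \<psi>_CR] \<psi>_value f(3) by simp
    then show "\<phi> s \<in> Units (cls_ring (LR b c))"
      unfolding f(1) \<phi>_class[OF f(2)] using nonunits_LR[OF cch] LR_fr[OF cch \<psi>_CR, of f] unfolding nonunits_def by auto
    define k where "k = lookup f 0"
    let ?t = "single 0 (1 / k) :: mpoly"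
    have t: "?t \<in> PR (4 + r)" by (rule PR_single) simp
    have ft: "f * ?t \<in> PR (4 + r)" "1 - f * ?t \<in> PR (4 + r)"
      using f(2) t subring_setD[OF PR_subring] subring_set_diff[OF PR_subring] by auto
    have "lookup (1 - f * ?t) 0 = 0"
      using f(3) by (simp add: mult.commute[of f] lookup_minus lookup_scalar_mult lookup_one k_def)
    then have "node_class r (1 - f * ?t) \<in> node_origin r" using lookup_not_origin[OF ft(2)] by blast
    moreover have "\<one>\<^bsub>node_ring r\<^esub> \<ominus>\<^bsub>node_ring r\<^esub> s \<otimes>\<^bsub>node_ring r\<^esub> node_class r ?t = node_class r (1 - f * ?t)"
      unfolding node_class_one f(1) node_class_mult[OF f(2) t] by (rule node_class_minus[OF subring_setD(2)[OF PR_subring] ft(1)])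
    moreover have "node_class r ?t \<in> carrier (node_ring r)" using t node_carrier by blast
    ultimately show "\<exists>t\<in>carrier (node_ring r). \<one>\<^bsub>node_ring r\<^esub> \<ominus>\<^bsub>node_ring r\<^esub> s \<otimes>\<^bsub>node_ring r\<^esub> t \<in> node_origin r"
      by (intro bexI[of _ "node_class r ?t"]) simp_all
  next
    fix a assume "a \<in> carrier (cls_ring (LR b c))"
    then have "a \<in> LR b c" by simp
    then obtain f g where fg: "a = Fract f g" "f \<in> CR b" "g \<in> CR b" "evalp g c \<noteq> 0" "g \<noteq> 0" by (rule LR_E)
    obtain \<mu> f' g' where m: "\<mu> \<in> T b" "f' \<in> PR (4 + r)" "g' \<in> PR (4 + r)"
      "\<psi> f' = f * single \<mu> 1" "\<psi> g' = g * single \<mu> 1"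
      using \<psi>_surj[OF fg(2,3)] by metis
    have \<mu>S: "single \<mu> 1 \<in> CR b" using m(1) T_S by (intro CR_single) blast
    have "evalp (\<psi> g') c \<noteq> 0"
      unfolding m(5) using fg(4) evalp_mult[OF cch fg(3) \<mu>S] can_iff[OF c, of \<mu>] m(1) T_S by (auto simp: evalp_single)
    then have "node_class r g' \<in> carrier (node_ring r) - node_origin r"
      using m(3) node_carrier lookup_not_origin[OF m(3)] \<psi>_value by auto
    moreover have "node_class r f' \<in> carrier (node_ring r)" using m(2) node_carrier by blast
    moreover have "a \<otimes>\<^bsub>cls_ring (LR b c)\<^esub> \<phi> (node_class r g') = \<phi> (node_class r f')"
      unfolding \<phi>_class[OF m(2)] \<phi>_class[OF m(3)] m(4,5) fg(1) using fg(5) by (simp add: eq_fract)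
    ultimately show "\<exists>x\<in>carrier (node_ring r). \<exists>s\<in>carrier (node_ring r) - node_origin r. a \<otimes>\<^bsub>cls_ring (LR b c)\<^esub> \<phi> s = \<phi> x"
      by blast
  qed
qed

text \<open>A function vanishes on the stratum exactly if each of its monomials involves one of the four node variables.\<close>

lemma germ_ext:
  "germ_ideal D \<Sigma> (W b) (Pt b c) = localization_pair.ext (cls_ring (LR b c)) (node_ring r) \<phi> (node_origin r) (node_axis r)"
proof -
  interpret L: localization_pair "cls_ring (LR b c)" "node_ring r" \<phi> "node_origin r" by (rule localization)
  have mono_T: "keys (\<psi> h) \<inter> T b = {}" if h: "h \<in> mono_ideal r {..<4}" for h
  proof -
    have "\<forall>t\<in>torus D. evalp (\<psi> h) (orb b t) = 0"
    proof
      fix t assume t: "t \<in> torus D"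
      have ot: "orb b t \<in> can b" by (rule orb_can[OF t])
      have c0: "orb b t 0 = 1" using can_ch[OF ot] by (simp add: ch_iff)
      let ?\<epsilon> = "\<lambda>i. evalp (\<rho>0 i) (orb b t)"
      let ?E = "\<lambda>i. ev (\<lambda>a. a) ?\<epsilon> (var i + single 0 (- aa i))"
      have "evalp (\<psi> h) (orb b t) = ev (\<lambda>a. evalp (single 0 a) (orb b t)) ?\<epsilon> (sh (\<lambda>i. - aa i) h)"
        unfolding \<psi>_def
        by (rule sgl.hom_ev[OF CR_subring CR_single[OF S_zero] \<rho>0_CR])
          (auto simp: evalp_add evalp_mult[OF can_ch[OF ot]] evalp_one[OF can_ch[OF ot]])
      also have "\<dots> = ev (\<lambda>a. a) ?\<epsilon> (sh (\<lambda>i. - aa i) h)" by (simp add: evalp_single c0)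
      also have "\<dots> = ev (\<lambda>a. ev (\<lambda>a. a) ?\<epsilon> (single 0 a)) ?E h"
        unfolding sh_def
        by (rule sgl.hom_ev[where S = UNIV and \<tau> = "ev (\<lambda>a. a) ?\<epsilon>"]) (auto simp: subring_set_def idc.ev_add idc.ev_mult idc.ev_one)
      also have "\<dots> = 0"
        unfolding ev_def[of _ ?E] lin_def
      proof (rule sum.neutral, rule ballI)
        fix \<mu> assume "\<mu> \<in> keys h"
        then obtain i where i: "i < 4" "0 < lookup \<mu> i" using h by (auto simp: mono_ideal_def)
        have "u i \<notin> T b" using u_sum[OF i(1)] by (auto simp: T_def b_def)
        then have "?\<epsilon> i = 0" using i(1) by (simp add: \<rho>0_def l_def evalp_single orb_def u_S)
        then have "?E i = 0" unfolding idc.ev_add idc.ev_var idc.ev_const using aa_zero(2)[OF i(1)] by simp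
        then have "pw ?E \<mu> = 0" unfolding pw_def using i(2) by (intro prod_zero bexI[of _ i]) (auto simp: in_keys_iff)
        then show "ev (\<lambda>a. a) ?\<epsilon> (single 0 (lookup h \<mu>)) * pw ?E \<mu> = 0" by simp
      qed
      finally show "evalp (\<psi> h) (orb b t) = 0" .
    qed
    then show ?thesis using orb_nonvanishing[OF \<psi>_CR[of h]] by blast
  qed
  show ?thesis unfolding germ_ideal_eq[OF b c]
  proof (rule Set.equalityI; rule subsetI)
    fix x assume "x \<in> {Fract f g | f g. f \<in> CR b \<and> g \<in> CR b \<and> evalp g c \<noteq> 0 \<and> keys f \<inter> T b = {}}"
    then obtain f g where fg: "x = Fract f g" "f \<in> CR b" "g \<in> CR b" "evalp g c \<noteq> 0" "keys f \<inter> T b = {}" by blast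
    obtain \<mu> f' g' where m: "\<mu> \<in> T b" "f' \<in> PR (4 + r)" "g' \<in> PR (4 + r)"
      "\<psi> f' = f * single \<mu> 1" "\<psi> g' = g * single \<mu> 1" "f' \<in> mono_ideal r {..<4}"
      using \<psi>_surj[OF fg(2,3)] fg(5) by metis
    have \<mu>S: "single \<mu> 1 \<in> CR b" using m(1) T_S by (intro CR_single) blast
    have "evalp (\<psi> g') c \<noteq> 0"
      unfolding m(5) using fg(4) evalp_mult[OF cch fg(3) \<mu>S] can_iff[OF c, of \<mu>] m(1) T_S by (auto simp: evalp_single)
    then have s: "node_class r g' \<in> carrier (node_ring r) - node_origin r"
      using m(3) node_carrier lookup_not_origin[OF m(3)] \<psi>_value by auto
    have bL: "node_class r f' \<in> node_axis r" unfolding node_axis_eq using m(6) by blast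
    have xc: "x \<in> carrier (cls_ring (LR b c))" using LR_I[OF fg(2-4)] fg(1) by simp
    have "x \<otimes>\<^bsub>cls_ring (LR b c)\<^esub> \<phi> (node_class r g') = \<phi> (node_class r f')"
      unfolding \<phi>_class[OF m(2)] \<phi>_class[OF m(3)] m(4,5) fg(1) using evalp_ne[OF fg(4)] by (simp add: eq_fract)
    then show "x \<in> L.ext (node_axis r)" by (rule L.ext_I[OF xc bL s])
  next
    fix x assume "x \<in> L.ext (node_axis r)"
    then obtain y s where y: "x \<in> LR b c" "y \<in> node_axis r" "s \<in> carrier (node_ring r) - node_origin r" "x * \<phi> s = \<phi> y"
      unfolding L.ext_def by auto
    obtain h where h: "y = node_class r h" "h \<in> mono_ideal r {..<4}" using y(2) unfolding node_axis_eq by blast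
    have hP: "h \<in> PR (4 + r)" using h(2) ideal_setD(1)[OF mono_ideal_set] by blast
    obtain q where q: "s = node_class r q" "q \<in> PR (4 + r)" "lookup q 0 \<noteq> 0" using y(3) by (rule compl_originE)
    have ev: "evalp (\<psi> q) c \<noteq> 0" using \<psi>_value q(3) by simp
    have e: "x * fr (\<psi> q) = fr (\<psi> h)" using y(4) unfolding h(1) q(1) \<phi>_class[OF hP] \<phi>_class[OF q(2)] .
    have "x = Fract (\<psi> h) (\<psi> q)"
    proof -
      have nz: "\<psi> q \<noteq> 0" using ev by auto
      have "fr (\<psi> q) * Fract 1 (\<psi> q) = 1" using nz by (simp add: One_fract_def eq_fract)
      then have "x = x * fr (\<psi> q) * Fract 1 (\<psi> q)" by (simp only: mult.assoc mult_1_right)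
      also have "\<dots> = Fract (\<psi> h) (\<psi> q)" unfolding e by simp
      finally show ?thesis .
    qed
    then show "x \<in> {Fract f g | f g. f \<in> CR b \<and> g \<in> CR b \<and> evalp g c \<noteq> 0 \<and> keys f \<inter> T b = {}}"
      using \<psi>_CR ev mono_T[OF h(2)] by blast
  qed
qed

lemma transversal: "transversal_node D \<Sigma> (card D - 3) (W b) (Pt b c)"
proof -
  interpret L: localization_pair "cls_ring (LR b c)" "node_ring r" \<phi> "node_origin r" by (rule localization)
  interpret C: completion_pair "cls_ring (LR b c)" "node_ring r" \<phi> "nonunits (cls_ring (LR b c))" "node_origin r"
    by (rule L.completion_pair)
  have const: "C.pull (to_completion (cls_ring (LR b c)) (nonunits (cls_ring (LR b c))) (const_fun a)) =
      to_completion (node_ring r) (node_origin r) (node_class r (single 0 a))" for a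
  proof -
    have P: "single 0 a \<in> PR (4 + r)" by (rule PR_single) simp
    have "\<phi> (node_class r (single 0 a)) = const_fun a"
      unfolding \<phi>_class[OF P] \<psi>_const const_fun_def ..
    then show ?thesis using C.pull_to_completion[of "node_class r (single 0 a)"] P node_carrier by fastforce
  qed
  show ?thesis
    unfolding transversal_node_def Let_def local_ring_eq[OF b c] r_def[symmetric] germ_ext
    using C.pull_iso const L.pull_ext[OF node_axis_ideal] by blast
qed

end

section \<open>Forests\<close>

text \<open>A forest on \<open>V\<close>, in which the vertices of \<open>A\<close> have a parent \<open>\<pi>\<close> and \<open>sg\<close> is the sign of the edge to the parent. The
  invariant \<open>\<theta>\<close> is constant on trees and separates the marked vertices \<open>Q\<close>; so a tree contains at most one of them.\<close>

locale forest =
  fixes V A Q :: "'v set" and \<pi> :: "'v \<Rightarrow> 'v" and sg :: "'v \<Rightarrow> int" and rk :: "'v \<Rightarrow> nat" and \<theta> :: "'v \<Rightarrow> 'w"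
  assumes finV: "finite V" and AV: "A \<subseteq> V" and QV: "Q \<subseteq> V"
    and \<pi>: "v \<in> A \<Longrightarrow> \<pi> v \<in> V" and rk: "v \<in> A \<Longrightarrow> rk (\<pi> v) < rk v"
    and sg: "v \<in> A \<Longrightarrow> sg v * sg v = 1"
    and \<theta>: "v \<in> A \<Longrightarrow> \<theta> (\<pi> v) = \<theta> v" and \<theta>_Q: "inj_on \<theta> Q"
begin

function base :: "'v \<Rightarrow> 'v" where "base v = (if v \<in> A then base (\<pi> v) else v)"
  by auto
termination by (relation "Wellfounded.measure rk") (auto simp: rk)

text \<open>The coefficient of the edge from \<open>a\<close> to its parent in the path from the root of \<open>v\<close> to \<open>v\<close>.\<close>

function climb :: "'v \<Rightarrow> 'v \<Rightarrow> int" where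
  "climb a v = (if v \<in> A then climb a (\<pi> v) + (if v = a then sg a else 0) else 0)"
  by auto
termination by (relation "Wellfounded.measure (\<lambda>(a, v). rk v)") (auto simp: rk)

declare base.simps [simp del] climb.simps [simp del]

lemma base_step: "v \<in> A \<Longrightarrow> base (\<pi> v) = base v" by (subst (2) base.simps) simp

lemma base_id: "v \<notin> A \<Longrightarrow> base v = v" by (subst base.simps) simp

lemma climb_step: "v \<in> A \<Longrightarrow> climb a v = climb a (\<pi> v) + (if v = a then sg a else 0)" by (subst climb.simps) simp

lemma base_props: "v \<in> V \<Longrightarrow> base v \<in> V - A \<and> \<theta> (base v) = \<theta> v"
proof (induction v rule: base.induct)
  case (1 v)
  show ?case
  proof (cases "v \<in> A")
    case True
    then show ?thesis using 1(1)[OF True \<pi>[OF True]] by (simp add: base_step \<theta>)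
  qed (use 1 in \<open>simp add: base_id\<close>)
qed

lemma base_inj: "inj_on base Q"
proof (rule inj_onI)
  fix s t assume st: "s \<in> Q" "t \<in> Q" "base s = base t"
  then have "s \<in> V" "t \<in> V" using QV by auto
  then have "\<theta> s = \<theta> t" using base_props[of s] base_props[of t] st(3) by simp
  then show "s = t" using \<theta>_Q st by (auto dest: inj_onD)
qed

text \<open>The roots of the trees without a marked vertex.\<close>

definition R :: "'v set" where "R = V - A - base ` Q"

text \<open>The vertex of the tree with root \<open>x\<close> where the functions dual to the edges are normalised to vanish.\<close>

definition anchor :: "'v \<Rightarrow> 'v" where "anchor x = (if x \<in> base ` Q then inv_into Q base x else x)"

text \<open>The basis dual to the values on the edges of the forest and on the roots of the trees without a marked
  vertex. In a tree with a marked vertex, functions are normalised to vanish there.\<close>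

definition basis :: "'v \<Rightarrow> 'v \<Rightarrow> int" where
  "basis i v = (if i \<in> A then climb i v - climb i (anchor (base v)) else if base v = i then 1 else 0)"

definition coord :: "'v \<Rightarrow> ('v \<Rightarrow> int) \<Rightarrow> int" where
  "coord i m = (if i \<in> A then sg i * (m i - m (\<pi> i)) else m i)"

lemma basis_Q: assumes "i \<in> A \<union> R" "s \<in> Q" shows "basis i s = 0"
  using assms base_inj by (auto simp: basis_def anchor_def R_def)

lemma coord_basis:
  assumes i: "i \<in> A \<union> R" and j: "j \<in> A \<union> R" shows "coord i (basis j) = (if i = j then 1 else 0)"
proof (cases "i \<in> A")
  case True
  have "climb j i - climb j (\<pi> i) = (if i = j then sg i else 0)" using climb_step[OF True, of j] by simp
  then have "j \<in> A \<Longrightarrow> basis j i - basis j (\<pi> i) = (if i = j then sg i else 0)"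
    using True by (simp add: basis_def base_step)
  then show ?thesis using j True sg[OF True] by (auto simp: coord_def basis_def base_step R_def)
next
  case False
  then have "i \<in> R" using i by auto
  then have "base i = i" "anchor i = i" using False by (auto simp: base_id anchor_def R_def)
  then show ?thesis using False by (auto simp: coord_def basis_def)
qed

text \<open>A function whose edge coordinates vanish is constant on trees, and the value on each tree is fixed by the marked vertex or
  by the coordinate at the root.\<close>

lemma coord_zero:
  assumes Q: "\<And>s. s \<in> Q \<Longrightarrow> m s = 0" and z: "\<And>i. i \<in> A \<union> R \<Longrightarrow> coord i m = 0" and v: "v \<in> V"
  shows "m v = 0"
proof -
  have const: "v \<in> V \<Longrightarrow> m (base v) = m v" for v
  proof (induction v rule: base.induct)
    case (1 v)
    show ?case
    proof (cases "v \<in> A")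
      case True
      have "sg v \<noteq> 0" using sg[OF True] by auto
      then have "m v = m (\<pi> v)" using z[of v] True by (simp add: coord_def)
      then show ?thesis using 1(1)[OF True \<pi>[OF True]] True by (simp add: base_step)
    qed (simp add: base_id)
  qed
  show ?thesis
  proof (cases "base v \<in> base ` Q")
    case True
    then obtain s where "s \<in> Q" "base v = base s" by auto
    then show ?thesis using const[OF v] const[of s] Q QV by auto
  next
    case False
    then have R: "base v \<in> R" using base_props[OF v] by (auto simp: R_def)
    then have "coord (base v) m = m (base v)" by (auto simp: coord_def R_def)
    then show ?thesis using z[of "base v"] R const[OF v] by simp
  qed
qed

lemma card_basis: "card (A \<union> R) = card (V - Q)" "finite (A \<union> R)" "A \<inter> R = {}"
proof -
  have fin: "finite A" "finite R" using finite_subset[OF AV finV] finV by (auto simp: R_def)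
  show f: "finite (A \<union> R)" using fin by simp
  show d: "A \<inter> R = {}" by (auto simp: R_def)
  have "base ` Q \<subseteq> V - A" using base_props QV by auto
  then have "card R = card (V - A) - card (base ` Q)" "card (base ` Q) \<le> card (V - A)"
    unfolding R_def using finV by (auto simp: card_Diff_subset finite_subset intro: card_mono)
  then have "card R + card Q = card (V - A)" using card_image[OF base_inj] by simp
  moreover have "card (V - A) = card V - card A" "card A \<le> card V" "card (V - Q) = card V - card Q" "card Q \<le> card V"
    using finV AV QV fin by (auto simp: card_Diff_subset finite_subset intro: card_mono)
  ultimately show "card (A \<union> R) = card (V - Q)" using card_Un_disjoint[OF fin d] by linarith
qed

lemma enumeration:
  obtains f where "bij_betw f {..<card (V - Q)} (A \<union> R)" "f ` {..<card A} = A" "card A \<le> card (V - Q)"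
proof -
  have fin: "finite A" "finite R" using card_basis(2) by auto
  have c: "card (V - Q) = card A + card R" using card_Un_disjoint[OF fin card_basis(3)] card_basis(1) by simp
  obtain f where f: "bij_betw f {0..<card A} A" using ex_bij_betw_nat_finite[OF fin(1)] by blast
  obtain g where g: "bij_betw g {0..<card R} R" using ex_bij_betw_nat_finite[OF fin(2)] by blast
  define h where "h i = (if i < card A then f i else g (i - card A))" for i
  have hA: "bij_betw h {..<card A} A"
    using f by (subst bij_betw_cong[of _ _ f]) (auto simp: h_def atLeast0LessThan)
  have "bij_betw (\<lambda>i. i - card A) {card A..<card A + card R} {0..<card R}"
    by (rule bij_betwI[where g = "\<lambda>i. i + card A"]) auto
  from bij_betw_trans[OF this g] have hR: "bij_betw h {card A..<card A + card R} R"
    by (subst bij_betw_cong[of _ _ "g \<circ> (\<lambda>i. i - card A)"]) (auto simp: h_def)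
  have "{..<card (V - Q)} = {..<card A} \<union> {card A..<card A + card R}" unfolding c by auto
  then have "bij_betw h {..<card (V - Q)} (A \<union> R)" using bij_betw_combine[OF hA hR card_basis(3)] by simp
  then show ?thesis using that[of h] hA c by (simp add: bij_betw_def)
qed

end

section \<open>The ladder diagram\<close>

lemma nsum_Suc: "nsum k (Suc i) = nsum k i + k (Suc i)" by (simp add: nsum_def)

lemma nsum_0 [simp]: "nsum k 0 = 0" by (simp add: nsum_def)

lemma nsum_mono: "i \<le> j \<Longrightarrow> nsum k i \<le> nsum k j"
  by (induction j rule: dec_induct) (auto simp: nsum_Suc)

locale ladder =
  fixes l :: nat and k :: "nat \<Rightarrow> nat"
  assumes l: "1 \<le> l" and k: "i \<in> {1..l+1} \<Longrightarrow> 0 < k i"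
begin

abbreviation "D \<equiv> dots l k"
abbreviation "Q \<equiv> stars l k"
abbreviation "V \<equiv> D \<union> Q"
abbreviation "E \<equiv> edges l k"

lemma nsum_strict: assumes "i < j" "j \<le> l + 1" shows "nsum k i < nsum k j"
proof -
  obtain j' where j': "j = Suc j'" using assms(1) by (cases j) auto
  have "nsum k i \<le> nsum k j'" using assms(1) j' by (intro nsum_mono) simp
  moreover have "0 < k j" using assms j' by (intro k) auto
  ultimately show ?thesis unfolding j' nsum_Suc by simp
qed

lemma nsum_less_iff: "i \<le> l + 1 \<Longrightarrow> nsum k i < nsum k j \<Longrightarrow> i < j"
  using nsum_mono[of j i k] by (meson leD not_le_imp_less)

lemma dotsE:
  assumes "x \<in> D" obtains i where "i \<in> {1..l+1}" "nsum k (i - 1) < col x" "col x \<le> nsum k i" "1 \<le> row x"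
    "row x + nsum k i \<le> nsum k (l + 1)"
proof -
  obtain a c i where *: "x = Cell a c" "i \<in> {1..l+1}" "nsum k (i-1) < a" "a \<le> nsum k i" "1 \<le> c" "c \<le> nsum k (l+1) - nsum k i"
    using assms unfolding dots_def by blast
  have "nsum k i \<le> nsum k (l + 1)" using *(2) by (intro nsum_mono) simp
  then show ?thesis using * by (intro that[of i]) auto
qed

lemma dotsI:
  assumes "i \<in> {1..l+1}" "1 \<le> a" "a \<le> nsum k i" "1 \<le> c" "c + nsum k i \<le> nsum k (l + 1)" shows "Cell a c \<in> D"
proof -
  define j where "j = (LEAST j. a \<le> nsum k j)"
  have j: "a \<le> nsum k j" unfolding j_def by (rule LeastI) (rule assms(3))
  have ji: "j \<le> i" unfolding j_def by (rule Least_le) (rule assms(3))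
  have "0 < j" using j assms(2) by (cases j) auto
  then have "\<not> a \<le> nsum k (j - 1)" using not_less_Least[of "j - 1" "\<lambda>j. a \<le> nsum k j"] unfolding j_def[symmetric] by simp
  moreover have "nsum k j \<le> nsum k i" using ji by (rule nsum_mono)
  ultimately show ?thesis
    unfolding dots_def using assms ji j \<open>0 < j\<close> by (intro CollectI exI[of _ a] exI[of _ c] exI[of _ j]) auto
qed

lemma dots_pos: "x \<in> D \<Longrightarrow> 1 \<le> col x \<and> 1 \<le> row x" by (elim dotsE) auto

lemma dots_down: assumes "Cell a c \<in> D" "1 \<le> a'" "a' \<le> a" "1 \<le> c'" "c' \<le> c" shows "Cell a' c' \<in> D"
  using assms(1) by (rule dotsE) (use assms in \<open>auto intro: dotsI\<close>)

lemma starsE: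
  assumes "s \<in> Q" obtains i where "i \<in> {1..l+1}" "col s = nsum k (i - 1) + 1" "row s + nsum k i = nsum k (l + 1) + 1"
proof -
  obtain i where i: "i \<in> {1..l+1}" "s = Cell (nsum k (i-1) + 1) (nsum k (l+1) - nsum k i + 1)" using assms unfolding stars_def by blast
  have "nsum k i \<le> nsum k (l + 1)" using i(1) by (intro nsum_mono) simp
  then show ?thesis using i by (intro that[of i]) auto
qed

text \<open>The stars sit outside the corners of the staircase, so nothing lies weakly above and to the right of them.\<close>

lemma star_maximal:
  assumes s: "s \<in> Q" and v: "v \<in> V" and le: "col s \<le> col v" "row s \<le> row v" shows "v \<in> Q \<and> v = s"
proof -
  obtain i where i: "i \<in> {1..l+1}" "col s = nsum k (i - 1) + 1" "row s + nsum k i = nsum k (l + 1) + 1" using s by (rule starsE)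
  have "v \<notin> D"
  proof
    assume "v \<in> D"
    then obtain j where j: "j \<in> {1..l+1}" "col v \<le> nsum k j" "row v + nsum k j \<le> nsum k (l + 1)" by (rule dotsE)
    have "i - 1 < j" by (rule nsum_less_iff[of _ j]) (use i j le in auto)
    then have "nsum k i \<le> nsum k j" by (intro nsum_mono) simp
    then show False using i j le by linarith
  qed
  then have vQ: "v \<in> Q" using v by blast
  then obtain j where j: "j \<in> {1..l+1}" "col v = nsum k (j - 1) + 1" "row v + nsum k j = nsum k (l + 1) + 1" by (rule starsE)
  have "\<not> j - 1 < i - 1"
  proof
    assume "j - 1 < i - 1"
    then have "nsum k (j - 1) < nsum k (i - 1)" using i(1) by (intro nsum_strict) auto
    then show False using i(2) j(2) le(1) by linarith
  qed
  moreover have "\<not> i < j"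
  proof
    assume "i < j"
    then have "nsum k i < nsum k j" using j(1) by (intro nsum_strict) auto
    then show False using i(3) j(3) le(2) by linarith
  qed
  ultimately have "i = j" using i(1) j(1) by auto
  then show ?thesis using i j vQ by (auto intro: cell.expand)
qed

lemma stars_disjoint: "D \<inter> Q = {}"
proof (rule ccontr)
  assume "D \<inter> Q \<noteq> {}"
  then obtain s where s: "s \<in> D" "s \<in> Q" by blast
  obtain i where i: "i \<in> {1..l+1}" "col s = nsum k (i - 1) + 1" "row s + nsum k i = nsum k (l + 1) + 1" using s(2) by (rule starsE)
  obtain j where j: "j \<in> {1..l+1}" "col s \<le> nsum k j" "row s + nsum k j \<le> nsum k (l + 1)" using s(1) by (rule dotsE)
  have "i - 1 < j" by (rule nsum_less_iff[of _ j]) (use i j in auto)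
  then have "nsum k i \<le> nsum k j" by (intro nsum_mono) simp
  then show False using i j by linarith
qed

lemma V_pos: "x \<in> V \<Longrightarrow> 1 \<le> col x \<and> 1 \<le> row x"
proof (elim UnE dots_pos)
  assume "x \<in> Q"
  then obtain i where i: "i \<in> {1..l+1}" "col x = nsum k (i - 1) + 1" "row x + nsum k i = nsum k (l + 1) + 1" by (rule starsE)
  have "nsum k i \<le> nsum k (l + 1)" using i(1) by (intro nsum_mono) simp
  then show ?thesis using i by simp
qed

definition diag :: "cell \<Rightarrow> int" where "diag x = int (col x) - int (row x)"

text \<open>Distinct stars are incomparable in the product order, so one that lies further right also lies lower.\<close>

lemma diag_stars: "inj_on diag Q"
proof (rule inj_onI)
  fix s t assume st: "s \<in> Q" "t \<in> Q" "diag s = diag t"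
  consider "col s \<le> col t" "row s \<le> row t" | "col t \<le> col s" "row t \<le> row s"
    using st(3) unfolding diag_def by linarith
  then show "s = t" using star_maximal[of s t] star_maximal[of t s] st by cases auto
qed

lemma top_star: "\<exists>h\<ge>1. Cell 1 (h + 1) \<in> Q \<and> (\<forall>c\<in>{1..h}. Cell 1 c \<in> D)"
proof (intro exI conjI ballI)
  let ?h = "nsum k (l + 1) - nsum k 1"
  have "nsum k 1 < nsum k (l + 1)" using l by (intro nsum_strict) auto
  then show "1 \<le> ?h" by simp
  show "Cell 1 (?h + 1) \<in> Q" unfolding stars_def by (rule image_eqI[of _ _ 1]) auto
  fix c assume "c \<in> {1..?h}"
  moreover have "1 \<le> nsum k 1" using nsum_strict[of 0 1] by simp
  ultimately show "Cell 1 c \<in> D" by (intro dotsI[of 1]) auto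
qed

lemma right_star: "\<exists>h\<ge>1. Cell (h + 1) 1 \<in> Q \<and> (\<forall>a\<in>{1..h}. Cell a 1 \<in> D)"
proof (intro exI conjI ballI)
  let ?h = "nsum k l"
  show "1 \<le> ?h" using nsum_strict[of 0 l] l by simp
  show "Cell (?h + 1) 1 \<in> Q" unfolding stars_def by (rule image_eqI[of _ _ "l + 1"]) auto
  fix a assume "a \<in> {1..?h}"
  moreover have "nsum k l < nsum k (l + 1)" by (intro nsum_strict) auto
  ultimately show "Cell a 1 \<in> D" using l by (intro dotsI[of l]) auto
qed

lemma finite_D: "finite D"
proof (rule finite_subset)
  show "D \<subseteq> (\<lambda>(a, c). Cell a c) ` ({..nsum k (l + 1)} \<times> {..nsum k (l + 1)})"
  proof
    fix x assume "x \<in> D"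
    then obtain i where i: "i \<in> {1..l+1}" "col x \<le> nsum k i" "row x + nsum k i \<le> nsum k (l + 1)" by (rule dotsE)
    have "nsum k i \<le> nsum k (l + 1)" using i(1) by (intro nsum_mono) simp
    then show "x \<in> (\<lambda>(a, c). Cell a c) ` ({..nsum k (l + 1)} \<times> {..nsum k (l + 1)})"
      using i by (intro image_eqI[of _ _ "(col x, row x)"]) auto
  qed
qed simp

lemma finite_Q: "finite Q" by (simp add: stars_def)

lemma finite_E: "finite E"
  by (rule finite_subset[of _ "V \<times> V"]) (auto simp: edges_def finite_D finite_Q)

subsection \<open>Edges as functionals\<close>

text \<open>Lattice functionals are integer functions on the dots; extended by zero to the stars, the value on
  \<open>\<delta>(e)\<close> is the difference of the values at head and tail.\<close>

definition ip :: "(cell \<Rightarrow>\<^sub>0 int) \<Rightarrow> edge \<Rightarrow> int" where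
  "ip m e = (if snd e \<in> D then lookup m (snd e) else 0) - (if fst e \<in> D then lookup m (fst e) else 0)"

lemma lookup_outside: "m \<in> dual_lattice D \<Longrightarrow> x \<notin> D \<Longrightarrow> lookup m x = 0"
  by (auto simp: dual_lattice_def in_keys_iff)

lemma ip_dual: "m \<in> dual_lattice D \<Longrightarrow> ip m e = lookup m (snd e) - lookup m (fst e)"
  by (simp add: ip_def lookup_outside)

lemma ip_pair: "m \<in> dual_lattice D \<Longrightarrow> ip m (x, y) = lookup m y - lookup m x"
  by (simp add: ip_dual)

lemma lookup_delta: "lookup (delta l k e) x = (if x \<in> D then (if x = snd e then 1 else 0) - (if x = fst e then 1 else 0) else 0)"
  unfolding delta_def proj_dots_def lookup_sum lookup_single when_def lookup_minus
  using finite_D by (simp add: eq_commute[of x])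

lemma pairing_delta: "pairing m (delta l k e) = of_int (ip m e)"
proof -
  have *: "(\<Sum>x\<in>keys m. of_int (lookup m x) * (if x = y then g else 0)) =
     (of_int (lookup m y) * g :: real)" for y g
    by (simp add: if_distrib[of "\<lambda>z. _ * z"] in_keys_iff cong: if_cong)
  have "pairing m (delta l k e) = (\<Sum>x\<in>keys m.
      of_int (lookup m x) * (if x = snd e then (if snd e \<in> D then 1 else 0) else 0) -
      of_int (lookup m x) * (if x = fst e then (if fst e \<in> D then 1 else 0) else 0))"
    unfolding pairing_def lookup_delta by (intro sum.cong refl) auto
  then show ?thesis unfolding sum_subtractf * by (simp add: ip_def)
qed

text \<open>A function that decreases along every edge is bounded by zero from both sides, because every dot lies on
  a directed path from the top star to the rightmost star.\<close>

lemma monotone_zero: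
  fixes m :: "cell \<Rightarrow> real"
  assumes Q: "\<And>s. s \<in> Q \<Longrightarrow> m s = 0" and le: "\<And>x y. (x, y) \<in> E \<Longrightarrow> m y \<le> m x" and v: "v \<in> V"
  shows "m v = 0"
proof (cases "v \<in> Q")
  case False
  define a c where "a = col v" and "c = row v"
  have v: "Cell a c \<in> D" using v False by (simp add: a_def c_def)
  have pos: "1 \<le> a" "1 \<le> c" using dots_pos[OF v] by auto
  obtain h where h: "Cell 1 (h + 1) \<in> Q" "\<And>c. 1 \<le> c \<Longrightarrow> c \<le> h \<Longrightarrow> Cell 1 c \<in> D" using top_star by fastforce
  obtain g where g: "Cell (g + 1) 1 \<in> Q" "\<And>a. 1 \<le> a \<Longrightarrow> a \<le> g \<Longrightarrow> Cell a 1 \<in> D" using right_star by fastforce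
  have ch: "c \<le> h" using star_maximal[OF h(1), of "Cell a c"] v pos stars_disjoint by (intro leI notI) auto
  have ag: "a \<le> g" using star_maximal[OF g(1), of "Cell a c"] v pos stars_disjoint by (intro leI notI) auto
  have E_right: "(Cell x y, Cell (x + 1) y) \<in> E" if "Cell x y \<in> V" "Cell (x + 1) y \<in> V" for x y
    using that by (simp add: edges_def)
  have E_down: "(Cell x (y + 1), Cell x y) \<in> E" if "Cell x (y + 1) \<in> V" "Cell x y \<in> V" for x y
    using that by (simp add: edges_def)
  have right: "m (Cell (x + j) y) \<le> m (Cell x y)" if "\<And>i. i \<le> j \<Longrightarrow> Cell (x + i) y \<in> V" for x y j
    using that
  proof (induction j)
    case (Suc j)
    have "m (Cell (x + Suc j) y) \<le> m (Cell (x + j) y)"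
      using le[OF E_right[of "x + j" y]] Suc.prems[of j] Suc.prems[of "Suc j"] by simp
    also have "m (Cell (x + j) y) \<le> m (Cell x y)" by (rule Suc.IH) (rule Suc.prems, simp)
    finally show ?case .
  qed simp
  have down: "m (Cell x y) \<le> m (Cell x (y + j))" if "\<And>i. i \<le> j \<Longrightarrow> Cell x (y + i) \<in> V" for x y j
    using that
  proof (induction j)
    case (Suc j)
    have "m (Cell x (y + j)) \<le> m (Cell x (y + Suc j))"
      using le[OF E_down[of x "y + j"]] Suc.prems[of j] Suc.prems[of "Suc j"] by simp
    with Suc.IH[OF Suc.prems] show ?case by simp
  qed simp
  have "m (Cell 1 c) \<le> m (Cell 1 (c + (h + 1 - c)))"
  proof (rule down)
    fix i assume "i \<le> h + 1 - c"
    then show "Cell 1 (c + i) \<in> V" using h pos ch by (cases "i = h + 1 - c") auto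
  qed
  moreover have "m (Cell (1 + (a - 1)) c) \<le> m (Cell 1 c)"
    using dots_down[OF v, of "1 + _" c] pos by (intro right) auto
  moreover have "m (Cell a 1) \<le> m (Cell a (1 + (c - 1)))"
    using dots_down[OF v, of a "1 + _"] pos by (intro down) auto
  moreover have "m (Cell (a + (g + 1 - a)) 1) \<le> m (Cell a 1)"
  proof (rule right)
    fix i assume "i \<le> g + 1 - a"
    then show "Cell (a + i) 1 \<in> V" using g pos ag by (cases "i = g + 1 - a") auto
  qed
  ultimately have "m (Cell a c) \<le> 0" "0 \<le> m (Cell a c)" using Q[OF h(1)] Q[OF g(1)] pos ch ag by simp_all
  then show ?thesis by (simp add: a_def c_def)
qed (rule Q)

lemma E_nonempty: "E \<noteq> {}"
proof -
  obtain h where h: "1 \<le> h" "Cell 1 (h + 1) \<in> Q" "\<And>c. 1 \<le> c \<Longrightarrow> c \<le> h \<Longrightarrow> Cell 1 c \<in> D" using top_star by fastforce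
  then have "(Cell 1 (h + 1), Cell 1 h) \<in> E" by (simp add: edges_def)
  then show ?thesis by blast
qed

subsection \<open>The fan in terms of edges\<close>

text \<open>A proper face is cut out by an integral functional whose maximum over the edges is positive; it is
  recorded by the set of edges where the maximum is attained.\<close>

definition supports :: "(cell \<Rightarrow>\<^sub>0 int) \<Rightarrow> int \<Rightarrow> edge set \<Rightarrow> bool" where
  "supports u N F \<longleftrightarrow> u \<in> dual_lattice D \<and> 0 < N \<and> F \<subseteq> E \<and> (\<forall>e\<in>E. ip u e \<le> N \<and> (ip u e = N \<longleftrightarrow> e \<in> F))"

definition faces :: "edge set set" where "faces = {F. \<exists>u N. supports u N F}"

lemma ip_scale: "ip (frag_cmul c m) e = c * ip m e" by (simp add: ip_def algebra_simps)
lemma ip_minus: "ip (m - m') e = ip m e - ip m' e" by (simp add: ip_def lookup_minus)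

text \<open>A face of a cone is cut out by a large multiple of \<open>u\<close> minus the given functional. To separate two cones, subtract their
  supporting functionals after rescaling them to the same bound.\<close>

sublocale toric D faces "delta l k" ip
proof
  show "finite D" by (rule finite_D)
  show "finite F" if "F \<in> faces" for F
    using that finite_E by (auto simp: faces_def supports_def dest: finite_subset)
  show "pairing m (delta l k e) = of_int (ip m e)" for m e by (rule pairing_delta)
  show "{} \<in> faces"
    unfolding faces_def supports_def by (intro CollectI exI[of _ 0] exI[of _ 1]) (auto simp: dual_lattice_zero ip_def)
  show "{e \<in> F. ip m e = 0} \<in> faces" if F: "F \<in> faces" and m: "m \<in> dual_lattice D" and pos: "\<And>e. e \<in> F \<Longrightarrow> 0 \<le> ip m e" for F m
  proof -
    obtain u N where u: "supports u N F" using F by (auto simp: faces_def)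
    define K where "K = 1 + (\<Sum>e\<in>E. \<bar>ip m e\<bar>)"
    have K: "\<bar>ip m e\<bar> < K" if "e \<in> E" for e
      using member_le_sum[of e E "\<lambda>e. \<bar>ip m e\<bar>"] that finite_E by (simp add: K_def)
    have K0: "0 < K" unfolding K_def by (intro add_pos_nonneg sum_nonneg) auto
    let ?m = "frag_cmul K u - m"
    have "supports ?m (K * N) {e \<in> F. ip m e = 0}"
      unfolding supports_def
    proof (intro conjI ballI)
      show "?m \<in> dual_lattice D" using u m by (auto simp: supports_def intro: dual_lattice_diff dual_lattice_cmul)
      show "0 < K * N" using K0 u by (simp add: supports_def)
      show "{e \<in> F. ip m e = 0} \<subseteq> E" using u by (auto simp: supports_def)
      fix e assume e: "e \<in> E"
      have "ip ?m e \<le> K * N \<and> ((ip ?m e = K * N) = (e \<in> {e \<in> F. ip m e = 0}))"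
      proof (cases "e \<in> F")
        case True
        then have "ip u e = N" using u e by (simp add: supports_def)
        then show ?thesis using pos[OF True] True by (auto simp: ip_minus ip_scale)
      next
        case False
        then have "ip u e \<le> N - 1" using u e by (force simp: supports_def)
        then have "K * ip u e \<le> K * (N - 1)" using K0 by (intro mult_left_mono) auto
        then have "K * ip u e - ip m e < K * N" using K[OF e] by (simp add: algebra_simps)
        then show ?thesis using False by (auto simp: ip_minus ip_scale)
      qed
      then show "ip ?m e \<le> K * N" "(ip ?m e = K * N) = (e \<in> {e \<in> F. ip m e = 0})" by blast+
    qed
    then show ?thesis unfolding faces_def by blast
  qed
  show "\<exists>m\<in>dual_lattice D. (\<forall>e\<in>F. 0 \<le> ip m e \<and> (ip m e = 0 \<longleftrightarrow> e \<in> G)) \<and> (\<forall>e\<in>G. ip m e \<le> 0 \<and> (ip m e = 0 \<longleftrightarrow> e \<in> F))"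
    if F: "F \<in> faces" and G: "G \<in> faces" for F G
  proof -
    obtain u N where u: "supports u N F" using F by (auto simp: faces_def)
    obtain u' N' where u': "supports u' N' G" using G by (auto simp: faces_def)
    let ?m = "frag_cmul N' u - frag_cmul N u'"
    have v: "ip ?m e = N' * ip u e - N * ip u' e" for e by (simp add: ip_minus ip_scale)
    show ?thesis
    proof (intro bexI[of _ "?m"] conjI ballI)
      show "?m \<in> dual_lattice D"
        using u u' by (auto simp: supports_def intro: dual_lattice_diff dual_lattice_cmul)
      fix e assume e: "e \<in> F"
      then have "e \<in> E" "ip u e = N" "0 < N" using u by (auto simp: supports_def)
      then have eq: "ip ?m e = N * (N' - ip u' e)" unfolding v by (simp add: algebra_simps)
      have "ip u' e \<le> N' \<and> (ip u' e = N' \<longleftrightarrow> e \<in> G)" using u' \<open>e \<in> E\<close> by (simp add: supports_def)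
      then show "0 \<le> ip ?m e" "(ip ?m e = 0) = (e \<in> G)"
        unfolding eq using \<open>0 < N\<close> by auto
    next
      fix e assume e: "e \<in> G"
      then have "e \<in> E" "ip u' e = N'" "0 < N'" using u' by (auto simp: supports_def)
      then have eq: "ip ?m e = N' * (ip u e - N)" unfolding v by (simp add: algebra_simps)
      have "ip u e \<le> N \<and> (ip u e = N \<longleftrightarrow> e \<in> F)" using u \<open>e \<in> E\<close> by (simp add: supports_def)
      then show "ip ?m e \<le> 0" "(ip ?m e = 0) = (e \<in> F)"
        unfolding eq using \<open>0 < N'\<close> by (auto simp: mult_le_0_iff)
    qed
  qed
qed

end

section \<open>Cones without a box are smooth\<close>

context forest
begin

lemma coord_cong:
  assumes "i \<in> A \<union> R" "\<And>v. v \<in> V \<Longrightarrow> m v = m' v" shows "coord i m = coord i m'"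
proof -
  have "i \<in> V" using assms(1) AV by (auto simp: R_def)
  then show ?thesis using assms(2)[of i] assms(2)[OF \<pi>[of i]] by (simp add: coord_def)
qed

lemma coord_add: "coord i (\<lambda>v. m v + m' v) = coord i m + coord i m'"
  by (simp add: coord_def algebra_simps)

lemma coord_sum: "coord i (\<lambda>v. \<Sum>j\<in>J. g j * m j v) = (\<Sum>j\<in>J. g j * coord i (m j))"
  by (simp add: coord_def sum_distrib_left sum_subtractf algebra_simps)

end

context ladder
begin

definition top_end :: "edge \<Rightarrow> cell" where "top_end e = (if row (fst e) = row (snd e) then snd e else fst e)"
definition bot_end :: "edge \<Rightarrow> cell" where "bot_end e = (if row (fst e) = row (snd e) then fst e else snd e)"
definition esgn :: "edge \<Rightarrow> int" where "esgn e = (if row (fst e) = row (snd e) then 1 else - 1)"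

lemma edge_cases:
  assumes "e \<in> E"
  obtains (horizontal) a c where "e = (Cell a c, Cell (a + 1) c)" "Cell a c \<in> V" "Cell (a + 1) c \<in> V"
  | (vertical) a c where "e = (Cell a (c + 1), Cell a c)" "Cell a (c + 1) \<in> V" "Cell a c \<in> V"
proof -
  obtain x y where e: "e = (x, y)" "x \<in> V" "y \<in> V" "col y = col x + 1 \<and> row y = row x \<or> col y = col x \<and> row x = row y + 1"
    using assms by (auto simp: edges_def)
  from e(4) show ?thesis
  proof
    assume "col y = col x + 1 \<and> row y = row x"
    then have "y = Cell (col x + 1) (row x)" by (auto intro: cell.expand)
    then show ?thesis using e horizontal[of "col x" "row x"] by simp
  next
    assume "col y = col x \<and> row x = row y + 1"
    then have "x = Cell (col y) (row y + 1)" by (auto intro: cell.expand)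
    then show ?thesis using e vertical[of "col y" "row y"] by simp
  qed
qed

lemma edge_ends:
  assumes "e \<in> E"
  shows "top_end e \<in> V" "bot_end e \<in> V" "col (bot_end e) + row (bot_end e) < col (top_end e) + row (top_end e)"
    "diag (top_end e) - diag (bot_end e) = esgn e"
  using assms by (cases rule: edge_cases; auto simp: top_end_def bot_end_def esgn_def diag_def)+

lemma esgn_sq: "esgn e * esgn e = 1" by (simp add: esgn_def)

lemma ip_ends:
  assumes "m \<in> dual_lattice D"
  shows "ip m e = esgn e * (lookup m (top_end e) - lookup m (bot_end e))"
  by (simp add: ip_dual[OF assms] esgn_def top_end_def bot_end_def)

text \<open>Two edges of a face that meet at a common upper right end are the upper and right sides of a unit square.
  The values of the supporting functional on the two other sides have the same sum, so these sides lie in the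
  face as well.\<close>

lemma top_end_inj:
  assumes F: "supports u N F" and free: "\<And>b. b \<in> boxes l k \<Longrightarrow> \<not> b \<subseteq> F"
  shows "inj_on top_end F"
proof -
  have FE: "F \<subseteq> E" using F by (simp add: supports_def)
  have corner: False if "(Cell a (c + 1), Cell (a + 1) (c + 1)) \<in> F" "(Cell (a + 1) (c + 1), Cell (a + 1) c) \<in> F" for a c
  proof -
    let ?p = "Cell a (c + 1)" and ?q = "Cell (a + 1) (c + 1)" and ?r = "Cell (a + 1) c" and ?s = "Cell a c"
    have V: "?p \<in> V" "?q \<in> V" "?r \<in> V" using that FE by (auto simp: edges_def)
    have "?p \<notin> Q" using star_maximal[OF _ V(2), of ?p] by auto
    then have "?p \<in> D" using V(1) by blast
    have pos: "1 \<le> a" "1 \<le> c" using V_pos[OF V(1)] V_pos[OF V(3)] by simp_all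
    have "?s \<in> D" by (rule dots_down[OF \<open>?p \<in> D\<close> pos(1) order_refl pos(2) le_add1])
    then have E: "(?p, ?s) \<in> E" "(?s, ?r) \<in> E" using V by (simp_all add: edges_def)
    have u: "u \<in> dual_lattice D" using F by (simp add: supports_def)
    have "ip u (?p, ?s) + ip u (?s, ?r) = ip u (?p, ?q) + ip u (?q, ?r)" unfolding ip_pair[OF u] by simp
    moreover have "ip u (?p, ?q) = N" "ip u (?q, ?r) = N" using that FE F by (auto simp: supports_def)
    moreover have "ip u (?p, ?s) \<le> N" "ip u (?s, ?r) \<le> N" using E F by (auto simp: supports_def)
    ultimately have "ip u (?p, ?s) = N" "ip u (?s, ?r) = N" by linarith+
    then have "(?p, ?s) \<in> F" "(?s, ?r) \<in> F" using E F by (auto simp: supports_def)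
    then have sub: "{(?p, ?q), (?q, ?r), (?p, ?s), (?s, ?r)} \<subseteq> F" using that by blast
    then have "{(?p, ?q), (?q, ?r), (?p, ?s), (?s, ?r)} \<in> boxes l k" unfolding boxes_def using FE by blast
    then show False using free sub by blast
  qed
  show ?thesis
  proof (rule inj_onI)
    fix e e' assume e: "e \<in> F" "e' \<in> F" "top_end e = top_end e'"
    have E: "e \<in> E" "e' \<in> E" using e FE by auto
    from E(1) show "e = e'"
    proof (cases rule: edge_cases)
      case (horizontal a c)
      from E(2) show ?thesis
      proof (cases rule: edge_cases)
        case v: (vertical a' c')
        then have "a' = a + 1" "c = c' + 1" using e(3) horizontal by (auto simp: top_end_def)
        then show ?thesis using corner[of a c'] e horizontal v by simp
      qed (use e horizontal in \<open>auto simp: top_end_def\<close>)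
    next
      case (vertical a c)
      from E(2) show ?thesis
      proof (cases rule: edge_cases)
        case h: (horizontal a' c')
        then have "a = a' + 1" "c' = c + 1" using e(3) vertical by (auto simp: top_end_def)
        then show ?thesis using corner[of a' c] e vertical h by simp
      qed (use e vertical in \<open>auto simp: top_end_def\<close>)
    qed
  qed
qed

text \<open>Without boxes the edges of a face form a forest with parents to the left or below. The supporting functional minus \<open>N\<close>
  times \<open>diag\<close> is constant along its edges and distinguishes the stars, which are the marked vertices.\<close>

lemma box_free_regular:
  assumes F: "F \<in> faces" and free: "\<And>b. b \<in> boxes l k \<Longrightarrow> \<not> b \<subseteq> F" and c: "c \<in> can F"
  shows "regular_local (local_ring D (Pt F c))"
proof -
  obtain u N where u: "supports u N F" using F by (auto simp: faces_def)
  have uD: "u \<in> dual_lattice D" and N: "0 < N" and FE: "F \<subseteq> E" using u by (auto simp: supports_def)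
  have inj: "inj_on top_end F" by (rule top_end_inj[OF u free])
  define A where "A = top_end ` F"
  have ball_A: "(\<forall>a\<in>A. P a) \<longleftrightarrow> (\<forall>e\<in>F. P (top_end e))" for P by (simp add: A_def)
  define en where "en = inv_into F top_end"
  have en: "en v \<in> F" "top_end (en v) = v" if "v \<in> A" for v
    using that by (auto simp: A_def en_def inv_into_into f_inv_into_f)
  have en_top: "en (top_end e) = e" if "e \<in> F" for e using that inj by (simp add: en_def)
  define \<theta> where "\<theta> v = lookup u v - N * diag v" for v
  interpret f: forest V A Q "\<lambda>v. bot_end (en v)" "\<lambda>v. esgn (en v)" "\<lambda>v. col v + row v" \<theta>
  proof
    show "finite V" using finite_D finite_Q by simp
    show "A \<subseteq> V" unfolding A_def using FE edge_ends by auto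
    show "Q \<subseteq> V" by simp
    fix v assume v: "v \<in> A"
    then have E: "en v \<in> E" using en FE by blast
    show "bot_end (en v) \<in> V" by (rule edge_ends(2)[OF E])
    show "col (bot_end (en v)) + row (bot_end (en v)) < col v + row v" using edge_ends(3)[OF E] en(2)[OF v] by simp
    show "esgn (en v) * esgn (en v) = 1" by (rule esgn_sq)
    have "ip u (en v) = N" using u E en(1)[OF v] by (simp add: supports_def)
    then have "esgn (en v) * (lookup u v - lookup u (bot_end (en v))) = N"
      unfolding ip_ends[OF uD] en(2)[OF v] .
    then have "lookup u v - lookup u (bot_end (en v)) = esgn (en v) * N"
      by (metis esgn_sq mult.assoc mult_1)
    moreover have "diag v - diag (bot_end (en v)) = esgn (en v)" using edge_ends(4)[OF E] en(2)[OF v] by simp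
    ultimately have "lookup u v - lookup u (bot_end (en v)) = N * diag v - N * diag (bot_end (en v))"
      by (metis mult.commute right_diff_distrib)
    then show "\<theta> (bot_end (en v)) = \<theta> v" by (simp add: \<theta>_def)
  next
    show "inj_on \<theta> Q"
    proof (rule inj_onI)
      fix s t assume st: "s \<in> Q" "t \<in> Q" "\<theta> s = \<theta> t"
      have "lookup u s = 0" "lookup u t = 0"
        using st stars_disjoint by (auto intro!: lookup_outside[OF uD])
      then have "diag s = diag t" using st(3) N by (simp add: \<theta>_def)
      then show "s = t" using diag_stars st by (auto dest: inj_onD)
    qed
  qed
  have VQ: "V - Q = D" using stars_disjoint by blast
  obtain f where f: "bij_betw f {..<card D} (A \<union> f.R)" "f ` {..<card A} = A" "card A \<le> card D"
    by (rule f.enumeration[unfolded VQ])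
  have fI: "f i \<in> A \<union> f.R" if "i < card D" for i using f(1) that by (auto simp: bij_betw_def)
  define w where "w i = (\<Sum>v\<in>D. single v (f.basis (f i) v))" for i
  define co where "co i m = f.coord (f i) (lookup m)" for i and m :: "cell \<Rightarrow>\<^sub>0 int"
  have w_D: "lookup (w i) v = (if v \<in> D then f.basis (f i) v else 0)" for i v
    unfolding w_def lookup_sum lookup_single when_def using finite_D by simp
  have w_V: "lookup (w i) v = f.basis (f i) v" if "i < card D" "v \<in> V" for i v
    using that f.basis_Q[OF fI[OF that(1)]] by (auto simp: w_D)
  have co_w: "co i (w j) = (if i = j then 1 else 0)" if ij: "i < card D" "j < card D" for i j
  proof -
    have "co i (w j) = f.coord (f i) (f.basis (f j))" unfolding co_def by (rule f.coord_cong[OF fI[OF ij(1)] w_V[OF ij(2)]])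
    also have "\<dots> = (if f i = f j then 1 else 0)" by (rule f.coord_basis[OF fI fI]) (use ij in simp_all)
    also have "f i = f j \<longleftrightarrow> i = j" using f(1) ij by (auto simp: bij_betw_def inj_on_def)
    finally show ?thesis .
  qed
  have w_lat: "w i \<in> dual_lattice D" for i using w_D[of i] by (auto simp: dual_lattice_def in_keys_iff split: if_splits)
  interpret sc: smooth_chart D faces "delta l k" ip F c w co "card A" "card D"
  proof
    show "F \<in> faces" "c \<in> can F" by (rule F, rule c)
    show "w i \<in> dual_lattice D" for i by (rule w_lat)
    show "co i (m + m') = co i m + co i m'" for i m m'
    proof -
      have "lookup (m + m') = (\<lambda>v. lookup m v + lookup m' v)" by (rule ext) (rule lookup_add)
      then show ?thesis unfolding co_def by (simp only: f.coord_add)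
    qed
    show "co i (w j) = (if i = j then 1 else 0)" if "i < card D" "j < card D" for i j by (rule co_w[OF that])
    show "m = (\<Sum>i<card D. frag_cmul (co i m) (w i))" if m: "m \<in> dual_lattice D" for m
    proof -
      define g where "g v = lookup m v - (\<Sum>i<card D. co i m * lookup (w i) v)" for v
      have g0: "g v = 0" if "v \<notin> D" for v unfolding g_def using lookup_outside[OF m that] w_D that by simp
      have "g v = 0" if "v \<in> V" for v
      proof (rule f.coord_zero[OF _ _ that])
        show "g s = 0" if "s \<in> Q" for s using g0 that stars_disjoint by blast
        fix j assume j: "j \<in> A \<union> f.R"
        then obtain j' where j': "j = f j'" "j' < card D" using f(1) by (auto simp: bij_betw_def)
        have "lookup m = (\<lambda>v. g v + (\<Sum>i<card D. co i m * lookup (w i) v))" by (simp add: g_def)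
        then have "f.coord j (lookup m) = f.coord j g + (\<Sum>i<card D. co i m * f.coord j (lookup (w i)))"
          by (simp only: f.coord_add f.coord_sum)
        then have "co j' m = f.coord j g + (\<Sum>i<card D. co i m * co j' (w i))" unfolding j'(1) co_def .
        also have "(\<Sum>i<card D. co i m * co j' (w i)) = (\<Sum>i<card D. if i = j' then co i m else 0)"
          using co_w[OF j'(2)] by (intro sum.cong refl) auto
        also have "\<dots> = co j' m" using j'(2) by simp
        finally show "f.coord j g = 0" by simp
      qed
      then have "g v = 0" for v using g0[of v] by blast
      then show ?thesis by (intro poly_mapping_eqI) (simp add: g_def lookup_sum)
    qed
    show "m \<in> S F \<longleftrightarrow> (\<forall>i<card A. 0 \<le> co i m)" if m: "m \<in> dual_lattice D" for m
    proof -
      have e: "f.coord (top_end e) (lookup m) = ip m e" if "e \<in> F" for e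
        using that en_top[OF that] unfolding f.coord_def ip_ends[OF m] by (simp add: A_def)
      have "(\<forall>i<card A. 0 \<le> co i m) \<longleftrightarrow> (\<forall>a\<in>f ` {..<card A}. 0 \<le> f.coord a (lookup m))"
        by (auto simp: co_def)
      also have "\<dots> \<longleftrightarrow> (\<forall>e\<in>F. 0 \<le> f.coord (top_end e) (lookup m))" unfolding f(2) by (rule ball_A)
      also have "\<dots> \<longleftrightarrow> (\<forall>e\<in>F. 0 \<le> ip m e)" using e by simp
      finally show ?thesis using m by (simp add: S_def)
    qed
  qed (use f(3) in simp_all)
  show ?thesis by (rule sc.regular)
qed

section \<open>Boxes are conifold cones\<close>

lemma boxE:
  assumes "b \<in> boxes l k"
  obtains a c where "b = {(Cell a (c+1), Cell (a+1) (c+1)), (Cell (a+1) (c+1), Cell (a+1) c), (Cell a (c+1), Cell a c), (Cell a c, Cell (a+1) c)}"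
    "Cell a (c + 1) \<in> D" "Cell (a + 1) c \<in> D" "Cell a c \<in> D" "b \<subseteq> E"
proof -
  obtain a c where b: "b \<subseteq> E"
    "b = {(Cell a (c+1), Cell (a+1) (c+1)), (Cell (a+1) (c+1), Cell (a+1) c), (Cell a (c+1), Cell a c), (Cell a c, Cell (a+1) c)}"
    using assms unfolding boxes_def by blast
  then have V: "Cell a (c+1) \<in> V" "Cell (a+1) (c+1) \<in> V" "Cell (a+1) c \<in> V" "Cell a c \<in> V" by (auto simp: edges_def)
  have in_D: "x \<in> D" if "x \<in> V" "x \<noteq> Cell (a+1) (c+1)" "col x \<le> a + 1" "row x \<le> c + 1" for x
    using star_maximal[OF _ V(2), of x] that by auto
  have "Cell a (c+1) \<in> D" by (rule in_D[OF V(1)]) simp_all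
  moreover have "Cell (a+1) c \<in> D" by (rule in_D[OF V(3)]) simp_all
  moreover have "Cell a c \<in> D" by (rule in_D[OF V(4)]) simp_all
  ultimately show ?thesis by (rule that[OF b(2) _ _ _ b(1)])
qed

abbreviation chi :: "cell \<Rightarrow> (cell \<Rightarrow>\<^sub>0 int)" where "chi x \<equiv> single x 1"

lemma chi_D: "x \<in> D \<Longrightarrow> chi x \<in> dual_lattice D" by (simp add: dual_lattice_def)

lemma lookup_chi: "lookup (chi x) y = (if x = y then 1 else 0)" by (simp add: lookup_single when_def)

text \<open>The functional is \<open>1\<close> at the lower right corner and \<open>-1\<close> at the upper left corner of the box. An edge on which it increases
  enters the former or leaves the latter, so it is a side of the box, and no edge does both.\<close>

lemma box_supports:
  assumes b: "b \<in> boxes l k" shows "b \<in> faces"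
proof -
  obtain a c where b: "b = {(Cell a (c+1), Cell (a+1) (c+1)), (Cell (a+1) (c+1), Cell (a+1) c), (Cell a (c+1), Cell a c), (Cell a c, Cell (a+1) c)}"
    and D: "Cell a (c + 1) \<in> D" "Cell (a + 1) c \<in> D" "Cell a c \<in> D" "b \<subseteq> E" using assms by (rule boxE)
  let ?u = "chi (Cell (a + 1) c) - chi (Cell a (c + 1))"
  have u: "?u \<in> dual_lattice D" using D by (intro dual_lattice_diff chi_D)
  have "supports ?u 1 b"
    unfolding supports_def
  proof (intro conjI ballI)
    fix e assume "e \<in> E"
    then have "ip ?u e \<le> 1 \<and> (ip ?u e = 1 \<longleftrightarrow> e \<in> b)"
    proof (cases rule: edge_cases)
      case (horizontal a' c')
      then show ?thesis unfolding ip_dual[OF u] b by (auto simp: lookup_minus lookup_chi)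
    next
      case (vertical a' c')
      then show ?thesis unfolding ip_dual[OF u] b by (auto simp: lookup_minus lookup_chi)
    qed
    then show "ip ?u e \<le> 1" "(ip ?u e = 1) = (e \<in> b)" by blast+
  qed (use u D in simp_all)
  then show ?thesis unfolding faces_def by blast
qed

text \<open>The units are the functions that are constant on the box. Its upper right corner may be a star, and then this constant is
  zero; otherwise the corner serves as the coordinate of the constant.\<close>

lemma box_conifold:
  assumes b: "b \<in> boxes l k"
  shows "\<exists>e1 e2 e3 e4 X v u. conifold_node D faces (delta l k) ip b e1 e2 e3 e4 X v u"
proof -
  obtain a c where b_eq: "b = {(Cell a (c+1), Cell (a+1) (c+1)), (Cell (a+1) (c+1), Cell (a+1) c), (Cell a (c+1), Cell a c), (Cell a c, Cell (a+1) c)}"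
    and DD: "Cell a (c + 1) \<in> D" "Cell (a + 1) c \<in> D" "Cell a c \<in> D" and bE: "b \<subseteq> E" using assms by (rule boxE)
  define p q r s where "p = Cell a (c + 1)" and "q = Cell (a + 1) (c + 1)" and "r = Cell (a + 1) c" and "s = Cell a c"
  have D: "p \<in> D" "r \<in> D" "s \<in> D" using DD by (simp_all add: p_def r_def s_def)
  have ne: "p \<noteq> q" "p \<noteq> r" "p \<noteq> s" "q \<noteq> r" "q \<noteq> s" "r \<noteq> s" "q \<noteq> p" "r \<noteq> p" "s \<noteq> p" "r \<noteq> q" "s \<noteq> q" "s \<noteq> r"
    by (simp_all add: p_def q_def r_def s_def)
  have b_eq: "b = {(p, q), (q, r), (p, s), (s, r)}" unfolding b_eq p_def q_def r_def s_def ..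
  define X where "X = D - {p, r, s}"
  define v where "v x = (if x = q then chi p + chi q + chi r + chi s else chi x)" for x
  define u where "u i = (if i = 0 then chi r else if i = 1 then - chi p else if i = 2 then - chi p - chi s else chi r + chi s)" for i :: nat
  note lk = lookup_chi lookup_add lookup_minus lookup_uminus
  have uD: "u i \<in> dual_lattice D" for i
    unfolding u_def using D by (auto intro: chi_D dual_lattice_diff dual_lattice_add dual_lattice_uminus)
  have vD: "v x \<in> dual_lattice D" if "x \<in> D" for x
    unfolding v_def using D that by (auto intro: chi_D dual_lattice_add)
  have u_ip: "ip (u 0) (p, q) = 0" "ip (u 0) (q, r) = 1" "ip (u 0) (p, s) = 0" "ip (u 0) (s, r) = 1"
      "ip (u 1) (p, q) = 1" "ip (u 1) (q, r) = 0" "ip (u 1) (p, s) = 1" "ip (u 1) (s, r) = 0"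
      "ip (u 2) (p, q) = 1" "ip (u 2) (q, r) = 0" "ip (u 2) (p, s) = 0" "ip (u 2) (s, r) = 1"
      "ip (u 3) (p, q) = 0" "ip (u 3) (q, r) = 1" "ip (u 3) (p, s) = 1" "ip (u 3) (s, r) = 0"
    unfolding ip_pair[OF uD] by (simp_all add: u_def lk ne)
  have T_iff: "m \<in> T b \<longleftrightarrow> m \<in> dual_lattice D \<and> lookup m p = lookup m q \<and>
      lookup m r = lookup m q \<and> lookup m s = lookup m q" for m
    unfolding T_def b_eq by (auto simp: ip_pair)
  have vT: "v x \<in> T b" if "x \<in> X" for x
    unfolding T_iff using that vD[of x] by (auto simp: X_def v_def lk ne)
  have vX: "lookup (v x) y = (if x = y then 1 else 0)" if "x \<in> X" "y \<in> X" for x y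
    using that by (auto simp: X_def v_def lk ne)
  have "conifold_node D faces (delta l k) ip b (p, q) (q, r) (p, s) (s, r) X v u"
  proof unfold_locales
    show "b \<in> faces" by (rule box_supports[OF b])
    show "b = {(p, q), (q, r), (p, s), (s, r)}" by (rule b_eq)
    show "ip m (p, q) + ip m (q, r) = ip m (p, s) + ip m (s, r)" for m by (simp add: ip_def)
    show "u i \<in> S b" if "i < 4" for i
    proof -
      from that consider "i = 0" | "i = 1" | "i = 2" | "i = 3" by linarith
      then show ?thesis unfolding S_def b_eq using uD[of i] u_ip by cases simp_all
    qed
    show "X \<subseteq> D" by (auto simp: X_def)
    have "card {p, r, s} = 3" using ne by simp
    moreover have "{p, r, s} \<subseteq> D" using D by simp
    ultimately show "card X = card D - 3" "3 \<le> card D"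
      unfolding X_def using finite_D card_mono[OF finite_D, of "{p, r, s}"] by (auto simp: card_Diff_subset)
    show "v x \<in> T b" if "x \<in> X" for x by (rule vT[OF that])
    show "lookup (v x) x' = (if x = x' then 1 else 0)" if "x \<in> X" "x' \<in> X" for x x' by (rule vX[OF that])
    show "u 0 + u 1 = u 2 + u 3" by (simp add: u_def)
    show "lookup (u i) x = 0" if "i < 4" "x \<in> X" for i x using that by (auto simp: X_def u_def lk)
    show "m = (\<Sum>x\<in>X. frag_cmul (lookup m x) (v x))" if m: "m \<in> T b" for m
    proof (rule poly_mapping_eqI)
      fix y
      have mD: "m \<in> dual_lattice D" using m by (simp add: T_iff)
      have finX: "finite X" using finite_D by (simp add: X_def)
      have "(\<Sum>x\<in>X. lookup m x * lookup (v x) y) = lookup m y"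
      proof -
        consider "y \<in> X" | "y \<in> {p, r, s}" | "y \<notin> D" by (auto simp: X_def)
        then show ?thesis
        proof cases
          case 1
          then have "(\<Sum>x\<in>X. lookup m x * lookup (v x) y) = (\<Sum>x\<in>X. if x = y then lookup m x else 0)"
            using vX[OF _ 1] by (intro sum.cong refl) simp
          then show ?thesis using 1 finX by simp
        next
          case 2
          then have "lookup (v x) y = (if x = q then 1 else 0)" if "x \<in> X" for x
            using that ne by (auto simp: X_def v_def lk)
          then have "(\<Sum>x\<in>X. lookup m x * lookup (v x) y) = (\<Sum>x\<in>X. if x = q then lookup m x else 0)"
            by (intro sum.cong refl) simp
          also have "\<dots> = lookup m q" using finX lookup_outside[OF mD, of q] ne by (auto simp: X_def)
          also have "\<dots> = lookup m y" using 2 m by (auto simp: T_iff)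
          finally show ?thesis .
        next
          case 3
          have "lookup (v x) y = 0" if "x \<in> X" for x
            using lookup_outside[OF vD 3] that by (auto simp: X_def)
          then show ?thesis using lookup_outside[OF mD 3] by simp
        qed
      qed
      then show "lookup m y = lookup (\<Sum>x\<in>X. frag_cmul (lookup m x) (v x)) y"
        by (simp add: lookup_sum)
    qed
  qed (rule u_ip)+
  then show ?thesis by blast
qed

end

section \<open>Faces of a polytope\<close>

text \<open>By induction on the number of functionals. If \<open>a j\<close> cannot be omitted, some \<open>y\<close> satisfies the other inequalities but
  \<open>g y > 0\<close>; restricting all functionals to the kernel of \<open>a j\<close> reduces to the smaller family.\<close>

lemma farkas:
  fixes a :: "'i \<Rightarrow> 'w::real_vector \<Rightarrow> real"
  assumes "finite I" "\<And>i. i \<in> I \<Longrightarrow> linear (a i)" "linear g" "\<And>x. (\<And>i. i \<in> I \<Longrightarrow> a i x \<le> 0) \<Longrightarrow> g x \<le> 0"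
  shows "\<exists>c. (\<forall>i\<in>I. 0 \<le> c i) \<and> (\<forall>x. g x = (\<Sum>i\<in>I. c i * a i x))"
  using assms
proof (induction I arbitrary: a g rule: finite_induct)
  case empty
  have "g x = 0" for x
    using empty.prems(3)[of x] empty.prems(3)[of "- x"] linear_neg[OF empty.prems(2)] by force
  then show ?case by simp
next
  case (insert j I)
  show ?case
  proof (cases "\<forall>x. (\<forall>i\<in>I. a i x \<le> 0) \<longrightarrow> g x \<le> 0")
    case True
    have "\<exists>c. (\<forall>i\<in>I. 0 \<le> c i) \<and> (\<forall>x. g x = (\<Sum>i\<in>I. c i * a i x))"
      by (rule insert.IH) (use insert.prems True in auto)
    then obtain c where c: "\<forall>i\<in>I. 0 \<le> c i" "\<forall>x. g x = (\<Sum>i\<in>I. c i * a i x)" by blast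
    have "(\<Sum>i\<in>insert j I. (c(j := 0)) i * a i x) = (\<Sum>i\<in>I. c i * a i x)" for x
    proof -
      have "(\<Sum>i\<in>insert j I. (c(j := 0)) i * a i x) = (\<Sum>i\<in>I. (c(j := 0)) i * a i x)" using insert.hyps by simp
      also have "\<dots> = (\<Sum>i\<in>I. c i * a i x)" using insert.hyps by (intro sum.cong refl) auto
      finally show ?thesis .
    qed
    then show ?thesis using c by (intro exI[of _ "c(j := 0)"]) auto
  next
    case False
    then obtain z where z: "\<forall>i\<in>I. a i z \<le> 0" "0 < g z" by (auto simp: not_le)
    have "0 < a j z" using insert.prems(3)[of z] z by (force simp: not_less)
    define y where "y = (1 / a j z) *\<^sub>R z"
    have lin: "linear (a i)" if "i \<in> insert j I" for i using insert.prems(1) that by blast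
    have y: "a j y = 1" "\<forall>i\<in>I. a i y \<le> 0" "0 < g y"
      using z \<open>0 < a j z\<close> linear_scale[OF lin] linear_scale[OF insert.prems(2)]
      by (auto simp: y_def divide_le_0_iff)
    \<comment> \<open>restrict everything to the kernel of \<open>a j\<close> by projecting along \<open>y\<close>\<close>
    define proj where "proj f x = f x - a j x * f y" for f :: "'w \<Rightarrow> real" and x
    have proj_eq: "proj f x = f (x - a j x *\<^sub>R y)" if "linear f" for f x
      using linear_diff[OF that] linear_scale[OF that] by (simp add: proj_def)
    have proj_lin: "linear (proj f)" if "linear f" for f
      using linear_add[OF that] linear_scale[OF that] linear_add[OF lin] linear_scale[OF lin]
      by (intro linearI) (auto simp: proj_def algebra_simps)
    have "\<exists>c. (\<forall>i\<in>I. 0 \<le> c i) \<and> (\<forall>x. proj g x = (\<Sum>i\<in>I. c i * proj (a i) x))"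
    proof (rule insert.IH)
      show "linear (proj (a i))" if "i \<in> I" for i using that by (intro proj_lin lin) simp
      show "linear (proj g)" by (rule proj_lin[OF insert.prems(2)])
      fix x assume x: "\<And>i. i \<in> I \<Longrightarrow> proj (a i) x \<le> 0"
      have "g (x - a j x *\<^sub>R y) \<le> 0"
      proof (rule insert.prems(3))
        fix i assume i: "i \<in> insert j I"
        have "proj (a i) x \<le> 0" using x i y(1) by (cases "i = j") (auto simp: proj_def)
        then show "a i (x - a j x *\<^sub>R y) \<le> 0" using proj_eq[OF lin[OF i]] by simp
      qed
      then show "proj g x \<le> 0" using proj_eq[OF insert.prems(2)] by simp
    qed
    then obtain c where c: "\<forall>i\<in>I. 0 \<le> c i" "\<forall>x. proj g x = (\<Sum>i\<in>I. c i * proj (a i) x)" by blast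
    define t where "t = g y - (\<Sum>i\<in>I. c i * a i y)"
    have "(\<Sum>i\<in>I. c i * a i y) \<le> 0" using c(1) y(2) by (intro sum_nonpos) (simp add: mult_nonneg_nonpos)
    then have t: "0 \<le> t" using y(3) by (simp add: t_def)
    have "g x = (\<Sum>i\<in>insert j I. (c(j := t)) i * a i x)" for x
    proof -
      have "g x - a j x * g y = (\<Sum>i\<in>I. c i * a i x) - a j x * (\<Sum>i\<in>I. c i * a i y)"
        using c(2)[rule_format, of x] unfolding proj_def
        by (simp add: right_diff_distrib sum_subtractf sum_distrib_left algebra_simps)
      then have "g x = (\<Sum>i\<in>I. c i * a i x) + t * a j x" unfolding t_def by (simp add: algebra_simps)
      moreover have "(\<Sum>i\<in>I. (c(j := t)) i * a i x) = (\<Sum>i\<in>I. c i * a i x)"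
        using insert.hyps by (intro sum.cong) auto
      ultimately show ?thesis using insert.hyps by simp
    qed
    then show ?thesis using c(1) t by (intro exI[of _ "c(j := t)"]) auto
  qed
qed

lemma convex_hull_family:
  fixes p :: "'i \<Rightarrow> 'a::real_vector"
  assumes I: "finite I" and x: "x \<in> convex hull (p ` I)"
  shows "\<exists>c. (\<forall>i\<in>I. 0 \<le> c i) \<and> sum c I = 1 \<and> x = (\<Sum>i\<in>I. c i *\<^sub>R p i)"
  using x
proof (rule hull_induct)
  fix x assume "x \<in> p ` I"
  then obtain i where i: "i \<in> I" "x = p i" by blast
  have "(\<Sum>i'\<in>I. (if i' = i then 1 else 0) *\<^sub>R p i') = (\<Sum>i'\<in>I. if i' = i then p i' else 0)"
    by (intro sum.cong) auto
  then show "\<exists>c. (\<forall>i\<in>I. 0 \<le> c i) \<and> sum c I = 1 \<and> x = (\<Sum>i\<in>I. c i *\<^sub>R p i)"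
    using I i by (intro exI[of _ "\<lambda>i'. if i' = i then 1 else 0"]) auto
next
  show "convex {x. \<exists>c. (\<forall>i\<in>I. 0 \<le> c i) \<and> sum c I = 1 \<and> x = (\<Sum>i\<in>I. c i *\<^sub>R p i)}" (is "convex ?H")
  proof (rule convexI)
    fix x y and u v :: real
    assume x: "x \<in> ?H"
      and y: "y \<in> ?H"
      and uv: "0 \<le> u" "0 \<le> v" "u + v = 1"
    obtain c d where c: "\<forall>i\<in>I. 0 \<le> c i" "sum c I = 1" "x = (\<Sum>i\<in>I. c i *\<^sub>R p i)"
      and d: "\<forall>i\<in>I. 0 \<le> d i" "sum d I = 1" "y = (\<Sum>i\<in>I. d i *\<^sub>R p i)" using x y by blast
    have "u *\<^sub>R x + v *\<^sub>R y = (\<Sum>i\<in>I. (u * c i + v * d i) *\<^sub>R p i)"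
      unfolding c(3) d(3) by (simp add: scaleR_sum_right sum.distrib scaleR_add_left)
    moreover have "(\<Sum>i\<in>I. u * c i + v * d i) = 1"
      unfolding sum.distrib sum_distrib_left[symmetric] c(2) d(2) using uv(3) by simp
    ultimately show "u *\<^sub>R x + v *\<^sub>R y \<in> ?H"
      using uv c(1) d(1) by (intro CollectI exI[of _ "\<lambda>i. u * c i + v * d i"]) auto
  qed
qed

lemma convex_hull_sum:
  fixes p :: "'i \<Rightarrow> 'a::real_vector"
  assumes "finite I" "\<forall>i\<in>I. 0 \<le> c i" "sum c I = 1" shows "(\<Sum>i\<in>I. c i *\<^sub>R p i) \<in> convex hull (p ` I)"
  by (rule convex_sum[OF assms(1) convex_convex_hull assms(3)]) (use assms(2) in \<open>auto intro: hull_inc\<close>)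

text \<open>If the weight of \<open>p j\<close> is not \<open>1\<close>, the combination lies in the interior of a segment from \<open>p j\<close> to another point of the
  polytope.\<close>

lemma face_combination:
  fixes p :: "'i \<Rightarrow> 'a::real_vector"
  assumes F: "F face_of convex hull (p ` I)" and I: "finite I" and c: "\<forall>i\<in>I. 0 \<le> c i" "sum c I = 1"
    and x: "(\<Sum>i\<in>I. c i *\<^sub>R p i) \<in> F" and j: "j \<in> I" "0 < c j"
  shows "p j \<in> F"
proof -
  let ?x = "\<Sum>i\<in>I. c i *\<^sub>R p i"
  have split: "sum f I = f j + sum f (I - {j})" for f :: "'i \<Rightarrow> 'z::comm_monoid_add" by (rule sum.remove[OF I j(1)])
  have rest: "sum c (I - {j}) = 1 - c j" using c(2) split[of c] by simp
  have nn: "\<forall>i\<in>I - {j}. 0 \<le> c i" using c(1) by simp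
  show ?thesis
  proof (cases "c j = 1")
    case True
    then have "sum c (I - {j}) = 0" using rest by simp
    then have "\<forall>i\<in>I - {j}. c i = 0" by (subst (asm) sum_nonneg_eq_0_iff) (use nn I in auto)
    then have "?x = p j" using split[of "\<lambda>i. c i *\<^sub>R p i"] True by simp
    then show ?thesis using x by simp
  next
    case False
    have "0 \<le> sum c (I - {j})" using nn by (intro sum_nonneg) simp
    then have lt: "0 < 1 - c j" using False rest by simp
    define z where "z = (\<Sum>i\<in>I - {j}. (c i / (1 - c j)) *\<^sub>R p i)"
    have z: "z \<in> convex hull (p ` I)"
      unfolding z_def
    proof (rule convex_sum)
      show "(\<Sum>i\<in>I - {j}. c i / (1 - c j)) = 1" unfolding sum_divide_distrib[symmetric] rest using lt by simp
    qed (use I nn lt in \<open>auto intro: hull_inc\<close>)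
    have eq: "?x = (1 - (1 - c j)) *\<^sub>R p j + (1 - c j) *\<^sub>R z"
      unfolding split[of "\<lambda>i. c i *\<^sub>R p i"] z_def scaleR_sum_right using lt by simp
    show ?thesis
    proof (cases "z = p j")
      case True
      then have "?x = p j" unfolding eq by (simp add: scaleR_add_left[symmetric])
      then show ?thesis using x by simp
    next
      case False
      then have "?x \<in> open_segment (p j) z" unfolding in_segment eq using lt j(2) by (intro conjI exI[of _ "1 - c j"]) auto
      moreover have "p j \<in> convex hull (p ` I)" using j(1) by (intro hull_inc) simp
      ultimately show ?thesis using face_ofD[OF F _ _ z x] by blast
    qed
  qed
qed

context ladder
begin

abbreviation "\<delta> \<equiv> delta l k"

lemma ip_bounds_combination:
  assumes u: "supports u N F" and c: "\<forall>e\<in>E. 0 \<le> c e" "sum c E = 1"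
  shows "pairing u (\<Sum>e\<in>E. c e *\<^sub>R \<delta> e) \<le> of_int N"
    "pairing u (\<Sum>e\<in>E. c e *\<^sub>R \<delta> e) = of_int N \<Longrightarrow> e \<in> E - F \<Longrightarrow> c e = 0"
proof -
  have lin: "pairing u (\<Sum>e\<in>J. c e *\<^sub>R \<delta> e) = (\<Sum>e\<in>J. c e * of_int (ip u e))" for J
  proof (induction J rule: infinite_finite_induct)
    case (insert e J)
    then show ?case by (simp add: pairing_add_right pairing_scaleR pairing_delta)
  qed (simp_all add: pairing_def)
  have "of_int N = (\<Sum>e\<in>E. c e * of_int N)" unfolding sum_distrib_right[symmetric] c(2) by simp
  then have gap: "of_int N - pairing u (\<Sum>e\<in>E. c e *\<^sub>R \<delta> e) = (\<Sum>e\<in>E. c e * of_int (N - ip u e))"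
    unfolding lin by (simp add: right_diff_distrib sum_subtractf)
  have nn: "0 \<le> c e * real_of_int (N - ip u e)" if "e \<in> E" for e
    using u c(1) that by (intro mult_nonneg_nonneg) (auto simp: supports_def)
  then have "0 \<le> (\<Sum>e\<in>E. c e * real_of_int (N - ip u e))" by (rule sum_nonneg)
  then show "pairing u (\<Sum>e\<in>E. c e *\<^sub>R \<delta> e) \<le> of_int N" using gap by linarith
  assume "pairing u (\<Sum>e\<in>E. c e *\<^sub>R \<delta> e) = of_int N" and e: "e \<in> E - F"
  then have "(\<Sum>e\<in>E. c e * real_of_int (N - ip u e)) = 0" using gap by linarith
  then have "\<forall>e\<in>E. c e * real_of_int (N - ip u e) = 0"
    by (subst (asm) sum_nonneg_eq_0_iff) (use nn finite_E in auto)
  then have "c e * real_of_int (N - ip u e) = 0" using e by blast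
  moreover have "ip u e \<noteq> N" using u e by (auto simp: supports_def)
  ultimately show "c e = 0" by simp
qed

text \<open>Otherwise \<open>u\<close> would increase along all edges and hence be zero.\<close>

lemma supports_strict: assumes "supports u N F" shows "F \<noteq> E"
proof
  assume FE: "F = E"
  have uD: "u \<in> dual_lattice D" and N: "0 < N" and eq: "\<And>e. e \<in> E \<Longrightarrow> ip u e = N" using assms FE by (auto simp: supports_def)
  define m where "m v = - real_of_int (lookup u v)" for v
  have z: "m v = 0" if "v \<in> V" for v
  proof (rule monotone_zero[OF _ _ that])
    show "m s = 0" if "s \<in> Q" for s using lookup_outside[OF uD, of s] that stars_disjoint by (auto simp: m_def)
    show "m y \<le> m x" if "(x, y) \<in> E" for x y using eq[OF that] N unfolding ip_pair[OF uD] by (simp add: m_def)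
  qed
  obtain x y where e: "(x, y) \<in> E" using E_nonempty by auto
  then have "m x = 0" "m y = 0" using z by (auto simp: edges_def)
  then show False using eq[OF e] N unfolding ip_pair[OF uD] by (simp add: m_def)
qed

lemma supported_face:
  assumes u: "supports u N F"
  shows "convex hull (\<delta> ` F) face_of ladder_polytope l k" "convex hull (\<delta> ` F) \<noteq> ladder_polytope l k"
proof -
  let ?C = "convex hull (\<delta> ` F)" and ?P = "ladder_polytope l k"
  have FE: "F \<subseteq> E" using u by (simp add: supports_def)
  have le: "pairing u x \<le> of_int N" and in_C: "pairing u x = of_int N \<Longrightarrow> x \<in> ?C" if x: "x \<in> ?P" for x
  proof -
    obtain c where c: "\<forall>e\<in>E. 0 \<le> c e" "sum c E = 1" and xc: "x = (\<Sum>e\<in>E. c e *\<^sub>R \<delta> e)"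
      using convex_hull_family[OF finite_E] x unfolding ladder_polytope_def by blast
    show "pairing u x \<le> of_int N" unfolding xc by (rule ip_bounds_combination[OF u c])
    assume "pairing u x = of_int N"
    then have z: "\<forall>e\<in>E - F. c e = 0" using ip_bounds_combination(2)[OF u c] unfolding xc by blast
    have "x = (\<Sum>e\<in>F. c e *\<^sub>R \<delta> e)" unfolding xc by (rule sum.mono_neutral_right[OF finite_E FE]) (use z in simp)
    moreover have "sum c F = 1" using c(2) sum.mono_neutral_right[OF finite_E FE z] by simp
    ultimately show "x \<in> ?C" using c(1) FE by (auto intro!: convex_hull_sum[OF finite_subset[OF FE finite_E]])
  qed
  have on_C: "pairing u x = of_int N" if "x \<in> ?C" for x
    using that
  proof (rule hull_induct)
    show "pairing u x = of_int N" if "x \<in> \<delta> ` F" for x using that u FE by (auto simp: pairing_delta supports_def)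
    show "convex {x. pairing u x = of_int N}"
      by (rule convexI) (simp add: pairing_add_right pairing_scaleR distrib_right[symmetric])
  qed
  have CP: "?C \<subseteq> ?P" unfolding ladder_polytope_def using FE by (intro hull_mono) blast
  show "?C face_of ?P"
    unfolding face_of_def
  proof (intro conjI ballI impI)
    fix a b x assume a: "a \<in> ?P" and b: "b \<in> ?P" and x: "x \<in> ?C" and seg: "x \<in> open_segment a b"
    obtain t where t: "0 < t" "t < 1" "x = (1 - t) *\<^sub>R a + t *\<^sub>R b" using seg unfolding in_segment by blast
    have e: "(1 - t) * pairing u a + t * pairing u b = of_int N"
      using on_C[OF x] unfolding t(3) by (simp add: pairing_add_right pairing_scaleR)
    have "(1 - t) * pairing u a \<le> (1 - t) * of_int N" "t * pairing u b \<le> t * of_int N"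
      using t le[OF a] le[OF b] by (auto intro: mult_left_mono)
    then have "(1 - t) * pairing u a = (1 - t) * of_int N" "t * pairing u b = t * of_int N"
      using e distrib_right[of "1 - t" t "real_of_int N"] by (simp_all only: diff_add_cancel mult_1)
    then have "pairing u a = of_int N" "pairing u b = of_int N" using t by auto
    then show "a \<in> ?C" "b \<in> ?C" using in_C a b by blast+
  qed (use CP in simp_all)
  show "?C \<noteq> ?P"
  proof
    assume eq: "?C = ?P"
    have "e \<in> F" if e: "e \<in> E" for e
    proof -
      have "\<delta> e \<in> ?C" unfolding eq ladder_polytope_def using e by (intro hull_inc) simp
      then show ?thesis using on_C[of "\<delta> e"] u e by (simp add: pairing_delta supports_def)
    qed
    then show False using supports_strict[OF u] FE by blast
  qed
qed

definition height :: "(cell \<Rightarrow>\<^sub>0 real) \<Rightarrow> cell \<Rightarrow> real" where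
  "height m v = (if v \<in> D then lookup m v else 0)"

text \<open>The linear functional \<open>m\<close> on \<open>\<delta>(e)\<close> minus the bound \<open>N\<close>, as a function of the pair \<open>(m, N)\<close>.\<close>

definition excess :: "edge \<Rightarrow> (cell \<Rightarrow>\<^sub>0 real) \<times> real \<Rightarrow> real" where
  "excess e w = height (fst w) (snd e) - height (fst w) (fst e) - snd w"

lemma excess_linear: "linear (excess e)"
  by (rule linearI) (auto simp: excess_def height_def lookup_add algebra_simps)

text \<open>If there is no such \<open>w\<close>, Farkas' lemma writes a positive combination of generators that involves \<open>\<delta> j\<close> as a nonnegative
  combination of generators in the face; then \<open>\<delta> j\<close> lies in the face.\<close>

lemma excess_separates:
  assumes F: "F face_of ladder_polytope l k" and j: "j \<in> E" "\<delta> j \<notin> F"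
  shows "\<exists>w. (\<forall>e\<in>E. excess e w \<le> 0 \<and> (\<delta> e \<in> F \<longrightarrow> excess e w = 0)) \<and> excess j w < 0"
proof (rule ccontr)
  assume no: "\<not> ?thesis"
  define EF where "EF = {e \<in> E. \<delta> e \<in> F}"
  define I where "I = E \<times> {True} \<union> EF \<times> {False}"
  define a where "a i w = (if snd i then excess (fst i) w else - excess (fst i) w)" for i :: "edge \<times> bool" and w
  have fin: "finite EF" "finite I" using finite_E by (auto simp: EF_def I_def)
  have "\<exists>c. (\<forall>i\<in>I. 0 \<le> c i) \<and> (\<forall>x. - excess j x = (\<Sum>i\<in>I. c i * a i x))"
  proof (rule farkas[OF fin(2)])
    show "linear (a i)" for i
    proof (cases "snd i")
      case True
      then have "a i = excess (fst i)" by (simp add: a_def fun_eq_iff)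
      then show ?thesis using excess_linear by simp
    next
      case False
      then have "a i = (\<lambda>w. - excess (fst i) w)" by (simp add: a_def fun_eq_iff)
      then show ?thesis using linear_compose_neg[OF excess_linear] by simp
    qed
    show "linear (\<lambda>x. - excess j x)" by (rule linear_compose_neg[OF excess_linear])
    fix x assume x: "\<And>i. i \<in> I \<Longrightarrow> a i x \<le> 0"
    have "excess e x \<le> 0" if "e \<in> E" for e using x[of "(e, True)"] that by (simp add: a_def I_def)
    moreover have "0 \<le> excess e x" if "e \<in> E" "\<delta> e \<in> F" for e using x[of "(e, False)"] that by (simp add: a_def I_def EF_def)
    ultimately have "\<forall>e\<in>E. excess e x \<le> 0 \<and> (\<delta> e \<in> F \<longrightarrow> excess e x = 0)" by (intro ballI conjI impI antisym) simp_all
    then have "\<not> excess j x < 0" using no by blast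
    then show "- excess j x \<le> 0" by simp
  qed
  then obtain c where c: "\<forall>i\<in>I. 0 \<le> c i" "\<And>x. - excess j x = (\<Sum>i\<in>I. c i * a i x)" by blast
  define C where "C e = c (e, True) + (if e = j then 1 else 0)" for e
  define d where "d e = c (e, False)" for e
  have C0: "\<forall>e\<in>E. 0 \<le> C e" "0 < C j" using c(1) j(1) by (auto simp: C_def I_def intro: add_nonneg_pos)
  have d0: "\<forall>e\<in>EF. 0 \<le> d e" using c(1) by (auto simp: d_def I_def)
  have key: "(\<Sum>e\<in>E. C e * excess e x) = (\<Sum>e\<in>EF. d e * excess e x)" for x
  proof -
    have "(\<Sum>i\<in>I. c i * a i x) = (\<Sum>i\<in>E \<times> {True}. c i * a i x) + (\<Sum>i\<in>EF \<times> {False}. c i * a i x)"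
      unfolding I_def using finite_E fin(1) by (intro sum.union_disjoint) auto
    also have "(\<Sum>i\<in>E \<times> {True}. c i * a i x) = (\<Sum>e\<in>E. c (e, True) * excess e x)"
      by (rule sum.reindex_bij_witness[of _ "\<lambda>e. (e, True)" fst]) (auto simp: a_def)
    also have "(\<Sum>i\<in>EF \<times> {False}. c i * a i x) = (\<Sum>e\<in>EF. - (d e * excess e x))"
      by (rule sum.reindex_bij_witness[of _ "\<lambda>e. (e, False)" fst]) (auto simp: a_def d_def)
    finally have 1: "- excess j x = (\<Sum>e\<in>E. c (e, True) * excess e x) - (\<Sum>e\<in>EF. d e * excess e x)"
      unfolding c(2)[symmetric] by (simp add: sum_negf)
    have "(\<Sum>e\<in>E. C e * excess e x) = (\<Sum>e\<in>E. c (e, True) * excess e x) + (\<Sum>e\<in>E. if e = j then excess e x else 0)"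
      unfolding C_def sum.distrib[symmetric] by (intro sum.cong refl) (simp add: algebra_simps)
    then show ?thesis using 1 j(1) finite_E by simp
  qed
  define \<Lambda> where "\<Lambda> = sum C E"
  have \<Lambda>: "0 < \<Lambda>" unfolding \<Lambda>_def using C0 j(1) finite_E by (intro sum_pos2[of E j]) auto
  have "excess e (0, -1) = 1" for e by (simp add: excess_def height_def)
  then have sum_d: "sum d EF = \<Lambda>" using key[of "(0, -1)"] by (simp add: \<Lambda>_def)
  have vec: "(\<Sum>e\<in>E. C e *\<^sub>R \<delta> e) = (\<Sum>e\<in>EF. d e *\<^sub>R \<delta> e)"
  proof (rule poly_mapping_eqI)
    fix y
    have "excess e (single y 1, 0) = lookup (\<delta> e) y" if "y \<in> D" for e
      using that unfolding lookup_delta by (auto simp: excess_def height_def lookup_single when_def)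
    then show "lookup (\<Sum>e\<in>E. C e *\<^sub>R \<delta> e) y = lookup (\<Sum>e\<in>EF. d e *\<^sub>R \<delta> e) y"
      using key[of "(single y 1, 0)"] by (cases "y \<in> D") (simp_all add: lookup_sum lookup_delta)
  qed
  have Fs: "F face_of convex hull (\<delta> ` E)" using F unfolding ladder_polytope_def .
  have "(\<Sum>e\<in>EF. (d e / \<Lambda>) *\<^sub>R \<delta> e) \<in> F"
  proof (rule convex_sum[OF fin(1) face_of_imp_convex[OF F]])
    show "(\<Sum>e\<in>EF. d e / \<Lambda>) = 1" unfolding sum_divide_distrib[symmetric] sum_d using \<Lambda> by simp
  qed (use d0 \<Lambda> in \<open>auto simp: EF_def\<close>)
  also have "(\<Sum>e\<in>EF. (d e / \<Lambda>) *\<^sub>R \<delta> e) = (1 / \<Lambda>) *\<^sub>R (\<Sum>e\<in>EF. d e *\<^sub>R \<delta> e)" by (simp add: scaleR_sum_right)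
  also have "\<dots> = (\<Sum>e\<in>E. (C e / \<Lambda>) *\<^sub>R \<delta> e)" unfolding vec[symmetric] by (simp add: scaleR_sum_right)
  finally have "(\<Sum>e\<in>E. (C e / \<Lambda>) *\<^sub>R \<delta> e) \<in> F" .
  moreover have "(\<Sum>e\<in>E. C e / \<Lambda>) = 1" unfolding sum_divide_distrib[symmetric] \<Lambda>_def[symmetric] using \<Lambda> by simp
  ultimately have "\<delta> j \<in> F"
    using C0 \<Lambda> j(1) by (intro face_combination[OF Fs finite_E, of "\<lambda>e. C e / \<Lambda>"]) auto
  then show False using j(2) by blast
qed

text \<open>The functionals that separate the face from single generators add up to one that separates it from all of them. Its maximum
  is positive, since otherwise it would decrease along all edges. After scaling, rounding down makes it integral without
  changing the edges where the maximum is attained.\<close>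

lemma face_supported:
  assumes F: "F face_of ladder_polytope l k" and ne: "F \<noteq> ladder_polytope l k"
  shows "{e \<in> E. \<delta> e \<in> F} \<in> faces" "F = convex hull (\<delta> ` {e \<in> E. \<delta> e \<in> F})"
proof -
  define EF where "EF = {e \<in> E. \<delta> e \<in> F}"
  have finEF: "finite EF" using finite_E by (simp add: EF_def)
  have Fs: "F face_of convex hull (\<delta> ` E)" using F unfolding ladder_polytope_def .
  have hull: "F = convex hull (\<delta> ` EF)"
  proof (rule Set.equalityI; rule subsetI)
    fix x assume x: "x \<in> F"
    then have "x \<in> convex hull (\<delta> ` E)" using face_of_imp_subset[OF Fs] by blast
    then obtain c where c: "\<forall>e\<in>E. 0 \<le> c e" "sum c E = 1" and xc: "x = (\<Sum>e\<in>E. c e *\<^sub>R \<delta> e)"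
      using convex_hull_family[OF finite_E] by blast
    have sub: "EF \<subseteq> E" by (auto simp: EF_def)
    have z: "\<forall>e\<in>E - EF. c e = 0"
    proof
      fix e assume e: "e \<in> E - EF"
      have "\<not> 0 < c e" using face_combination[OF Fs finite_E c x[unfolded xc], of e] e by (auto simp: EF_def)
      moreover have "0 \<le> c e" using c(1) e by blast
      ultimately show "c e = 0" by linarith
    qed
    have "x = (\<Sum>e\<in>EF. c e *\<^sub>R \<delta> e)" unfolding xc by (rule sum.mono_neutral_right[OF finite_E sub]) (use z in simp)
    moreover have "sum c EF = 1" using c(2) sum.mono_neutral_right[OF finite_E sub z] by simp
    ultimately show "x \<in> convex hull (\<delta> ` EF)" using c(1) sub by (auto intro!: convex_hull_sum[OF finEF])
  next
    fix x assume "x \<in> convex hull (\<delta> ` EF)"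
    moreover have "convex hull (\<delta> ` EF) \<subseteq> F" by (rule hull_minimal) (auto simp: EF_def face_of_imp_convex[OF F])
    ultimately show "x \<in> F" by blast
  qed
  then show "F = convex hull (\<delta> ` {e \<in> E. \<delta> e \<in> F})" unfolding EF_def .
  have "\<forall>j\<in>E - EF. \<exists>w. (\<forall>e\<in>E. excess e w \<le> 0 \<and> (\<delta> e \<in> F \<longrightarrow> excess e w = 0)) \<and> excess j w < 0"
    using excess_separates[OF F] by (auto simp: EF_def)
  from bchoice[OF this] obtain ws where ws: "\<forall>j\<in>E - EF. (\<forall>e\<in>E. excess e (ws j) \<le> 0 \<and> (\<delta> e \<in> F \<longrightarrow> excess e (ws j) = 0)) \<and> excess j (ws j) < 0"
    by (elim exE) (rule that)
  define w where "w = (\<Sum>j\<in>E - EF. ws j)"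
  have ex_w: "excess e w = (\<Sum>j\<in>E - EF. excess e (ws j))" for e unfolding w_def by (rule linear_sum[OF excess_linear])
  have on: "excess e w = 0" if "e \<in> EF" for e unfolding ex_w using ws that by (intro sum.neutral) (auto simp: EF_def)
  have off: "excess e w < 0" if "e \<in> E - EF" for e
  proof -
    have "excess e w = excess e (ws e) + (\<Sum>j\<in>E - EF - {e}. excess e (ws j))"
      unfolding ex_w using finite_E that by (intro sum.remove) auto
    moreover have "(\<Sum>j\<in>E - EF - {e}. excess e (ws j)) \<le> 0" using ws that by (intro sum_nonpos) auto
    ultimately show ?thesis using ws that by force
  qed
  define m N where "m = height (fst w)" and "N = snd w"
  have gap: "excess e w = m (snd e) - m (fst e) - N" for e by (simp add: excess_def m_def N_def)
  have m_Q: "m v = 0" if "v \<notin> D" for v using that by (simp add: m_def height_def)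
  have N: "0 < N"
  proof (rule ccontr)
    assume "\<not> 0 < N"
    have le: "m y - m x \<le> N" if "(x, y) \<in> E" for x y
      using on[of "(x, y)"] off[of "(x, y)"] gap[of "(x, y)"] that by (cases "(x, y) \<in> EF") auto
    have z: "m v = 0" if "v \<in> V" for v
    proof (rule monotone_zero[OF _ _ that])
      show "m s = 0" if "s \<in> Q" for s using m_Q that stars_disjoint by blast
      show "m y \<le> m x" if "(x, y) \<in> E" for x y using le[OF that] \<open>\<not> 0 < N\<close> by linarith
    qed
    have z': "m v = 0" for v using z m_Q by (cases "v \<in> D") auto
    obtain x y where "(x, y) \<in> E" using E_nonempty by auto
    then have "N = 0" using le \<open>\<not> 0 < N\<close> z' by force
    then have "excess e w = 0" for e by (simp add: gap z')
    then have "EF = E" using off by (force simp: EF_def)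
    then show False using hull ne unfolding ladder_polytope_def by simp
  qed
  define y where "y v = m v / N" for v
  have y_on: "y (snd e) - y (fst e) = 1" if "e \<in> EF" for e
    using on[OF that] N unfolding gap by (simp add: y_def diff_divide_distrib[symmetric])
  have y_off: "0 < 1 - (y (snd e) - y (fst e))" if "e \<in> E - EF" for e
    using off[OF that] N unfolding gap by (simp add: y_def diff_divide_distrib[symmetric])
  \<comment> \<open>\<open>K\<close> is so large that rounding down \<open>K y\<close> cannot make up the gap at an edge off the face\<close>
  define K where "K = 1 + \<lceil>\<Sum>e\<in>E - EF. 1 / (1 - (y (snd e) - y (fst e)))\<rceil>"
  have s0: "0 \<le> (\<Sum>e\<in>E - EF. 1 / (1 - (y (snd e) - y (fst e))))"
    using y_off by (intro sum_nonneg) (simp add: less_imp_le)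
  then have K0: "0 < K" unfolding K_def by (simp add: add_pos_nonneg)
  have K: "of_int K * (y (snd e) - y (fst e)) \<le> of_int K - 1" if e: "e \<in> E - EF" for e
  proof -
    have "1 / (1 - (y (snd e) - y (fst e))) \<le> (\<Sum>e\<in>E - EF. 1 / (1 - (y (snd e) - y (fst e))))"
      using y_off finite_E e by (intro member_le_sum) (auto simp: less_imp_le)
    also have "\<dots> \<le> of_int K" unfolding K_def by linarith
    finally have "1 \<le> of_int K * (1 - (y (snd e) - y (fst e)))" using y_off[OF e] by (simp add: divide_le_eq)
    then show ?thesis by (simp add: right_diff_distrib)
  qed
  define u where "u = (\<Sum>v\<in>D. single v \<lfloor>of_int K * y v\<rfloor>)"
  have lu: "lookup u v = \<lfloor>of_int K * y v\<rfloor>" for v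
    unfolding u_def lookup_sum lookup_single when_def using finite_D m_Q[of v] by (simp add: y_def)
  have uD: "u \<in> dual_lattice D" using m_Q by (auto simp: dual_lattice_def in_keys_iff lu y_def intro: ccontr)
  have "supports u K EF"
    unfolding supports_def
  proof (intro conjI ballI)
    fix e assume e: "e \<in> E"
    have "ip u e \<le> K \<and> (ip u e = K \<longleftrightarrow> e \<in> EF)"
    proof (cases "e \<in> EF")
      case True
      have "of_int K * y (snd e) = of_int K * y (fst e) + of_int K" using y_on[OF True] by (simp add: algebra_simps)
      then have "ip u e = K" unfolding ip_dual[OF uD] lu by simp
      then show ?thesis using True by simp
    next
      case False
      have "of_int K * y (snd e) \<le> of_int K * y (fst e) + of_int (K - 1)" using K[of e] e False by (simp add: algebra_simps)
      then have "\<lfloor>of_int K * y (snd e)\<rfloor> \<le> \<lfloor>of_int K * y (fst e) + of_int (K - 1)\<rfloor>" by (rule floor_mono)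
      then have "ip u e \<le> K - 1" unfolding ip_dual[OF uD] lu by simp
      then show ?thesis using False by simp
    qed
    then show "ip u e \<le> K" "(ip u e = K) = (e \<in> EF)" by blast+
  qed (use uD K0 in \<open>auto simp: EF_def\<close>)
  then show "{e \<in> E. \<delta> e \<in> F} \<in> faces" unfolding faces_def EF_def by blast
qed

lemma cone_convex_hull: "convex_cone hull (convex hull S) = convex_cone hull S" for S :: "(cell \<Rightarrow>\<^sub>0 real) set"
proof (rule Set.equalityI)
  show "convex_cone hull (convex hull S) \<subseteq> convex_cone hull S"
    by (rule hull_minimal) (rule convex_hull_subset_convex_cone_hull, rule convex_cone_convex_cone_hull)
  show "convex_cone hull S \<subseteq> convex_cone hull (convex hull S)" by (rule hull_mono) (rule hull_subset)
qed

lemma ladder_fan_eq: "ladder_fan l k = \<Sigma>"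
proof (rule Set.equalityI; rule subsetI)
  fix \<sigma> assume "\<sigma> \<in> ladder_fan l k"
  then obtain F where F: "F face_of ladder_polytope l k" "F \<noteq> ladder_polytope l k" "\<sigma> = convex_cone hull F"
    unfolding ladder_fan_def by blast
  have "\<sigma> = cn {e \<in> E. \<delta> e \<in> F}"
    using arg_cong[OF face_supported(2)[OF F(1,2)], of "\<lambda>X. convex_cone hull X"] F(3)
    unfolding cone_convex_hull cn_def by simp
  then show "\<sigma> \<in> \<Sigma>" using face_supported(1)[OF F(1,2)] by blast
next
  fix \<sigma> assume "\<sigma> \<in> \<Sigma>"
  then obtain F u N where F: "\<sigma> = cn F" "supports u N F" by (auto simp: faces_def)
  have "\<sigma> = convex_cone hull (convex hull (\<delta> ` F))" unfolding cone_convex_hull F(1) cn_def ..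
  then show "\<sigma> \<in> ladder_fan l k" unfolding ladder_fan_def using supported_face[OF F(2)] by blast
qed

lemma dim_box_cone:
  assumes "b \<in> boxes l k" shows "dim (box_cone l k b) = 3"
proof -
  obtain a c where b_eq: "b = {(Cell a (c+1), Cell (a+1) (c+1)), (Cell (a+1) (c+1), Cell (a+1) c), (Cell a (c+1), Cell a c), (Cell a c, Cell (a+1) c)}"
    and D: "Cell a (c + 1) \<in> D" "Cell (a + 1) c \<in> D" "Cell a c \<in> D" using assms by (rule boxE)
  define e1 e2 e3 e4 where "e1 = \<delta> (Cell a (c+1), Cell (a+1) (c+1))" and "e2 = \<delta> (Cell (a+1) (c+1), Cell (a+1) c)"
    and "e3 = \<delta> (Cell a (c+1), Cell a c)" and "e4 = \<delta> (Cell a c, Cell (a+1) c)"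
  have img: "\<delta> ` b = {e1, e2, e3, e4}" unfolding b_eq e1_def e2_def e3_def e4_def by simp
  have e4: "e4 = e1 + e2 - e3"
    by (rule poly_mapping_eqI) (simp add: e1_def e2_def e3_def e4_def lookup_delta lookup_add lookup_minus)
  have at: "lookup e1 (Cell a (c+1)) = -1" "lookup e2 (Cell a (c+1)) = 0" "lookup e3 (Cell a (c+1)) = -1"
    "lookup e1 (Cell (a+1) c) = 0" "lookup e2 (Cell (a+1) c) = 1" "lookup e3 (Cell (a+1) c) = 0"
    "lookup e1 (Cell a c) = 0" "lookup e2 (Cell a c) = 0" "lookup e3 (Cell a c) = 1"
    using D by (simp_all add: e1_def e2_def e3_def lookup_delta)
  have ne: "e1 \<noteq> e2" "e1 \<noteq> e3" "e2 \<noteq> e3" using at by auto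
  show ?thesis
  proof (rule dim_unique)
    have "{e1, e2, e3} \<subseteq> \<delta> ` b" unfolding img by blast
    also have "\<delta> ` b \<subseteq> box_cone l k b" unfolding box_cone_def by (rule hull_subset)
    finally show "{e1, e2, e3} \<subseteq> box_cone l k b" .
    show "box_cone l k b \<subseteq> span {e1, e2, e3}"
      unfolding box_cone_def
    proof (rule hull_minimal)
      have "e1 + e2 - e3 \<in> span {e1, e2, e3}" by (intro span_diff span_add span_base) simp_all
      then show "\<delta> ` b \<subseteq> span {e1, e2, e3}" unfolding img e4[symmetric] by (auto intro: span_base)
      show "convex_cone (span {e1, e2, e3})" unfolding convex_cone_iff by (auto intro: span_add span_scale span_zero)
    qed
    show "independent {e1, e2, e3}"
    proof (rule independent_if_scalars_zero)
      fix f x assume s: "(\<Sum>x\<in>{e1, e2, e3}. f x *\<^sub>R x) = 0" and x: "x \<in> {e1, e2, e3}"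
      have "f e1 * lookup e1 v + f e2 * lookup e2 v + f e3 * lookup e3 v = 0" for v
        using arg_cong[OF s, of "\<lambda>z. lookup z v"] ne by (simp add: lookup_add)
      from this[of "Cell a (c+1)"] this[of "Cell (a+1) c"] this[of "Cell a c"]
      have "f e1 = 0" "f e2 = 0" "f e3 = 0" unfolding at by simp_all
      then show "f x = 0" using x by blast
    qed simp
    show "card {e1, e2, e3} = 3" using ne by simp
  qed
qed

section \<open>The singular locus\<close>

theorem singular_locus_ladder:
  "singular_locus (dots l k) (ladder_fan l k) = (\<Union>b\<in>boxes l k. box_stratum l k b)"
proof -
  have W: "box_stratum l k b = W b" for b unfolding box_stratum_def ladder_fan_eq box_cone_def cn_def ..
  have *: "\<not> regular_local (local_ring D (Pt G c)) \<longleftrightarrow> (\<exists>b\<in>boxes l k. Pt G c \<in> W b)" if G: "G \<in> faces" "c \<in> can G" for G c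
  proof
    assume "\<not> regular_local (local_ring D (Pt G c))"
    then obtain b where "b \<in> boxes l k" "b \<subseteq> G" using box_free_regular[OF G(1) _ G(2)] by blast
    then show "\<exists>b\<in>boxes l k. Pt G c \<in> W b" using W_iff[OF box_supports G] by blast
  next
    assume "\<exists>b\<in>boxes l k. Pt G c \<in> W b"
    then obtain b where b: "b \<in> boxes l k" "Pt G c \<in> W b" by blast
    then have bG: "b \<subseteq> G" using W_iff[OF box_supports G] by blast
    obtain e1 e2 e3 e4 X v u where "conifold_node D faces \<delta> ip b e1 e2 e3 e4 X v u"
      using box_conifold[OF b(1)] by (elim exE) (rule that)
    then interpret cb: conifold_node D faces \<delta> ip b e1 e2 e3 e4 X v u .
    show "\<not> regular_local (local_ring D (Pt G c))" by (rule cb.not_regular[OF G bG])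
  qed
  show ?thesis
  proof (rule Set.equalityI; rule subsetI)
    fix p assume "p \<in> singular_locus (dots l k) (ladder_fan l k)"
    then obtain G c where "p = Pt G c" "G \<in> faces" "c \<in> can G" "\<not> regular_local (local_ring D p)"
      unfolding singular_locus_def ladder_fan_eq toric_variety_eq by blast
    then show "p \<in> (\<Union>b\<in>boxes l k. box_stratum l k b)" using * unfolding W by blast
  next
    fix p assume "p \<in> (\<Union>b\<in>boxes l k. box_stratum l k b)"
    then obtain b where b: "b \<in> boxes l k" "p \<in> W b" unfolding W by blast
    then have pV: "p \<in> toric_variety D \<Sigma>" using W_sub by blast
    then obtain G c where "p = Pt G c" "G \<in> faces" "c \<in> can G" unfolding toric_variety_eq by blast
    then show "p \<in> singular_locus (dots l k) (ladder_fan l k)"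
      unfolding singular_locus_def ladder_fan_eq using pV b * by blast
  qed
qed

text \<open>The open set is the chart of the cone of the box, which meets the stratum in its open orbit.\<close>

theorem box_stratum_node:
  assumes b: "b \<in> boxes l k"
  shows "codim_in (zariski (dots l k) (ladder_fan l k)) (box_stratum l k b) = 3"
    "\<exists>U. openin (zariski (dots l k) (ladder_fan l k)) U \<and>
       box_stratum l k b \<subseteq> zariski (dots l k) (ladder_fan l k) closure_of (U \<inter> box_stratum l k b) \<and>
       (\<forall>p \<in> U \<inter> box_stratum l k b.
          transversal_node (dots l k) (ladder_fan l k) (card (dots l k) - 3) (box_stratum l k b) p)" (is ?node)
proof -
  have W: "box_stratum l k b = W b" unfolding box_stratum_def ladder_fan_eq box_cone_def cn_def ..
  obtain e1 e2 e3 e4 X v u where cn: "conifold_node D faces \<delta> ip b e1 e2 e3 e4 X v u"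
    using box_conifold[OF b] by (elim exE) (rule that)
  then interpret cb: conifold_node D faces \<delta> ip b e1 e2 e3 e4 X v u .
  have bF: "b \<in> faces" by (rule box_supports[OF b])
  show "codim_in (zariski (dots l k) (ladder_fan l k)) (box_stratum l k b) = 3"
    unfolding W ladder_fan_eq by (rule cb.codim)
  show ?node
    unfolding W ladder_fan_eq
  proof (intro exI[of _ "U b 1"] conjI ballI)
    show "openin Z (U b 1)" by (rule openin_U[OF bF one_CR])
    have "torus_orbit D \<Sigma> (cn b) \<subseteq> U b 1 \<inter> W b"
      unfolding torus_orbit_eq[OF bF]
      using orbit_in_W[OF bF] Pt_in_U[OF bF orb_can] evalp_one[OF can_ch[OF orb_can]] by auto
    then show "W b \<subseteq> Z closure_of (U b 1 \<inter> W b)"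
      unfolding orbit_closure_def[of D \<Sigma> "cn b"] by (rule closure_of_mono)
    fix p assume p: "p \<in> U b 1 \<inter> W b"
    then obtain G c where G: "p = Pt G c" "G \<in> faces" "G \<subseteq> b" "c \<in> can G" unfolding U_def by blast
    have "b \<subseteq> G" using W_iff[OF bF G(2,4)] p G(1) by blast
    then have Gb: "G = b" using G(3) by blast
    interpret np: node_point D faces \<delta> ip b e1 e2 e3 e4 X v u c
      by unfold_locales (use G(4) Gb in simp)
    show "transversal_node D \<Sigma> (card D - 3) (W b) p" unfolding G(1) Gb by (rule np.transversal)
  qed
qed

end

theorem theorem3p1p4:
  fixes l :: nat and k :: "nat \<Rightarrow> nat"
  assumes "1 \<le> l" and "\<And>i. i \<in> {1..l+1} \<Longrightarrow> 0 < k i"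
  shows
    "singular_locus (dots l k) (ladder_fan l k) = (\<Union>b\<in>boxes l k. box_stratum l k b) \<and>
     (\<forall>b\<in>boxes l k.
        box_cone l k b \<in> ladder_fan l k \<and> dim (box_cone l k b) = 3 \<and>
        codim_in (zariski (dots l k) (ladder_fan l k)) (box_stratum l k b) = 3 \<and>
        (\<exists>U. openin (zariski (dots l k) (ladder_fan l k)) U \<and>
           box_stratum l k b \<subseteq>
             zariski (dots l k) (ladder_fan l k) closure_of (U \<inter> box_stratum l k b) \<and>
           (\<forall>p \<in> U \<inter> box_stratum l k b.
              transversal_node (dots l k) (ladder_fan l k) (card (dots l k) - 3)
                (box_stratum l k b) p)))"
proof -
  interpret ladder l k by unfold_locales (use assms in auto)
  have "box_cone l k b \<in> ladder_fan l k" if "b \<in> boxes l k" for b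
    unfolding ladder_fan_eq box_cone_def using box_supports[OF that] by (auto simp: cn_def)
  then show ?thesis using singular_locus_ladder dim_box_cone box_stratum_node by blast
qed

end
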